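(* Let $q\in L_2(0,\pi)$ be real valued and $h,H\in\mathbb{R}$, and let $\rho_n$, $\alpha_n$, $\alpha_n^0$, $\omega$, $c(\rho,x)$ and the transmutation kernels $G(x,t)$ and $H(x,t)$ be as defined in the context. The kernels $G$ and $H$ admit, for $0\le t\le x\le\pi$, the representations $$\begin{aligned}G(x,t)&=\sum_{n=1}^{\infty}\left(\frac{c(n,x)\cos nt}{\alpha_n^0}-\frac{c(\rho_n,x)\cos\rho_n t}{\alpha_n}-\frac{2\omega}{\pi^2 n}\bigl(x\sin nx\cos nt+t\sin nt\cos nx\bigr)\right)\\&\quad+\frac{c(0,x)}{\pi}-\frac{c(\rho_0,x)\cos\rho_0 t}{\alpha_0}+\frac{\omega}{\pi^2}\bigl(\pi x-x^2-t^2\bigr)\end{aligned}$$ and $$\begin{aligned}H(x,t)&=\sum_{n=1}^{\infty}\left(\frac{\cos\rho_n x\,c(\rho_n,t)}{\alpha_n}-\frac{\cos nx\,c(n,t)}{\alpha_n^0}+\frac{2\omega}{\pi^2 n}\bigl(x\sin nx\cos nt+t\sin nt\cos nx\bigr)\right)\\&\quad+\frac{\cos\rho_0 x\,c(\rho_0,t)}{\alpha_0}-\frac{c(0,t)}{\pi}-\frac{\omega}{\pi^2}\bigl(\pi x-x^2-t^2\bigr),\end{aligned}$$ where the series converge uniformly and absolutely.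
   Context: Let $q\in L_2(0,\pi)$ be real valued and let $h$, $H$ be real numbers (the constant $H$ is not to be confused with the kernel $H(x,t)$ below). For $\rho\in\mathbb{C}$, $c(\rho,x)$ denotes the solution on $[0,\pi]$ of the Cauchy problem $-c''(\rho,x)+q(x)c(\rho,x)=\rho^2c(\rho,x)$, $c(\rho,0)=1$, $c'(\rho,0)=h$ (prime is the derivative in $x$; $c(n,x)$ means $c(\rho,x)$ with $\rho=n$). Consider the Sturm-Liouville problem $-y''+q(x)y=\lambda y$ on $(0,\pi)$, $y'(0)-hy(0)=0$, $y'(\pi)+Hy(\pi)=0$. Its eigenvalues are real and simple and are enumerated in increasing order as $\{\lambda_n\}_{n=0}^\infty$; put $\rho_n:=\sqrt{\lambda_n}$ (possibly purely imaginary for finitely many $n$; all expressions used are even in $\rho_n$). The weight numbers are $\alpha_n:=\int_0^\pi c^2(\rho_n,x)\,dx>0$. Put $\omega:=h+H+\frac12\int_0^\pi q(t)\,dt$. The known asymptotics are $\rho_n=n+\frac{\omega}{\pi n}+\frac{k_n}{n}$ and $\alpha_n=\frac{\pi}{2}+\frac{K_n}{n}$ ($n\ge1$) with $\{k_n\},\{K_n\}\in\ell_2$. Put $\alpha_n^0=\pi/2$ for $n>0$ and $\alpha_0^0=\pi$. The kernel $G(x,t)$, continuous on $0\le t\le x\le\pi$, is the integral kernel of the transmutation operator $T[u](x)=u(x)+\int_0^xG(x,s)u(s)\,ds$, which satisfies $T[\cos\rho x]=c(\rho,x)$ for all $\rho\in\mathbb{C}$ and relates $L=\frac{d^2}{dx^2}-q(x)$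 to $B=\frac{d^2}{dx^2}$ by $LTu=TBu$ for $u\in C^2[0,\pi]$ with $u'(0)=0$. The kernel $H(x,t)$, continuous on $0\le t\le x\le\pi$, is the integral kernel of the inverse operator, $T^{-1}[u](x)=u(x)+\int_0^xH(x,s)u(s)\,ds$. With $$F(x,t)=\sum_{n=0}^\infty\left(\frac{\cos\rho_n x\cos\rho_n t}{\alpha_n}-\frac{\cos nx\cos nt}{\alpha_n^0}\right),$$ the kernels satisfy $G(x,t)+F(x,t)+\int_0^xF(t,s)G(x,s)\,ds=0$ and $H(x,t)-F(x,t)-\int_0^tF(x,s)G(t,s)\,ds=0$ for $0\le t<x$. *)

theory Defs
  imports "HOL-Analysis.Analysis"
begin

definition L2_0pi :: "(real \<Rightarrow> real) \<Rightarrow> bool" where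
  "L2_0pi q \<longleftrightarrow>
     q \<in> borel_measurable (lebesgue_on {0<..<pi}) \<and>
     integrable (lebesgue_on {0<..<pi}) (\<lambda>x. (q x)\<^sup>2)"

text \<open>
  \<open>L_eq q y dy f\<close> says that \<open>y'' - q y = f\<close> on \<open>[0,pi]\<close> with \<open>y' = dy\<close>.
  As \<open>q\<close> is only square integrable, the equation holds almost everywhere with \<open>y'\<close> absolutely
  continuous; this is expressed by the integrated form \<open>y'(x) - y'(0) = \<integral>\<^sub>0\<^sup>x (q y + f)\<close>.
\<close>
definition L_eq ::
  "(real \<Rightarrow> real) \<Rightarrow> (real \<Rightarrow> complex) \<Rightarrow> (real \<Rightarrow> complex) \<Rightarrow> (real \<Rightarrow> complex) \<Rightarrow> bool" where
  "L_eq q y dy f \<longleftrightarrow>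
     (\<forall>x\<in>{0..pi}. (y has_vector_derivative dy x) (at x within {0..pi})) \<and>
     (\<forall>x\<in>{0..pi}. ((\<lambda>t. of_real (q t) * y t + f t) has_integral (dy x - dy 0)) {0..x})"

definition cauchy_solution ::
  "(real \<Rightarrow> real) \<Rightarrow> real \<Rightarrow> complex \<Rightarrow> (real \<Rightarrow> complex) \<Rightarrow> bool" where
  "cauchy_solution q h \<rho> y \<longleftrightarrow>
     (\<exists>dy. L_eq q y dy (\<lambda>x. - \<rho>\<^sup>2 * y x) \<and> y 0 = 1 \<and> dy 0 = of_real h)"

definition sl_eigenvalues :: "(real \<Rightarrow> real) \<Rightarrow> real \<Rightarrow> real \<Rightarrow> complex set" where
  "sl_eigenvalues q h H =
     {\<mu>. \<exists>y dy. L_eq q y dy (\<lambda>x. - \<mu> * y x) \<and>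
            dy 0 - of_real h * y 0 = 0 \<and> dy pi + of_real H * y pi = 0 \<and>
            (\<exists>x\<in>{0..pi}. y x \<noteq> 0)}"

text \<open>The spectrum is real, bounded below and discrete; \<open>lam\<close> is its increasing enumeration.\<close>
definition eigenvalue_enumeration ::
  "(real \<Rightarrow> real) \<Rightarrow> real \<Rightarrow> real \<Rightarrow> (nat \<Rightarrow> real) \<Rightarrow> bool" where
  "eigenvalue_enumeration q h H lam \<longleftrightarrow>
     strict_mono lam \<and> range (\<lambda>n. complex_of_real (lam n)) = sl_eigenvalues q h H"

text \<open>Purely imaginary for negative eigenvalues; only even functions of it are used.\<close>
definition rho :: "(nat \<Rightarrow> real) \<Rightarrow> nat \<Rightarrow> complex" where
  "rho lam n = csqrt (of_real (lam n))"

text \<open>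
  The weight numbers. The integrand is the square \<open>c\<^sup>2\<close>, not \<open>\<bar>c\<bar>\<^sup>2\<close>; since \<open>c(rho n, x)\<close> is
  real valued, the value is a positive real number, here viewed as a complex one.
\<close>
definition alpha :: "(complex \<Rightarrow> real \<Rightarrow> complex) \<Rightarrow> (nat \<Rightarrow> real) \<Rightarrow> nat \<Rightarrow> complex" where
  "alpha c lam n = integral {0..pi} (\<lambda>x. (c (rho lam n) x)\<^sup>2)"

definition alpha0 :: "nat \<Rightarrow> complex" where
  "alpha0 n = (if n = 0 then of_real pi else of_real (pi / 2))"

definition omega :: "(real \<Rightarrow> real) \<Rightarrow> real \<Rightarrow> real \<Rightarrow> real" where
  "omega q h H = h + H + 1 / 2 * integral {0..pi} q"

definition kernel_dom :: "(real \<times> real) set" where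
  "kernel_dom = {(x, t). 0 \<le> t \<and> t \<le> x \<and> x \<le> pi}"

definition volterra_op ::
  "(real \<Rightarrow> real \<Rightarrow> complex) \<Rightarrow> (real \<Rightarrow> complex) \<Rightarrow> real \<Rightarrow> complex" where
  "volterra_op K u x = u x + integral {0..x} (\<lambda>s. K x s * u s)"

text \<open>
  The third conjunct is \<open>L T u = T B u\<close> for \<open>u \<in> C\<^sup>2[0,pi]\<close> with \<open>u'(0) = 0\<close>,
  where \<open>B u = u''\<close>.
\<close>
definition transmutation_kernel ::
  "(real \<Rightarrow> real) \<Rightarrow> (complex \<Rightarrow> real \<Rightarrow> complex) \<Rightarrow> (real \<Rightarrow> real \<Rightarrow> complex) \<Rightarrow> bool" where
  "transmutation_kernel q c G \<longleftrightarrow>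
     continuous_on kernel_dom (\<lambda>(x, t). G x t) \<and>
     (\<forall>\<rho>. \<forall>x\<in>{0..pi}. volterra_op G (\<lambda>t. cos (\<rho> * of_real t)) x = c \<rho> x) \<and>
     (\<forall>u du ddu.
        (\<forall>x\<in>{0..pi}. (u has_vector_derivative du x) (at x within {0..pi})) \<and>
        (\<forall>x\<in>{0..pi}. (du has_vector_derivative ddu x) (at x within {0..pi})) \<and>
        continuous_on {0..pi} ddu \<and> du 0 = 0 \<longrightarrow>
        (\<exists>dv. L_eq q (volterra_op G u) dv (volterra_op G ddu)))"

definition inverse_kernel ::
  "(real \<Rightarrow> real \<Rightarrow> complex) \<Rightarrow> (real \<Rightarrow> real \<Rightarrow> complex) \<Rightarrow> bool" where
  "inverse_kernel G K \<longleftrightarrow>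
     continuous_on kernel_dom (\<lambda>(x, t). K x t) \<and>
     (\<forall>u. continuous_on {0..pi} u \<longrightarrow>
        (\<forall>x\<in>{0..pi}. volterra_op K (volterra_op G u) x = u x \<and>
                       volterra_op G (volterra_op K u) x = u x))"

text \<open>In the correction term, \<open>w\<close> stands for the constant \<open>omega\<close>.\<close>
definition corr_term :: "real \<Rightarrow> nat \<Rightarrow> real \<Rightarrow> real \<Rightarrow> real" where
  "corr_term w n x t =
     2 * w / (pi\<^sup>2 * real n) *
       (x * sin (real n * x) * cos (real n * t) + t * sin (real n * t) * cos (real n * x))"

definition G_term ::
  "(complex \<Rightarrow> real \<Rightarrow> complex) \<Rightarrow> (nat \<Rightarrow> real) \<Rightarrow> real \<Rightarrow> nat \<Rightarrow> real \<Rightarrow> real \<Rightarrow> complex" where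
  "G_term c lam w n x t =
     c (of_nat n) x * cos (of_nat n * of_real t) / alpha0 n
     - c (rho lam n) x * cos (rho lam n * of_real t) / alpha c lam n
     - of_real (corr_term w n x t)"

definition H_term ::
  "(complex \<Rightarrow> real \<Rightarrow> complex) \<Rightarrow> (nat \<Rightarrow> real) \<Rightarrow> real \<Rightarrow> nat \<Rightarrow> real \<Rightarrow> real \<Rightarrow> complex" where
  "H_term c lam w n x t =
     cos (rho lam n * of_real x) * c (rho lam n) t / alpha c lam n
     - cos (of_nat n * of_real x) * c (of_nat n) t / alpha0 n
     + of_real (corr_term w n x t)"

text \<open>
  The series \<open>\<Sum>n\<ge>1. a n x t\<close> converges absolutely at each point of the set \<open>S\<close>,
  and its partial sums converge uniformly on \<open>S\<close>.
\<close>
definition converges_unif_abs_on ::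
  "(real \<times> real) set \<Rightarrow> (nat \<Rightarrow> real \<Rightarrow> real \<Rightarrow> complex) \<Rightarrow> bool" where
  "converges_unif_abs_on S a \<longleftrightarrow>
     (\<forall>(x, t)\<in>S. summable (\<lambda>n. norm (a (Suc n) x t))) \<and>
     uniform_limit S (\<lambda>N (x, t). \<Sum>n=1..N. a n x t) (\<lambda>(x, t). \<Sum>n. a (Suc n) x t) sequentially"

end

theory Submission
  imports Defs "HOL-Computational_Algebra.Fundamental_Theorem_Algebra"
begin

text \<open>
  Integrating the difference \<open>G - \<Phi>\<close> of the kernel and the proposed series against
  \<open>c (rho m) x\<close> and \<open>cos (k t)\<close> collapses both series to single terms, so that the difference has
  zero coefficients on the whole square \<open>[0,pi]\<^sup>2\<close>, where \<open>G\<close> is continued by \<open>- Hker t x\<close> to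
  \<open>x < t\<close>. Both representations follow from this one identity, because \<open>H_term n x t = - G_term n t x\<close>.

  It remains to show that the eigenfunctions are complete and that \<open>rho n - n\<close> has the index \<open>n\<close>
  attached to the right eigenvalue. Variation of constants gives
  \<open>\<Delta>(\<rho>) = - \<rho> sin (\<rho> pi) + omega cos (\<rho> pi) + J(\<rho>) + O(1/\<rho>)\<close> for the characteristic function, with
  \<open>J(n)\<close> square summable by Bessel's inequality; hence there is exactly one eigenvalue near \<open>n\<^sup>2\<close>
  for each large \<open>n\<close>, and its eigenfunction is within \<open>O(1/n)\<close> of \<open>cos (n x)\<close>. An orthogonal system
  whose tail is quadratically close to that of a complete one leaves only a finite-dimensional
  orthogonal complement. This complement is invariant under the resolvent, so if it were nonzero it
  would contain a further eigenfunction; hence the eigenfunctions are complete. Comparing dimensions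
  in both directions then shows that no eigenvalue is missing or superfluous.
\<close>

section \<open>Absolutely continuous functions\<close>

text \<open>The correction terms carry the first-order effect of the shift \<open>rho n - n\<close>,
  about \<open>omega / (pi * n)\<close>, on the difference of the two products; once it is removed,
  the rest is a square summable sequence divided by \<open>n\<close>, hence absolutely summable.
  Away from \<open>(pi, pi)\<close> the corrections add up to
  \<open>omega / pi\<^sup>2 * corr_sum x t\<close>, which explains the terms outside the series. At
  \<open>(pi, pi)\<close>, however, each of them is 0 while
  \<open>corr_sum pi pi = - pi\<^sup>2\<close>, so for \<open>omega \<noteq> 0\<close> their series
  is not uniformly convergent and cannot be split off. It is therefore summed only after integration
  against \<open>cos (k * t)\<close>, where its terms decay like \<open>1 / n\<^sup>2\<close>. The
  continuation by \<open>- Hker t x\<close> is forced by the second product in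
  \<open>G_term\<close>: exchanging the order of integration makes the columns of
  \<open>Hker\<close> act as the inverse of \<open>T\<close> on an eigenfunction, and this returns
  \<open>cos (rho m * t)\<close>. Bounds of \<open>c\<close> that are uniform in the spectral
  parameter come from the boundedness of \<open>T\<close> on cosines. They are available only for
  real parameters, so the few eigenvalues below the threshold \<open>N0\<close> are never located,
  only counted.\<close>

lemma absolutely_integrable_on_subIcc:
  fixes f :: "real \<Rightarrow> 'a::euclidean_space"
  assumes "f absolutely_integrable_on {a..b}" "a \<le> c" "d \<le> b"
  shows "f absolutely_integrable_on {c..d}"
  by (rule set_integrable_subset[OF assms(1)]) (use assms in auto)

lemma absolutely_integrable_mult_continuous:
  fixes f g :: "real \<Rightarrow> 'a::{real_normed_field,euclidean_space}"
  assumes f: "f absolutely_integrable_on {a..b}" and g: "continuous_on {a..b} g"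
  shows "(\<lambda>t. f t * g t) absolutely_integrable_on {a..b}"
proof -
  have "g \<in> borel_measurable (lebesgue_on {a..b})"
    by (simp add: continuous_imp_measurable_on_sets_lebesgue g)
  moreover have "bounded (g ` {a..b})"
    by (simp add: compact_continuous_image compact_imp_bounded g)
  moreover have "bilinear (\<lambda>x y::'a. x * y)"
    using bilinear_conv_bounded_bilinear bounded_bilinear_mult by blast
  ultimately have "(\<lambda>t. g t * f t) absolutely_integrable_on {a..b}"
    using absolutely_integrable_bounded_measurable_product[OF _ _ _ _ f] by auto
  then show ?thesis by (simp add: mult.commute)
qed

lemma integral_Icc_diff:
  fixes f :: "real \<Rightarrow> 'a::euclidean_space"
  assumes "f integrable_on {a..b}" "a \<le> x" "x \<le> y" "y \<le> b"
  shows "integral {x..y} f = integral {a..y} f - integral {a..x} f"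
proof -
  have "f integrable_on {a..y}"
    using assms(1) by (rule integrable_on_subinterval) (use assms in auto)
  then show ?thesis
    using Henstock_Kurzweil_Integration.integral_combine[of a x y f] assms by (simp add: algebra_simps)
qed

text \<open>
  The difference of the two sides, as a function of the upper limit, has derivative zero everywhere:
  its increment over \<open>[x,y]\<close> is \<open>O((y - x) \<integral>\<^sub>x\<^sup>y \<bar>f\<bar>)\<close>. So no Fubini argument is needed.
\<close>
lemma by_parts_AC:
  fixes f F g g' :: "real \<Rightarrow> 'a::{real_normed_field,euclidean_space}"
  assumes ab: "a \<le> b" and f: "f absolutely_integrable_on {a..b}"
    and F: "\<And>x. x \<in> {a..b} \<Longrightarrow> (f has_integral (F x - F a)) {a..x}"
    and g: "\<And>x. x \<in> {a..b} \<Longrightarrow> (g has_vector_derivative g' x) (at x within {a..b})"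
    and g': "continuous_on {a..b} g'"
  shows "((\<lambda>t. f t * g t + F t * g' t) has_integral (F b * g b - F a * g a)) {a..b}"
proof -
  have fi: "f integrable_on {a..b}" and nfi: "(\<lambda>t. norm (f t)) integrable_on {a..b}"
    using f unfolding absolutely_integrable_on_def by auto
  have Fe: "F x = F a + integral {a..x} f" if "x \<in> {a..b}" for x
    using F[OF that] by (auto dest: integral_unique)
  have contF: "continuous_on {a..b} F"
    by (rule continuous_on_eq[where f="\<lambda>x. F a + integral {a..x} f"])
       (auto intro!: continuous_intros indefinite_integral_continuous_1 fi simp flip: Fe)
  have contg: "continuous_on {a..b} g"
    using g continuous_on_vector_derivative by blast
  define k where "k = (\<lambda>t. f t * g t + F t * g' t)"
  have ki: "k integrable_on {a..b}"
    unfolding k_def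
    by (rule integrable_add[OF set_lebesgue_integral_eq_integral(1)[OF absolutely_integrable_mult_continuous[OF f contg]]
        integrable_continuous_real[OF continuous_on_mult[OF contF g']]])
  obtain C where C0: "C > 0" and C: "\<And>x. x \<in> {a..b} \<Longrightarrow> norm (g' x) \<le> C"
    using compact_imp_bounded[OF compact_continuous_image[OF g' compact_Icc]]
    unfolding bounded_pos by auto
  define P where "P = (\<lambda>x. integral {a..x} (\<lambda>t. norm (f t)))"
  define D where "D = (\<lambda>x. F x * g x - integral {a..x} k)"
  have key: "norm (D y - D x) \<le> 2 * C * (y - x) * (P y - P x)" if xy: "a \<le> x" "x \<le> y" "y \<le> b" for x y
  proof -
    have sub: "{x..y} \<subseteq> {a..b}" using xy by auto
    have fi': "f integrable_on {x..y}" and nfi': "(\<lambda>t. norm (f t)) integrable_on {x..y}"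
      and ki': "k integrable_on {x..y}"
      using fi nfi ki integrable_on_subinterval sub by blast+
    have Ix: "(f has_integral (F t - F x)) {x..t}" if "t \<in> {x..y}" for t
    proof -
      have "f integrable_on {x..t}" using fi' by (rule integrable_on_subinterval) (use that in auto)
      moreover have "integral {x..t} f = F t - F x"
        using integral_Icc_diff[OF fi, of x t] Fe[of t] Fe[of x] that xy by auto
      ultimately show ?thesis by (metis integrable_integral)
    qed
    have Px: "((\<lambda>t. norm (f t)) has_integral (P t - P x)) {x..t}" if "t \<in> {x..y}" for t
    proof -
      have "(\<lambda>t. norm (f t)) integrable_on {x..t}" using nfi' by (rule integrable_on_subinterval) (use that in auto)
      moreover have "integral {x..t} (\<lambda>t. norm (f t)) = P t - P x"
        using integral_Icc_diff[OF nfi, of x t] that xy by (auto simp: P_def)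
      ultimately show ?thesis by (metis integrable_integral)
    qed
    have Pmono: "P s - P x \<le> P y - P x" if "s \<in> {x..y}" for s
    proof -
      have "0 \<le> integral {s..y} (\<lambda>t. norm (f t))"
        by (rule Henstock_Kurzweil_Integration.integral_nonneg) (use nfi' that in \<open>auto intro: integrable_on_subinterval\<close>)
      also have "\<dots> = P y - P s" using integral_Icc_diff[OF nfi, of s y] that xy by (auto simp: P_def)
      finally show ?thesis by simp
    qed
    have Gx: "(g' has_integral (g y - g t)) {t..y}" if "t \<in> {x..y}" for t
      by (rule fundamental_theorem_of_calculus) (use that xy in \<open>auto intro: has_vector_derivative_within_subset[OF g]\<close>)
    \<comment> \<open>Freezing \<open>g\<close> at \<open>y\<close> and \<open>F\<close> at
      \<open>x\<close> yields exactly the increment \<open>F y * g y - F x * g x\<close>. The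
      difference to \<open>k\<close> is \<open>f t * (g y - g t) - (F t - F x) * g' t\<close>, a
      product of two small factors in each summand.\<close>
    have h1: "((\<lambda>t. f t * g y + F x * g' t - k t) has_integral
          ((F y - F x) * g y + F x * (g y - g x) - integral {x..y} k)) {x..y}"
      by (intro has_integral_diff has_integral_add has_integral_mult_left has_integral_mult_right
          Ix Gx integrable_integral ki') (use xy in auto)
    have kk: "integral {x..y} k = integral {a..y} k - integral {a..x} k"
      by (rule integral_Icc_diff[OF ki]) (use xy in auto)
    have Deq: "D y - D x = (F y - F x) * g y + F x * (g y - g x) - integral {x..y} k"
      unfolding D_def kk by (simp add: algebra_simps)
    have gb: "norm (g y - g t) \<le> C * (y - x)" if t: "t \<in> {x..y}" for t
    proof -
      have "norm (g y - g t) \<le> C * measure lborel {t..y}"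
        by (rule has_integral_bound_real[OF _ finite.emptyI Gx[OF t]]) (use C C0 t sub in auto)
      also have "\<dots> \<le> C * (y - x)" using t C0 by auto
      finally show ?thesis .
    qed
    have Fb: "norm (F t - F x) \<le> P y - P x" if t: "t \<in> {x..y}" for t
      using integral_norm_bound_integral[of f "{x..t}" "\<lambda>t. norm (f t)"] Ix[OF t] Px[OF t] Pmono[OF t]
      by (smt (verit) has_integral_integrable_integral)
    have h2: "((\<lambda>t. norm (f t) * (C * (y - x)) + (P y - P x) * C) has_integral
          ((P y - P x) * (C * (y - x)) + (y - x) *\<^sub>R ((P y - P x) * C))) {x..y}"
      using has_integral_add[OF has_integral_mult_left[OF Px[of y], of "C * (y - x)"]
          has_integral_const_real[of "(P y - P x) * C" x y]] xy by (simp add: content_real)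
    have "norm (D y - D x) \<le> (P y - P x) * (C * (y - x)) + (y - x) *\<^sub>R ((P y - P x) * C)"
      unfolding Deq
    proof -
      show "norm ((F y - F x) * g y + F x * (g y - g x) - integral {x..y} k)
        \<le> (P y - P x) * (C * (y - x)) + (y - x) *\<^sub>R ((P y - P x) * C)"
      proof -
        have "norm (f t * g y + F x * g' t - k t) \<le> norm (f t) * (C * (y - x)) + (P y - P x) * C"
          if t: "t \<in> {x..y}" for t
        proof -
          have "f t * g y + F x * g' t - k t = f t * (g y - g t) - (F t - F x) * g' t"
            unfolding k_def by (simp add: algebra_simps)
          also have "norm \<dots> \<le> norm (f t * (g y - g t)) + norm ((F t - F x) * g' t)"
            by (rule norm_triangle_ineq4)
          also have "\<dots> \<le> norm (f t) * (C * (y - x)) + (P y - P x) * C"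
            unfolding norm_mult using gb[OF t] Fb[OF t] C[of t] t sub order_trans[OF norm_ge_zero Fb[OF t]]
            by (intro add_mono mult_mono) auto
          finally show ?thesis .
        qed
        then show ?thesis
          using integral_norm_bound_integral[OF has_integral_integrable[OF h1] has_integral_integrable[OF h2]]
          integral_unique[OF h1] integral_unique[OF h2] by simp
      qed
    qed
    then show ?thesis by (simp add: algebra_simps)
  qed
  have contP: "continuous_on {a..b} P"
    unfolding P_def by (rule indefinite_integral_continuous_1[OF nfi])
  have "\<exists>c. \<forall>x\<in>{a..b}. D x = c"
  proof (rule has_derivative_zero_constant)
    show "convex {a..b}" by simp
    fix x assume x: "x \<in> {a..b}"
    show "(D has_derivative (\<lambda>h. 0)) (at x within {a..b})"
      unfolding has_derivative_within_alt
    proof (intro conjI allI impI)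
      fix e :: real assume e: "0 < e"
      then obtain d where d: "d > 0" "\<And>y. y \<in> {a..b} \<Longrightarrow> dist y x < d \<Longrightarrow> dist (P y) (P x) < e / (2 * C)"
        using contP x C0 unfolding continuous_on_iff by (metis divide_pos_pos mult_pos_pos zero_less_numeral)
      have "norm (D y - D x - 0) \<le> e * norm (y - x)" if y: "y \<in> {a..b}" "norm (y - x) < d" for y
      proof -
        have P1: "\<bar>P y - P x\<bar> < e / (2 * C)" using d(2)[of y] y by (auto simp: dist_norm)
        have "norm (D y - D x) \<le> 2 * C * \<bar>y - x\<bar> * \<bar>P y - P x\<bar>"
        proof (cases "x \<le> y")
          case True
          then have "norm (D y - D x) \<le> 2 * C * (y - x) * (P y - P x)" using key[of x y] x y by auto
          also have "\<dots> \<le> 2 * C * \<bar>y - x\<bar> * \<bar>P y - P x\<bar>"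
            using True C0 by (simp add: mult_left_mono)
          finally show ?thesis .
        next
          case False
          then have "norm (D x - D y) \<le> 2 * C * (x - y) * (P x - P y)" using key[of y x] x y by auto
          also have "\<dots> \<le> 2 * C * \<bar>y - x\<bar> * \<bar>P y - P x\<bar>"
            using False C0 by (simp add: mult_left_mono)
          finally show ?thesis by (simp add: norm_minus_commute)
        qed
        also have "\<dots> \<le> 2 * C * \<bar>y - x\<bar> * (e / (2 * C))"
          using P1 C0 by (intro mult_left_mono) auto
        also have "\<dots> = e * norm (y - x)" using C0 by (simp add: field_simps)
        finally show ?thesis by simp
      qed
      then show "\<exists>d>0. \<forall>y\<in>{a..b}. norm (y - x) < d \<longrightarrow> norm (D y - D x - 0) \<le> e * norm (y - x)"
        using d(1) by blast
    qed simp
  qed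
  then have "D b = D a" using ab by auto
  then have "integral {a..b} k = F b * g b - F a * g a"
    unfolding D_def by (simp add: algebra_simps)
  then show ?thesis using ki unfolding k_def by (metis integrable_integral)
qed

text \<open>Two integrations by parts whose terms \<open>dy t * dz t\<close> cancel. In each one the
  derivative that is only absolutely continuous (\<open>dz\<close>, then \<open>dy\<close>) plays
  the role of \<open>F\<close>, and the continuously differentiable function (\<open>y\<close>, then
  \<open>z\<close>) that of \<open>g\<close>.\<close>

lemma lagrange_identity:
  fixes y dy z dz F1 F2 :: "real \<Rightarrow> 'a::{real_normed_field,euclidean_space}"
  assumes ab: "a \<le> b"
    and y: "\<And>x. x \<in> {a..b} \<Longrightarrow> (y has_vector_derivative dy x) (at x within {a..b})"
    and dy: "\<And>x. x \<in> {a..b} \<Longrightarrow> (F1 has_integral (dy x - dy a)) {a..x}"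
    and F1: "F1 absolutely_integrable_on {a..b}"
    and z: "\<And>x. x \<in> {a..b} \<Longrightarrow> (z has_vector_derivative dz x) (at x within {a..b})"
    and dz: "\<And>x. x \<in> {a..b} \<Longrightarrow> (F2 has_integral (dz x - dz a)) {a..x}"
    and F2: "F2 absolutely_integrable_on {a..b}"
  shows "((\<lambda>t. y t * F2 t - z t * F1 t) has_integral
           (y b * dz b - z b * dy b - (y a * dz a - z a * dy a))) {a..b}"
proof -
  have cont: "continuous_on {a..b} dw"
    if "\<And>x. x \<in> {a..b} \<Longrightarrow> (F has_integral (dw x - dw a)) {a..x}" "F absolutely_integrable_on {a..b}"
    for F dw :: "real \<Rightarrow> 'a"
  proof (rule continuous_on_eq[where f="\<lambda>x. dw a + integral {a..x} F"])
    show "continuous_on {a..b} (\<lambda>x. dw a + integral {a..x} F)"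
      by (intro continuous_intros indefinite_integral_continuous_1 set_lebesgue_integral_eq_integral(1)[OF that(2)])
  next
    fix x assume "x \<in> {a..b}"
    then show "dw a + integral {a..x} F = dw x" using integral_unique[OF that(1)] by simp
  qed
  have 1: "((\<lambda>t. F2 t * y t + dz t * dy t) has_integral (dz b * y b - dz a * y a)) {a..b}"
    by (rule by_parts_AC[OF ab F2 dz y cont[OF dy F1]])
  have 2: "((\<lambda>t. F1 t * z t + dy t * dz t) has_integral (dy b * z b - dy a * z a)) {a..b}"
    by (rule by_parts_AC[OF ab F1 dy z cont[OF dz F2]])
  show ?thesis
    using has_integral_diff[OF 1 2] by (simp add: algebra_simps)
qed

text \<open>The interval is walked through in steps so short that \<open>m\<close> has integral
  below \<open>1/2\<close> over each. If \<open>y\<close> vanishes before a step, its maximum on the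
  step is at most half of itself. The step is \<open>d / 2\<close> because uniform continuity asks
  for a distance strictly below \<open>d\<close>.\<close>

lemma gronwall_zero:
  fixes y m :: "real \<Rightarrow> real"
  assumes b: "0 \<le> b" and y: "continuous_on {0..b} y" "\<And>x. x \<in> {0..b} \<Longrightarrow> 0 \<le> y x"
    and m: "m absolutely_integrable_on {0..b}" "\<And>x. x \<in> {0..b} \<Longrightarrow> 0 \<le> m x"
    and le: "\<And>x. x \<in> {0..b} \<Longrightarrow> y x \<le> integral {0..x} (\<lambda>t. m t * y t)"
    and x: "x \<in> {0..b}"
  shows "y x = 0"
proof -
  have mi: "m integrable_on {0..b}" by (rule set_lebesgue_integral_eq_integral(1)[OF m(1)])
  have myi: "(\<lambda>t. m t * y t) integrable_on {0..b}"
    by (rule set_lebesgue_integral_eq_integral(1)[OF absolutely_integrable_mult_continuous[OF m(1) y(1)]])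
  define P where "P = (\<lambda>x. integral {0..x} m)"
  have "continuous_on {0..b} P"
    unfolding P_def by (rule indefinite_integral_continuous_1[OF mi])
  then have "uniformly_continuous_on {0..b} P"
    by (simp add: compact_uniformly_continuous)
  then obtain d where d: "d > 0" "\<And>s t. s \<in> {0..b} \<Longrightarrow> t \<in> {0..b} \<Longrightarrow> dist s t < d \<Longrightarrow> dist (P s) (P t) < 1/2"
    unfolding uniformly_continuous_on_def by (metis half_gt_zero zero_less_one)
  have main: "\<forall>x\<in>{0..b}. x \<le> real n * (d / 2) \<longrightarrow> y x = 0" for n
  proof (induction n)
    case 0
    show ?case using le[of 0] y(2)[of 0] b by (auto intro!: antisym)
  next
    case (Suc n)
    show ?case
    proof (intro ballI impI)
      fix x assume x: "x \<in> {0..b}" "x \<le> real (Suc n) * (d / 2)"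
      define a0 where "a0 = real n * (d / 2)"
      show "y x = 0"
      proof (cases "x \<le> a0")
        case True then show ?thesis using Suc x a0_def by auto
      next
        case False
        have a0: "0 \<le> a0" using d by (simp add: a0_def)
        have sub: "{a0..x} \<subseteq> {0..b}" using x a0 by auto
        obtain z where z: "z \<in> {a0..x}" "\<And>t. t \<in> {a0..x} \<Longrightarrow> y t \<le> y z"
        proof -
          have "continuous_on {a0..x} y" by (rule continuous_on_subset[OF y(1) sub])
          moreover have "{a0..x} \<noteq> {}" using False by simp
          ultimately have "\<exists>z\<in>{a0..x}. \<forall>t\<in>{a0..x}. y t \<le> y z"
            by (intro continuous_attains_sup) auto
          then show ?thesis using that by blast
        qed
        have zb: "z \<in> {0..b}" using z sub by auto
        have mz: "m integrable_on {a0..z}" using mi by (rule integrable_on_subinterval) (use z sub in auto)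
        have "y z \<le> integral {0..z} (\<lambda>t. m t * y t)" using le zb by auto
        also have "\<dots> = integral {0..a0} (\<lambda>t. m t * y t) + integral {a0..z} (\<lambda>t. m t * y t)"
          using integral_Icc_diff[OF myi, of a0 z] a0 z zb by auto
        also have "integral {0..a0} (\<lambda>t. m t * y t) = integral {0..a0} (\<lambda>t. 0)"
          by (rule Henstock_Kurzweil_Integration.integral_cong) (use Suc.IH z zb a0_def in auto)
        also have "integral {a0..z} (\<lambda>t. m t * y t) \<le> integral {a0..z} (\<lambda>t. m t * y z)"
        proof (rule integral_le)
          show "(\<lambda>t. m t * y t) integrable_on {a0..z}" using myi by (rule integrable_on_subinterval) (use z sub in auto)
          show "(\<lambda>t. m t * y z) integrable_on {a0..z}" using mz by (rule integrable_on_mult_left)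
          show "\<And>t. t \<in> {a0..z} \<Longrightarrow> m t * y t \<le> m t * y z"
            using z m(2) sub by (intro mult_left_mono) auto
        qed
        also have "\<dots> = (P z - P a0) * y z"
          using integral_Icc_diff[OF mi, of a0 z] a0 z zb by (simp add: P_def)
        also have "\<dots> \<le> 1/2 * y z"
        proof (rule mult_right_mono)
          have "dist (P z) (P a0) < 1/2"
            by (rule d(2)) (use zb z sub a0 x d(1) in \<open>auto simp: dist_norm a0_def algebra_simps\<close>)
          then show "P z - P a0 \<le> 1/2" unfolding dist_real_def by linarith
        qed (use y zb in auto)
        finally have "y z \<le> 0" by simp
        then show ?thesis using z(2)[of x] y(2)[of x] x False by auto
      qed
    qed
  qed
  obtain n where "b / (d/2) \<le> real n" using real_arch_simple by blast
  then have "b \<le> real n * (d/2)" using d by (simp add: field_simps)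
  then show ?thesis using main[of n] x by auto
qed

text \<open>Since \<open>y\<close> and \<open>dy\<close> vanish at 0, \<open>dy\<close> is bounded
  on \<open>{0..x}\<close> by the integral of \<open>norm (p t) * norm (y t)\<close>, and one more
  integration costs a factor of at most \<open>b\<close>. This is the hypothesis of
  \<open>gronwall_zero\<close> with weight \<open>b * norm (p t)\<close>.\<close>

lemma second_order_unique:
  fixes y dy p :: "real \<Rightarrow> complex"
  assumes p: "p absolutely_integrable_on {0..b}" and b: "0 \<le> b"
    and y: "\<And>x. x \<in> {0..b} \<Longrightarrow> (y has_vector_derivative dy x) (at x within {0..b})"
    and dy: "\<And>x. x \<in> {0..b} \<Longrightarrow> ((\<lambda>t. p t * y t) has_integral (dy x - dy 0)) {0..x}"
    and y0: "y 0 = 0" "dy 0 = 0" and x: "x \<in> {0..b}"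
  shows "y x = 0"
proof -
  have conty: "continuous_on {0..b} y" using y continuous_on_vector_derivative by blast
  have np: "(\<lambda>t. norm (p t)) absolutely_integrable_on {0..b}" using absolutely_integrable_norm[OF p] by (simp add: comp_def)
  have npy: "(\<lambda>t. norm (p t) * norm (y t)) integrable_on {0..b}"
    by (intro set_lebesgue_integral_eq_integral(1) absolutely_integrable_mult_continuous np continuous_on_norm conty)
  have "norm (y x) = 0"
  proof (rule gronwall_zero[OF b _ _ _ _ _ x, of "\<lambda>x. norm (y x)" "\<lambda>x. b * norm (p x)"])
    show "continuous_on {0..b} (\<lambda>x. norm (y x))" by (intro continuous_intros conty)
    show "(\<lambda>x. b * norm (p x)) absolutely_integrable_on {0..b}"
      by (intro set_integrable_mult_right np)
    fix x assume x: "x \<in> {0..b}"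
    have npyx: "(\<lambda>t. norm (p t) * norm (y t)) integrable_on {0..x}"
      using npy by (rule integrable_on_subinterval) (use x in auto)
    define W where "W = integral {0..x} (\<lambda>t. norm (p t) * norm (y t))"
    have W0: "W \<ge> 0" unfolding W_def by (rule Henstock_Kurzweil_Integration.integral_nonneg[OF npyx]) auto
    have dyb: "norm (dy s) \<le> W" if s: "s \<in> {0..x}" for s
    proof -
      have "norm (dy s) = norm (integral {0..s} (\<lambda>t. p t * y t))"
        using dy[of s] y0 s x by (auto dest: integral_unique)
      also have "\<dots> \<le> integral {0..s} (\<lambda>t. norm (p t) * norm (y t))"
        by (rule integral_norm_bound_integral)
           (use dy[of s] s x npyx in \<open>auto simp: norm_mult intro: integrable_on_subinterval\<close>)
      also have "\<dots> \<le> W" unfolding W_def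
        by (rule integral_subset_le) (use npyx s in \<open>auto intro: integrable_on_subinterval\<close>)
      finally show ?thesis .
    qed
    have "(dy has_integral (y x - y 0)) {0..x}"
      by (rule fundamental_theorem_of_calculus) (use x in \<open>auto intro: has_vector_derivative_within_subset[OF y]\<close>)
    then have "norm (y x - y 0) \<le> W * measure lborel {0..x}"
      by (rule has_integral_bound_real[OF W0 finite.emptyI]) (use dyb in auto)
    also have "\<dots> \<le> b * W" using x W0 by (simp add: mult.commute mult_left_mono)
    also have "\<dots> = integral {0..x} (\<lambda>t. b * norm (p t) * norm (y t))"
      unfolding W_def by (simp add: mult.assoc)
    finally show "norm (y x) \<le> integral {0..x} (\<lambda>t. b * norm (p t) * norm (y t))" using y0 by simp
  qed (use b in auto)
  then show ?thesis by simp
qed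

section \<open>Orthogonal systems and their perturbations\<close>

text \<open>Bilinear, without conjugation, like the weight numbers \<open>alpha\<close>. The
  orthogonal systems used with it are real valued, so bilinear and Hermitian orthogonality agree for
  them; norms are measured by \<open>sqnorm\<close>.\<close>

definition ip :: "(real \<Rightarrow> complex) \<Rightarrow> (real \<Rightarrow> complex) \<Rightarrow> complex" where
  "ip f g = integral {0..pi} (\<lambda>x. f x * g x)"

definition sqnorm :: "(real \<Rightarrow> complex) \<Rightarrow> real" where
  "sqnorm v = integral {0..pi} (\<lambda>x. (norm (v x))\<^sup>2)"

text \<open>Density in the supremum norm, stronger than in L_2: it permits testing a function that
  is merely integrable, as in \<open>dense_span_complete\<close>.\<close>

definition dense_span :: "(nat \<Rightarrow> real \<Rightarrow> complex) \<Rightarrow> bool" where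
  "dense_span \<phi> \<longleftrightarrow> (\<forall>v. continuous_on {0..pi} v \<longrightarrow>
     (\<forall>e>0. \<exists>K b. \<forall>x\<in>{0..pi}. norm (v x - (\<Sum>n<(K::nat). b n * \<phi> n x)) < e))"

definition real_orthogonal :: "(nat \<Rightarrow> real \<Rightarrow> complex) \<Rightarrow> (nat \<Rightarrow> real) \<Rightarrow> bool" where
  "real_orthogonal \<phi> \<beta> \<longleftrightarrow>
     (\<forall>n. continuous_on {0..pi} (\<phi> n)) \<and> (\<forall>n. \<forall>x\<in>{0..pi}. Im (\<phi> n x) = 0) \<and>
     (\<forall>m n. ip (\<phi> m) (\<phi> n) = (if m = n then of_real (\<beta> n) else 0)) \<and> (\<forall>n. 0 < \<beta> n)"

lemma ip_commute: "ip f g = ip g f"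
  unfolding ip_def by (simp add: mult.commute)

lemma ip_cong:
  "(\<And>x. x \<in> {0..pi} \<Longrightarrow> f x = f' x) \<Longrightarrow> (\<And>x. x \<in> {0..pi} \<Longrightarrow> g x = g' x) \<Longrightarrow> ip f g = ip f' g'"
  unfolding ip_def by (rule Henstock_Kurzweil_Integration.integral_cong) auto

lemma ip_integrable:
  fixes f g :: "real \<Rightarrow> complex"
  assumes "continuous_on {0..pi} f" "continuous_on {0..pi} g"
  shows "(\<lambda>x. f x * g x) integrable_on {0..pi}"
  by (rule integrable_continuous_real[OF continuous_on_mult[OF assms]])

lemma ip_diff_left:
  assumes "continuous_on {0..pi} f" "continuous_on {0..pi} g" "continuous_on {0..pi} h"
  shows "ip (\<lambda>x. f x - g x) h = ip f h - ip g h"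
  unfolding ip_def left_diff_distrib
  by (intro Henstock_Kurzweil_Integration.integral_diff ip_integrable assms)

lemma ip_add_left:
  assumes "continuous_on {0..pi} f" "continuous_on {0..pi} g" "continuous_on {0..pi} h"
  shows "ip (\<lambda>x. f x + g x) h = ip f h + ip g h"
  unfolding ip_def distrib_right
  by (intro Henstock_Kurzweil_Integration.integral_add ip_integrable assms)

lemma ip_diff_right:
  assumes "continuous_on {0..pi} f" "continuous_on {0..pi} g" "continuous_on {0..pi} h"
  shows "ip h (\<lambda>x. f x - g x) = ip h f - ip h g"
  using ip_diff_left[OF assms] by (simp add: ip_commute)

lemma ip_mult_left: "ip (\<lambda>x. a * f x) g = a * ip f g"
  unfolding ip_def mult.assoc by simp

lemma ip_sum_left:
  assumes "finite I" "\<And>i. i \<in> I \<Longrightarrow> continuous_on {0..pi} (f i)" "continuous_on {0..pi} h"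
  shows "ip (\<lambda>x. \<Sum>i\<in>I. a i * f i x) h = (\<Sum>i\<in>I. a i * ip (f i) h)"
proof -
  have "ip (\<lambda>x. \<Sum>i\<in>I. a i * f i x) h = integral {0..pi} (\<lambda>x. \<Sum>i\<in>I. a i * (f i x * h x))"
    unfolding ip_def by (simp add: sum_distrib_right mult.assoc)
  also have "\<dots> = (\<Sum>i\<in>I. integral {0..pi} (\<lambda>x. a i * (f i x * h x)))"
    by (rule integral_sum) (use assms in \<open>auto intro!: integrable_on_mult_right ip_integrable\<close>)
  finally show ?thesis unfolding ip_def by simp
qed

lemma ip_uniform_limit:
  assumes u: "uniform_limit {0..pi} f g F" and c: "\<And>n. continuous_on {0..pi} (f n)"
    and h: "continuous_on {0..pi} h" and F: "F \<noteq> bot"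
  shows "((\<lambda>n. ip (f n) h) \<longlongrightarrow> ip g h) F"
proof -
  have g: "continuous_on {0..pi} g"
    by (rule uniform_limit_theorem[OF always_eventually u F]) (use c in auto)
  have "uniform_limit {0..pi} (\<lambda>n x. f n x * h x) (\<lambda>x. g x * h x) F"
    by (intro uniform_lim_mult u uniform_limit_const) (auto intro!: compact_imp_bounded compact_continuous_image g h)
  moreover have "\<And>n. continuous_on {0..pi} (\<lambda>x. f n x * h x)" by (intro continuous_on_mult c h)
  ultimately obtain I J where IJ: "\<And>n. ((\<lambda>x. f n x * h x) has_integral I n) {0..pi}"
    "((\<lambda>x. g x * h x) has_integral J) {0..pi}" "(I \<longlongrightarrow> J) F"
    by (rule uniform_limit_integral[OF _ _ F]) auto
  show ?thesis
    unfolding ip_def integral_unique[OF IJ(1)] integral_unique[OF IJ(2)] by (rule IJ(3))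
qed

lemma sqnorm_nonneg: "0 \<le> sqnorm v"
  unfolding sqnorm_def by (cases "(\<lambda>x. (norm (v x))\<^sup>2) integrable_on {0..pi}")
    (auto intro: Henstock_Kurzweil_Integration.integral_nonneg simp: not_integrable_integral)

lemma sqnorm_eq_0_imp:
  assumes "continuous_on {0..pi} v" "sqnorm v = 0" "x \<in> {0..pi}"
  shows "v x = 0"
proof -
  have c: "continuous_on {0..pi} (\<lambda>x. (norm (v x))\<^sup>2)" by (intro continuous_intros assms)
  have "((\<lambda>x. (norm (v x))\<^sup>2) has_integral 0) (cbox 0 pi)"
    using integrable_integral[OF integrable_continuous_real[OF c]] assms(2) by (simp add: sqnorm_def)
  moreover have "pi / 2 \<in> box 0 pi" by simp
  then have "box 0 pi \<noteq> {}" by blast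
  ultimately have "(norm (v x))\<^sup>2 = 0"
    by (rule has_integral_0_cbox_imp_0[rotated 2]) (use c assms in auto)
  then show ?thesis by simp
qed

text \<open>After bounding \<open>w\<close> by \<open>d\<close>, the Cauchy-Schwarz inequality
  between \<open>norm (v x)\<close> and the constant 1 remains. It comes from expanding the square
  of \<open>norm (v x) - I / pi\<close>, the deviation from the mean.\<close>

lemma norm_ip_le:
  assumes v: "continuous_on {0..pi} v" and w: "continuous_on {0..pi} w"
    and d: "\<And>x. x \<in> {0..pi} \<Longrightarrow> norm (w x) \<le> d"
  shows "(norm (ip v w))\<^sup>2 \<le> pi * d\<^sup>2 * sqnorm v"
proof -
  have d0: "0 \<le> d" using d[of 0] norm_ge_zero[of "w 0"] by (simp del: norm_ge_zero)
  define I where "I = integral {0..pi} (\<lambda>x. norm (v x))"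
  have nv: "(\<lambda>x. norm (v x)) integrable_on {0..pi}" by (intro integrable_continuous_real continuous_intros v)
  have nv2: "(\<lambda>x. (norm (v x))\<^sup>2) integrable_on {0..pi}" by (intro integrable_continuous_real continuous_intros v)
  have I0: "0 \<le> I" unfolding I_def by (rule Henstock_Kurzweil_Integration.integral_nonneg[OF nv]) auto
  have "norm (ip v w) \<le> integral {0..pi} (\<lambda>x. norm (v x) * d)"
    unfolding ip_def
    by (rule integral_norm_bound_integral)
       (use ip_integrable[OF v w] nv d in \<open>auto simp: norm_mult intro: mult_left_mono integrable_on_mult_left\<close>)
  then have 1: "norm (ip v w) \<le> I * d" by (simp add: I_def)
  have "((\<lambda>x. (norm (v x))\<^sup>2 - 2 * (I / pi) * norm (v x) + (I / pi)\<^sup>2) has_integral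
      sqnorm v - 2 * (I / pi) * I + pi *\<^sub>R (I/pi)\<^sup>2) {0..pi}"
    unfolding sqnorm_def I_def
    using has_integral_const_real[of "(I/pi)\<^sup>2" 0 pi]
    by (intro has_integral_add has_integral_diff has_integral_mult_right integrable_integral nv nv2) (simp add: I_def)
  then have "0 \<le> sqnorm v - 2 * (I / pi) * I + pi *\<^sub>R (I/pi)\<^sup>2"
  proof (rule has_integral_nonneg)
    fix x
    show "0 \<le> (norm (v x))\<^sup>2 - 2 * (I / pi) * norm (v x) + (I / pi)\<^sup>2"
      using zero_le_power2[of "norm (v x) - I / pi"] by (simp add: power2_diff algebra_simps)
  qed
  then have 2: "I\<^sup>2 \<le> pi * sqnorm v" by (simp add: field_simps power2_eq_square)
  have "(norm (ip v w))\<^sup>2 \<le> (I * d)\<^sup>2" by (rule power_mono[OF 1]) simp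
  also have "\<dots> \<le> pi * sqnorm v * d\<^sup>2"
    unfolding power_mult_distrib using 2 by (intro mult_right_mono) auto
  finally show ?thesis by (simp add: algebra_simps)
qed

lemma real_orthogonalD:
  assumes "real_orthogonal \<phi> \<beta>"
  shows "continuous_on {0..pi} (\<phi> n)" "x \<in> {0..pi} \<Longrightarrow> Im (\<phi> n x) = 0"
    "m \<noteq> n \<Longrightarrow> ip (\<phi> m) (\<phi> n) = 0" "ip (\<phi> n) (\<phi> n) = of_real (\<beta> n)" "0 < \<beta> n"
  using assms unfolding real_orthogonal_def by auto

text \<open>The right-hand side is a quadratic in \<open>b\<close>; completing the square shows that
  its minimum, at \<open>b = ip v (\<phi> n) / \<beta> n\<close>, is the left-hand side.\<close>

lemma sqnorm_subtract_ge:
  assumes ro: "real_orthogonal \<phi> \<beta>" and v: "continuous_on {0..pi} v"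
  shows "sqnorm v - (norm (ip v (\<phi> n)))\<^sup>2 / \<beta> n \<le> sqnorm (\<lambda>x. v x - b * \<phi> n x)"
proof -
  note r = real_orthogonalD[OF ro]
  define B where "B = ip v (\<phi> n)"
  have h1: "((\<lambda>x. (norm (v x))\<^sup>2) has_integral sqnorm v) {0..pi}"
    unfolding sqnorm_def by (intro integrable_integral integrable_continuous_real continuous_intros v)
  have h2: "((\<lambda>x. v x * \<phi> n x) has_integral B) {0..pi}"
    unfolding B_def ip_def by (intro integrable_integral ip_integrable v r)
  have h3: "((\<lambda>x. \<phi> n x * \<phi> n x) has_integral of_real (\<beta> n)) {0..pi}"
    using integrable_integral[OF ip_integrable[OF r(1) r(1)], of n n] r(4)[of n] by (simp add: ip_def)
  have "((\<lambda>x. (norm (v x))\<^sup>2 - 2 * Re (cnj b * (v x * \<phi> n x)) + (norm b)\<^sup>2 * Re (\<phi> n x * \<phi> n x)) has_integral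
    sqnorm v - 2 * Re (cnj b * B) + (norm b)\<^sup>2 * Re (of_real (\<beta> n))) {0..pi}"
    using has_integral_linear[OF has_integral_mult_right[OF h2, of "cnj b"] bounded_linear_Re]
      has_integral_linear[OF h3 bounded_linear_Re]
    unfolding o_def by (intro has_integral_add has_integral_diff has_integral_mult_right h1)
  then have "((\<lambda>x. (norm (v x - b * \<phi> n x))\<^sup>2) has_integral
    sqnorm v - 2 * Re (cnj b * B) + (norm b)\<^sup>2 * Re (of_real (\<beta> n))) {0..pi}"
  proof (rule has_integral_eq[rotated])
    fix x assume x: "x \<in> {0..pi}"
    have "\<phi> n x = of_real (Re (\<phi> n x))" using r(2)[OF x] by (simp add: complex_eq_iff)
    then obtain p where p: "\<phi> n x = of_real p" by blast
    show "(norm (v x))\<^sup>2 - 2 * Re (cnj b * (v x * \<phi> n x)) + (norm b)\<^sup>2 * Re (\<phi> n x * \<phi> n x) = (norm (v x - b * \<phi> n x))\<^sup>2"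
      unfolding p cmod_power2 by (simp add: power2_eq_square algebra_simps)
  qed
  then have eq: "sqnorm (\<lambda>x. v x - b * \<phi> n x) = sqnorm v - 2 * Re (cnj b * B) + (norm b)\<^sup>2 * \<beta> n"
    unfolding sqnorm_def[of "\<lambda>x. v x - b * \<phi> n x"] by (auto dest: integral_unique)
  have "0 \<le> (norm (of_real (\<beta> n) * b - B))\<^sup>2 / \<beta> n" using r(5)[of n] by simp
  also have "\<dots> = (norm b)\<^sup>2 * \<beta> n - 2 * Re (cnj b * B) + (norm B)\<^sup>2 / \<beta> n"
    using r(5)[of n] unfolding cmod_power2 by (simp add: field_simps power2_eq_square)
  finally show ?thesis unfolding eq B_def[symmetric] by simp
qed

text \<open>Together with density this is the half of Parseval's identity opposite to Bessel's
  inequality: up to the error of approximation, \<open>sqnorm v\<close> is at most the sum of the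
  squared coefficients divided by \<open>\<beta> n\<close>.\<close>

lemma sqnorm_approx_ge:
  assumes ro: "real_orthogonal \<phi> \<beta>" and v: "continuous_on {0..pi} v"
  shows "sqnorm v - (\<Sum>n<K. (norm (ip v (\<phi> n)))\<^sup>2 / \<beta> n) \<le> sqnorm (\<lambda>x. v x - (\<Sum>n<K. b n * \<phi> n x))"
  using v
proof (induction K arbitrary: v)
  case 0 then show ?case by simp
next
  case (Suc K)
  note r = real_orthogonalD[OF ro]
  define v' where "v' = (\<lambda>x. v x - b K * \<phi> K x)"
  have v': "continuous_on {0..pi} v'" unfolding v'_def by (intro continuous_intros Suc.prems r)
  have "ip v' (\<phi> n) = ip v (\<phi> n)" if "n < K" for n
    using that unfolding v'_def
    by (subst ip_diff_left) (auto intro!: continuous_intros Suc.prems r simp: ip_mult_left)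
  then have "sqnorm v' - (\<Sum>n<K. (norm (ip v (\<phi> n)))\<^sup>2 / \<beta> n) \<le> sqnorm (\<lambda>x. v' x - (\<Sum>n<K. b n * \<phi> n x))"
    using Suc.IH[OF v'] by simp
  moreover have "sqnorm v - (norm (ip v (\<phi> K)))\<^sup>2 / \<beta> K \<le> sqnorm v'"
    unfolding v'_def by (rule sqnorm_subtract_ge[OF ro Suc.prems])
  ultimately show ?case by (simp add: v'_def algebra_simps)
qed

text \<open>For \<open>n \<ge> K\<close> the coefficient of \<open>v\<close> against
  \<open>\<phi> n\<close> equals the one against \<open>\<phi> n - \<psi> n\<close>, so these
  coefficients together carry at most \<open>\<theta> * sqnorm v\<close>. By density they carry all
  of \<open>sqnorm v\<close>, which must then be 0. It is applied twice, with cosines and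
  eigenfunctions exchanging roles.\<close>

lemma perturbed_complete:
  assumes ro: "real_orthogonal \<phi> \<beta>" and dense: "dense_span \<phi>" and v: "continuous_on {0..pi} v"
    and \<psi>: "\<And>n. continuous_on {0..pi} (\<psi> n)"
    and lo: "\<And>n. n < K \<Longrightarrow> ip v (\<phi> n) = 0" and hi: "\<And>n. K \<le> n \<Longrightarrow> ip v (\<psi> n) = 0"
    and d: "\<And>n x. K \<le> n \<Longrightarrow> x \<in> {0..pi} \<Longrightarrow> norm (\<phi> n x - \<psi> n x) \<le> d n"
    and \<beta>: "\<And>n. K \<le> n \<Longrightarrow> 1 \<le> \<beta> n"
    and small: "\<And>K'. (\<Sum>n=K..<K'. pi * (d n)\<^sup>2) \<le> \<theta>" and \<theta>: "\<theta> < 1"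
    and x: "x \<in> {0..pi}"
  shows "v x = 0"
proof -
  note r = real_orthogonalD[OF ro]
  have est: "sqnorm v \<le> e + \<theta> * sqnorm v" if e: "e > 0" for e
  proof -
    \<comment> \<open>A uniform error \<open>e'\<close> on an interval of length \<open>pi\<close>
      has squared norm at most \<open>pi * e'\<^sup>2 = e\<close>.\<close>
    define e' where "e' = sqrt (e / pi)"
    have e': "e' > 0" "e'\<^sup>2 * pi = e" using e by (auto simp: e'_def)
    obtain K' b where K': "\<And>x. x \<in> {0..pi} \<Longrightarrow> norm (v x - (\<Sum>n<(K'::nat). b n * \<phi> n x)) < e'"
      using dense v e'(1) unfolding dense_span_def by metis
    have c: "continuous_on {0..pi} (\<lambda>x. v x - (\<Sum>n<K'. b n * \<phi> n x))"
      by (intro continuous_intros v r)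
    have "sqnorm (\<lambda>x. v x - (\<Sum>n<K'. b n * \<phi> n x)) \<le> integral {0..pi} (\<lambda>x. e'\<^sup>2)"
      unfolding sqnorm_def
    proof (rule integral_le)
      show "(cmod (v x - (\<Sum>n<K'. b n * \<phi> n x)))\<^sup>2 \<le> e'\<^sup>2" if "x \<in> {0..pi}" for x
        using K'[OF that] by (intro power_mono) auto
    qed (intro integrable_continuous_real continuous_intros c)+
    then have "sqnorm v \<le> e + (\<Sum>n<K'. (norm (ip v (\<phi> n)))\<^sup>2 / \<beta> n)"
      using sqnorm_approx_ge[OF ro v, where K=K' and b=b] e' by (simp add: mult.commute)
    also have "(\<Sum>n<K'. (norm (ip v (\<phi> n)))\<^sup>2 / \<beta> n) \<le> (\<Sum>n\<in>{K..<K'}. pi * (d n)\<^sup>2 * sqnorm v)"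
    proof -
      have "(\<Sum>n<K'. (norm (ip v (\<phi> n)))\<^sup>2 / \<beta> n) = (\<Sum>n=K..<K'. (norm (ip v (\<phi> n)))\<^sup>2 / \<beta> n)"
        by (rule sum.mono_neutral_right) (use lo in \<open>auto simp: not_le\<close>)
      also have "\<dots> \<le> (\<Sum>n\<in>{K..<K'}. pi * (d n)\<^sup>2 * sqnorm v)"
      proof (rule sum_mono)
        fix n assume n: "n \<in> {K..<K'}"
        have "ip v (\<phi> n) = ip v (\<lambda>x. \<phi> n x - \<psi> n x)"
          using hi[of n] n by (subst ip_diff_right) (auto intro: r \<psi> v)
        then have "(norm (ip v (\<phi> n)))\<^sup>2 \<le> pi * (d n)\<^sup>2 * sqnorm v"
          using norm_ip_le[OF v, of "\<lambda>x. \<phi> n x - \<psi> n x" "d n"] d n by (auto intro!: continuous_intros r \<psi>)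
        moreover have "(norm (ip v (\<phi> n)))\<^sup>2 / \<beta> n \<le> (norm (ip v (\<phi> n)))\<^sup>2"
          using \<beta>[of n] n by (simp add: divide_le_eq mult_left_le_one_le mult_le_cancel_left1)
        ultimately show "(norm (ip v (\<phi> n)))\<^sup>2 / \<beta> n \<le> pi * (d n)\<^sup>2 * sqnorm v" by linarith
      qed
      finally show ?thesis .
    qed
    also have "\<dots> \<le> \<theta> * sqnorm v"
      using mult_right_mono[OF small[of K'] sqnorm_nonneg[of v]] by (simp add: sum_distrib_right)
    finally show ?thesis by simp
  qed
  have "sqnorm v \<le> \<theta> * sqnorm v"
    by (rule field_le_epsilon) (use est in \<open>simp add: add.commute\<close>)
  then have "sqnorm v * (1 - \<theta>) \<le> 0" by (simp add: algebra_simps)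
  then have "sqnorm v = 0"
    using sqnorm_nonneg[of v] \<theta> mult_pos_pos[of "sqnorm v" "1 - \<theta>"] by linarith
  then show ?thesis using sqnorm_eq_0_imp v x by blast
qed

text \<open>Here \<open>v\<close> need not be continuous: it is later the difference
  \<open>Gt x - Phi x\<close>, which may jump. Integrability of \<open>v\<close> is enough against a
  uniform approximation of \<open>u\<close>.\<close>

lemma dense_span_complete:
  assumes dense: "dense_span \<phi>" and phi: "\<And>n. continuous_on {0..pi} (\<phi> n)" and v: "v absolutely_integrable_on {0..pi}"
    and orth: "\<And>n. ip v (\<phi> n) = 0" and u: "continuous_on {0..pi} u"
  shows "ip v u = 0"
proof -
  define I where "I = integral {0..pi} (\<lambda>x. norm (v x))"
  have vi: "(\<lambda>x. norm (v x)) integrable_on {0..pi}" using v absolutely_integrable_on_def by blast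
  have I0: "0 \<le> I" unfolding I_def by (rule Henstock_Kurzweil_Integration.integral_nonneg[OF vi]) auto
  have vm: "(\<lambda>x. v x * f x) integrable_on {0..pi}" if "continuous_on {0..pi} f" for f
    by (rule set_lebesgue_integral_eq_integral(1)[OF absolutely_integrable_mult_continuous[OF v that]])
  have "norm (ip v u) \<le> 0 + e" if e: "e > 0" for e
  proof -
    define e' where "e' = e / (I + 1)"
    have e': "e' > 0" "I * e' \<le> e" using e I0 by (auto simp: e'_def field_simps)
    obtain K b where K: "\<And>x. x \<in> {0..pi} \<Longrightarrow> norm (u x - (\<Sum>n<(K::nat). b n * \<phi> n x)) < e'"
      using dense u e'(1) unfolding dense_span_def by metis
    have cs: "continuous_on {0..pi} (\<lambda>x. \<Sum>n<K. b n * \<phi> n x)" by (intro continuous_intros phi)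
    have "ip v (\<lambda>x. \<Sum>n<K. b n * \<phi> n x) = integral {0..pi} (\<lambda>x. \<Sum>n<K. b n * (v x * \<phi> n x))"
      unfolding ip_def by (simp add: sum_distrib_left algebra_simps)
    also have "\<dots> = (\<Sum>n<K. b n * ip v (\<phi> n))"
      unfolding ip_def by (subst integral_sum) (auto intro!: integrable_on_mult_right vm phi)
    finally have "ip v (\<lambda>x. \<Sum>n<K. b n * \<phi> n x) = 0" using orth by simp
    then have "ip v u = integral {0..pi} (\<lambda>x. v x * u x - v x * (\<Sum>n<K. b n * \<phi> n x))"
      unfolding ip_def by (subst Henstock_Kurzweil_Integration.integral_diff) (auto intro: vm u cs)
    also have "norm \<dots> \<le> integral {0..pi} (\<lambda>x. norm (v x) * e')"
    proof (rule integral_norm_bound_integral)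
      show "(\<lambda>x. v x * u x - v x * (\<Sum>n<K. b n * \<phi> n x)) integrable_on {0..pi}"
        by (intro integrable_diff vm u cs)
      show "(\<lambda>x. norm (v x) * e') integrable_on {0..pi}" by (intro integrable_on_mult_left vi)
      fix x assume "x \<in> {0..pi}"
      then show "norm (v x * u x - v x * (\<Sum>n<K. b n * \<phi> n x)) \<le> norm (v x) * e'"
        unfolding right_diff_distrib[symmetric] norm_mult by (intro mult_left_mono less_imp_le[OF K]) auto
    qed
    finally show ?thesis using e' by (simp add: I_def)
  qed
  then have "norm (ip v u) \<le> 0" by (rule field_le_epsilon)
  then show ?thesis by simp
qed

text \<open>Gaussian elimination, by induction on the equations. It drives all dimension counts:
  more functions than conditions leave a nontrivial combination that satisfies every
  condition.\<close>

lemma homogeneous_system_nontrivial: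
  fixes A :: "'i \<Rightarrow> 'j \<Rightarrow> 'a::field"
  assumes "finite I" "finite J" "card I < card J"
  shows "\<exists>a. (\<exists>j\<in>J. a j \<noteq> 0) \<and> (\<forall>i\<in>I. (\<Sum>j\<in>J. a j * A i j) = 0)"
  using assms
proof (induction I arbitrary: J A rule: finite_induct)
  case empty
  then obtain j where "j \<in> J" by fastforce
  then show ?case by (intro exI[of _ "\<lambda>_. 1"]) auto
next
  case (insert i I)
  show ?case
  proof (cases "\<forall>j\<in>J. A i j = 0")
    case True
    then show ?thesis using insert.IH[of J A] insert.prems insert.hyps by auto
  next
    case False
    then obtain p where p: "p \<in> J" "A i p \<noteq> 0" by blast
    have "card I < card (J - {p})" using insert p by simp
    then obtain a where a: "\<exists>j\<in>J-{p}. a j \<noteq> 0"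
      "\<And>k. k \<in> I \<Longrightarrow> (\<Sum>j\<in>J-{p}. a j * (A k j - A k p * A i j / A i p)) = 0"
      using insert.IH[of "J - {p}" "\<lambda>k j. A k j - A k p * A i j / A i p"] insert.prems by auto
    \<comment> \<open>The value of the eliminated unknown \<open>p\<close>, solved from equation
      \<open>i\<close>.\<close>
    define ap where "ap = - (\<Sum>j\<in>J-{p}. a j * A i j) / A i p"
    have split: "(\<Sum>j\<in>J. (a(p := ap)) j * A k j) = ap * A k p + (\<Sum>j\<in>J-{p}. a j * A k j)" for k
      using p(1) insert.prems(1) by (subst sum.remove[of _ p]) auto
    have "(\<Sum>j\<in>J. (a(p := ap)) j * A k j) = 0" if "k \<in> insert i I" for k
    proof (cases "k = i")
      case True
      have "(\<Sum>j\<in>J. (a(p := ap)) j * A i j) = 0" unfolding split unfolding ap_def using p(2) by simp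
      then show ?thesis using True by simp
    next
      case False
      then have "(\<Sum>j\<in>J-{p}. a j * A k j) - A k p / A i p * (\<Sum>j\<in>J-{p}. a j * A i j) = 0"
        using a(2)[of k] that by (simp add: sum_distrib_left sum_subtractf algebra_simps)
      then show ?thesis unfolding split unfolding ap_def using p(2) by (simp add: field_simps)
    qed
    then show ?thesis using a(1) by (intro exI[of _ "a(p := ap)"]) auto
  qed
qed

text \<open>Here \<open>g i\<close> stands for the \<open>i\<close>-th iterate of an operator
  available only as a relation, and \<open>P\<close> for a class of such orbits closed under
  polynomials in the operator. Splitting off a root \<open>\<kappa>\<close> of \<open>p\<close>
  makes the cofactor \<open>p'\<close>, applied to \<open>g\<close>, an eigenvector, which
  \<open>eig\<close> kills; so \<open>p'\<close> annihilates \<open>g\<close> as well, with smaller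
  degree.\<close>

lemma annihilated_sequence_zero:
  fixes p :: "complex poly" and g :: "nat \<Rightarrow> 'x \<Rightarrow> complex"
  assumes closed: "\<And>g p. P g \<Longrightarrow> P (\<lambda>i x. \<Sum>j\<le>degree p. coeff p j * g (i + j) x)"
    and eig: "\<And>g \<kappa>. P g \<Longrightarrow> (\<And>x. x \<in> X \<Longrightarrow> g (Suc 0) x = \<kappa> * g 0 x) \<Longrightarrow> \<forall>x\<in>X. g 0 x = 0"
    and "P g" "p \<noteq> 0" "\<And>x. x \<in> X \<Longrightarrow> (\<Sum>j\<le>degree p. coeff p j * g j x) = 0"
  shows "\<forall>x\<in>X. g 0 x = 0"
  using assms(3-5)
proof (induction "degree p" arbitrary: p)
  case 0
  then have "coeff p 0 \<noteq> 0" by (metis leading_coeff_0_iff)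
  then show ?case using 0 by simp
next
  case (Suc d)
  have "\<not> constant (poly p)" using Suc.hyps(2) by (simp add: constant_degree)
  then obtain \<kappa> where "poly p \<kappa> = 0" using fundamental_theorem_of_algebra by blast
  then obtain p' where p': "p = [:-\<kappa>, 1:] * p'" unfolding poly_eq_0_iff_dvd by (rule dvdE)
  have p'0: "p' \<noteq> 0" using p' Suc.prems by auto
  have deg: "degree p = Suc (degree p')" unfolding p' using p'0 by (subst degree_mult_eq) auto
  have eq: "p = pCons 0 p' - smult \<kappa> p'" unfolding p' by (simp add: algebra_simps)
  define u where "u = (\<lambda>i x. \<Sum>j\<le>degree p'. coeff p' j * g (i + j) x)"
  have Pu: "P u" unfolding u_def by (rule closed[OF Suc.prems(1)])
  have "u (Suc 0) x = \<kappa> * u 0 x" if "x \<in> X" for x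
  proof -
    have "0 = (\<Sum>j\<le>Suc (degree p'). coeff p j * g j x)" using Suc.prems(3)[OF that] deg by simp
    also have "\<dots> = (\<Sum>j\<le>Suc (degree p'). coeff (pCons 0 p') j * g j x) - \<kappa> * (\<Sum>j\<le>Suc (degree p'). coeff p' j * g j x)"
      by (subst eq) (simp add: sum_subtractf sum_distrib_left algebra_simps del: sum.atMost_Suc)
    also have "(\<Sum>j\<le>Suc (degree p'). coeff (pCons 0 p') j * g j x) = u (Suc 0) x"
      unfolding u_def by (subst sum.atMost_Suc_shift) simp
    also have "(\<Sum>j\<le>Suc (degree p'). coeff p' j * g j x) = u 0 x"
      unfolding u_def by (simp add: coeff_eq_0)
    finally show ?thesis by simp
  qed
  then have "\<forall>x\<in>X. u 0 x = 0" by (rule eig[OF Pu])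
  then show ?case using Suc.hyps(1)[of p'] Suc.hyps(2) deg Suc.prems(1) p'0 by (simp add: u_def)
qed

section \<open>The cosine system\<close>

abbreviation cosn :: "nat \<Rightarrow> real \<Rightarrow> complex" where
  "cosn n \<equiv> (\<lambda>x. cos (of_nat n * complex_of_real x))"

lemma cosn_eq: "cosn n x = of_real (cos (real n * x))"
  by (metis cos_of_real of_real_mult of_real_of_nat_eq)

section \<open>Orthogonality relations of cosines and sines on \<open>{0..pi}\<close>\<close>

lemma has_integral_cos_scaled:
  assumes "a \<noteq> 0" "0 \<le> b"
  shows "((\<lambda>x. cos (a * x)) has_integral (sin (a * b) / a)) {0..b::real}"
proof -
  have "((\<lambda>x. cos (a * x)) has_integral (sin (a * b) / a - sin (a * 0) / a)) {0..b}"
    by (rule fundamental_theorem_of_calculus)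
       (use assms in \<open>auto intro!: derivative_eq_intros simp flip: has_real_derivative_iff_has_vector_derivative\<close>)
  then show ?thesis by simp
qed

lemma has_integral_cos_nat: "((\<lambda>x. cos (real m * x)) has_integral (if m = 0 then pi else 0)) {0..pi}"
proof (cases "m = 0")
  case True then show ?thesis using has_integral_const_real[of "1::real" 0 pi] by simp
next
  case False then show ?thesis using has_integral_cos_scaled[of "real m" pi] by (simp add: sin_npi)
qed

lemma has_integral_cos_nat_diff:
  "((\<lambda>x. cos ((real j - real k) * x)) has_integral (if j = k then pi else 0)) {0..pi}"
proof (induction j k rule: linorder_wlog)
  case (le a b)
  have "cos ((real a - real b) * x) = cos (real (b - a) * x)" for x
    using cos_minus[of "(real b - real a) * x"] le by (simp add: algebra_simps of_nat_diff)
  then show ?case using has_integral_cos_nat[of "b - a"] le by (auto simp: le_diff_conv)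
next
  case (sym a b)
  have "cos ((real a - real b) * x) = cos ((real b - real a) * x)" for x
    using cos_minus[of "(real b - real a) * x"] by (simp add: algebra_simps)
  then show ?case using sym by (simp add: eq_commute)
qed

lemma has_integral_cos_cos:
  "((\<lambda>x. cos (real j * x) * cos (real k * x)) has_integral
     (if j = k then if j = 0 then pi else pi / 2 else 0)) {0..pi}"
proof -
  have "((\<lambda>x. (cos ((real j - real k) * x) + cos (real (j + k) * x)) * (1/2)) has_integral
     ((if j = k then pi else 0) + (if j + k = 0 then pi else 0)) * (1/2)) {0..pi}"
    by (intro has_integral_mult_left has_integral_add has_integral_cos_nat_diff has_integral_cos_nat)
  moreover have "(cos ((real j - real k) * x) + cos (real (j + k) * x)) * (1/2) = cos (real j * x) * cos (real k * x)" for x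
    unfolding cos_times_cos by (simp add: algebra_simps)
  ultimately show ?thesis by (auto split: if_splits)
qed

lemma has_integral_sin_sin:
  "((\<lambda>x. sin (real j * x) * sin (real k * x)) has_integral (if j = k \<and> j \<noteq> 0 then pi / 2 else 0)) {0..pi}"
proof -
  have "((\<lambda>x. (cos ((real j - real k) * x) - cos (real (j + k) * x)) * (1/2)) has_integral
     ((if j = k then pi else 0) - (if j + k = 0 then pi else 0)) * (1/2)) {0..pi}"
    by (intro has_integral_mult_left has_integral_diff has_integral_cos_nat_diff has_integral_cos_nat)
  moreover have "(cos ((real j - real k) * x) - cos (real (j + k) * x)) * (1/2) = sin (real j * x) * sin (real k * x)" for x
    unfolding sin_times_sin by (simp add: algebra_simps)
  ultimately show ?thesis by (auto split: if_splits)
qed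

definition cos_norm :: "nat \<Rightarrow> real" where
  "cos_norm n = (if n = 0 then pi else pi / 2)"

lemma continuous_on_cosn: "continuous_on S (cosn n)"
  by (intro continuous_intros)

lemma real_orthogonal_cosn: "real_orthogonal cosn cos_norm"
  unfolding real_orthogonal_def
proof (intro conjI allI ballI)
  fix m n
  show "ip (cosn m) (cosn n) = (if m = n then of_real (cos_norm n) else 0)"
  proof -
    have "((\<lambda>x. complex_of_real (cos (real m * x) * cos (real n * x))) has_integral
        of_real (if m = n then cos_norm n else 0)) {0..pi}"
      using has_integral_cos_cos[of m n] by (intro has_integral_of_real) (auto simp: cos_norm_def split: if_splits)
    then show ?thesis
      unfolding ip_def cosn_eq of_real_mult[symmetric] by (auto dest: integral_unique split: if_splits)
  qed
  show "continuous_on {0..pi} (cosn n)" by (rule continuous_on_cosn)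
  show "Im (cosn n x) = 0" for x by (simp only: cosn_eq Im_complex_of_real)
  show "0 < cos_norm n" by (simp add: cos_norm_def)
qed

section \<open>Uniform density of the cosine polynomials\<close>

definition cos_polys :: "(real \<Rightarrow> real) set" where
  "cos_polys = {f. \<exists>K a. (\<forall>k\<ge>K. a k = 0) \<and> (\<forall>x. f x = (\<Sum>k<K. a k * cos (real k * x)))}"

text \<open>The expansion holds for every sufficiently large length, which brings two cosine
  polynomials to a common length.\<close>

lemma cos_polys_iff:
  "f \<in> cos_polys \<longleftrightarrow> (\<exists>K a. \<forall>L\<ge>K. \<forall>x. f x = (\<Sum>k<L. a k * cos (real k * x)))"
proof
  assume "f \<in> cos_polys"
  then obtain K a where K: "\<forall>k\<ge>K. a k = 0" "\<forall>x. f x = (\<Sum>k<K. a k * cos (real k * x))"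
    unfolding cos_polys_def by auto
  have "f x = (\<Sum>k<L. a k * cos (real k * x))" if "L \<ge> K" for L x
    unfolding K(2)[rule_format] by (rule sum.mono_neutral_left) (use K(1) that in auto)
  then show "\<exists>K a. \<forall>L\<ge>K. \<forall>x. f x = (\<Sum>k<L. a k * cos (real k * x))" by blast
next
  assume "\<exists>K a. \<forall>L\<ge>K. \<forall>x. f x = (\<Sum>k<L. a k * cos (real k * x))"
  then obtain K a where K: "\<forall>x. f x = (\<Sum>k<K. a k * cos (real k * x))" by blast
  have "f x = (\<Sum>k<K. (if k < K then a k else 0) * cos (real k * x))" for x
    unfolding K[rule_format] by (rule sum.cong) auto
  then show "f \<in> cos_polys" unfolding cos_polys_def
    by (auto intro!: exI[of _ K] exI[of _ "\<lambda>k. if k < K then a k else 0"])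
qed

lemma cos_polys_add:
  assumes "f \<in> cos_polys" "g \<in> cos_polys" shows "(\<lambda>x. f x + g x) \<in> cos_polys"
proof -
  obtain K a where K: "\<forall>L\<ge>K. \<forall>x. f x = (\<Sum>k<L. a k * cos (real k * x))"
    using assms(1) unfolding cos_polys_iff by blast
  obtain M b where M: "\<forall>L\<ge>M. \<forall>x. g x = (\<Sum>k<L. b k * cos (real k * x))"
    using assms(2) unfolding cos_polys_iff by blast
  have "f x + g x = (\<Sum>k<L. (a k + b k) * cos (real k * x))" if "L \<ge> max K M" for L x
    using K[rule_format, of L x] M[rule_format, of L x] that by (simp add: sum.distrib distrib_right)
  then show ?thesis unfolding cos_polys_iff
    by (intro exI[of _ "max K M"] exI[of _ "\<lambda>k. a k + b k"]) blast
qed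

lemma cos_polys_scale:
  assumes "f \<in> cos_polys" shows "(\<lambda>x. r * f x) \<in> cos_polys"
proof -
  obtain K a where K: "\<forall>L\<ge>K. \<forall>x. f x = (\<Sum>k<L. a k * cos (real k * x))"
    using assms(1) unfolding cos_polys_iff by blast
  have "r * f x = (\<Sum>k<L. (r * a k) * cos (real k * x))" if "L \<ge> K" for L x
    using K[rule_format, of L x] that by (simp add: sum_distrib_left mult.assoc)
  then show ?thesis unfolding cos_polys_iff
    by (intro exI[of _ K] exI[of _ "\<lambda>k. r * a k"]) blast
qed

lemma cos_polys_cos: "(\<lambda>x. cos (real n * x)) \<in> cos_polys"
  unfolding cos_polys_iff
proof (intro exI[of _ "Suc n"] exI[of _ "\<lambda>k. if k = n then 1 else 0"] allI impI)
  fix L x assume "Suc n \<le> L"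
  then show "cos (real n * x) = (\<Sum>k<L. (if k = n then 1 else 0) * cos (real k * x))"
    by (simp add: if_distrib[of "\<lambda>z. z * _"] sum.delta cong: if_cong)
qed

lemma cos_polys_zero: "(\<lambda>x. 0) \<in> cos_polys"
  using cos_polys_scale[OF cos_polys_cos[of 0], of 0] by simp

lemma cos_polys_sum:
  assumes "finite I" "\<And>i. i \<in> I \<Longrightarrow> f i \<in> cos_polys" shows "(\<lambda>x. \<Sum>i\<in>I. f i x) \<in> cos_polys"
  using assms by (induction I rule: finite_induct) (auto intro: cos_polys_add cos_polys_zero)

lemma cos_polys_cos_cos: "(\<lambda>x. cos (real j * x) * cos (real k * x)) \<in> cos_polys"
proof (induction j k rule: linorder_wlog)
  case (le a b)
  have "cos (real a * x) * cos (real b * x) = 1/2 * cos (real (b - a) * x) + 1/2 * cos (real (a + b) * x)" for x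
    unfolding cos_times_cos using cos_minus[of "real a * x - real b * x"] le
    by (simp add: algebra_simps of_nat_diff)
  then show ?case by (simp only:) (intro cos_polys_add cos_polys_scale cos_polys_cos)
next
  case (sym a b) then show ?case by (simp add: mult.commute)
qed

lemma cos_polys_mult:
  assumes "f \<in> cos_polys" "g \<in> cos_polys" shows "(\<lambda>x. f x * g x) \<in> cos_polys"
proof -
  obtain K a where K: "\<And>x. f x = (\<Sum>k<K. a k * cos (real k * x))"
    using assms(1) unfolding cos_polys_def by auto
  obtain M b where M: "\<And>x. g x = (\<Sum>k<M. b k * cos (real k * x))"
    using assms(2) unfolding cos_polys_def by auto
  have "f x * g x = (\<Sum>j<K. \<Sum>k<M. (a j * b k) * (cos (real j * x) * cos (real k * x)))" for x
    unfolding K M sum_product by (simp add: mult_ac)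
  then show ?thesis by (simp only:) (intro cos_polys_sum cos_polys_scale cos_polys_cos_cos finite_lessThan)
qed

text \<open>Products stay inside by the product-to-sum formula, and \<open>cos\<close> alone
  separates the points of \<open>{0..pi}\<close>; this is the setting of the Stone-Weierstrass
  theorem.\<close>

lemma function_ring_on_cos_polys: "function_ring_on cos_polys {0..pi}"
proof
  show "continuous_on {0..pi} f" if "f \<in> cos_polys" for f
  proof -
    obtain K a where "\<And>x. f x = (\<Sum>k<K. a k * cos (real k * x))"
      using \<open>f \<in> cos_polys\<close> unfolding cos_polys_def by auto
    then show ?thesis by (simp add: continuous_intros)
  qed
  show "(\<lambda>_. r) \<in> cos_polys" for r
    using cos_polys_scale[OF cos_polys_cos[of 0], of r] by simp
  show "\<exists>f\<in>cos_polys. f x \<noteq> f y" if "x \<in> {0..pi}" "y \<in> {0..pi}" "x \<noteq> y" for x y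
    using that cos_inj_pi[of x y] by (intro bexI[OF _ cos_polys_cos[of 1]]) auto
qed (auto intro: cos_polys_add cos_polys_mult)

lemma dense_span_cosn: "dense_span cosn"
  unfolding dense_span_def
proof (intro allI impI)
  fix v :: "real \<Rightarrow> complex" and e :: real
  assume v: "continuous_on {0..pi} v" and e: "0 < e"
  have *: "\<exists>g\<in>cos_polys. \<forall>x\<in>{0..pi}. \<bar>f x - g x\<bar> < e / 2" if "continuous_on {0..pi} f" for f
    by (rule function_ring_on.Stone_Weierstrass_basic[OF function_ring_on_cos_polys that half_gt_zero[OF e]])
  obtain g1 where g1: "g1 \<in> cos_polys" "\<And>x. x \<in> {0..pi} \<Longrightarrow> \<bar>Re (v x) - g1 x\<bar> < e / 2"
    using *[OF continuous_on_Re[OF v]] by blast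
  obtain g2 where g2: "g2 \<in> cos_polys" "\<And>x. x \<in> {0..pi} \<Longrightarrow> \<bar>Im (v x) - g2 x\<bar> < e / 2"
    using *[OF continuous_on_Im[OF v]] by blast
  obtain K a where K: "\<forall>L\<ge>K. \<forall>x. g1 x = (\<Sum>k<L. a k * cos (real k * x))"
    using g1(1) unfolding cos_polys_iff by blast
  obtain M b where M: "\<forall>L\<ge>M. \<forall>x. g2 x = (\<Sum>k<L. b k * cos (real k * x))"
    using g2(1) unfolding cos_polys_iff by blast
  define L where "L = max K M"
  have "norm (v x - (\<Sum>n<L. Complex (a n) (b n) * cosn n x)) < e" if x: "x \<in> {0..pi}" for x
  proof -
    have "Re (\<Sum>n<L. Complex (a n) (b n) * cosn n x) = g1 x" "Im (\<Sum>n<L. Complex (a n) (b n) * cosn n x) = g2 x"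
      unfolding cosn_eq using K[rule_format, of L x] M[rule_format, of L x] by (simp_all add: L_def)
    then have "norm (v x - (\<Sum>n<L. Complex (a n) (b n) * cosn n x)) \<le> \<bar>Re (v x) - g1 x\<bar> + \<bar>Im (v x) - g2 x\<bar>"
      using cmod_le[of "v x - (\<Sum>n<L. Complex (a n) (b n) * cosn n x)"] by simp
    then show ?thesis using g1(2)[OF x] g2(2)[OF x] by linarith
  qed
  then show "\<exists>K b. \<forall>x\<in>{0..pi}. norm (v x - (\<Sum>n<K. b n * cosn n x)) < e"
    by (intro exI[of _ L] exI[of _ "\<lambda>n. Complex (a n) (b n)"] ballI)
qed

text \<open>Stated for a function that is only square integrable, as \<open>q\<close> is, whereas
  \<open>sqnorm_approx_ge\<close> concerns continuous functions. Each induction step removes one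
  component of \<open>f\<close> and lowers the squared norm by its share.\<close>

lemma bessel_inequality:
  fixes f :: "real \<Rightarrow> real" and \<phi> :: "nat \<Rightarrow> real \<Rightarrow> real"
  assumes f: "f absolutely_integrable_on {0..pi}" and f2: "(\<lambda>x. (f x)\<^sup>2) integrable_on {0..pi}"
    and \<phi>: "\<And>n. continuous_on {0..pi} (\<phi> n)" and \<beta>: "0 < \<beta>"
    and orth: "\<And>m n. ((\<lambda>x. \<phi> m x * \<phi> n x) has_integral (if m = n then \<beta> else 0)) {0..pi}"
  shows "(\<Sum>n<K. (integral {0..pi} (\<lambda>x. f x * \<phi> n x))\<^sup>2) \<le> \<beta> * integral {0..pi} (\<lambda>x. (f x)\<^sup>2)"
  using f f2
proof (induction K arbitrary: f)
  case 0
  have "0 \<le> integral {0..pi} (\<lambda>x. (f x)\<^sup>2)" by (rule Henstock_Kurzweil_Integration.integral_nonneg[OF 0(2)]) auto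
  then show ?case using \<beta> by simp
next
  case (Suc K)
  define b where "b = (\<lambda>n. integral {0..pi} (\<lambda>x. f x * \<phi> n x))"
  have bi: "((\<lambda>x. f x * \<phi> n x) has_integral b n) {0..pi}" for n
    unfolding b_def
    by (intro integrable_integral set_lebesgue_integral_eq_integral(1) absolutely_integrable_mult_continuous Suc.prems \<phi>)
  define r where "r = b K / \<beta>"
  define f' where "f' = (\<lambda>x. f x - r * \<phi> K x)"
  have f': "f' absolutely_integrable_on {0..pi}"
    unfolding f'_def
    by (intro set_integral_diff Suc.prems absolutely_integrable_continuous_real continuous_intros \<phi>)
  have "((\<lambda>x. (f x)\<^sup>2 - 2 * r * (f x * \<phi> K x) + r\<^sup>2 * (\<phi> K x * \<phi> K x)) has_integral
     integral {0..pi} (\<lambda>x. (f x)\<^sup>2) - 2 * r * b K + r\<^sup>2 * (if K = K then \<beta> else 0)) {0..pi}"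
    by (intro has_integral_add has_integral_diff has_integral_mult_right bi orth integrable_integral Suc.prems)
  moreover have "(f x)\<^sup>2 - 2 * r * (f x * \<phi> K x) + r\<^sup>2 * (\<phi> K x * \<phi> K x) = (f' x)\<^sup>2" for x
    by (simp add: f'_def power2_eq_square algebra_simps)
  moreover have "2 * r * b K - r\<^sup>2 * \<beta> = (b K)\<^sup>2 / \<beta>" using \<beta> by (simp add: r_def power2_eq_square field_simps)
  ultimately have f'2: "((\<lambda>x. (f' x)\<^sup>2) has_integral integral {0..pi} (\<lambda>x. (f x)\<^sup>2) - (b K)\<^sup>2 / \<beta>) {0..pi}"
    by (simp add: algebra_simps)
  have "integral {0..pi} (\<lambda>x. f' x * \<phi> n x) = b n" if "n < K" for n
  proof -
    have "((\<lambda>x. f x * \<phi> n x - r * (\<phi> K x * \<phi> n x)) has_integral b n - r * (if K = n then \<beta> else 0)) {0..pi}"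
      by (intro has_integral_diff has_integral_mult_right bi orth)
    then show ?thesis using that by (auto simp: f'_def algebra_simps dest: integral_unique)
  qed
  then have "(\<Sum>n<K. (b n)\<^sup>2) \<le> \<beta> * integral {0..pi} (\<lambda>x. (f' x)\<^sup>2)"
    using Suc.IH[OF f' has_integral_integrable[OF f'2]] by simp
  then have "(\<Sum>n<Suc K. (b n)\<^sup>2) \<le> \<beta> * integral {0..pi} (\<lambda>x. (f x)\<^sup>2)"
    using \<beta> integral_unique[OF f'2] by (simp add: algebra_simps)
  then show ?case by (simp add: b_def)
qed

text \<open>Even frequencies suffice, because products such as
  \<open>sin (n * t) * cos (n * t)\<close> double the frequency. The index 0 is split off since
  there the cosine has squared norm \<open>pi\<close> instead of \<open>pi / 2\<close> and the sine
  is zero.\<close>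

lemma summable_fourier_coeffs:
  fixes f :: "real \<Rightarrow> real"
  assumes f: "f absolutely_integrable_on {0..pi}" and f2: "(\<lambda>x. (f x)\<^sup>2) integrable_on {0..pi}"
  shows "summable (\<lambda>n. (integral {0..pi} (\<lambda>x. f x * cos (2 * real n * x)))\<^sup>2)"
    and "summable (\<lambda>n. (integral {0..pi} (\<lambda>x. f x * sin (2 * real n * x)))\<^sup>2)"
proof -
  have o1: "((\<lambda>x. cos (2 * real (Suc m) * x) * cos (2 * real (Suc n) * x)) has_integral (if m = n then pi / 2 else 0)) {0..pi}" for m n
    using has_integral_cos_cos[of "2 * Suc m" "2 * Suc n"] unfolding of_nat_mult of_nat_numeral
    by (auto simp del: of_nat_Suc split: if_splits)
  have o2: "((\<lambda>x. sin (2 * real (Suc m) * x) * sin (2 * real (Suc n) * x)) has_integral (if m = n then pi / 2 else 0)) {0..pi}" for m n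
    using has_integral_sin_sin[of "2 * Suc m" "2 * Suc n"] unfolding of_nat_mult of_nat_numeral
    by (auto simp del: of_nat_Suc split: if_splits)
  have "summable (\<lambda>n. (integral {0..pi} (\<lambda>x. f x * cos (2 * real (Suc n) * x)))\<^sup>2)"
    by (rule bounded_imp_summable[where B="pi / 2 * integral {0..pi} (\<lambda>x. (f x)\<^sup>2)"])
       (use bessel_inequality[OF f f2 continuous_on_cos[OF continuous_on_mult[OF continuous_on_const continuous_on_id]] _ o1, where K="Suc _"]
        in \<open>auto simp: lessThan_Suc_atMost simp del: of_nat_Suc\<close>)
  then show "summable (\<lambda>n. (integral {0..pi} (\<lambda>x. f x * cos (2 * real n * x)))\<^sup>2)"
    by (subst (asm) summable_Suc_iff)
  have "summable (\<lambda>n. (integral {0..pi} (\<lambda>x. f x * sin (2 * real (Suc n) * x)))\<^sup>2)"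
    by (rule bounded_imp_summable[where B="pi / 2 * integral {0..pi} (\<lambda>x. (f x)\<^sup>2)"])
       (use bessel_inequality[OF f f2 continuous_on_sin[OF continuous_on_mult[OF continuous_on_const continuous_on_id]] _ o2, where K="Suc _"]
        in \<open>auto simp: lessThan_Suc_atMost simp del: of_nat_Suc\<close>)
  then show "summable (\<lambda>n. (integral {0..pi} (\<lambda>x. f x * sin (2 * real n * x)))\<^sup>2)"
    by (subst (asm) summable_Suc_iff)
qed

section \<open>The Cauchy problem and the eigenfunctions\<close>

lemma integral_rescale:
  fixes g :: "real \<Rightarrow> complex"
  assumes g: "continuous_on {a..b} g" and ab: "a \<le> b"
  shows "integral {a..b} g = (b - a) *\<^sub>R integral {0..1} (\<lambda>r. g (a + (b - a) * r))"
proof (cases "a = b")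
  case False
  then have m: "b - a > 0" using ab by simp
  have "(g has_integral integral {a..b} g) (cbox a b)"
    using integrable_integral[OF integrable_continuous_real[OF g]] by simp
  from has_integral_affinity'[OF this m, of a]
  have "((\<lambda>x. g ((b - a) * x + a)) has_integral (integral {a..b} g /\<^sub>R (b - a))) {0..1}"
    using m by (simp add: divide_inverse[symmetric])
  then have "integral {0..1} (\<lambda>r. g (a + (b - a) * r)) = integral {a..b} g /\<^sub>R (b - a)"
    by (simp add: integral_unique add.commute)
  then show ?thesis using m by simp
qed simp

text \<open>A substitution maps every interval \<open>{l x..u x}\<close> to \<open>{0..1}\<close>;
  the parameter then occurs only in the integrand and in a factor.\<close>

lemma continuous_on_integral_variable_bounds:
  fixes f :: "real \<Rightarrow> real \<Rightarrow> complex" and l u :: "real \<Rightarrow> real"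
  assumes f: "continuous_on {(x, t). x \<in> U \<and> l x \<le> t \<and> t \<le> u x} (\<lambda>(x, t). f x t)"
    and l: "continuous_on U l" and u: "continuous_on U u" and lu: "\<And>x. x \<in> U \<Longrightarrow> l x \<le> u x"
  shows "continuous_on U (\<lambda>x. integral {l x..u x} (f x))"
proof -
  let ?S = "{(x, t). x \<in> U \<and> l x \<le> t \<and> t \<le> u x}"
  have sl: "continuous_on {l x..u x} (f x)" if "x \<in> U" for x
  proof -
    have "continuous_on {l x..u x} (\<lambda>t. case (x, t) of (x, t) \<Rightarrow> f x t)"
      by (rule continuous_on_compose2[OF f]) (use that in \<open>auto intro!: continuous_intros\<close>)
    then show ?thesis by simp
  qed
  have "continuous_on (U \<times> cbox 0 1) (\<lambda>z. (case (fst z, l (fst z) + (u (fst z) - l (fst z)) * snd z) of (x, t) \<Rightarrow> f x t))"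
  proof (rule continuous_on_compose2[OF f])
    show "continuous_on (U \<times> cbox 0 1) (\<lambda>z. (fst z, l (fst z) + (u (fst z) - l (fst z)) * snd z))"
      by (intro continuous_intros continuous_on_compose2[OF l] continuous_on_compose2[OF u]) auto
    show "(\<lambda>z. (fst z, l (fst z) + (u (fst z) - l (fst z)) * snd z)) ` (U \<times> cbox 0 1) \<subseteq> ?S"
    proof clarify
      fix x r :: real assume x: "x \<in> U" and r: "r \<in> cbox 0 1"
      have "0 \<le> (u x - l x) * r" "(u x - l x) * r \<le> (u x - l x) * 1"
        using lu[OF x] r mult_left_mono[of r 1 "u x - l x"] by auto
      then show "fst (x, r) \<in> U \<and> l (fst (x, r)) \<le> l (fst (x, r)) + (u (fst (x, r)) - l (fst (x, r))) * snd (x, r) \<and>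
          l (fst (x, r)) + (u (fst (x, r)) - l (fst (x, r))) * snd (x, r) \<le> u (fst (x, r))"
        using x by simp
    qed
  qed
  then have "continuous_on (U \<times> cbox 0 1) (\<lambda>(x, r). f x (l x + (u x - l x) * r))"
    by (simp add: case_prod_beta)
  then have "continuous_on U (\<lambda>x. (u x - l x) *\<^sub>R integral (cbox 0 1) (\<lambda>r. f x (l x + (u x - l x) * r)))"
    by (intro continuous_intros l u integral_continuous_on_param)
  then show ?thesis
    by (rule continuous_on_eq) (use integral_rescale[OF sl lu] in simp)
qed

lemma continuous_on_kernel_slice:
  assumes "continuous_on kernel_dom (\<lambda>(x, t). K x t)" "x \<in> {0..pi}"
  shows "continuous_on {0..x} (K x)"
proof -
  have "continuous_on {0..x} (\<lambda>t. case (x, t) of (x, t) \<Rightarrow> K x t)"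
    by (rule continuous_on_compose2[OF assms(1)]) (use assms(2) in \<open>auto intro!: continuous_intros simp: kernel_dom_def\<close>)
  then show ?thesis by simp
qed

lemma continuous_on_volterra_op:
  assumes K: "continuous_on kernel_dom (\<lambda>(x, t). K x t)" and u: "continuous_on {0..pi} u"
  shows "continuous_on {0..pi} (volterra_op K u)"
proof -
  have "continuous_on kernel_dom (\<lambda>z. u (snd z))"
    by (rule continuous_on_compose2[OF u]) (auto intro!: continuous_intros simp: kernel_dom_def)
  then have "continuous_on kernel_dom (\<lambda>(x, t). K x t * u t)"
    using continuous_on_mult[OF K, of "\<lambda>z. u (snd z)"] by (simp add: case_prod_beta)
  then have "continuous_on {0..pi} (\<lambda>x. integral {0..x} (\<lambda>t. K x t * u t))"
    by (intro continuous_on_integral_variable_bounds)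
       (auto elim!: continuous_on_subset simp: kernel_dom_def intro!: continuous_intros)
  then show ?thesis unfolding volterra_op_def[abs_def] by (intro continuous_on_add u)
qed

lemma compact_kernel_dom: "compact kernel_dom"
proof -
  have "kernel_dom = ({0..pi} \<times> {0..pi}) \<inter> {z. snd z \<le> fst z}"
    by (auto simp: kernel_dom_def)
  moreover have "closed {z::real \<times> real. snd z \<le> fst z}"
    by (intro closed_Collect_le continuous_intros)
  ultimately show ?thesis by (metis compact_Int_closed compact_Times compact_Icc)
qed

lemma kernel_bounded:
  assumes "continuous_on kernel_dom (\<lambda>(x, t). K x t)"
  obtains M :: real where "M > 0" "\<And>x t. 0 \<le> t \<Longrightarrow> t \<le> x \<Longrightarrow> x \<le> pi \<Longrightarrow> norm (K x t :: complex) \<le> M"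
proof -
  obtain M where "M > 0" "\<forall>z\<in>(\<lambda>(x, t). K x t) ` kernel_dom. norm z \<le> M"
    using compact_imp_bounded[OF compact_continuous_image[OF assms compact_kernel_dom]]
    unfolding bounded_pos by blast
  then show ?thesis by (intro that[of M]) (auto simp: kernel_dom_def)
qed

section \<open>Linear structure of the equation \<open>L_eq\<close>\<close>

lemma L_eq_continuous: "L_eq q y dy f \<Longrightarrow> continuous_on {0..pi} y"
  unfolding L_eq_def using continuous_on_vector_derivative by blast

lemma L_eq_add:
  assumes "L_eq q y dy f" "L_eq q z dz k"
  shows "L_eq q (\<lambda>x. y x + z x) (\<lambda>x. dy x + dz x) (\<lambda>x. f x + k x)"
  unfolding L_eq_def
proof (intro conjI ballI)
  fix x assume x: "x \<in> {0..pi}"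
  show "((\<lambda>x. y x + z x) has_vector_derivative dy x + dz x) (at x within {0..pi})"
    using assms x unfolding L_eq_def by (intro has_vector_derivative_add) auto
  have "((\<lambda>t. (of_real (q t) * y t + f t) + (of_real (q t) * z t + k t)) has_integral (dy x - dy 0) + (dz x - dz 0)) {0..x}"
    using assms x unfolding L_eq_def by (intro has_integral_add) auto
  then show "((\<lambda>t. of_real (q t) * (y t + z t) + (f t + k t)) has_integral dy x + dz x - (dy 0 + dz 0)) {0..x}"
    by (simp add: algebra_simps)
qed

lemma L_eq_scale:
  assumes "L_eq q y dy f"
  shows "L_eq q (\<lambda>x. a * y x) (\<lambda>x. a * dy x) (\<lambda>x. a * f x)"
  unfolding L_eq_def
proof (intro conjI ballI)
  fix x assume x: "x \<in> {0..pi}"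
  show "((\<lambda>x. a * y x) has_vector_derivative a * dy x) (at x within {0..pi})"
    using assms x unfolding L_eq_def by (intro has_vector_derivative_mult_right) auto
  have "((\<lambda>t. a * (of_real (q t) * y t + f t)) has_integral a * (dy x - dy 0)) {0..x}"
    using assms x unfolding L_eq_def by (intro has_integral_mult_right) auto
  then show "((\<lambda>t. of_real (q t) * (a * y t) + a * f t) has_integral a * dy x - a * dy 0) {0..x}"
    by (simp add: algebra_simps)
qed

lemma L_eq_cong:
  assumes "L_eq q y dy f" "\<And>x. x \<in> {0..pi} \<Longrightarrow> y x = y' x" "\<And>x. x \<in> {0..pi} \<Longrightarrow> dy x = dy' x"
    "\<And>x. x \<in> {0..pi} \<Longrightarrow> f x = f' x"
  shows "L_eq q y' dy' f'"
  unfolding L_eq_def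
proof (intro conjI ballI)
  fix x assume x: "x \<in> {0..pi}"
  have "(y has_vector_derivative dy' x) (at x within {0..pi})"
    using assms(1,3) x unfolding L_eq_def by auto
  then show "(y' has_vector_derivative dy' x) (at x within {0..pi})"
    using assms(2) by (intro has_vector_derivative_transform[OF x, of y' y]) auto
  have "((\<lambda>t. of_real (q t) * y t + f t) has_integral dy' x - dy' 0) {0..x}"
    using assms(1,3) x unfolding L_eq_def by auto
  then show "((\<lambda>t. of_real (q t) * y' t + f' t) has_integral dy' x - dy' 0) {0..x}"
    by (rule has_integral_eq[rotated]) (use assms(2,4) x in auto)
qed

lemma L_eq_zero: "L_eq q (\<lambda>x. 0) (\<lambda>x. 0) (\<lambda>x. 0)"
  unfolding L_eq_def by auto

lemma L_eq_sum:
  assumes "finite I" "\<And>i. i \<in> I \<Longrightarrow> L_eq q (y i) (dy i) (f i)"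
  shows "L_eq q (\<lambda>x. \<Sum>i\<in>I. a i * y i x) (\<lambda>x. \<Sum>i\<in>I. a i * dy i x) (\<lambda>x. \<Sum>i\<in>I. a i * f i x)"
  using assms
proof (induction I rule: finite_induct)
  case (insert i I)
  then show ?case using L_eq_add[OF L_eq_scale[of q "y i" "dy i" "f i" "a i"]] by simp
qed (simp add: L_eq_zero)

text \<open>The interval has finite measure and
  \<open>\<bar>q x\<bar> \<le> 1 + (q x)\<^sup>2\<close>, so \<open>q\<close> is integrable together
  with its square.\<close>

lemma L2_0pi_integrable:
  assumes "L2_0pi q"
  shows "q absolutely_integrable_on {0..pi}" "(\<lambda>x. (q x)\<^sup>2) integrable_on {0..pi}"
proof -
  let ?M = "lebesgue_on {0<..<pi}"
  have m: "q \<in> borel_measurable ?M" and i: "integrable ?M (\<lambda>x. (q x)\<^sup>2)"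
    using assms by (auto simp: L2_0pi_def)
  have "integrable ?M (\<lambda>x. 1::real)"
    by (simp add: integrable_restrict_space)
  then have "integrable ?M (\<lambda>x. 1 + (q x)\<^sup>2)" using i by simp
  then have iq: "integrable ?M q"
  proof (rule Bochner_Integration.integrable_bound[OF _ m], intro AE_I2)
    fix x
    have "0 \<le> (\<bar>q x\<bar> - 1)\<^sup>2 + (q x)\<^sup>2 + 1" by simp
    then show "norm (q x) \<le> norm (1 + (q x)\<^sup>2)"
      by (simp add: power2_eq_square algebra_simps)
  qed
  have "q absolutely_integrable_on {0<..<pi}"
    using iq by (simp add: set_integrable_def integrable_restrict_space)
  then show "q absolutely_integrable_on {0..pi}" by (simp add: absolutely_integrable_on_Icc_iff_Ioo)
  have "(\<lambda>x. (q x)\<^sup>2) absolutely_integrable_on {0<..<pi}"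
    using i by (simp add: set_integrable_def integrable_restrict_space)
  then show "(\<lambda>x. (q x)\<^sup>2) integrable_on {0..pi}"
    by (simp add: absolutely_integrable_on_Icc_iff_Ioo set_lebesgue_integral_eq_integral(1))
qed

locale sturm_liouville =
  fixes q :: "real \<Rightarrow> real" and h H :: real
    and c :: "complex \<Rightarrow> real \<Rightarrow> complex"
    and lam :: "nat \<Rightarrow> real"
    and G Hker :: "real \<Rightarrow> real \<Rightarrow> complex"
  assumes q_L2: "L2_0pi q"
    and c_sol: "\<And>\<rho>. cauchy_solution q h \<rho> (c \<rho>)"
    and lam_enum: "eigenvalue_enumeration q h H lam"
    and G_trans: "transmutation_kernel q c G"
    and Hker_inv: "inverse_kernel G Hker"
begin

lemmas q_int = L2_0pi_integrable(1)[OF q_L2] and q2_int = L2_0pi_integrable(2)[OF q_L2]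

lemma qc_int:
  assumes "continuous_on {0..pi} y"
  shows "(\<lambda>t. of_real (q t) * y t :: complex) absolutely_integrable_on {0..pi}"
  using absolutely_integrable_mult_continuous[OF absolutely_integrable_linear[OF q_int bounded_linear_of_real] assms]
  by (simp add: o_def)

text \<open>\<open>cauchy_solution\<close> hides the derivative behind an existential quantifier;
  fixing one makes its boundary values available as terms.\<close>

definition dc :: "complex \<Rightarrow> real \<Rightarrow> complex" where
  "dc \<rho> = (SOME dy. L_eq q (c \<rho>) dy (\<lambda>x. - \<rho>\<^sup>2 * c \<rho> x) \<and> c \<rho> 0 = 1 \<and> dy 0 = of_real h)"

lemma c_eq: "L_eq q (c \<rho>) (dc \<rho>) (\<lambda>x. - \<rho>\<^sup>2 * c \<rho> x)" and c_0: "c \<rho> 0 = 1" and dc_0: "dc \<rho> 0 = of_real h"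
  using someI_ex[OF c_sol[of \<rho>, unfolded cauchy_solution_def]] by (auto simp: dc_def)

lemma c_cont: "continuous_on {0..pi} (c \<rho>)"
  by (rule L_eq_continuous[OF c_eq])

lemma L_eq_rhs_int:
  assumes "L_eq q y dy f" "continuous_on {0..pi} f"
  shows "(\<lambda>t. of_real (q t) * y t + f t) absolutely_integrable_on {0..pi}"
  by (rule set_integral_add(1)[OF qc_int[OF L_eq_continuous[OF assms(1)]] absolutely_integrable_continuous_real[OF assms(2)]])

text \<open>The terms with \<open>q\<close> cancel in the Lagrange identity, so only the continuous
  right-hand sides and the boundary values remain.\<close>

lemma L_eq_lagrange:
  assumes y: "L_eq q y dy f" "continuous_on {0..pi} f" and z: "L_eq q z dz k" "continuous_on {0..pi} k"
  shows "ip y k - ip z f = y pi * dz pi - z pi * dy pi - (y 0 * dz 0 - z 0 * dy 0)"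
proof -
  have "((\<lambda>t. y t * (of_real (q t) * z t + k t) - z t * (of_real (q t) * y t + f t)) has_integral
           (y pi * dz pi - z pi * dy pi - (y 0 * dz 0 - z 0 * dy 0))) {0..pi}"
    by (rule lagrange_identity)
       (use y z L_eq_rhs_int[OF y] L_eq_rhs_int[OF z] in \<open>auto simp: L_eq_def\<close>)
  moreover have "((\<lambda>t. y t * k t - z t * f t) has_integral ip y k - ip z f) {0..pi}"
    unfolding ip_def
    by (intro has_integral_diff integrable_integral ip_integrable L_eq_continuous[OF y(1)] L_eq_continuous[OF z(1)] y(2) z(2))
  ultimately show ?thesis
    by (auto simp: algebra_simps dest: has_integral_unique)
qed

lemma L_eq_unique_zero:
  assumes "L_eq q y dy (\<lambda>x. - \<mu> * y x)" "y 0 = 0" "dy 0 = 0" "x \<in> {0..pi}"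
  shows "y x = 0" "dy x = 0"
proof -
  have p: "(\<lambda>t. of_real (q t) - \<mu>) absolutely_integrable_on {0..pi}"
    using set_integral_diff(1)[OF qc_int[OF continuous_on_const[of _ 1]] absolutely_integrable_continuous_real[OF continuous_on_const[of _ \<mu>]]]
    by simp
  have y: "y t = 0" if "t \<in> {0..pi}" for t
    by (rule second_order_unique[where dy=dy and b=pi, OF p])
       (use assms that in \<open>auto simp: L_eq_def left_diff_distrib\<close>)
  have "((\<lambda>t. of_real (q t) * y t + - \<mu> * y t) has_integral dy x - dy 0) {0..x}"
    using assms(1,4) by (auto simp: L_eq_def)
  moreover have "((\<lambda>t. of_real (q t) * y t + - \<mu> * y t) has_integral 0) {0..x}"
    by (rule has_integral_is_0) (use y assms(4) in auto)
  ultimately show "dy x = 0" using assms(3) by (auto dest: has_integral_unique)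
  show "y x = 0" by (rule y[OF assms(4)])
qed


text \<open>Uniqueness applied to \<open>y - y 0 * c \<rho>\<close>. Consequently every
  eigenfunction is a multiple of some \<open>c \<rho>\<close>, and eigenspaces are
  one-dimensional.\<close>

lemma L_eq_unique:
  assumes y: "L_eq q y dy (\<lambda>x. - \<rho>\<^sup>2 * y x)" and d0: "dy 0 = of_real h * y 0" and x: "x \<in> {0..pi}"
  shows "y x = y 0 * c \<rho> x" "dy x = y 0 * dc \<rho> x"
proof -
  have "L_eq q (\<lambda>x. y x + (- y 0) * c \<rho> x) (\<lambda>x. dy x + (- y 0) * dc \<rho> x)
      (\<lambda>x. - \<rho>\<^sup>2 * y x + (- y 0) * (- \<rho>\<^sup>2 * c \<rho> x))"
    by (intro L_eq_add y L_eq_scale c_eq)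
  then have e: "L_eq q (\<lambda>x. y x + (- y 0) * c \<rho> x) (\<lambda>x. dy x + (- y 0) * dc \<rho> x)
      (\<lambda>x. - \<rho>\<^sup>2 * (y x + (- y 0) * c \<rho> x))"
    by (simp add: algebra_simps)
  show "y x = y 0 * c \<rho> x" "dy x = y 0 * dc \<rho> x"
    using L_eq_unique_zero[OF e _ _ x] d0 by (simp_all add: c_0 dc_0)
qed

text \<open>For real \<open>\<rho>\<^sup>2\<close> the conjugate of \<open>c \<rho>\<close> solves
  the same Cauchy problem, because \<open>q\<close> and \<open>h\<close> are real. Imaginary
  \<open>\<rho>\<close>, that is negative eigenvalues, are included.\<close>

lemma c_real:
  assumes r: "Im (\<rho>\<^sup>2) = 0" and x: "x \<in> {0..pi}"
  shows "Im (c \<rho> x) = 0" "Im (dc \<rho> x) = 0"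
proof -
  have r': "cnj (\<rho>\<^sup>2) = \<rho>\<^sup>2"
    by (rule complex_eqI) (use r in \<open>simp_all del: complex_cnj_power\<close>)
  have e: "L_eq q (\<lambda>x. cnj (c \<rho> x)) (\<lambda>x. cnj (dc \<rho> x)) (\<lambda>x. - \<rho>\<^sup>2 * cnj (c \<rho> x))"
    unfolding L_eq_def
  proof (intro conjI ballI)
    fix x assume x: "x \<in> {0..pi}"
    show "((\<lambda>x. cnj (c \<rho> x)) has_vector_derivative cnj (dc \<rho> x)) (at x within {0..pi})"
      using c_eq[of \<rho>] x unfolding L_eq_def by (intro has_vector_derivative_cnj) auto
    have "((\<lambda>t. of_real (q t) * c \<rho> t + - \<rho>\<^sup>2 * c \<rho> t) has_integral (dc \<rho> x - dc \<rho> 0)) {0..x}"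
      using c_eq[of \<rho>] x unfolding L_eq_def by auto
    then have "(cnj \<circ> (\<lambda>t. of_real (q t) * c \<rho> t + - \<rho>\<^sup>2 * c \<rho> t) has_integral cnj (dc \<rho> x - dc \<rho> 0)) {0..x}"
      by (simp only: has_integral_cnj)
    then show "((\<lambda>t. of_real (q t) * cnj (c \<rho> t) + - \<rho>\<^sup>2 * cnj (c \<rho> t)) has_integral (cnj (dc \<rho> x) - cnj (dc \<rho> 0))) {0..x}"
      using r' by (simp add: o_def)
  qed
  have "cnj (c \<rho> x) = c \<rho> x" "cnj (dc \<rho> x) = dc \<rho> x"
    using L_eq_unique[OF e _ x] by (simp_all add: c_0 dc_0)
  then show "Im (c \<rho> x) = 0" "Im (dc \<rho> x) = 0"
    by (simp_all add: complex_eq_iff)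
qed

text \<open>The characteristic function, called \<open>\<Delta>\<close> above: the defect of
  \<open>c \<rho>\<close> in the boundary condition at \<open>pi\<close>.\<close>

definition charf :: "complex \<Rightarrow> complex" where
  "charf \<rho> = dc \<rho> pi + of_real H * c \<rho> pi"

lemma eigenvalue_iff: "\<rho>\<^sup>2 \<in> sl_eigenvalues q h H \<longleftrightarrow> charf \<rho> = 0"
proof
  assume "\<rho>\<^sup>2 \<in> sl_eigenvalues q h H"
  then obtain y dy where y: "L_eq q y dy (\<lambda>x. - \<rho>\<^sup>2 * y x)" "dy 0 - of_real h * y 0 = 0"
    "dy pi + of_real H * y pi = 0" "\<exists>x\<in>{0..pi}. y x \<noteq> 0"
    unfolding sl_eigenvalues_def by blast
  note u = L_eq_unique[OF y(1)]
  have "y 0 \<noteq> 0" using u y(2,4) by fastforce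
  moreover have "y 0 * charf \<rho> = 0"
    using u[of pi] y(2,3) by (simp add: charf_def algebra_simps)
  ultimately show "charf \<rho> = 0" by simp
next
  assume "charf \<rho> = 0"
  then show "\<rho>\<^sup>2 \<in> sl_eigenvalues q h H"
    unfolding sl_eigenvalues_def charf_def
    using c_eq[of \<rho>] c_0[of \<rho>] dc_0[of \<rho>] pi_ge_zero
    by (intro CollectI exI[of _ "c \<rho>"] exI[of _ "dc \<rho>"] conjI bexI[of _ 0]) auto
qed

text \<open>The Lagrange identity between two solutions; the boundary terms at 0 cancel since the
  initial values are the same.\<close>

lemma ip_c_c: "(\<rho>\<^sup>2 - \<sigma>\<^sup>2) * ip (c \<rho>) (c \<sigma>) = c \<rho> pi * dc \<sigma> pi - c \<sigma> pi * dc \<rho> pi"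
proof -
  have "ip (c \<rho>) (\<lambda>x. - \<sigma>\<^sup>2 * c \<sigma> x) - ip (c \<sigma>) (\<lambda>x. - \<rho>\<^sup>2 * c \<rho> x) = c \<rho> pi * dc \<sigma> pi - c \<sigma> pi * dc \<rho> pi"
    using L_eq_lagrange[OF c_eq _ c_eq, of \<rho> \<sigma>] by (simp add: c_0 dc_0 c_cont continuous_intros)
  moreover have "ip (c \<rho>) (\<lambda>x. - \<sigma>\<^sup>2 * c \<sigma> x) = - \<sigma>\<^sup>2 * ip (c \<rho>) (c \<sigma>)"
    "ip (c \<sigma>) (\<lambda>x. - \<rho>\<^sup>2 * c \<rho> x) = - \<rho>\<^sup>2 * ip (c \<rho>) (c \<sigma>)"
    using ip_mult_left[of "- \<sigma>\<^sup>2" "c \<sigma>" "c \<rho>"] ip_mult_left[of "- \<rho>\<^sup>2" "c \<rho>" "c \<sigma>"] by (simp_all add: ip_commute)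
  ultimately show ?thesis by (simp add: algebra_simps)
qed

lemma ip_c_orth:
  assumes "charf \<rho> = 0" "charf \<sigma> = 0" "\<rho>\<^sup>2 \<noteq> \<sigma>\<^sup>2"
  shows "ip (c \<rho>) (c \<sigma>) = 0"
proof -
  have "dc \<rho> pi = - of_real H * c \<rho> pi" "dc \<sigma> pi = - of_real H * c \<sigma> pi"
    using assms(1,2) unfolding charf_def by (simp_all add: eq_neg_iff_add_eq_0)
  then have "(\<rho>\<^sup>2 - \<sigma>\<^sup>2) * ip (c \<rho>) (c \<sigma>) = 0" by (simp add: ip_c_c)
  then show ?thesis using assms(3) by simp
qed

lemma rho_sq: "(rho lam n)\<^sup>2 = of_real (lam n)"
  by (simp add: rho_def)

lemma charf_rho: "charf (rho lam n) = 0"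
  using lam_enum unfolding eigenvalue_iff[symmetric] rho_sq eigenvalue_enumeration_def by blast

lemma charf_zero_imp:
  assumes "charf \<rho> = 0" obtains n where "\<rho>\<^sup>2 = of_real (lam n)"
  using assms lam_enum unfolding eigenvalue_iff[symmetric] eigenvalue_enumeration_def by blast

lemma lam_mono: "strict_mono lam"
  using lam_enum by (simp add: eigenvalue_enumeration_def)

definition ef :: "nat \<Rightarrow> real \<Rightarrow> complex" where "ef n = c (rho lam n)"

text \<open>A real copy of the weight number; by \<open>alpha_wt\<close> nothing is lost.\<close>

definition wt :: "nat \<Rightarrow> real" where "wt n = Re (alpha c lam n)"

lemma ef_cont: "continuous_on {0..pi} (ef n)"
  unfolding ef_def by (rule c_cont)

lemma ef_real: "x \<in> {0..pi} \<Longrightarrow> Im (ef n x) = 0"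
  unfolding ef_def by (rule c_real) (simp_all add: rho_sq)

lemma alpha_ip: "alpha c lam n = ip (ef n) (ef n)"
  by (simp add: alpha_def ip_def ef_def power2_eq_square)

lemma alpha_wt: "alpha c lam n = of_real (wt n)"
proof -
  have "((\<lambda>x. ef n x * ef n x) has_integral alpha c lam n) {0..pi}"
    unfolding alpha_ip ip_def by (intro integrable_integral ip_integrable ef_cont)
  then have "((\<lambda>x. Im (ef n x * ef n x)) has_integral Im (alpha c lam n)) {0..pi}"
    by (rule has_integral_Im)
  moreover have "((\<lambda>x. Im (ef n x * ef n x)) has_integral 0) {0..pi}"
    by (rule has_integral_is_0) (simp add: ef_real)
  ultimately have "Im (alpha c lam n) = 0" by (rule has_integral_unique)
  then show ?thesis by (simp add: wt_def complex_eq_iff)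
qed

lemma wt_sqnorm: "wt n = sqnorm (ef n)"
proof -
  have "((\<lambda>x. ef n x * ef n x) has_integral alpha c lam n) {0..pi}"
    unfolding alpha_ip ip_def by (intro integrable_integral ip_integrable ef_cont)
  then have "((\<lambda>x. Re (ef n x * ef n x)) has_integral wt n) {0..pi}"
    unfolding wt_def by (rule has_integral_Re)
  then have "((\<lambda>x. (norm (ef n x))\<^sup>2) has_integral wt n) {0..pi}"
    by (rule has_integral_eq[rotated]) (simp add: cmod_power2 ef_real, simp add: power2_eq_square)
  then show ?thesis by (simp add: sqnorm_def integral_unique)
qed

lemma wt_pos: "0 < wt n"
proof -
  have "ef n 0 \<noteq> 0" by (simp add: ef_def c_0)
  then have "sqnorm (ef n) \<noteq> 0" using sqnorm_eq_0_imp[OF ef_cont, of n 0] by auto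
  then show ?thesis using sqnorm_nonneg[of "ef n"] by (simp add: wt_sqnorm)
qed

lemma real_orthogonal_ef: "real_orthogonal ef wt"
  unfolding real_orthogonal_def
proof (intro conjI allI ballI)
  fix m n
  show "ip (ef m) (ef n) = (if m = n then of_real (wt n) else 0)"
  proof (cases "m = n")
    case True then show ?thesis by (simp add: alpha_ip[symmetric] alpha_wt)
  next
    case False
    then have "lam m \<noteq> lam n" using lam_mono by (simp add: strict_mono_eq)
    then show ?thesis using False unfolding ef_def
      by (simp add: ip_c_orth charf_rho rho_sq)
  qed
qed (auto intro: ef_cont ef_real wt_pos)

lemma G_cont: "continuous_on kernel_dom (\<lambda>(x, t). G x t)"
  using G_trans by (simp add: transmutation_kernel_def)

lemma Hker_cont: "continuous_on kernel_dom (\<lambda>(x, t). Hker x t)"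
  using Hker_inv by (simp add: inverse_kernel_def)

lemma c_volterra: "x \<in> {0..pi} \<Longrightarrow> c \<rho> x = volterra_op G (\<lambda>t. cos (\<rho> * of_real t)) x"
  using G_trans by (simp add: transmutation_kernel_def)

lemma Hker_G: "continuous_on {0..pi} u \<Longrightarrow> x \<in> {0..pi} \<Longrightarrow> volterra_op Hker (volterra_op G u) x = u x"
  and G_Hker: "continuous_on {0..pi} u \<Longrightarrow> x \<in> {0..pi} \<Longrightarrow> volterra_op G (volterra_op Hker u) x = u x"
  using Hker_inv by (auto simp: inverse_kernel_def)

text \<open>The constant is \<open>1 + pi * M\<close> with \<open>M\<close> a bound of the kernel on
  the compact triangle. Applied to cosines, this is the source of all estimates of \<open>c\<close>
  that are uniform in the spectral parameter.\<close>

lemma volterra_G_bound: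
  "\<exists>M>0. \<forall>u v x d. continuous_on {0..pi} u \<longrightarrow> continuous_on {0..pi} v \<longrightarrow> x \<in> {0..pi} \<longrightarrow>
     (\<forall>t\<in>{0..pi}. norm (u t - v t) \<le> d) \<longrightarrow> norm (volterra_op G u x - volterra_op G v x) \<le> M * d"
proof -
  obtain M where M: "M > 0" "\<And>x t. 0 \<le> t \<Longrightarrow> t \<le> x \<Longrightarrow> x \<le> pi \<Longrightarrow> norm (G x t) \<le> M"
    using kernel_bounded[OF G_cont] by blast
  show ?thesis
  proof (intro exI[of _ "1 + pi * M"] conjI allI impI)
    show "1 + pi * M > 0" using M(1) by (simp add: add_pos_pos)
    fix u v :: "real \<Rightarrow> complex" and x d :: real
    assume u: "continuous_on {0..pi} u" and v: "continuous_on {0..pi} v" and x: "x \<in> {0..pi}"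
      and "\<forall>t\<in>{0..pi}. norm (u t - v t) \<le> d"
    then have d: "\<And>t. t \<in> {0..pi} \<Longrightarrow> norm (u t - v t) \<le> d" by blast
    have d0: "0 \<le> d" using order_trans[OF norm_ge_zero d[of 0]] by simp
    have int: "(\<lambda>s. G x s * w s) integrable_on {0..x}" if "continuous_on {0..pi} w" for w
      by (intro integrable_continuous_real continuous_on_mult continuous_on_kernel_slice[OF G_cont] x
          continuous_on_subset[OF that]) (use x in auto)
    have "volterra_op G u x - volterra_op G v x = (u x - v x) + integral {0..x} (\<lambda>s. G x s * u s - G x s * v s)"
      by (simp add: volterra_op_def Henstock_Kurzweil_Integration.integral_diff[OF int[OF u] int[OF v]])
    also have "norm \<dots> \<le> d + integral {0..x} (\<lambda>s. M * d)"
    proof (intro norm_triangle_le add_mono d x integral_norm_bound_integral integrable_diff int u v)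
      fix s assume s: "s \<in> {0..x}"
      show "norm (G x s * u s - G x s * v s) \<le> M * d"
        unfolding right_diff_distrib[symmetric] norm_mult
        using M s x d d0 by (intro mult_mono) auto
    qed auto
    also have "\<dots> \<le> (1 + pi * M) * d"
      using x M(1) d0 mult_right_mono[of x pi "M * d"] by (simp add: algebra_simps)
    finally show "norm (volterra_op G u x - volterra_op G v x) \<le> (1 + pi * M) * d" .
  qed
qed

end

section \<open>Asymptotics of the solutions\<close>

lemma abs_sin_diff_le: "\<bar>sin a - sin b\<bar> \<le> \<bar>a - b :: real\<bar>"
proof -
  have "\<bar>sin a - sin b\<bar> = 2 * \<bar>sin ((a - b) / 2)\<bar> * \<bar>cos ((a + b) / 2)\<bar>"
    unfolding sin_diff_sin abs_mult by simp
  also have "\<dots> \<le> 2 * \<bar>(a - b) / 2\<bar> * 1"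
    by (intro mult_mono abs_sin_x_le_abs_x) auto
  finally show ?thesis by simp
qed

lemma abs_cos_diff_le: "\<bar>cos a - cos b\<bar> \<le> \<bar>a - b :: real\<bar>"
  using abs_sin_diff_le[of "pi/2 - a" "pi/2 - b"] by (simp add: sin_diff abs_minus_commute)

lemma abs_sin_sub_self_le: "\<bar>sin x - x\<bar> \<le> x\<^sup>2 / (2::real)"
proof -
  have "(\<Sum>m<2. sin_coeff m * x ^ m) = x"
    by (simp add: numeral_2_eq_2 sin_coeff_def)
  moreover have "inverse (fact 2) * \<bar>x\<bar> ^ 2 = x\<^sup>2 / 2" by (simp add: fact_numeral)
  ultimately show ?thesis using Maclaurin_sin_bound[of x 2] by simp
qed

lemma abs_cos_sub_1_le: "\<bar>cos x - 1\<bar> \<le> x\<^sup>2 / (2::real)"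
proof -
  have "cos x = 1 - 2 * (sin (x / 2))\<^sup>2" using cos_double_sin[of "x / 2"] by simp
  moreover have "(sin (x / 2))\<^sup>2 \<le> (x / 2)\<^sup>2"
    using abs_sin_x_le_abs_x[of "x / 2"] by (simp only: abs_le_square_iff)
  ultimately show ?thesis by (simp add: power_divide)
qed

text \<open>As \<open>\<bar>x\<bar> \<le> 2\<close>, the cubic Taylor error
  \<open>\<bar>x\<bar> ^ 3 / 6\<close> is at most two thirds of \<open>\<bar>x\<bar>\<close>. The
  factor \<open>1 / 3\<close> is later absorbed by \<open>pi > 3\<close>.\<close>

lemma abs_sin_ge:
  assumes "\<bar>x\<bar> \<le> pi / (2::real)" shows "\<bar>x\<bar> / 3 \<le> \<bar>sin x\<bar>"
proof -
  have "\<bar>sin x - x\<bar> \<le> \<bar>x\<bar> ^ 3 / 6"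
    using Maclaurin_sin_bound[of x 3] by (simp add: numeral_3_eq_3 numeral_2_eq_2 sin_coeff_def fact_numeral)
  also have "\<bar>x\<bar> ^ 3 / 6 \<le> \<bar>x\<bar> * 4 / 6"
  proof -
    have "\<bar>x\<bar> \<le> 2" using assms pi_less_4 by linarith
    then have "\<bar>x\<bar>\<^sup>2 \<le> 2\<^sup>2" by (intro power_mono) auto
    then have "\<bar>x\<bar> * \<bar>x\<bar>\<^sup>2 \<le> \<bar>x\<bar> * 4" by (intro mult_left_mono) auto
    then show ?thesis by (simp add: power3_eq_cube power2_eq_square)
  qed
  finally show ?thesis by linarith
qed

context sturm_liouville
begin

section \<open>Integrals against \<open>q\<close>, and the solution at real spectral
  parameters\<close>

definition qn :: real where "qn = integral {0..pi} (\<lambda>t. \<bar>q t\<bar>)"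

lemma abs_q_int: "(\<lambda>t. \<bar>q t\<bar>) integrable_on {0..pi}"
  using q_int unfolding absolutely_integrable_on_def by (simp add: real_norm_def)

lemma qn_nonneg: "0 \<le> qn"
  unfolding qn_def by (rule Henstock_Kurzweil_Integration.integral_nonneg[OF abs_q_int]) auto

lemma qg_abs_int:
  "continuous_on {0..pi} g \<Longrightarrow> (\<lambda>t. q t * g t) absolutely_integrable_on {0..pi}" for g :: "real \<Rightarrow> real"
  by (rule absolutely_integrable_mult_continuous[OF q_int])

lemma qg_int:
  fixes g :: "real \<Rightarrow> real"
  assumes "continuous_on {0..pi} g" "x \<in> {0..pi}" shows "(\<lambda>t. q t * g t) integrable_on {0..x}"
  using set_lebesgue_integral_eq_integral(1)[OF qg_abs_int[OF assms(1)]]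
  by (rule integrable_on_subinterval) (use assms(2) in auto)

lemma qg_bound:
  fixes g :: "real \<Rightarrow> real"
  assumes g: "continuous_on {0..pi} g" and x: "x \<in> {0..pi}" and B: "\<And>t. t \<in> {0..x} \<Longrightarrow> \<bar>g t\<bar> \<le> B"
  shows "\<bar>integral {0..x} (\<lambda>t. q t * g t)\<bar> \<le> qn * B"
proof -
  have B0: "0 \<le> B" using B[of 0] x by fastforce
  have i: "(\<lambda>t. \<bar>q t\<bar>) integrable_on {0..x}"
    using abs_q_int by (rule integrable_on_subinterval) (use x in auto)
  have "\<bar>integral {0..x} (\<lambda>t. q t * g t)\<bar> \<le> integral {0..x} (\<lambda>t. \<bar>q t\<bar> * B)"
    unfolding real_norm_def[symmetric]
    by (rule integral_norm_bound_integral[OF qg_int[OF g x] integrable_on_mult_left[OF i[folded real_norm_def]]])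
       (use B in \<open>auto simp: abs_mult intro: mult_left_mono\<close>)
  also have "\<dots> = integral {0..x} (\<lambda>t. \<bar>q t\<bar>) * B" by simp
  also have "\<dots> \<le> qn * B" unfolding qn_def
    by (intro mult_right_mono integral_subset_le i abs_q_int B0) (use x in auto)
  finally show ?thesis .
qed

lemma qg_diff_bound:
  fixes g g' :: "real \<Rightarrow> real"
  assumes g: "continuous_on {0..pi} g" "continuous_on {0..pi} g'" and x: "x \<in> {0..pi}"
    and B: "\<And>t. t \<in> {0..x} \<Longrightarrow> \<bar>g t - g' t\<bar> \<le> B"
  shows "\<bar>integral {0..x} (\<lambda>t. q t * g t) - integral {0..x} (\<lambda>t. q t * g' t)\<bar> \<le> qn * B"
proof -
  have "integral {0..x} (\<lambda>t. q t * g t) - integral {0..x} (\<lambda>t. q t * g' t) = integral {0..x} (\<lambda>t. q t * (g t - g' t))"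
    unfolding right_diff_distrib by (intro Henstock_Kurzweil_Integration.integral_diff[symmetric] qg_int g x)
  then show ?thesis using qg_bound[OF continuous_on_diff[OF g] x B] by simp
qed

definition cr :: "real \<Rightarrow> real \<Rightarrow> real" where "cr \<rho> x = Re (c (of_real \<rho>) x)"
definition dcr :: "real \<Rightarrow> real \<Rightarrow> real" where "dcr \<rho> x = Re (dc (of_real \<rho>) x)"

lemma c_of_real: "x \<in> {0..pi} \<Longrightarrow> c (of_real \<rho>) x = of_real (cr \<rho> x)"
  using c_real(1)[of "of_real \<rho>" x] by (simp add: cr_def complex_eq_iff power2_eq_square)

lemma dc_of_real: "x \<in> {0..pi} \<Longrightarrow> dc (of_real \<rho>) x = of_real (dcr \<rho> x)"
  using c_real(2)[of "of_real \<rho>" x] by (simp add: dcr_def complex_eq_iff power2_eq_square)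

lemma cr_cont: "continuous_on {0..pi} (cr \<rho>)"
  unfolding cr_def[abs_def] by (intro continuous_on_Re c_cont)

lemma cr_0: "cr \<rho> 0 = 1" and dcr_0: "dcr \<rho> 0 = h"
  by (simp_all add: cr_def dcr_def c_0 dc_0)

lemma cr_deriv: "x \<in> {0..pi} \<Longrightarrow> (cr \<rho> has_vector_derivative dcr \<rho> x) (at x within {0..pi})"
  using c_eq[of "of_real \<rho>"] unfolding L_eq_def cr_def[abs_def] dcr_def
  by (auto intro: bounded_linear.has_vector_derivative[OF bounded_linear_Re])

lemma dcr_integral:
  assumes x: "x \<in> {0..pi}"
  shows "((\<lambda>t. q t * cr \<rho> t - \<rho>\<^sup>2 * cr \<rho> t) has_integral dcr \<rho> x - dcr \<rho> 0) {0..x}"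
proof -
  have "((\<lambda>t. of_real (q t) * c (of_real \<rho>) t + - (of_real \<rho>)\<^sup>2 * c (of_real \<rho>) t) has_integral dc (of_real \<rho>) x - dc (of_real \<rho>) 0) {0..x}"
    using c_eq[of "of_real \<rho>"] x unfolding L_eq_def by blast
  from has_integral_Re[OF this]
  have "((\<lambda>t. Re (of_real (q t) * c (of_real \<rho>) t + - (of_real \<rho>)\<^sup>2 * c (of_real \<rho>) t)) has_integral dcr \<rho> x - dcr \<rho> 0) {0..x}"
    by (simp only: dcr_def minus_complex.simps)
  then show ?thesis
    by (rule has_integral_eq[rotated]) (use x in \<open>simp add: c_of_real power2_eq_square\<close>)
qed

text \<open>The Lagrange identity between \<open>cr \<rho>\<close> and a solution \<open>z\<close>
  of the equation with zero potential. Choosing \<open>z\<close> so that \<open>z x\<close> or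
  \<open>dz x\<close> vanishes isolates \<open>cr \<rho> x\<close> or
  \<open>dcr \<rho> x\<close>.\<close>

lemma variation_of_constants:
  fixes z dz :: "real \<Rightarrow> real"
  assumes x: "x \<in> {0..pi}"
    and z: "\<And>t. (z has_real_derivative dz t) (at t)" "\<And>t. (dz has_real_derivative - \<rho>\<^sup>2 * z t) (at t)"
  shows "cr \<rho> x * dz x - z x * dcr \<rho> x = dz 0 - h * z 0 - integral {0..x} (\<lambda>t. q t * (cr \<rho> t * z t))"
proof -
  have zc: "continuous_on S z" "continuous_on S dz" for S
    using z by (meson DERIV_isCont continuous_at_imp_continuous_on)+
  have sub: "continuous_on {0..x} g" if "continuous_on {0..pi} g" for g :: "real \<Rightarrow> real"
    using that by (rule continuous_on_subset) (use x in auto)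
  have ai: "(\<lambda>t. q t * cr \<rho> t - \<rho>\<^sup>2 * cr \<rho> t) absolutely_integrable_on {0..pi}"
    by (intro set_integral_diff(1) qg_abs_int cr_cont absolutely_integrable_continuous_real continuous_intros)
  have "((\<lambda>t. cr \<rho> t * (- \<rho>\<^sup>2 * z t) - z t * (q t * cr \<rho> t - \<rho>\<^sup>2 * cr \<rho> t)) has_integral
      (cr \<rho> x * dz x - z x * dcr \<rho> x - (cr \<rho> 0 * dz 0 - z 0 * dcr \<rho> 0))) {0..x}"
  proof (rule lagrange_identity)
    show "0 \<le> x" using x by simp
    show "(cr \<rho> has_vector_derivative dcr \<rho> t) (at t within {0..x})" if "t \<in> {0..x}" for t
      by (rule has_vector_derivative_within_subset[OF cr_deriv]) (use that x in auto)
    show "((\<lambda>t. q t * cr \<rho> t - \<rho>\<^sup>2 * cr \<rho> t) has_integral dcr \<rho> t - dcr \<rho> 0) {0..t}" if "t \<in> {0..x}" for t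
      using that x by (intro dcr_integral) auto
    show "(\<lambda>t. q t * cr \<rho> t - \<rho>\<^sup>2 * cr \<rho> t) absolutely_integrable_on {0..x}"
      by (rule absolutely_integrable_on_subIcc[OF ai]) (use x in auto)
    show "(z has_vector_derivative dz t) (at t within {0..x})" for t
      using z(1) has_field_derivative_at_within has_real_derivative_iff_has_vector_derivative by blast
    show "((\<lambda>t. - \<rho>\<^sup>2 * z t) has_integral dz t - dz 0) {0..t}" if "t \<in> {0..x}" for t
    proof (rule fundamental_theorem_of_calculus)
      show "(dz has_vector_derivative - \<rho>\<^sup>2 * z s) (at s within {0..t})" for s
        using z(2)[of s] has_field_derivative_at_within has_real_derivative_iff_has_vector_derivative by blast
    qed (use that in auto)
    show "(\<lambda>t. - \<rho>\<^sup>2 * z t) absolutely_integrable_on {0..x}"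
      by (intro absolutely_integrable_continuous_real continuous_intros zc)
  qed
  then have "((\<lambda>t. - (q t * (cr \<rho> t * z t))) has_integral
      (cr \<rho> x * dz x - z x * dcr \<rho> x - (dz 0 - h * z 0))) {0..x}"
    by (simp add: algebra_simps cr_0 dcr_0)
  from integral_unique[OF this] show ?thesis by simp
qed

text \<open>The deviation from the free solution:
  \<open>cr \<rho> x = cos (\<rho> * x) + sf \<rho> x / \<rho>\<close>. Written as an integral of
  \<open>cr\<close>, it inherits bounds that are uniform in \<open>\<rho>\<close>.\<close>

definition sf :: "real \<Rightarrow> real \<Rightarrow> real" where
  "sf \<rho> x = h * sin (\<rho> * x) + integral {0..x} (\<lambda>t. q t * (cr \<rho> t * sin (\<rho> * (x - t))))"

lemma cr_sf: "x \<in> {0..pi} \<Longrightarrow> \<rho> * cr \<rho> x = \<rho> * cos (\<rho> * x) + sf \<rho> x"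
proof -
  assume x: "x \<in> {0..pi}"
  have "cr \<rho> x * (- \<rho> * cos (\<rho> * (x - x))) - sin (\<rho> * (x - x)) * dcr \<rho> x =
      - \<rho> * cos (\<rho> * (x - 0)) - h * sin (\<rho> * (x - 0)) - integral {0..x} (\<lambda>t. q t * (cr \<rho> t * sin (\<rho> * (x - t))))"
    by (rule variation_of_constants[OF x, where z="\<lambda>t. sin (\<rho> * (x - t))" and dz="\<lambda>t. - \<rho> * cos (\<rho> * (x - t))"])
       (auto intro!: derivative_eq_intros simp: power2_eq_square)
  then show ?thesis by (simp add: sf_def algebra_simps)
qed

lemma dcr_formula:
  "x \<in> {0..pi} \<Longrightarrow> dcr \<rho> x = - \<rho> * sin (\<rho> * x) + h * cos (\<rho> * x) + integral {0..x} (\<lambda>t. q t * (cr \<rho> t * cos (\<rho> * (x - t))))"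
proof -
  assume x: "x \<in> {0..pi}"
  have "cr \<rho> x * (\<rho> * sin (\<rho> * (x - x))) - cos (\<rho> * (x - x)) * dcr \<rho> x =
      \<rho> * sin (\<rho> * (x - 0)) - h * cos (\<rho> * (x - 0)) - integral {0..x} (\<lambda>t. q t * (cr \<rho> t * cos (\<rho> * (x - t))))"
    by (rule variation_of_constants[OF x, where z="\<lambda>t. cos (\<rho> * (x - t))" and dz="\<lambda>t. \<rho> * sin (\<rho> * (x - t))"])
       (auto intro!: derivative_eq_intros simp: power2_eq_square)
  then show ?thesis by simp
qed

definition KC :: real where
  "KC = (SOME K. K > 0 \<and> (\<forall>\<rho> x. x \<in> {0..pi} \<longrightarrow> \<bar>cr \<rho> x\<bar> \<le> K) \<and>
     (\<forall>\<rho> \<sigma> x. x \<in> {0..pi} \<longrightarrow> \<bar>cr \<rho> x - cr \<sigma> x\<bar> \<le> K * \<bar>\<rho> - \<sigma>\<bar>))"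

text \<open>Cosines are bounded by 1 and satisfy \<open>\<bar>cos (\<rho> * t) - cos (\<sigma> *
  t)\<bar> \<le> pi * \<bar>\<rho> - \<sigma>\<bar>\<close> on \<open>{0..pi}\<close>; the bounded
  operator \<open>T\<close> transports both facts to \<open>c\<close>. As \<open>pi > 1\<close>, the
  one constant \<open>M * pi\<close> serves for both.\<close>

lemma KC_pos: "KC > 0" and cr_bound: "x \<in> {0..pi} \<Longrightarrow> \<bar>cr \<rho> x\<bar> \<le> KC"
  and cr_lipschitz: "x \<in> {0..pi} \<Longrightarrow> \<bar>cr \<rho> x - cr \<sigma> x\<bar> \<le> KC * \<bar>\<rho> - \<sigma>\<bar>"
proof -
  obtain M :: real where M: "M > 0" "\<And>u v x d. continuous_on {0..pi} u \<Longrightarrow> continuous_on {0..pi} v \<Longrightarrow> x \<in> {0..pi} \<Longrightarrow>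
       \<forall>t\<in>{0..pi}. norm (u t - v t) \<le> d \<Longrightarrow> norm (volterra_op G u x - volterra_op G v x) \<le> M * d"
    using volterra_G_bound by blast
  have cosr: "cos (of_real \<rho> * complex_of_real t) = of_real (cos (\<rho> * t))" for \<rho> t
    by (metis cos_of_real of_real_mult)
  have 1: "\<bar>cr \<rho> x\<bar> \<le> M" if x: "x \<in> {0..pi}" for \<rho> x
  proof -
    have "norm (volterra_op G (\<lambda>t. cos (of_real \<rho> * of_real t)) x - volterra_op G (\<lambda>t. 0) x) \<le> M * 1"
      by (rule M(2)[OF _ _ x]) (auto simp: cosr norm_of_real intro!: continuous_intros)
    then have "norm (c (of_real \<rho>) x) \<le> M"
      unfolding c_volterra[OF x] by (simp add: volterra_op_def[of _ "\<lambda>t. 0"])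
    then show ?thesis unfolding c_of_real[OF x] norm_of_real .
  qed
  have 2: "\<bar>cr \<rho> x - cr \<sigma> x\<bar> \<le> M * (pi * \<bar>\<rho> - \<sigma>\<bar>)" if x: "x \<in> {0..pi}" for \<rho> \<sigma> x
  proof -
    have "norm (volterra_op G (\<lambda>t. cos (of_real \<rho> * of_real t)) x - volterra_op G (\<lambda>t. cos (of_real \<sigma> * of_real t)) x) \<le> M * (pi * \<bar>\<rho> - \<sigma>\<bar>)"
    proof (rule M(2)[OF _ _ x], goal_cases)
      case 3
      show ?case
      proof
      fix t assume t: "t \<in> {0..pi}"
      have "norm (cos (of_real \<rho> * complex_of_real t) - cos (of_real \<sigma> * complex_of_real t)) = \<bar>cos (\<rho> * t) - cos (\<sigma> * t)\<bar>"
        unfolding cosr of_real_diff[symmetric] norm_of_real ..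
      also have "\<dots> \<le> \<bar>\<rho> * t - \<sigma> * t\<bar>" by (rule abs_cos_diff_le)
      also have "\<dots> \<le> pi * \<bar>\<rho> - \<sigma>\<bar>"
        using t mult_right_mono[of t pi "\<bar>\<rho> - \<sigma>\<bar>"] by (simp add: left_diff_distrib[symmetric] abs_mult mult.commute)
      finally show "norm (cos (of_real \<rho> * complex_of_real t) - cos (of_real \<sigma> * complex_of_real t)) \<le> pi * \<bar>\<rho> - \<sigma>\<bar>" .
      qed
    qed (intro continuous_intros)+
    then show ?thesis
      unfolding c_volterra[OF x, symmetric] c_of_real[OF x] of_real_diff[symmetric] norm_of_real .
  qed
  have "M * 1 \<le> M * pi" using M(1) pi_gt3 by (intro mult_left_mono) auto
  then have "M \<le> M * pi" by simp
  have 3: "\<bar>cr \<rho> x\<bar> \<le> M * pi" if "x \<in> {0..pi}" for \<rho> x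
    using 1[OF that, of \<rho>] \<open>M \<le> M * pi\<close> by linarith
  have 4: "\<bar>cr \<rho> x - cr \<sigma> x\<bar> \<le> (M * pi) * \<bar>\<rho> - \<sigma>\<bar>" if "x \<in> {0..pi}" for \<rho> \<sigma> x
    using 2[OF that, of \<rho> \<sigma>] unfolding mult.assoc .
  have "M * pi > 0" using M(1) by simp
  then have "\<exists>K. K > 0 \<and> (\<forall>\<rho> x. x \<in> {0..pi} \<longrightarrow> \<bar>cr \<rho> x\<bar> \<le> K) \<and>
     (\<forall>\<rho> \<sigma> x. x \<in> {0..pi} \<longrightarrow> \<bar>cr \<rho> x - cr \<sigma> x\<bar> \<le> K * \<bar>\<rho> - \<sigma>\<bar>)"
    using 3 4 by blast
  note K = someI_ex[OF this, folded KC_def]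
  show "KC > 0" using K by blast
  show "x \<in> {0..pi} \<Longrightarrow> \<bar>cr \<rho> x\<bar> \<le> KC" using K by blast
  show "x \<in> {0..pi} \<Longrightarrow> \<bar>cr \<rho> x - cr \<sigma> x\<bar> \<le> KC * \<bar>\<rho> - \<sigma>\<bar>" using K by blast
qed

definition KS :: real where "KS = \<bar>h\<bar> + KC * qn"
definition KL :: real where "KL = \<bar>h\<bar> * pi + (KC + KC * pi) * qn"

lemma KS_nonneg: "0 \<le> KS" and KL_nonneg: "0 \<le> KL"
  using KC_pos qn_nonneg by (simp_all add: KS_def KL_def)

lemma sf_bound: assumes x: "x \<in> {0..pi}" shows "\<bar>sf \<rho> x\<bar> \<le> KS"
proof -
  have "\<bar>integral {0..x} (\<lambda>t. q t * (cr \<rho> t * sin (\<rho> * (x - t))))\<bar> \<le> qn * KC"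
  proof (rule qg_bound[OF _ x])
    show "continuous_on {0..pi} (\<lambda>t. cr \<rho> t * sin (\<rho> * (x - t)))" by (intro continuous_intros cr_cont)
    fix t assume "t \<in> {0..x}"
    then have "\<bar>cr \<rho> t\<bar> * \<bar>sin (\<rho> * (x - t))\<bar> \<le> KC * 1"
      using x KC_pos by (intro mult_mono cr_bound) auto
    then show "\<bar>cr \<rho> t * sin (\<rho> * (x - t))\<bar> \<le> KC" by (simp add: abs_mult)
  qed
  moreover have "\<bar>h * sin (\<rho> * x)\<bar> \<le> \<bar>h\<bar>" unfolding abs_mult by (simp add: mult_left_le)
  ultimately show ?thesis unfolding sf_def KS_def by (simp add: mult.commute)
qed

lemma sf_lipschitz: assumes x: "x \<in> {0..pi}" shows "\<bar>sf \<rho> x - sf \<sigma> x\<bar> \<le> KL * \<bar>\<rho> - \<sigma>\<bar>"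
proof -
  have sl: "\<bar>sin (\<rho> * y) - sin (\<sigma> * y)\<bar> \<le> pi * \<bar>\<rho> - \<sigma>\<bar>" if "y \<in> {0..pi}" for y
  proof -
    have "\<bar>sin (\<rho> * y) - sin (\<sigma> * y)\<bar> \<le> \<bar>\<rho> * y - \<sigma> * y\<bar>" by (rule abs_sin_diff_le)
    also have "\<dots> \<le> pi * \<bar>\<rho> - \<sigma>\<bar>"
      using that mult_right_mono[of y pi "\<bar>\<rho> - \<sigma>\<bar>"] by (simp add: left_diff_distrib[symmetric] abs_mult mult.commute)
    finally show ?thesis .
  qed
  have cc: "continuous_on {0..pi} (\<lambda>t. cr \<rho> t * sin (\<rho> * (x - t)))" for \<rho> by (intro continuous_intros cr_cont)
  have "\<bar>integral {0..x} (\<lambda>t. q t * (cr \<rho> t * sin (\<rho> * (x - t)))) - integral {0..x} (\<lambda>t. q t * (cr \<sigma> t * sin (\<sigma> * (x - t))))\<bar>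
      \<le> qn * ((KC + KC * pi) * \<bar>\<rho> - \<sigma>\<bar>)"
  proof (rule qg_diff_bound[OF cc cc x])
    fix t assume t: "t \<in> {0..x}"
    then have tx: "t \<in> {0..pi}" "x - t \<in> {0..pi}" using x by auto
    have "\<bar>cr \<rho> t * sin (\<rho> * (x - t)) - cr \<sigma> t * sin (\<sigma> * (x - t))\<bar>
      = \<bar>(cr \<rho> t - cr \<sigma> t) * sin (\<rho> * (x - t)) + cr \<sigma> t * (sin (\<rho> * (x - t)) - sin (\<sigma> * (x - t)))\<bar>"
      by (simp add: algebra_simps)
    also have "\<dots> \<le> \<bar>cr \<rho> t - cr \<sigma> t\<bar> * \<bar>sin (\<rho> * (x - t))\<bar> + \<bar>cr \<sigma> t\<bar> * \<bar>sin (\<rho> * (x - t)) - sin (\<sigma> * (x - t))\<bar>"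
      unfolding abs_mult[symmetric] by (rule abs_triangle_ineq)
    also have "\<dots> \<le> (KC * \<bar>\<rho> - \<sigma>\<bar>) * 1 + KC * (pi * \<bar>\<rho> - \<sigma>\<bar>)"
      using tx KC_pos by (intro add_mono mult_mono cr_lipschitz cr_bound sl) auto
    finally show "\<bar>cr \<rho> t * sin (\<rho> * (x - t)) - cr \<sigma> t * sin (\<sigma> * (x - t))\<bar> \<le> (KC + KC * pi) * \<bar>\<rho> - \<sigma>\<bar>"
      by (simp add: algebra_simps)
  qed
  moreover have "\<bar>h * sin (\<rho> * x) - h * sin (\<sigma> * x)\<bar> \<le> \<bar>h\<bar> * (pi * \<bar>\<rho> - \<sigma>\<bar>)"
    unfolding right_diff_distrib[symmetric] abs_mult by (intro mult_left_mono sl x) auto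
  moreover have "KL * \<bar>\<rho> - \<sigma>\<bar> = qn * ((KC + KC * pi) * \<bar>\<rho> - \<sigma>\<bar>) + \<bar>h\<bar> * (pi * \<bar>\<rho> - \<sigma>\<bar>)"
    by (simp add: KL_def algebra_simps)
  ultimately show ?thesis unfolding sf_def by linarith
qed

lemma sf_cont: "\<rho> \<noteq> 0 \<Longrightarrow> continuous_on {0..pi} (sf \<rho>)"
  by (rule continuous_on_eq[where f="\<lambda>x. \<rho> * cr \<rho> x - \<rho> * cos (\<rho> * x)"])
     (auto intro!: continuous_intros cr_cont simp: cr_sf)

lemma cr_eq: "\<rho> \<noteq> 0 \<Longrightarrow> x \<in> {0..pi} \<Longrightarrow> cr \<rho> x = cos (\<rho> * x) + sf \<rho> x / \<rho>"
  using cr_sf[of x \<rho>] by (simp add: eq_divide_eq add_divide_distrib[symmetric] mult.commute nonzero_eq_divide_eq add_divide_eq_iff)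

definition dr :: "real \<Rightarrow> real" where "dr \<rho> = dcr \<rho> pi + H * cr \<rho> pi"

lemma charf_dr: "charf (of_real \<rho>) = of_real (dr \<rho>)"
  by (simp add: charf_def dr_def c_of_real dc_of_real)

definition KD :: real where "KD = \<bar>h\<bar> + KC * qn + \<bar>H\<bar> * KC"

lemma KD_nonneg: "0 \<le> KD"
  using KC_pos qn_nonneg by (simp add: KD_def)

lemma dr_formula: "dr \<rho> + \<rho> * sin (\<rho> * pi) =
    h * cos (\<rho> * pi) + integral {0..pi} (\<lambda>t. q t * (cr \<rho> t * cos (\<rho> * (pi - t)))) + H * cr \<rho> pi"
  unfolding dr_def by (simp add: dcr_formula)

lemma dr_bound: "\<bar>dr \<rho> + \<rho> * sin (\<rho> * pi)\<bar> \<le> KD"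
proof -
  have "\<bar>integral {0..pi} (\<lambda>t. q t * (cr \<rho> t * cos (\<rho> * (pi - t))))\<bar> \<le> qn * KC"
  proof (rule qg_bound)
    show "continuous_on {0..pi} (\<lambda>t. cr \<rho> t * cos (\<rho> * (pi - t)))" by (intro continuous_intros cr_cont)
    fix t assume "t \<in> {0..pi}"
    then have "\<bar>cr \<rho> t\<bar> * \<bar>cos (\<rho> * (pi - t))\<bar> \<le> KC * 1"
      using KC_pos by (intro mult_mono cr_bound) auto
    then show "\<bar>cr \<rho> t * cos (\<rho> * (pi - t))\<bar> \<le> KC" by (simp add: abs_mult)
  qed auto
  moreover have "\<bar>h * cos (\<rho> * pi)\<bar> \<le> \<bar>h\<bar>" unfolding abs_mult by (simp add: mult_left_le)
  moreover have "\<bar>H * cr \<rho> pi\<bar> \<le> \<bar>H\<bar> * KC" unfolding abs_mult by (intro mult_left_mono cr_bound) auto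
  ultimately show ?thesis unfolding dr_formula KD_def by (simp add: mult.commute)
qed

text \<open>Apart from its explicit trigonometric terms, \<open>dr\<close> is Lipschitz in
  \<open>\<rho>\<close>. Continuity is wanted for the intermediate value theorem, which produces the
  eigenvalues.\<close>

lemma dr_cont: "continuous_on UNIV dr"
proof -
  define R where "R = (\<lambda>\<rho>. integral {0..pi} (\<lambda>t. q t * (cr \<rho> t * cos (\<rho> * (pi - t)))) + H * cr \<rho> pi)"
  define L where "L = qn * (KC + KC * pi) + \<bar>H\<bar> * KC"
  have L0: "0 \<le> L" using KC_pos qn_nonneg by (auto simp: L_def intro!: add_nonneg_nonneg mult_nonneg_nonneg)
  have "\<bar>R \<rho> - R \<sigma>\<bar> \<le> L * \<bar>\<rho> - \<sigma>\<bar>" for \<rho> \<sigma>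
  proof -
    have cl: "\<bar>cos (\<rho> * y) - cos (\<sigma> * y)\<bar> \<le> pi * \<bar>\<rho> - \<sigma>\<bar>" if "y \<in> {0..pi}" for y
    proof -
      have "\<bar>cos (\<rho> * y) - cos (\<sigma> * y)\<bar> \<le> \<bar>\<rho> * y - \<sigma> * y\<bar>" by (rule abs_cos_diff_le)
      also have "\<dots> \<le> pi * \<bar>\<rho> - \<sigma>\<bar>"
        using that mult_right_mono[of y pi "\<bar>\<rho> - \<sigma>\<bar>"] by (simp add: left_diff_distrib[symmetric] abs_mult mult.commute)
      finally show ?thesis .
    qed
    have cc: "continuous_on {0..pi} (\<lambda>t. cr \<rho> t * cos (\<rho> * (pi - t)))" for \<rho> by (intro continuous_intros cr_cont)
    have "\<bar>integral {0..pi} (\<lambda>t. q t * (cr \<rho> t * cos (\<rho> * (pi - t)))) - integral {0..pi} (\<lambda>t. q t * (cr \<sigma> t * cos (\<sigma> * (pi - t))))\<bar>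
        \<le> qn * ((KC + KC * pi) * \<bar>\<rho> - \<sigma>\<bar>)"
    proof (rule qg_diff_bound[OF cc cc])
      fix t assume t: "t \<in> {0..pi}"
      then have tx: "t \<in> {0..pi}" "pi - t \<in> {0..pi}" by auto
      have "\<bar>cr \<rho> t * cos (\<rho> * (pi - t)) - cr \<sigma> t * cos (\<sigma> * (pi - t))\<bar>
        = \<bar>(cr \<rho> t - cr \<sigma> t) * cos (\<rho> * (pi - t)) + cr \<sigma> t * (cos (\<rho> * (pi - t)) - cos (\<sigma> * (pi - t)))\<bar>"
        by (simp add: algebra_simps)
      also have "\<dots> \<le> \<bar>cr \<rho> t - cr \<sigma> t\<bar> * \<bar>cos (\<rho> * (pi - t))\<bar> + \<bar>cr \<sigma> t\<bar> * \<bar>cos (\<rho> * (pi - t)) - cos (\<sigma> * (pi - t))\<bar>"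
        unfolding abs_mult[symmetric] by (rule abs_triangle_ineq)
      also have "\<dots> \<le> (KC * \<bar>\<rho> - \<sigma>\<bar>) * 1 + KC * (pi * \<bar>\<rho> - \<sigma>\<bar>)"
        using tx KC_pos by (intro add_mono mult_mono cr_lipschitz cr_bound cl) auto
      finally show "\<bar>cr \<rho> t * cos (\<rho> * (pi - t)) - cr \<sigma> t * cos (\<sigma> * (pi - t))\<bar> \<le> (KC + KC * pi) * \<bar>\<rho> - \<sigma>\<bar>"
        by (simp add: algebra_simps)
    qed auto
    moreover have "\<bar>H * cr \<rho> pi - H * cr \<sigma> pi\<bar> \<le> \<bar>H\<bar> * (KC * \<bar>\<rho> - \<sigma>\<bar>)"
      unfolding right_diff_distrib[symmetric] abs_mult by (intro mult_left_mono cr_lipschitz) auto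
    moreover have "L * \<bar>\<rho> - \<sigma>\<bar> = qn * ((KC + KC * pi) * \<bar>\<rho> - \<sigma>\<bar>) + \<bar>H\<bar> * (KC * \<bar>\<rho> - \<sigma>\<bar>)"
      by (simp add: L_def algebra_simps)
    ultimately show ?thesis unfolding R_def by linarith
  qed
  then have "continuous_on UNIV R"
    by (intro lipschitz_on_continuous_on[of L] lipschitz_onI L0) (simp add: dist_real_def)
  then have "continuous_on UNIV (\<lambda>\<rho>. - \<rho> * sin (\<rho> * pi) + h * cos (\<rho> * pi) + R \<rho>)"
    by (intro continuous_intros)
  moreover have "dr = (\<lambda>\<rho>. - \<rho> * sin (\<rho> * pi) + h * cos (\<rho> * pi) + R \<rho>)"
  proof
    fix \<rho> show "dr \<rho> = - \<rho> * sin (\<rho> * pi) + h * cos (\<rho> * pi) + R \<rho>"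
      using dr_formula[of \<rho>] by (simp add: R_def)
  qed
  ultimately show ?thesis by simp
qed

end

section \<open>Localization of the eigenvalues\<close>

lemma sin_shift_npi: "sin (\<rho> * pi) = (- 1) ^ n * sin ((\<rho> - real n) * pi)"
  and cos_shift_npi: "cos (\<rho> * pi) = (- 1) ^ n * cos ((\<rho> - real n) * pi)"
proof -
  have e: "\<rho> * pi = real n * pi + (\<rho> - real n) * pi" by (simp add: algebra_simps)
  show "sin (\<rho> * pi) = (- 1) ^ n * sin ((\<rho> - real n) * pi)" "cos (\<rho> * pi) = (- 1) ^ n * cos ((\<rho> - real n) * pi)"
    by (subst e, simp add: sin_add cos_add cos_npi)+
qed

text \<open>The index map from \<open>a\<close> into \<open>b\<close> is strictly increasing, hence
  satisfies \<open>n \<le> \<sigma> n\<close>. Used in both directions, this shows that a set has at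
  most one increasing enumeration.\<close>

lemma strict_mono_same_range_le:
  fixes a b :: "nat \<Rightarrow> real"
  assumes a: "strict_mono a" and b: "strict_mono b" and r: "range a \<subseteq> range b"
  shows "b n \<le> a n"
proof -
  have "\<forall>n. \<exists>k. a n = b k" using r by blast
  then obtain \<sigma> where \<sigma>: "\<And>n. a n = b (\<sigma> n)" by metis
  have "strict_mono \<sigma>"
  proof (rule strict_monoI)
    fix m n :: nat assume "m < n"
    then have "b (\<sigma> m) < b (\<sigma> n)" using a \<sigma> by (metis strict_mono_less)
    then show "\<sigma> m < \<sigma> n" using b by (simp add: strict_mono_less)
  qed
  then have "n \<le> \<sigma> n" by (rule strict_mono_imp_increasing)
  then show ?thesis using b by (simp add: \<sigma> strict_mono_less_eq)
qed

context sturm_liouville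
begin

text \<open>\<open>KZ / n\<close> bounds the distance of a zero of \<open>dr\<close> from
  \<open>n\<close>; the factor 2 comes from \<open>\<rho> \<ge> n / 2\<close>. \<open>KE / n\<close>
  bounds the distance of \<open>cr \<rho> x\<close> from \<open>cos (n * x)\<close>:
  \<open>pi * KZ\<close> for the shift of the frequency, \<open>2 * KS\<close> for
  \<open>sf \<rho> x / \<rho>\<close>.\<close>

definition KZ :: real where "KZ = 2 * KD"
definition KE :: real where "KE = pi * KZ + 2 * KS"

lemma KZ_nonneg: "0 \<le> KZ" and KE_nonneg: "0 \<le> KE"
  using KD_nonneg KS_nonneg by (auto simp: KZ_def KE_def)

text \<open>At a zero, \<open>dr_bound\<close> reads
  \<open>\<rho> * \<bar>sin (\<rho> * pi)\<bar> \<le> KD\<close>, while the sine is at least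
  \<open>\<bar>\<rho> - n\<bar>\<close> by \<open>abs_sin_ge\<close> and
  \<open>pi > 3\<close>.\<close>

lemma dr_zero_near:
  assumes z: "dr \<rho> = 0" and n: "1 \<le> n" and near: "\<bar>\<rho> - real n\<bar> \<le> 1/2"
  shows "\<bar>\<rho> - real n\<bar> \<le> KZ / real n"
proof -
  have \<rho>: "\<rho> \<ge> real n / 2" using near n by linarith
  have "\<bar>(\<rho> - real n) * pi\<bar> \<le> pi / 2"
    using mult_right_mono[OF near, of pi] by (simp add: abs_mult)
  then have "\<bar>(\<rho> - real n) * pi\<bar> / 3 \<le> \<bar>sin ((\<rho> - real n) * pi)\<bar>" by (rule abs_sin_ge)
  also have "\<dots> = \<bar>sin (\<rho> * pi)\<bar>" by (simp add: sin_shift_npi[of \<rho> n] abs_mult)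
  finally have 1: "\<bar>\<rho> - real n\<bar> * pi / 3 \<le> \<bar>sin (\<rho> * pi)\<bar>" by (simp add: abs_mult)
  have "\<bar>\<rho> - real n\<bar> * 3 \<le> \<bar>\<rho> - real n\<bar> * pi" using pi_gt3 by (intro mult_left_mono) auto
  then have "\<bar>\<rho> - real n\<bar> \<le> \<bar>\<rho> - real n\<bar> * pi / 3" by simp
  then have 2: "\<bar>\<rho> - real n\<bar> \<le> \<bar>sin (\<rho> * pi)\<bar>" using 1 by (rule order_trans)
  have "real n / 2 * \<bar>\<rho> - real n\<bar> \<le> \<rho> * \<bar>sin (\<rho> * pi)\<bar>"
    using 2 \<rho> n by (intro mult_mono) auto
  also have "\<dots> = \<bar>dr \<rho> + \<rho> * sin (\<rho> * pi)\<bar>" using z \<rho> n by (simp add: abs_mult)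
  also have "\<dots> \<le> KD" by (rule dr_bound)
  finally show ?thesis using n by (simp add: KZ_def field_simps)
qed

text \<open>At half-integers the sine is \<open>1\<close> or \<open>-1\<close>, so for large
  \<open>n\<close> the main term \<open>- \<rho> * sin (\<rho> * pi)\<close> outweighs the rest,
  bounded by \<open>KD\<close>, and fixes the sign of \<open>dr\<close>.\<close>

lemma dr_at_half:
  assumes "n \<ge> 1"
  shows "\<bar>(- 1) ^ n * dr (real n + 1/2) + (real n + 1/2)\<bar> \<le> KD"
    "\<bar>(- 1) ^ n * dr (real n - 1/2) - (real n - 1/2)\<bar> \<le> KD"
proof -
  have *: "\<bar>(- 1) ^ n * y\<bar> = \<bar>y\<bar>" for y :: real by (simp add: abs_mult)
  have sq: "(- 1) ^ n * ((- 1) ^ n * y) = y" for y :: real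
    by (simp add: mult.assoc[symmetric] power_mult_distrib[symmetric])
  have "\<bar>(- 1) ^ n * (dr (real n + 1/2) + (real n + 1/2) * sin ((real n + 1/2) * pi))\<bar> \<le> KD"
    unfolding * by (rule dr_bound)
  moreover have "sin ((real n + 1/2) * pi) = (- 1) ^ n"
    using sin_shift_npi[of "real n + 1/2" n] by simp
  ultimately show "\<bar>(- 1) ^ n * dr (real n + 1/2) + (real n + 1/2)\<bar> \<le> KD"
    using sq[of "real n + 1/2"] by (simp add: distrib_left mult.commute mult.left_commute)
  have "\<bar>(- 1) ^ n * (dr (real n - 1/2) + (real n - 1/2) * sin ((real n - 1/2) * pi))\<bar> \<le> KD"
    unfolding * by (rule dr_bound)
  moreover have "sin ((real n - 1/2) * pi) = - ((- 1) ^ n)"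
    using sin_shift_npi[of "real n - 1/2" n] by simp
  ultimately show "\<bar>(- 1) ^ n * dr (real n - 1/2) - (real n - 1/2)\<bar> \<le> KD"
    using sq[of "real n - 1/2"] by (simp add: distrib_left mult.commute mult.left_commute)
qed

lemma dr_zero_exists:
  assumes n: "n \<ge> 1" "real n - 1/2 > KD"
  shows "\<exists>\<rho>. \<bar>\<rho> - real n\<bar> < 1/2 \<and> dr \<rho> = 0"
proof -
  define f where "f = (\<lambda>\<rho>. (- 1) ^ n * dr \<rho>)"
  have 1: "f (real n + 1/2) < 0" "0 < f (real n - 1/2)"
    using dr_at_half[OF n(1)] n by (auto simp: f_def)
  have "\<exists>x\<ge>real n - 1/2. x \<le> real n + 1/2 \<and> f x = 0"
  proof (rule IVT2')
    show "continuous_on {real n - 1/2..real n + 1/2} f"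
      unfolding f_def by (intro continuous_intros continuous_on_subset[OF dr_cont]) auto
  qed (use 1 in auto)
  then obtain x where x: "real n - 1/2 \<le> x" "x \<le> real n + 1/2" "f x = 0" by blast
  then have "x \<noteq> real n - 1/2" "x \<noteq> real n + 1/2" using 1 by auto
  then have "\<bar>x - real n\<bar> < 1/2" using x by linarith
  moreover have "dr x = 0" using x(3) by (simp add: f_def)
  ultimately show ?thesis by blast
qed

lemma dr_zero_localized:
  assumes N: "N \<ge> 1" "real N - 1/2 > KD" and z: "dr \<rho> = 0" "\<rho> \<ge> real N - 1/2"
  shows "\<exists>n\<ge>N. \<bar>\<rho> - real n\<bar> < 1/2"
proof -
  \<comment> \<open>The nearest integer: \<open>n - 1/2 \<le> \<rho> < n + 1/2\<close>, where
    equality on the left is excluded because \<open>dr\<close> does not vanish at large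
    half-integers.\<close>
  define n where "n = nat \<lfloor>\<rho> + 1/2\<rfloor>"
  have f0: "\<lfloor>\<rho> + 1/2\<rfloor> \<ge> int N" using z(2) by (simp add: le_floor_iff)
  then have n: "real n \<le> \<rho> + 1/2" "\<rho> + 1/2 < real n + 1" "n \<ge> N"
    unfolding n_def by linarith+
  have "\<rho> \<noteq> real n - 1/2"
  proof
    assume "\<rho> = real n - 1/2"
    then have "\<bar>real n - 1/2\<bar> \<le> KD" using dr_at_half(2)[of n] z(1) n(3) N(1) by simp
    then show False using N n(3) by linarith
  qed
  then have "\<bar>\<rho> - real n\<bar> < 1/2" using n by linarith
  then show ?thesis using n by blast
qed

lemma cr_near_cos:
  assumes n: "1 \<le> n" and near: "\<bar>\<rho> - real n\<bar> \<le> 1/2" "\<bar>\<rho> - real n\<bar> \<le> KZ / real n" and x: "x \<in> {0..pi}"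
  shows "\<bar>cr \<rho> x - cos (real n * x)\<bar> \<le> KE / real n"
proof -
  have \<rho>: "\<rho> \<ge> real n / 2" "\<rho> > 0" using near n by linarith+
  have "\<bar>cos (\<rho> * x) - cos (real n * x)\<bar> \<le> \<bar>\<rho> * x - real n * x\<bar>" by (rule abs_cos_diff_le)
  also have "\<dots> = x * \<bar>\<rho> - real n\<bar>" using x by (simp add: left_diff_distrib[symmetric] abs_mult)
  also have "\<dots> \<le> pi * (KZ / real n)" using x near by (intro mult_mono) auto
  finally have 1: "\<bar>cos (\<rho> * x) - cos (real n * x)\<bar> \<le> pi * KZ / real n" by simp
  have "\<bar>sf \<rho> x / \<rho>\<bar> \<le> KS / (real n / 2)"
    unfolding abs_divide using \<rho> n sf_bound[OF x, of \<rho>] KS_nonneg by (intro frac_le) auto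
  then have "\<bar>sf \<rho> x / \<rho>\<bar> \<le> 2 * KS / real n" by (simp add: mult.commute)
  then have "\<bar>cr \<rho> x - cos (real n * x)\<bar> \<le> pi * KZ / real n + 2 * KS / real n"
    using 1 cr_eq[of \<rho> x] \<rho> x by linarith
  then show ?thesis by (simp add: KE_def add_divide_distrib)
qed

text \<open>
  Two different eigenvalues near \<open>n\<^sup>2\<close> would have orthogonal eigenfunctions, both close to \<open>cos (n x)\<close>.
\<close>
lemma dr_zero_unique:
  assumes n: "1 \<le> n" "KE / real n \<le> 1/8"
    and \<rho>: "dr \<rho> = 0" "\<bar>\<rho> - real n\<bar> \<le> 1/2" and \<sigma>: "dr \<sigma> = 0" "\<bar>\<sigma> - real n\<bar> \<le> 1/2"
  shows "\<rho> = \<sigma>"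
proof (rule ccontr)
  assume ne: "\<rho> \<noteq> \<sigma>"
  have "\<rho> > 0" "\<sigma> > 0" using \<rho> \<sigma> n by linarith+
  then have "\<rho>\<^sup>2 \<noteq> \<sigma>\<^sup>2" using ne by (simp add: power2_eq_iff)
  then have ne2: "(complex_of_real \<rho>)\<^sup>2 \<noteq> (of_real \<sigma>)\<^sup>2" by (metis of_real_eq_iff of_real_power)
  have "ip (c (of_real \<rho>)) (c (of_real \<sigma>)) = 0"
    by (rule ip_c_orth[OF _ _ ne2]) (simp_all add: charf_dr \<rho> \<sigma>)
  moreover have "((\<lambda>x. c (of_real \<rho>) x * c (of_real \<sigma>) x) has_integral of_real (integral {0..pi} (\<lambda>x. cr \<rho> x * cr \<sigma> x))) {0..pi}"
  proof (rule has_integral_eq[rotated])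
    show "((\<lambda>x. complex_of_real (cr \<rho> x * cr \<sigma> x)) has_integral of_real (integral {0..pi} (\<lambda>x. cr \<rho> x * cr \<sigma> x))) {0..pi}"
      by (intro has_integral_of_real integrable_integral integrable_continuous_real continuous_intros cr_cont)
  qed (simp add: c_of_real)
  ultimately have "complex_of_real (integral {0..pi} (\<lambda>x. cr \<rho> x * cr \<sigma> x)) = 0"
    unfolding ip_def by (simp add: integral_unique)
  then have "integral {0..pi} (\<lambda>x. cr \<rho> x * cr \<sigma> x) = 0" by simp
  then have "((\<lambda>x. cr \<rho> x * cr \<sigma> x) has_integral 0) {0..pi}"
    by (metis integrable_continuous_real continuous_on_mult cr_cont integrable_integral)
  moreover have "((\<lambda>x. cos (real n * x) * cos (real n * x)) has_integral pi / 2) {0..pi}"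
    using has_integral_cos_cos[of n n] n by simp
  ultimately have I: "((\<lambda>x. cr \<rho> x * cr \<sigma> x - cos (real n * x) * cos (real n * x)) has_integral 0 - pi / 2) {0..pi}"
    by (rule has_integral_diff)
  have b: "\<bar>cr \<rho> x - cos (real n * x)\<bar> \<le> 1/8" "\<bar>cr \<sigma> x - cos (real n * x)\<bar> \<le> 1/8" if "x \<in> {0..pi}" for x
    using cr_near_cos[OF n(1) \<rho>(2) dr_zero_near[OF \<rho>(1) n(1) \<rho>(2)] that]
      cr_near_cos[OF n(1) \<sigma>(2) dr_zero_near[OF \<sigma>(1) n(1) \<sigma>(2)] that] n(2) by linarith+
  \<comment> \<open>The integrand is at most \<open>1/8 * 9/8 + 1/8 < 3/8\<close> in absolute value;
    any bound below \<open>1/2\<close> contradicts the value \<open>- pi / 2\<close> of the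
    integral.\<close>
  have "norm (0 - pi / 2) \<le> 3/8 * measure lborel {0..pi}"
  proof (rule has_integral_bound_real[OF _ finite.emptyI I])
    fix x assume "x \<in> {0..pi} - {}"
    then have x: "x \<in> {0..pi}" by simp
    have "cr \<rho> x * cr \<sigma> x - cos (real n * x) * cos (real n * x) =
       (cr \<rho> x - cos (real n * x)) * cr \<sigma> x + cos (real n * x) * (cr \<sigma> x - cos (real n * x))"
      by (simp add: algebra_simps)
    also have "\<bar>\<dots>\<bar> \<le> \<bar>cr \<rho> x - cos (real n * x)\<bar> * \<bar>cr \<sigma> x\<bar> + \<bar>cos (real n * x)\<bar> * \<bar>cr \<sigma> x - cos (real n * x)\<bar>"
      unfolding abs_mult[symmetric] by (rule abs_triangle_ineq)
    also have "\<dots> \<le> 1/8 * (1 + 1/8) + 1 * (1/8)"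
    proof (intro add_mono mult_mono b x)
      show "\<bar>cr \<sigma> x\<bar> \<le> 1 + 1/8" using b(2)[OF x] abs_cos_le_one[of "real n * x"] by linarith
    qed auto
    finally show "norm (cr \<rho> x * cr \<sigma> x - cos (real n * x) * cos (real n * x)) \<le> 3/8" by simp
  qed simp
  then show False using pi_gt_zero by simp
qed

text \<open>What is needed beyond \<open>N0\<close>: each window around \<open>n\<close> contains a
  zero and none lies on its end points (\<open>KD\<close>); the zero is unique and the weight is at
  least 1 (\<open>KE / n \<le> 1/16\<close>); the eigenfunctions are close enough to the cosines for
  \<open>perturbed_complete\<close> with \<open>\<theta> = 1/2\<close>.\<close>

definition N0_cond :: "nat \<Rightarrow> bool" where
  "N0_cond N \<longleftrightarrow> N \<ge> 1 \<and> real N - 1/2 > KD \<and> KE / real N \<le> 1/16 \<and> (\<forall>K. (\<Sum>n=N..<K. pi * (KE / real n)\<^sup>2) \<le> 1/2)"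

definition N0 :: nat where "N0 = (SOME N. N0_cond N)"

lemma N0_cond: "N0_cond N0"
proof -
  have s: "summable (\<lambda>n. pi * (KE / real n)\<^sup>2)"
    unfolding power_divide using inverse_power_summable[of 2, where 'a=real]
    by (auto simp: divide_inverse intro!: summable_mult)
  then obtain A where A: "\<And>m n. m \<ge> A \<Longrightarrow> norm (\<Sum>n=m..<n. pi * (KE / real n)\<^sup>2) < 1/2"
    unfolding summable_Cauchy by (metis half_gt_zero zero_less_one)
  obtain B :: nat where B: "real B > KD + 1" using reals_Archimedean2 by blast
  obtain C :: nat where C: "real C > 16 * KE" using reals_Archimedean2 by blast
  define N where "N = Suc (A + B + C)"
  have "N0_cond N" unfolding N0_cond_def
  proof (intro conjI allI)
    show "1 \<le> N" "real N - 1/2 > KD" using B KD_nonneg by (auto simp: N_def)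
    show "KE / real N \<le> 1/16" using C KE_nonneg by (simp add: N_def field_simps)
    show "(\<Sum>n=N..<K. pi * (KE / real n)\<^sup>2) \<le> 1/2" for K
      using A[of N K] by (simp add: N_def del: sum.op_ivl_Suc)
  qed
  then show ?thesis unfolding N0_def by (rule someI)
qed

lemma N0_props: "N0 \<ge> 1" "real N0 - 1/2 > KD" "KE / real N0 \<le> 1/16" "(\<Sum>n=N0..<K. pi * (KE / real n)\<^sup>2) \<le> 1/2"
  using N0_cond by (auto simp: N0_cond_def)

lemma N0_props_ge:
  assumes "n \<ge> N0" shows "n \<ge> 1" "real n - 1/2 > KD" "KE / real n \<le> 1/16"
proof -
  show "n \<ge> 1" "real n - 1/2 > KD" using N0_props(1,2) assms by auto
  have "KE / real n \<le> KE / real N0" using N0_props(1) assms KE_nonneg by (intro divide_left_mono) auto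
  then show "KE / real n \<le> 1/16" using N0_props(3) by linarith
qed

text \<open>Meaningful only for \<open>n \<ge> N0\<close>, where the zero exists and is
  unique.\<close>

definition rr :: "nat \<Rightarrow> real" where "rr n = (SOME \<rho>. \<bar>\<rho> - real n\<bar> < 1/2 \<and> dr \<rho> = 0)"

lemma rr:
  assumes "n \<ge> N0"
  shows "\<bar>rr n - real n\<bar> < 1/2" "dr (rr n) = 0" "\<bar>rr n - real n\<bar> \<le> KZ / real n" "rr n > 0" "rr n \<ge> real n / 2"
proof -
  note N = N0_props_ge[OF assms]
  show 1: "\<bar>rr n - real n\<bar> < 1/2" "dr (rr n) = 0"
    using someI_ex[OF dr_zero_exists[OF N(1,2)]] by (auto simp: rr_def)
  show "\<bar>rr n - real n\<bar> \<le> KZ / real n"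
    using dr_zero_near[OF 1(2) N(1)] 1(1) by simp
  show "rr n > 0" "rr n \<ge> real n / 2" using 1(1) N(1) by linarith+
qed

lemma dr_zero_rr:
  assumes "dr \<rho> = 0" "\<rho> \<ge> real N0 - 1/2"
  obtains n where "n \<ge> N0" "\<rho> = rr n"
proof -
  obtain n where n: "n \<ge> N0" "\<bar>\<rho> - real n\<bar> < 1/2"
    using dr_zero_localized[OF N0_props(1,2) assms] by blast
  then have "\<rho> = rr n"
    using N0_props_ge(3)[OF n(1)]
    by (intro dr_zero_unique[OF N0_props_ge(1)[OF n(1)] _ assms(1) less_imp_le[OF n(2)] rr(2)[OF n(1)] less_imp_le[OF rr(1)[OF n(1)]]]) linarith
  then show ?thesis using that n by blast
qed

text \<open>
  A priori the eigenvalue near \<open>n\<^sup>2\<close> is \<open>lam (n - N0 + M0)\<close>; that \<open>M0 = N0\<close> is only known once the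
  eigenfunctions are shown to be complete.
\<close>
definition M0 :: nat where "M0 = (LEAST m. lam m \<ge> (real N0 - 1/2)\<^sup>2)"

lemma rr_sq_ge: "n \<ge> N0 \<Longrightarrow> (rr n)\<^sup>2 \<ge> (real N0 - 1/2)\<^sup>2"
proof (rule power_mono)
  assume n: "N0 \<le> n"
  have "real n - 1/2 \<le> rr n" using rr(1)[OF n] by linarith
  then show "real N0 - 1/2 \<le> rr n" using n by linarith
qed (use N0_props(1) in simp)

lemma rr_sq_eigenvalue:
  assumes "n \<ge> N0" obtains m where "lam m = (rr n)\<^sup>2"
proof -
  have "charf (of_real (rr n)) = 0" using rr(2)[OF assms] by (simp add: charf_dr)
  then obtain m where "(complex_of_real (rr n))\<^sup>2 = of_real (lam m)" by (rule charf_zero_imp)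
  then show ?thesis using that by (metis of_real_eq_iff of_real_power)
qed

lemma lam_M0: "lam M0 \<ge> (real N0 - 1/2)\<^sup>2"
proof -
  obtain m where "lam m = (rr N0)\<^sup>2" by (rule rr_sq_eigenvalue[of N0]) auto
  then have "lam m \<ge> (real N0 - 1/2)\<^sup>2" using rr_sq_ge[of N0] by simp
  then show ?thesis unfolding M0_def by (rule LeastI)
qed

text \<open>Both sequences enumerate increasingly the eigenvalues not below
  \<open>(N0 - 1/2)\<^sup>2\<close>; the squares of \<open>rr n\<close> increase because the open
  windows of width 1 around the integers are disjoint.\<close>

lemma lam_shift: "lam (M0 + j) = (rr (N0 + j))\<^sup>2"
proof -
  have a: "strict_mono (\<lambda>j. lam (M0 + j))" using lam_mono by (simp add: strict_mono_def)
  have b: "strict_mono (\<lambda>j. (rr (N0 + j))\<^sup>2)"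
  proof (rule strict_monoI)
    fix i j :: nat assume "i < j"
    then have "rr (N0 + i) < rr (N0 + j)"
    proof -
      have "real (N0 + i) + 1 \<le> real (N0 + j)" using \<open>i < j\<close> by simp
      then show ?thesis using rr(1)[of "N0 + i"] rr(1)[of "N0 + j"] by linarith
    qed
    then show "(rr (N0 + i))\<^sup>2 < (rr (N0 + j))\<^sup>2"
      using rr(4)[of "N0 + i"] by (intro power_strict_mono) auto
  qed
  have 1: "range (\<lambda>j. (rr (N0 + j))\<^sup>2) \<subseteq> range (\<lambda>j. lam (M0 + j))"
  proof clarify
    fix j
    obtain m where m: "lam m = (rr (N0 + j))\<^sup>2" by (rule rr_sq_eigenvalue[of "N0 + j"]) auto
    then have "lam m \<ge> (real N0 - 1/2)\<^sup>2" using rr_sq_ge[of "N0 + j"] by simp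
    then have "M0 \<le> m" unfolding M0_def by (rule Least_le)
    then show "(rr (N0 + j))\<^sup>2 \<in> range (\<lambda>j. lam (M0 + j))"
      using m by (intro image_eqI[of _ _ "m - M0"]) auto
  qed
  have 2: "range (\<lambda>j. lam (M0 + j)) \<subseteq> range (\<lambda>j. (rr (N0 + j))\<^sup>2)"
  proof clarify
    fix j
    have l: "lam (M0 + j) \<ge> (real N0 - 1/2)\<^sup>2"
      using lam_M0 lam_mono by (meson le_add1 order_trans strict_mono_less_eq)
    then have l0: "lam (M0 + j) \<ge> 0" by (meson order_trans zero_le_power2)
    define \<rho> where "\<rho> = sqrt (lam (M0 + j))"
    have \<rho>: "\<rho>\<^sup>2 = lam (M0 + j)" using l0 by (simp add: \<rho>_def)
    have "rho lam (M0 + j) = of_real \<rho>" using l0 by (simp add: rho_def \<rho>_def csqrt_of_real_nonneg)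
    then have "dr \<rho> = 0" using charf_rho[of "M0 + j"] by (simp add: charf_dr)
    moreover have "\<rho> \<ge> real N0 - 1/2" using l by (simp add: \<rho>_def real_le_rsqrt)
    ultimately obtain n where n: "n \<ge> N0" "\<rho> = rr n" by (rule dr_zero_rr)
    show "lam (M0 + j) \<in> range (\<lambda>j. (rr (N0 + j))\<^sup>2)"
      using n \<rho> by (intro image_eqI[of _ _ "n - N0"]) auto
  qed
  show ?thesis
    using strict_mono_same_range_le[OF a b 2, of j] strict_mono_same_range_le[OF b a 1, of j] by simp
qed

lemma rho_shift: "rho lam (M0 + j) = of_real (rr (N0 + j))"
  using rr(4)[of "N0 + j"] by (simp add: rho_def lam_shift csqrt_of_real_nonneg)

lemma ef_shift: "x \<in> {0..pi} \<Longrightarrow> ef (M0 + j) x = of_real (cr (rr (N0 + j)) x)"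
  unfolding ef_def rho_shift by (rule c_of_real)

lemma ef_near_cosn:
  assumes x: "x \<in> {0..pi}"
  shows "norm (ef (M0 + j) x - cosn (N0 + j) x) \<le> KE / real (N0 + j)"
proof -
  have "\<bar>cr (rr (N0 + j)) x - cos (real (N0 + j) * x)\<bar> \<le> KE / real (N0 + j)"
    by (rule cr_near_cos[OF N0_props_ge(1) less_imp_le[OF rr(1)] rr(3) x]) auto
  then show ?thesis unfolding ef_shift[OF x] cosn_eq of_real_diff[symmetric] norm_of_real .
qed

text \<open>Being within \<open>1/16\<close> of the cosine changes its squared norm
  \<open>pi / 2\<close> by at most \<open>33/256 * pi\<close>, where
  \<open>33/256 = 1/16 * (2 + 1/16)\<close> bounds
  \<open>\<bar>a - b\<bar> * \<bar>a + b\<bar>\<close>. The lower bound 1 lets divisions by weights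
  be dropped.\<close>

lemma wt_shift_ge: "wt (M0 + j) \<ge> 1"
proof -
  define n where "n = N0 + j"
  have n1: "n \<ge> N0" by (simp add: n_def)
  note n = n1 N0_props_ge(1)[OF n1] N0_props_ge(3)[OF n1]
  have I: "((\<lambda>x. cos (real n * x) * cos (real n * x)) has_integral pi / 2) {0..pi}"
    using has_integral_cos_cos[of n n] n by simp
  have I2: "((\<lambda>x. (norm (ef (M0 + j) x))\<^sup>2) has_integral wt (M0 + j)) {0..pi}"
    unfolding wt_sqnorm sqnorm_def by (intro integrable_integral integrable_continuous_real continuous_intros ef_cont)
  have "norm (wt (M0 + j) - pi / 2) \<le> 33/256 * measure lborel {0..pi}"
  proof (rule has_integral_bound_real[OF _ finite.emptyI has_integral_diff[OF I2 I]])
    fix x assume "x \<in> {0..pi} - {}"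
    then have x: "x \<in> {0..pi}" by simp
    define a b where "a = cr (rr n) x" and "b = cos (real n * x)"
    have "norm (ef (M0 + j) x) = \<bar>a\<bar>" using ef_shift[OF x, of j] by (simp add: a_def n_def)
    then have e: "(norm (ef (M0 + j) x))\<^sup>2 = a * a" by (simp add: power2_eq_square)
    have ab: "\<bar>a - b\<bar> \<le> 1/16"
    proof -
      have "\<bar>a - b\<bar> \<le> KE / real n"
        unfolding a_def b_def
        by (rule cr_near_cos[OF n(2) less_imp_le[OF rr(1)[OF n1]] rr(3)[OF n1] x])
      then show ?thesis using n(3) by linarith
    qed
    have b1: "\<bar>b\<bar> \<le> 1" by (simp add: b_def)
    have "a * a - b * b = (a - b) * (a + b)" by (simp add: algebra_simps)
    also have "\<bar>\<dots>\<bar> \<le> 1/16 * (33/16)" unfolding abs_mult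
    proof (intro mult_mono ab)
      show "\<bar>a + b\<bar> \<le> 33/16" using ab b1 by linarith
    qed auto
    finally show "norm ((norm (ef (M0 + j) x))\<^sup>2 - cos (real n * x) * cos (real n * x)) \<le> 33/256"
      unfolding e b_def[symmetric] by simp
  qed simp
  then have "\<bar>wt (M0 + j) - pi / 2\<bar> \<le> 33/256 * pi" by simp
  then have "wt (M0 + j) \<ge> pi / 2 - 33/256 * pi" by linarith
  moreover have "pi / 2 - 33/256 * pi \<ge> 95/256 * 3" using pi_gt3 by simp
  ultimately show ?thesis using pi_gt3 by simp
qed

end

section \<open>Completeness of the eigenfunctions\<close>

lemma volterra_op_lincomb:
  assumes K: "continuous_on kernel_dom (\<lambda>(x, t). K x t)"
    and u: "continuous_on {0..pi} u" and v: "continuous_on {0..pi} v" and x: "x \<in> {0..pi}"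
  shows "volterra_op K (\<lambda>t. a * u t + b * v t) x = a * volterra_op K u x + b * volterra_op K v x"
proof -
  have int: "(\<lambda>s. K x s * w s) integrable_on {0..x}" if "continuous_on {0..pi} w" for w
    by (intro integrable_continuous_real continuous_on_mult continuous_on_kernel_slice[OF K] x
        continuous_on_subset[OF that]) (use x in auto)
  have "integral {0..x} (\<lambda>s. K x s * (a * u s + b * v s)) = integral {0..x} (\<lambda>s. a * (K x s * u s) + b * (K x s * v s))"
    by (simp add: algebra_simps)
  also have "\<dots> = a * integral {0..x} (\<lambda>s. K x s * u s) + b * integral {0..x} (\<lambda>s. K x s * v s)"
    using int[OF u] int[OF v]
    by (subst Henstock_Kurzweil_Integration.integral_add) (auto intro: integrable_on_mult_right)
  finally show ?thesis by (simp add: volterra_op_def algebra_simps)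
qed

lemma volterra_op_sum:
  assumes K: "continuous_on kernel_dom (\<lambda>(x, t). K x t)" and "finite I"
    and u: "\<And>i. i \<in> I \<Longrightarrow> continuous_on {0..pi} (u i)" and x: "x \<in> {0..pi}"
  shows "volterra_op K (\<lambda>t. \<Sum>i\<in>I. a i * u i t) x = (\<Sum>i\<in>I. a i * volterra_op K (u i) x)"
  using assms(2,3)
proof (induction I rule: finite_induct)
  case empty then show ?case by (simp add: volterra_op_def)
next
  case (insert i I)
  have "volterra_op K (\<lambda>t. a i * u i t + 1 * (\<Sum>i\<in>I. a i * u i t)) x = a i * volterra_op K (u i) x + 1 * volterra_op K (\<lambda>t. \<Sum>i\<in>I. a i * u i t) x"
    by (rule volterra_op_lincomb[OF K _ _ x]) (use insert in \<open>auto intro!: continuous_intros\<close>)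
  then show ?case using insert by simp
qed

context sturm_liouville
begin

text \<open>By \<open>perturbed_complete\<close> the tail of the cosines is exchanged for the tail
  of the eigenfunctions; the relation between \<open>M0\<close> and \<open>N0\<close> does not
  enter. This is the common root of \<open>M0_le_N0\<close> and \<open>ef_complete\<close>.\<close>

lemma cosn_ef_complete:
  assumes v: "continuous_on {0..pi} v" and lo: "\<And>n. n < N0 \<Longrightarrow> ip v (cosn n) = 0"
    and hi: "\<And>j. ip v (ef (M0 + j)) = 0" and x: "x \<in> {0..pi}"
  shows "v x = 0"
proof (rule perturbed_complete[OF real_orthogonal_cosn dense_span_cosn v, where K=N0 and \<psi>="\<lambda>n. ef (M0 + (n - N0))"
      and d="\<lambda>n. KE / real n" and \<theta>="1/2"])
  show "norm (cosn n x - ef (M0 + (n - N0)) x) \<le> KE / real n" if "N0 \<le> n" "x \<in> {0..pi}" for n x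
    using ef_near_cosn[OF that(2), of "n - N0"] that(1) by (simp add: norm_minus_commute)
  show "1 \<le> cos_norm n" if "N0 \<le> n" for n
    using N0_props_ge(1)[OF that] pi_gt3 by (simp add: cos_norm_def)
  show "ip v (ef (M0 + (n - N0))) = 0" for n by (rule hi)
qed (use lo x N0_props(4) ef_cont in auto)

text \<open>Otherwise \<open>M0\<close> eigenfunctions face only \<open>N0\<close> conditions: a
  nontrivial combination of them is orthogonal to the first \<open>N0\<close> cosines, and
  automatically to the later eigenfunctions, so it vanishes by \<open>cosn_ef_complete\<close>,
  against their orthogonality.\<close>

lemma M0_le_N0: "M0 \<le> N0"
proof (rule ccontr)
  assume "\<not> M0 \<le> N0"
  then obtain a where a: "\<exists>j\<in>{..<M0}. a j \<noteq> 0" "\<forall>i\<in>{..<N0}. (\<Sum>j\<in>{..<M0}. a j * ip (ef j) (cosn i)) = 0"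
    using homogeneous_system_nontrivial[of "{..<N0}" "{..<M0}" "\<lambda>i j. ip (ef j) (cosn i)"] by auto
  define v where "v = (\<lambda>x. \<Sum>j\<in>{..<M0}. a j * ef j x)"
  have v: "continuous_on {0..pi} v" unfolding v_def by (intro continuous_intros ef_cont)
  have ipv: "ip v w = (\<Sum>j\<in>{..<M0}. a j * ip (ef j) w)" if "continuous_on {0..pi} w" for w
    unfolding v_def by (intro ip_sum_left ef_cont that) auto
  note ro = real_orthogonalD[OF real_orthogonal_ef]
  have ipe: "ip v (ef k) = (if k < M0 then a k * of_real (wt k) else 0)" for k
  proof -
    have "ip v (ef k) = (\<Sum>j\<in>{..<M0}. if j = k then a k * of_real (wt k) else 0)"
      unfolding ipv[OF ef_cont] by (rule sum.cong) (auto simp: ro)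
    then show ?thesis by simp
  qed
  have "v x = 0" if "x \<in> {0..pi}" for x
    by (rule cosn_ef_complete[OF v]) (use ipv[OF continuous_on_cosn] a(2) ipe that in auto)
  then have "ip v (ef k) = 0" for k
    using ip_cong[of v "\<lambda>x. 0" "ef k" "ef k"] by (simp add: ip_def)
  then have "a k = 0" if "k < M0" for k using ipe[of k] that wt_pos[of k] by simp
  then show False using a(1) by auto
qed

section \<open>The resolvent of the boundary value problem\<close>

lemma c_cong_sq: "\<rho>\<^sup>2 = \<sigma>\<^sup>2 \<Longrightarrow> x \<in> {0..pi} \<Longrightarrow> c \<rho> x = c \<sigma> x"
  using L_eq_unique(1)[of "c \<rho>" "dc \<rho>" \<sigma> x] c_eq[of \<rho>] by (simp add: c_0 dc_0)

text \<open>\<open>u\<close> is the resolvent of the Sturm-Liouville operator at \<open>\<mu>\<close>, applied to \<open>g\<close>.\<close>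
definition bvp :: "complex \<Rightarrow> (real \<Rightarrow> complex) \<Rightarrow> (real \<Rightarrow> complex) \<Rightarrow> bool" where
  "bvp \<mu> g u \<longleftrightarrow> (\<exists>du. L_eq q u du (\<lambda>x. - \<mu> * u x - g x) \<and> du 0 = of_real h * u 0 \<and> du pi = - of_real H * u pi)"

lemma bvp_cont: "bvp \<mu> g u \<Longrightarrow> continuous_on {0..pi} u"
  unfolding bvp_def using L_eq_continuous by blast

lemma bvp_sum:
  assumes "finite I" "\<And>i. i \<in> I \<Longrightarrow> bvp \<mu> (g i) (u i)"
  shows "bvp \<mu> (\<lambda>x. \<Sum>i\<in>I. a i * g i x) (\<lambda>x. \<Sum>i\<in>I. a i * u i x)"
proof -
  have "\<forall>i\<in>I. \<exists>du. L_eq q (u i) du (\<lambda>x. - \<mu> * u i x - g i x) \<and> du 0 = of_real h * u i 0 \<and> du pi = - of_real H * u i pi"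
    using assms(2) unfolding bvp_def by blast
  then obtain du where du: "\<And>i. i \<in> I \<Longrightarrow> L_eq q (u i) (du i) (\<lambda>x. - \<mu> * u i x - g i x)"
    "\<And>i. i \<in> I \<Longrightarrow> du i 0 = of_real h * u i 0" "\<And>i. i \<in> I \<Longrightarrow> du i pi = - of_real H * u i pi"
    by metis
  have "L_eq q (\<lambda>x. \<Sum>i\<in>I. a i * u i x) (\<lambda>x. \<Sum>i\<in>I. a i * du i x) (\<lambda>x. \<Sum>i\<in>I. a i * (- \<mu> * u i x - g i x))"
    by (rule L_eq_sum[OF assms(1) du(1)])
  also have "(\<lambda>x. \<Sum>i\<in>I. a i * (- \<mu> * u i x - g i x)) = (\<lambda>x. - \<mu> * (\<Sum>i\<in>I. a i * u i x) - (\<Sum>i\<in>I. a i * g i x))"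
    by (simp add: sum_distrib_left sum_subtractf[symmetric] algebra_simps sum_negf[symmetric])
  finally have "L_eq q (\<lambda>x. \<Sum>i\<in>I. a i * u i x) (\<lambda>x. \<Sum>i\<in>I. a i * du i x) (\<lambda>x. - \<mu> * (\<Sum>i\<in>I. a i * u i x) - (\<Sum>i\<in>I. a i * g i x))" .
  moreover have "(\<Sum>i\<in>I. a i * du i 0) = of_real h * (\<Sum>i\<in>I. a i * u i 0)"
    "(\<Sum>i\<in>I. a i * du i pi) = - of_real H * (\<Sum>i\<in>I. a i * u i pi)"
    unfolding sum_distrib_left using du by (auto intro!: sum.cong)
  ultimately show ?thesis unfolding bvp_def by (intro exI conjI)
qed

text \<open>Symmetry of the operator: the boundary terms cancel because both functions satisfy the
  same boundary conditions. Hence orthogonality to all eigenfunctions passes from \<open>g\<close>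
  to its resolvent when \<open>\<mu>\<close> is no eigenvalue.\<close>

lemma bvp_ip:
  assumes u: "bvp \<mu> g u" and g: "continuous_on {0..pi} g"
  shows "(of_real (lam n) - \<mu>) * ip u (ef n) = ip g (ef n)"
proof -
  obtain du where du: "L_eq q u du (\<lambda>x. - \<mu> * u x - g x)" "du 0 = of_real h * u 0" "du pi = - of_real H * u pi"
    using u unfolding bvp_def by blast
  have uc: "continuous_on {0..pi} u" by (rule bvp_cont[OF u])
  have e: "L_eq q (ef n) (dc (rho lam n)) (\<lambda>x. - of_real (lam n) * ef n x)"
    using c_eq[of "rho lam n"] by (simp add: ef_def rho_sq)
  have de: "dc (rho lam n) 0 = of_real h * ef n 0" "dc (rho lam n) pi = - of_real H * ef n pi"
    using charf_rho[of n] by (simp_all add: dc_0 c_0 ef_def charf_def eq_neg_iff_add_eq_0)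
  have "ip u (\<lambda>x. - of_real (lam n) * ef n x) - ip (ef n) (\<lambda>x. - \<mu> * u x - g x) = 0"
    by (subst L_eq_lagrange[OF du(1) _ e]) (auto simp: de du intro!: continuous_intros uc g ef_cont)
  moreover have "ip u (\<lambda>x. - of_real (lam n) * ef n x) = - of_real (lam n) * ip u (ef n)"
    using ip_mult_left[of "- of_real (lam n)" "ef n" u] by (simp add: ip_commute)
  moreover have "ip (ef n) (\<lambda>x. - \<mu> * u x - g x) = - \<mu> * ip u (ef n) - ip g (ef n)"
    using ip_diff_left[of "\<lambda>x. - \<mu> * u x" g "ef n"] ip_mult_left[of "- \<mu>" u "ef n"] uc g
    by (simp add: ip_commute[of "ef n"] continuous_intros ef_cont)
  ultimately show ?thesis by (simp add: algebra_simps)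
qed

text \<open>The intertwining property leaves the initial slope of \<open>T u\<close> open, and the
  kernel is only known to be continuous. At 0 this is enough: \<open>u 0 = 0\<close> makes the
  integral over \<open>{0..y}\<close> of lower order than \<open>y\<close>.\<close>

lemma volterra_G_deriv_0:
  assumes u: "continuous_on {0..pi} u" and du: "(u has_vector_derivative u') (at 0 within {0..pi})" and u0: "u 0 = 0"
  shows "(volterra_op G u has_vector_derivative u') (at 0 within {0..pi})"
proof -
  obtain M :: real where M: "M > 0" "\<And>x t. 0 \<le> t \<Longrightarrow> t \<le> x \<Longrightarrow> x \<le> pi \<Longrightarrow> norm (G x t) \<le> M"
    using kernel_bounded[OF G_cont] by blast
  define w where "w = (\<lambda>x. integral {0..x} (\<lambda>s. G x s * u s))"
  have "(w has_derivative (\<lambda>y. 0)) (at 0 within {0..pi})"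
    unfolding has_derivative_within_alt
  proof (intro conjI allI impI)
    fix e :: real assume e: "0 < e"
    then obtain d where d: "d > 0" "\<And>s. s \<in> {0..pi} \<Longrightarrow> dist s 0 < d \<Longrightarrow> dist (u s) (u 0) < e / M"
      using u M(1) unfolding continuous_on_iff by (metis atLeastAtMost_iff divide_pos_pos order_refl pi_ge_zero)
    have "norm (w y - w 0 - 0) \<le> e * norm (y - 0)" if y: "y \<in> {0..pi}" "norm (y - 0) < d" for y
    proof -
      have "norm (w y) \<le> integral {0..y} (\<lambda>s. M * (e / M))"
        unfolding w_def
      proof (rule integral_norm_bound_integral)
        show "(\<lambda>s. G y s * u s) integrable_on {0..y}"
          by (intro integrable_continuous_real continuous_on_mult continuous_on_kernel_slice[OF G_cont] y
              continuous_on_subset[OF u]) (use y in auto)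
        fix s assume s: "s \<in> {0..y}"
        have "norm (u s) \<le> e / M" using d(2)[of s] s y u0 by (auto simp: dist_norm)
        then show "norm (G y s * u s) \<le> M * (e / M)"
          unfolding norm_mult using M s y by (intro mult_mono) auto
      qed auto
      also have "\<dots> = e * y" using y M(1) by simp
      finally show ?thesis using y by (simp add: w_def)
    qed
    then show "\<exists>d>0. \<forall>y\<in>{0..pi}. norm (y - 0) < d \<longrightarrow> norm (w y - w 0 - 0) \<le> e * norm (y - 0)"
      using d(1) by blast
  qed simp
  then have "(w has_vector_derivative 0) (at 0 within {0..pi})" by (simp add: has_vector_derivative_def)
  from has_vector_derivative_add[OF du this] show ?thesis
    unfolding volterra_op_def[abs_def] w_def by simp
qed

text \<open>
  A particular solution is \<open>v = T u\<close> with \<open>u'' + \<i> u = - T\<^sup>-\<^sup>1 g\<close>, so no second solution of the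
  homogeneous equation is needed; \<open>\<i>\<close> is not an eigenvalue since all eigenvalues are real.
\<close>
lemma bvp_exists:
  assumes g: "continuous_on {0..pi} g"
  shows "\<exists>u. bvp \<i> g u"
proof -
  define \<rho> where "\<rho> = csqrt \<i>"
  have \<rho>2: "\<rho>\<^sup>2 = \<i>" unfolding \<rho>_def by (rule power2_csqrt)
  then have \<rho>0: "\<rho> \<noteq> 0" by auto
  define gT where "gT = volterra_op Hker g"
  have gT: "continuous_on {0..pi} gT" unfolding gT_def by (rule continuous_on_volterra_op[OF Hker_cont g])
  \<comment> \<open>Variation of constants for \<open>u'' + \<rho>\<^sup>2 * u = - gT\<close>:
    \<open>A\<close> and \<open>B\<close> give its coefficient functions, both 0 at 0, so that
    \<open>u\<close> and \<open>du\<close> vanish there.\<close>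
  define A where "A = (\<lambda>x. integral {0..x} (\<lambda>s. cos (\<rho> * of_real s) * gT s))"
  define B where "B = (\<lambda>x. integral {0..x} (\<lambda>s. sin (\<rho> * of_real s) * gT s))"
  have Ad: "(A has_vector_derivative cos (\<rho> * of_real x) * gT x) (at x within {0..pi})" if "x \<in> {0..pi}" for x
    unfolding A_def by (rule integral_has_vector_derivative[OF _ that]) (intro continuous_intros gT)
  have Bd: "(B has_vector_derivative sin (\<rho> * of_real x) * gT x) (at x within {0..pi})" if "x \<in> {0..pi}" for x
    unfolding B_def by (rule integral_has_vector_derivative[OF _ that]) (intro continuous_intros gT)
  have Sd: "((\<lambda>x. sin (\<rho> * complex_of_real x)) has_vector_derivative \<rho> * cos (\<rho> * of_real x)) (at x within S)" for x S
    by (rule has_vector_derivative_real_field[where f="\<lambda>z. sin (\<rho> * z)"]) (auto intro!: derivative_eq_intros)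
  have Cd: "((\<lambda>x. cos (\<rho> * complex_of_real x)) has_vector_derivative - \<rho> * sin (\<rho> * of_real x)) (at x within S)" for x S
    by (rule has_vector_derivative_real_field[where f="\<lambda>z. cos (\<rho> * z)"]) (auto intro!: derivative_eq_intros)
  define u where "u = (\<lambda>x. - (1 / \<rho>) * (sin (\<rho> * of_real x) * A x - cos (\<rho> * of_real x) * B x))"
  define du where "du = (\<lambda>x. - (cos (\<rho> * of_real x) * A x + sin (\<rho> * of_real x) * B x))"
  define ddu where "ddu = (\<lambda>x. - \<i> * u x + (- 1) * gT x)"
  have sc: "(sin z)\<^sup>2 + (cos z)\<^sup>2 = 1" for z :: complex by simp
  have ud: "(u has_vector_derivative du x) (at x within {0..pi})" if x: "x \<in> {0..pi}" for x
  proof -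
    have "(u has_vector_derivative - (1 / \<rho>) * ((sin (\<rho> * of_real x) * (cos (\<rho> * of_real x) * gT x) + \<rho> * cos (\<rho> * of_real x) * A x)
        - (cos (\<rho> * of_real x) * (sin (\<rho> * of_real x) * gT x) + - \<rho> * sin (\<rho> * of_real x) * B x))) (at x within {0..pi})"
      unfolding u_def
      by (intro has_vector_derivative_mult_right has_vector_derivative_diff has_vector_derivative_mult Ad Bd Sd Cd x)
    moreover have "- (1 / \<rho>) * ((sin (\<rho> * of_real x) * (cos (\<rho> * of_real x) * gT x) + \<rho> * cos (\<rho> * of_real x) * A x)
        - (cos (\<rho> * of_real x) * (sin (\<rho> * of_real x) * gT x) + - \<rho> * sin (\<rho> * of_real x) * B x)) = du x"
      using \<rho>0 by (simp add: du_def field_simps)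
    ultimately show ?thesis by simp
  qed
  have dud: "(du has_vector_derivative ddu x) (at x within {0..pi})" if x: "x \<in> {0..pi}" for x
  proof -
    have "(du has_vector_derivative - ((cos (\<rho> * of_real x) * (cos (\<rho> * of_real x) * gT x) + - \<rho> * sin (\<rho> * of_real x) * A x)
        + (sin (\<rho> * of_real x) * (sin (\<rho> * of_real x) * gT x) + \<rho> * cos (\<rho> * of_real x) * B x))) (at x within {0..pi})"
      unfolding du_def
      by (intro has_vector_derivative_minus has_vector_derivative_add has_vector_derivative_mult Ad Bd Sd Cd x)
    moreover have "- ((cos (\<rho> * of_real x) * (cos (\<rho> * of_real x) * gT x) + - \<rho> * sin (\<rho> * of_real x) * A x)
        + (sin (\<rho> * of_real x) * (sin (\<rho> * of_real x) * gT x) + \<rho> * cos (\<rho> * of_real x) * B x)) = ddu x"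
    proof -
      have ru: "\<rho>\<^sup>2 * u x = - \<rho> * (sin (\<rho> * of_real x) * A x - cos (\<rho> * of_real x) * B x)"
        using \<rho>0 by (simp add: u_def power2_eq_square)
      have "- ((cos (\<rho> * of_real x) * (cos (\<rho> * of_real x) * gT x) + - \<rho> * sin (\<rho> * of_real x) * A x)
          + (sin (\<rho> * of_real x) * (sin (\<rho> * of_real x) * gT x) + \<rho> * cos (\<rho> * of_real x) * B x))
        = - ((sin (\<rho> * of_real x))\<^sup>2 + (cos (\<rho> * of_real x))\<^sup>2) * gT x - \<rho>\<^sup>2 * u x"
        unfolding ru power2_eq_square[of "sin _"] power2_eq_square[of "cos _"] by (simp only: ring_distribs mult_minus_left mult_minus_right minus_add_distrib diff_conv_add_uminus minus_minus mult_ac add_ac)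
      then show ?thesis unfolding sc \<rho>2 ddu_def by simp
    qed
    ultimately show ?thesis by simp
  qed
  have uc: "continuous_on {0..pi} u" using ud continuous_on_vector_derivative by blast
  have dduc: "continuous_on {0..pi} ddu" unfolding ddu_def by (intro continuous_intros uc gT)
  have z0: "u 0 = 0" "du 0 = 0" by (simp_all add: u_def du_def A_def B_def)
  have "(\<forall>x\<in>{0..pi}. (u has_vector_derivative du x) (at x within {0..pi})) \<and>
        (\<forall>x\<in>{0..pi}. (du has_vector_derivative ddu x) (at x within {0..pi})) \<and>
        continuous_on {0..pi} ddu \<and> du 0 = 0"
    using ud dud dduc z0 by blast
  then obtain dv where dv: "L_eq q (volterra_op G u) dv (volterra_op G ddu)"
    using G_trans unfolding transmutation_kernel_def by blast
  define v where "v = volterra_op G u"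
  have v0: "v 0 = 0" by (simp add: v_def volterra_op_def z0)
  have "(v has_vector_derivative 0) (at 0 within {0..pi})"
    unfolding v_def using volterra_G_deriv_0[OF uc ud[of 0] z0(1)] z0(2) by simp
  moreover have "(v has_vector_derivative dv 0) (at 0 within {0..pi})"
    using dv unfolding L_eq_def v_def by auto
  ultimately have dv0: "dv 0 = 0"
    using vector_derivative_unique_within_closed_interval[of 0 pi 0 v "dv 0" 0] by simp
  have Gd: "volterra_op G ddu x = - \<i> * v x - g x" if x: "x \<in> {0..pi}" for x
    unfolding ddu_def v_def volterra_op_lincomb[OF G_cont uc gT x] using G_Hker[OF g x] by (simp add: gT_def)
  have Lv: "L_eq q v dv (\<lambda>x. - \<i> * v x - g x)"
    by (rule L_eq_cong[OF dv[folded v_def] refl refl Gd])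
  have ch: "charf \<rho> \<noteq> 0"
  proof
    assume "charf \<rho> = 0"
    then obtain n where "\<rho>\<^sup>2 = of_real (lam n)" by (rule charf_zero_imp)
    then show False using \<rho>2 by (simp add: complex_eq_iff)
  qed
  \<comment> \<open>Adding a multiple of \<open>c \<rho>\<close> keeps the condition at 0; this
    coefficient enforces the one at \<open>pi\<close>.\<close>
  define b where "b = - (dv pi + of_real H * v pi) / charf \<rho>"
  have "L_eq q (\<lambda>x. v x + b * c \<rho> x) (\<lambda>x. dv x + b * dc \<rho> x) (\<lambda>x. (- \<i> * v x - g x) + b * (- \<rho>\<^sup>2 * c \<rho> x))"
    by (intro L_eq_add Lv L_eq_scale c_eq)
  moreover have "(\<lambda>x. (- \<i> * v x - g x) + b * (- \<rho>\<^sup>2 * c \<rho> x)) = (\<lambda>x. - \<i> * (v x + b * c \<rho> x) - g x)"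
    unfolding \<rho>2 by (simp add: fun_eq_iff algebra_simps)
  moreover have "dv pi + b * dc \<rho> pi = - of_real H * (v pi + b * c \<rho> pi)"
  proof -
    have "(dv pi + b * dc \<rho> pi) + of_real H * (v pi + b * c \<rho> pi) = (dv pi + of_real H * v pi) + b * charf \<rho>"
      by (simp add: charf_def algebra_simps)
    also have "\<dots> = 0" using ch by (simp add: b_def)
    finally show ?thesis by (simp only: eq_neg_iff_add_eq_0 mult_minus_left)
  qed
  ultimately have "bvp \<i> g (\<lambda>x. v x + b * c \<rho> x)"
    unfolding bvp_def by (intro exI[of _ "\<lambda>x. dv x + b * dc \<rho> x"]) (simp add: v0 dv0 c_0 dc_0)
  then show ?thesis by blast
qed

text \<open>A function orthogonal to all eigenfunctions, followed by its iterates under the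
  resolvent at \<open>\<i>\<close>. A whole sequence is recorded because the resolvent is given only
  as a relation.\<close>

definition res_seq :: "(nat \<Rightarrow> real \<Rightarrow> complex) \<Rightarrow> bool" where
  "res_seq g \<longleftrightarrow> (\<forall>i. continuous_on {0..pi} (g i)) \<and> (\<forall>i n. ip (g i) (ef n) = 0) \<and> (\<forall>i. bvp \<i> (g i) (g (Suc i)))"

text \<open>If \<open>\<kappa> = 0\<close>, then \<open>g 1 = 0\<close> and the equation leaves
  \<open>g 0 = 0\<close>. Otherwise \<open>g 1\<close> solves the homogeneous equation with spectral
  value \<open>\<i> + 1 / \<kappa>\<close> under both boundary conditions, so it is zero or a
  multiple of some \<open>ef n\<close>, to which it is orthogonal.\<close>

lemma res_seq_eigen:
  assumes g: "res_seq g" and eig: "\<And>x. x \<in> {0..pi} \<Longrightarrow> g (Suc 0) x = \<kappa> * g 0 x"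
  shows "\<forall>x\<in>{0..pi}. g 0 x = 0"
proof -
  obtain du where du: "L_eq q (g 1) du (\<lambda>x. - \<i> * g 1 x - g 0 x)" "du 0 = of_real h * g 1 0" "du pi = - of_real H * g 1 pi"
    using g unfolding res_seq_def bvp_def by (metis One_nat_def)
  have g0: "continuous_on {0..pi} (g 0)" using g by (simp add: res_seq_def)
  show ?thesis
  proof (cases "\<kappa> = 0")
    case True
    then have z: "g 1 x = 0" if "x \<in> {0..pi}" for x using eig that by simp
    have duz: "du x = 0" if x: "x \<in> {0..pi}" for x
    proof -
      have "(g 1 has_vector_derivative du x) (at x within {0..pi})" using du(1) x by (auto simp: L_eq_def)
      moreover have "(g 1 has_vector_derivative 0) (at x within {0..pi})"
        using z by (intro has_vector_derivative_transform[OF x, of "g 1" "\<lambda>_. 0"]) auto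
      ultimately show ?thesis
        using vector_derivative_unique_within_closed_interval[of 0 pi x "g 1" "du x" 0] x by simp
    qed
    have iz: "integral {0..x} (g 0) = 0" if x: "x \<in> {0..pi}" for x
    proof -
      have "((\<lambda>t. of_real (q t) * g 1 t + (- \<i> * g 1 t - g 0 t)) has_integral du x - du 0) {0..x}"
        using du(1) x by (auto simp: L_eq_def)
      then have "((\<lambda>t. of_real (q t) * g 1 t + (- \<i> * g 1 t - g 0 t)) has_integral 0) {0..x}"
        using duz[OF x] duz[of 0] by simp
      then have "((\<lambda>t. - g 0 t) has_integral 0) {0..x}"
        by (rule has_integral_eq[rotated]) (use z x in auto)
      from integral_unique[OF this] show ?thesis by simp
    qed
    show ?thesis
    proof
      fix x assume x: "x \<in> {0..pi}"
      have "((\<lambda>x. integral {0..x} (g 0)) has_vector_derivative g 0 x) (at x within {0..pi})"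
        by (rule integral_has_vector_derivative[OF g0 x])
      moreover have "((\<lambda>x. integral {0..x} (g 0)) has_vector_derivative 0) (at x within {0..pi})"
        by (rule has_vector_derivative_transform[OF x, of "\<lambda>x. integral {0..x} (g 0)" "\<lambda>_. 0"])
          (use iz in simp_all)
      ultimately show "g 0 x = 0"
        using vector_derivative_unique_within_closed_interval[of 0 pi x "\<lambda>x. integral {0..x} (g 0)" "g 0 x" 0] x by simp
    qed
  next
    case False
    define \<rho> where "\<rho> = csqrt (\<i> + 1 / \<kappa>)"
    have \<rho>2: "\<rho>\<^sup>2 = \<i> + 1 / \<kappa>" by (simp add: \<rho>_def)
    have e: "L_eq q (g 1) du (\<lambda>x. - \<rho>\<^sup>2 * g 1 x)"
      using du(1) by (rule L_eq_cong) (use eig False in \<open>auto simp: \<rho>2 field_simps\<close>)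
    note u = L_eq_unique[OF e du(2)]
    have pi: "pi \<in> {0..pi}" by simp
    have "g 1 0 * charf \<rho> = du pi + of_real H * g 1 pi"
      unfolding charf_def u(1)[OF pi] u(2)[OF pi] by (simp only: ring_distribs mult_ac)
    then have "g 1 0 * charf \<rho> = 0" using du(3) by simp
    moreover have "g 1 0 = 0" if ch: "charf \<rho> = 0"
    proof -
      obtain n where n: "\<rho>\<^sup>2 = of_real (lam n)" by (rule charf_zero_imp[OF ch])
      have "ip (g 1) (ef n) = ip (\<lambda>x. g 1 0 * ef n x) (ef n)"
      proof (rule ip_cong)
        fix x assume x: "x \<in> {0..pi}"
        show "g 1 x = g 1 0 * ef n x"
          using u(1)[OF x] c_cong_sq[of \<rho> "rho lam n" x] n x by (simp add: ef_def rho_sq)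
      qed simp
      also have "\<dots> = g 1 0 * of_real (wt n)"
        unfolding ip_mult_left using real_orthogonalD(4)[OF real_orthogonal_ef] by simp
      finally show ?thesis using g wt_pos[of n] by (simp add: res_seq_def)
    qed
    ultimately have "g 1 0 = 0" by auto
    then have "g 1 x = 0" if "x \<in> {0..pi}" for x using u(1)[OF that] by simp
    then show ?thesis using eig False by auto
  qed
qed

lemma ef_complete:
  assumes g: "continuous_on {0..pi} g" and orth: "\<And>n. ip g (ef n) = 0" and x: "x \<in> {0..pi}"
  shows "g x = 0"
proof -
  define gs where "gs = rec_nat g (\<lambda>_ u. SOME w. bvp \<i> u w)"
  have gs0: "gs 0 = g" and gsS: "gs (Suc i) = (SOME w. bvp \<i> (gs i) w)" for i
    by (simp_all add: gs_def)
  have cs: "continuous_on {0..pi} (gs i)" for i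
  proof (induction i)
    case (Suc i)
    then have "bvp \<i> (gs i) (gs (Suc i))" unfolding gsS using bvp_exists someI_ex by metis
    then show ?case by (rule bvp_cont)
  qed (simp add: gs0 g)
  have bs: "bvp \<i> (gs i) (gs (Suc i))" for i
    unfolding gsS using bvp_exists[OF cs] someI_ex by metis
  have li: "of_real (lam n) \<noteq> \<i>" for n by (simp add: complex_eq_iff)
  have os: "ip (gs i) (ef n) = 0" for i n
  proof (induction i)
    case (Suc i)
    then have "(of_real (lam n) - \<i>) * ip (gs (Suc i)) (ef n) = 0"
      using bvp_ip[OF bs cs] by simp
    then show ?case using li[of n] by simp
  qed (simp add: gs0 orth)
  have rs: "res_seq gs" unfolding res_seq_def using cs os bs by blast
  \<comment> \<open>There are \<open>N0 + 1\<close> unknowns against \<open>N0\<close> conditions.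
    The combination found is orthogonal to the first \<open>N0\<close> cosines and to all
    eigenfunctions, so it vanishes; read as a polynomial in the resolvent, it annihilates
    \<open>g\<close>.\<close>
  obtain a where a: "\<exists>j\<in>{..N0}. a j \<noteq> 0" "\<forall>i\<in>{..<N0}. (\<Sum>j\<in>{..N0}. a j * ip (gs j) (cosn i)) = 0"
    using homogeneous_system_nontrivial[of "{..<N0}" "{..N0}" "\<lambda>i j. ip (gs j) (cosn i)"] by auto
  have vz: "(\<Sum>j\<le>N0. a j * gs j x) = 0" if "x \<in> {0..pi}" for x
  proof (rule cosn_ef_complete[where v="\<lambda>x. \<Sum>j\<le>N0. a j * gs j x"])
    show "continuous_on {0..pi} (\<lambda>x. \<Sum>j\<le>N0. a j * gs j x)" by (intro continuous_intros cs)
    show "ip (\<lambda>x. \<Sum>j\<le>N0. a j * gs j x) (cosn n) = 0" if "n < N0" for n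
      by (subst ip_sum_left) (use a(2) that cs continuous_on_cosn in auto)
    show "ip (\<lambda>x. \<Sum>j\<le>N0. a j * gs j x) (ef (M0 + j)) = 0" for j
      by (subst ip_sum_left) (use os cs ef_cont in auto)
  qed (rule that)
  define p where "p = (\<Sum>j\<le>N0. monom (a j) j)"
  have cp: "coeff p j = (if j \<le> N0 then a j else 0)" for j
    by (simp add: p_def coeff_sum)
  have p0: "p \<noteq> 0" using a(1) cp by (metis atMost_iff coeff_0)
  have dp: "degree p \<le> N0" by (rule degree_le) (simp add: cp)
  have "\<forall>x\<in>{0..pi}. gs 0 x = 0"
  proof (rule annihilated_sequence_zero[where P=res_seq and p=p])
    show "(\<Sum>j\<le>degree p. coeff p j * gs j x) = 0" if x: "x \<in> {0..pi}" for x
    proof -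
      have "(\<Sum>j\<le>degree p. coeff p j * gs j x) = (\<Sum>j\<le>N0. coeff p j * gs j x)"
        by (rule sum.mono_neutral_left) (use dp in \<open>auto simp: coeff_eq_0\<close>)
      also have "\<dots> = (\<Sum>j\<le>N0. a j * gs j x)" by (rule sum.cong) (auto simp: cp)
      finally show ?thesis using vz[OF x] by simp
    qed
  next
    fix g :: "nat \<Rightarrow> real \<Rightarrow> complex" and p :: "complex poly"
    assume g: "res_seq g"
    show "res_seq (\<lambda>i x. \<Sum>j\<le>degree p. coeff p j * g (i + j) x)"
      unfolding res_seq_def
    proof (intro conjI allI)
      fix i n
      show "continuous_on {0..pi} (\<lambda>x. \<Sum>j\<le>degree p. coeff p j * g (i + j) x)"
        using g by (intro continuous_intros) (auto simp: res_seq_def)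
      show "ip (\<lambda>x. \<Sum>j\<le>degree p. coeff p j * g (i + j) x) (ef n) = 0"
        by (subst ip_sum_left) (use g ef_cont in \<open>auto simp: res_seq_def\<close>)
      show "bvp \<i> (\<lambda>x. \<Sum>j\<le>degree p. coeff p j * g (i + j) x) (\<lambda>x. \<Sum>j\<le>degree p. coeff p j * g (Suc i + j) x)"
        by (rule bvp_sum) (use g in \<open>auto simp: res_seq_def\<close>)
    qed
  qed (use res_seq_eigen rs p0 in auto)
  then show ?thesis using x gs0 by simp
qed

end

section \<open>Enumeration of the eigenvalues\<close>

context sturm_liouville
begin

text \<open>The coefficients of \<open>w\<close> are those of \<open>k\<close> divided by
  \<open>lam n\<close>, hence \<open>O(1 / n\<^sup>2)\<close>, and the eigenfunction series
  converges uniformly. Its sum has the coefficients of \<open>w\<close>, so the two agree by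
  \<open>ef_complete\<close>. Only tail coefficients are divided, so 0 may be an eigenvalue.\<close>

lemma bvp_expansion:
  assumes w: "bvp 0 k w" and k: "continuous_on {0..pi} k" and e: "e > 0"
  shows "\<exists>K b. \<forall>x\<in>{0..pi}. norm (w x - (\<Sum>n<K. b n * ef n x)) < e"
proof -
  have wc: "continuous_on {0..pi} w" by (rule bvp_cont[OF w])
  define b where "b = (\<lambda>n. ip w (ef n) / of_real (wt n))"
  define C where "C = sqrt (pi * KC\<^sup>2 * sqnorm k)"
  have C0: "0 \<le> C" by (simp add: C_def sqnorm_nonneg)
  have kb: "norm (ip k (ef (M0 + j))) \<le> C" for j
  proof -
    have "(norm (ip k (ef (M0 + j))))\<^sup>2 \<le> pi * KC\<^sup>2 * sqnorm k"
      by (rule norm_ip_le[OF k ef_cont]) (simp only: ef_shift norm_of_real cr_bound)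
    then show ?thesis unfolding C_def by (rule real_le_rsqrt)
  qed
  \<comment> \<open>The factor 4 comes from squaring \<open>rr (N0 + j) \<ge> (j + 1) / 2\<close>;
    the weights, at least 1, are dropped.\<close>
  have fb: "norm (b (M0 + j) * ef (M0 + j) x) \<le> 4 * C * KC * inverse ((real (Suc j))\<^sup>2)" if x: "x \<in> {0..pi}" for j x
  proof -
    have r: "rr (N0 + j) \<ge> real (Suc j) / 2"
      using rr(5)[of "N0 + j"] N0_props(1) by simp
    then have l: "lam (M0 + j) \<ge> (real (Suc j))\<^sup>2 / 4"
      unfolding lam_shift using power_mono[OF r, of 2] by (simp add: power_divide)
    have lp: "lam (M0 + j) > 0" using l by (rule less_le_trans[rotated]) simp
    have "of_real (lam (M0 + j)) * ip w (ef (M0 + j)) = ip k (ef (M0 + j))"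
      using bvp_ip[OF w k, of "M0 + j"] by simp
    then have "lam (M0 + j) * norm (ip w (ef (M0 + j))) = norm (ip k (ef (M0 + j)))"
      using lp by (metis abs_of_pos norm_mult norm_of_real)
    then have "norm (ip w (ef (M0 + j))) = norm (ip k (ef (M0 + j))) / lam (M0 + j)"
      using lp by (simp add: field_simps)
    also have "\<dots> \<le> C / ((real (Suc j))\<^sup>2 / 4)"
      by (rule frac_le[OF C0 kb _ l]) simp
    finally have "norm (b (M0 + j)) \<le> C / ((real (Suc j))\<^sup>2 / 4) / 1"
      unfolding b_def norm_divide norm_of_real
      using wt_shift_ge[of j] C0 by (intro frac_le) auto
    then have "norm (b (M0 + j)) * norm (ef (M0 + j) x) \<le> C / ((real (Suc j))\<^sup>2 / 4) * KC"
      using cr_bound[OF x] KC_pos C0 unfolding ef_shift[OF x] norm_of_real by (intro mult_mono) auto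
    then show ?thesis by (simp add: norm_mult field_simps)
  qed
  define Mn where "Mn = (\<lambda>n. 4 * C * KC * inverse ((real (Suc (n - M0)))\<^sup>2))"
  have s1: "summable (\<lambda>n. inverse ((real (Suc n))\<^sup>2))"
    using inverse_power_summable[of 2, where 'a=real] summable_Suc_iff[of "\<lambda>n. inverse ((real n)\<^sup>2)"] by simp
  have "(\<lambda>n. Mn (n + M0)) = (\<lambda>n. 4 * C * KC * inverse ((real (Suc n))\<^sup>2))" by (simp add: Mn_def)
  then have "summable (\<lambda>n. Mn (n + M0))" using summable_mult[OF s1] by simp
  then have sM: "summable Mn" using summable_iff_shift[of Mn M0] by blast
  have U: "uniform_limit {0..pi} (\<lambda>K x. \<Sum>n<K. b n * ef n x) (\<lambda>x. \<Sum>n. b n * ef n x) sequentially"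
  proof (rule Weierstrass_m_test_ev[OF _ sM])
    show "\<forall>\<^sub>F n in sequentially. \<forall>x\<in>{0..pi}. norm (b n * ef n x) \<le> Mn n"
    proof (rule eventually_sequentiallyI[of M0], intro ballI)
      fix n x assume "M0 \<le> n" "x \<in> {0..pi}"
      then show "norm (b n * ef n x) \<le> Mn n" using fb[of x "n - M0"] by (simp add: Mn_def)
    qed
  qed
  define g where "g = (\<lambda>x. \<Sum>n. b n * ef n x)"
  have pc: "continuous_on {0..pi} (\<lambda>x. \<Sum>n<K. b n * ef n x)" for K
    by (intro continuous_intros ef_cont)
  have gc: "continuous_on {0..pi} g"
    unfolding g_def by (rule uniform_limit_theorem[OF always_eventually U]) (use pc in auto)
  note ro = real_orthogonalD[OF real_orthogonal_ef]
  have ipg: "ip g (ef m) = ip w (ef m)" for m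
  proof -
    have lim: "(\<lambda>K. ip (\<lambda>x. \<Sum>n<K. b n * ef n x) (ef m)) \<longlonglongrightarrow> ip g (ef m)"
      unfolding g_def by (rule ip_uniform_limit[OF U pc ef_cont]) simp
    have ev: "\<forall>\<^sub>F K in sequentially. ip (\<lambda>x. \<Sum>n<K. b n * ef n x) (ef m) = ip w (ef m)"
    proof (rule eventually_sequentiallyI[of "Suc m"])
      fix K assume K: "Suc m \<le> K"
      have "ip (\<lambda>x. \<Sum>n<K. b n * ef n x) (ef m) = (\<Sum>n<K. b n * ip (ef n) (ef m))"
        by (rule ip_sum_left) (auto intro: ef_cont)
      also have "\<dots> = (\<Sum>n<K. if n = m then b m * of_real (wt m) else 0)"
        by (rule sum.cong) (auto simp: ro)
      also have "\<dots> = ip w (ef m)" using K wt_pos[of m] by (simp add: b_def)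
      finally show "ip (\<lambda>x. \<Sum>n<K. b n * ef n x) (ef m) = ip w (ef m)" .
    qed
    show ?thesis by (rule LIMSEQ_unique[OF lim tendsto_eventually[OF ev]])
  qed
  have wg: "w x = g x" if "x \<in> {0..pi}" for x
  proof -
    have "w x - g x = 0"
      by (rule ef_complete[where g="\<lambda>x. w x - g x"])
         (use that in \<open>auto intro!: continuous_intros wc gc simp: ip_diff_left[OF wc gc ef_cont] ipg\<close>)
    then show ?thesis by simp
  qed
  obtain K where "\<And>x. x \<in> {0..pi} \<Longrightarrow> dist (\<Sum>n<K. b n * ef n x) (g x) < e"
    using uniform_limitD[OF U e] unfolding eventually_sequentially g_def by blast
  then show ?thesis using wg
    by (intro exI[of _ K] exI[of _ b] ballI) (simp add: dist_norm norm_minus_commute)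
qed

text \<open>
  Images of cosine polynomials under \<open>T\<close> satisfy the boundary condition at \<open>0\<close>; the one at \<open>pi\<close> is
  enforced by a uniformly small multiple of \<open>c (n + 3/2)\<close>, where the characteristic function is large.
\<close>
lemma dense_span_ef: "dense_span ef"
  unfolding dense_span_def
proof (intro allI impI)
  fix f :: "real \<Rightarrow> complex" and e :: real
  assume f: "continuous_on {0..pi} f" and e: "0 < e"
  obtain M :: real where M: "M > 0" "\<And>u v x d. continuous_on {0..pi} u \<Longrightarrow> continuous_on {0..pi} v \<Longrightarrow> x \<in> {0..pi} \<Longrightarrow>
       \<forall>t\<in>{0..pi}. norm (u t - v t) \<le> d \<Longrightarrow> norm (volterra_op G u x - volterra_op G v x) \<le> M * d"
    using volterra_G_bound by blast
  define u0 where "u0 = volterra_op Hker f"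
  have u0: "continuous_on {0..pi} u0" unfolding u0_def by (rule continuous_on_volterra_op[OF Hker_cont f])
  have "e / (4 * M) > 0" using e M(1) by simp
  then obtain K a where Ka: "\<And>x. x \<in> {0..pi} \<Longrightarrow> norm (u0 x - (\<Sum>n<K. a n * cosn n x)) < e / (4 * M)"
    using dense_span_cosn u0 unfolding dense_span_def by metis
  define p where "p = (\<lambda>x. \<Sum>n<K. a n * c (of_nat n) x)"
  have pf: "norm (f x - p x) \<le> e / 4" if x: "x \<in> {0..pi}" for x
  proof -
    have "norm (volterra_op G u0 x - volterra_op G (\<lambda>t. \<Sum>n<K. a n * cosn n t) x) \<le> M * (e / (4 * M))"
      by (rule M(2)[OF u0 _ x]) (use Ka in \<open>auto intro!: continuous_intros less_imp_le\<close>)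
    moreover have "volterra_op G u0 x = f x" unfolding u0_def by (rule G_Hker[OF f x])
    moreover have "volterra_op G (\<lambda>t. \<Sum>n<K. a n * cosn n t) x = p x"
      unfolding p_def c_volterra[OF x] by (rule volterra_op_sum[OF G_cont _ continuous_on_cosn x]) simp
    ultimately show ?thesis using M(1) by simp
  qed
  define \<beta> where "\<beta> = (\<Sum>n<K. a n * charf (of_nat n))"
  \<comment> \<open>\<open>\<beta>\<close> is the defect of \<open>p\<close> at \<open>pi\<close>.
    Since \<open>\<bar>dr \<sigma>\<bar> \<ge> \<sigma> - KD\<close> at the half-integer
    \<open>\<sigma>\<close>, a large \<open>n\<close> keeps the multiple \<open>r\<close> of
    \<open>c \<sigma>\<close> below \<open>e / 4\<close>; the other errors are \<open>e / 4\<close>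
    for \<open>p\<close> and \<open>e / 2\<close> for the expansion.\<close>
  obtain n :: nat where n: "real n > KD + 4 * norm \<beta> * KC / e" using reals_Archimedean2 by blast
  define \<sigma> where "\<sigma> = real (Suc n) + 1/2"
  have "\<bar>(- 1) ^ Suc n * dr \<sigma> + \<sigma>\<bar> \<le> KD"
    unfolding \<sigma>_def by (rule dr_at_half(1)) simp
  moreover have "\<bar>(- 1) ^ Suc n * dr \<sigma>\<bar> = \<bar>dr \<sigma>\<bar>" by (simp add: abs_mult)
  ultimately have 1: "\<bar>dr \<sigma>\<bar> \<ge> \<sigma> - KD" by linarith
  have 2: "0 \<le> 4 * norm \<beta> * KC / e" using KC_pos e by simp
  have 3: "\<sigma> = real n + 3/2" by (simp add: \<sigma>_def)
  have ds: "\<bar>dr \<sigma>\<bar> > 4 * norm \<beta> * KC / e" "\<bar>dr \<sigma>\<bar> > 0"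
    using n 1 2 3 by linarith+
  define r where "r = - \<beta> / charf (of_real \<sigma>)"
  have ch: "charf (of_real \<sigma>) \<noteq> 0" using ds(2) by (simp add: charf_dr)
  have rb: "norm r * KC \<le> e / 4"
    using ds e by (simp add: r_def norm_divide charf_dr field_simps)
  define w where "w = (\<lambda>x. p x + r * c (of_real \<sigma>) x)"
  define k where "k = (\<lambda>x. (\<Sum>n<K. a n * ((of_nat n)\<^sup>2 * c (of_nat n) x)) + r * ((of_real \<sigma>)\<^sup>2 * c (of_real \<sigma>) x))"
  have kc: "continuous_on {0..pi} k" unfolding k_def by (intro continuous_intros c_cont)
  have "L_eq q w (\<lambda>x. (\<Sum>n<K. a n * dc (of_nat n) x) + r * dc (of_real \<sigma>) x)
      (\<lambda>x. (\<Sum>n<K. a n * (- (of_nat n)\<^sup>2 * c (of_nat n) x)) + r * (- (of_real \<sigma>)\<^sup>2 * c (of_real \<sigma>) x))"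
    unfolding w_def p_def by (intro L_eq_add L_eq_scale L_eq_sum c_eq) auto
  then have "L_eq q w (\<lambda>x. (\<Sum>n<K. a n * dc (of_nat n) x) + r * dc (of_real \<sigma>) x) (\<lambda>x. - 0 * w x - k x)"
    by (simp add: k_def sum_negf)
  moreover have "(\<Sum>n<K. a n * dc (of_nat n) 0) + r * dc (of_real \<sigma>) 0 = of_real h * w 0"
    by (simp add: w_def p_def c_0 dc_0 sum_distrib_left distrib_left mult.commute)
  moreover have "(\<Sum>n<K. a n * dc (of_nat n) pi) + r * dc (of_real \<sigma>) pi = - of_real H * w pi"
  proof -
    have e1: "(\<Sum>n<K. a n * dc (of_nat n) pi) + of_real H * p pi = \<beta>"
      by (simp add: \<beta>_def p_def charf_def distrib_left sum.distrib sum_distrib_left mult.left_commute)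
    have e2: "r * dc (of_real \<sigma>) pi + of_real H * (r * c (of_real \<sigma>) pi) = - \<beta>"
    proof -
      have "r * charf (of_real \<sigma>) = - \<beta>" using ch by (simp add: r_def)
      then show ?thesis by (simp add: charf_def algebra_simps)
    qed
    have "((\<Sum>n<K. a n * dc (of_nat n) pi) + r * dc (of_real \<sigma>) pi) + of_real H * w pi =
        ((\<Sum>n<K. a n * dc (of_nat n) pi) + of_real H * p pi) + (r * dc (of_real \<sigma>) pi + of_real H * (r * c (of_real \<sigma>) pi))"
      by (simp add: w_def distrib_left)
    also have "\<dots> = 0" unfolding e1 e2 by simp
    finally show ?thesis by (simp only: eq_neg_iff_add_eq_0 mult_minus_left)
  qed
  ultimately have "bvp 0 k w" unfolding bvp_def by (intro exI conjI)
  moreover have "e / 2 > 0" using e by simp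
  ultimately obtain K' b where b: "\<And>x. x \<in> {0..pi} \<Longrightarrow> norm (w x - (\<Sum>n<K'. b n * ef n x)) < e / 2"
    using bvp_expansion[OF _ kc] by metis
  have "norm (f x - (\<Sum>n<K'. b n * ef n x)) < e" if x: "x \<in> {0..pi}" for x
  proof -
    have "norm (r * c (of_real \<sigma>) x) \<le> norm r * KC"
      unfolding norm_mult c_of_real[OF x] norm_of_real by (intro mult_left_mono cr_bound x) simp
    then have rc: "norm (r * c (of_real \<sigma>) x) \<le> e / 4" using rb by linarith
    have "f x - (\<Sum>n<K'. b n * ef n x) = (f x - p x) - r * c (of_real \<sigma>) x + (w x - (\<Sum>n<K'. b n * ef n x))"
      by (simp add: w_def)
    also have "norm \<dots> \<le> norm (f x - p x) + norm (r * c (of_real \<sigma>) x) + norm (w x - (\<Sum>n<K'. b n * ef n x))"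
      by (intro order_trans[OF norm_triangle_ineq] add_mono norm_triangle_ineq4 order_refl)
    finally show ?thesis using pf[OF x] rc b[OF x] by linarith
  qed
  then show "\<exists>K b. \<forall>x\<in>{0..pi}. norm (f x - (\<Sum>n<K. b n * ef n x)) < e" by blast
qed

text \<open>The counterpart of \<open>M0_le_N0\<close>: now \<open>N0\<close> cosines face
  \<open>M0\<close> conditions, and the eigenfunctions are the complete system that is perturbed.
  This is what \<open>dense_span_ef\<close> is for.\<close>

lemma N0_le_M0: "N0 \<le> M0"
proof (rule ccontr)
  assume "\<not> N0 \<le> M0"
  then obtain a where a: "\<exists>j\<in>{..<N0}. a j \<noteq> 0" "\<forall>i\<in>{..<M0}. (\<Sum>j\<in>{..<N0}. a j * ip (cosn j) (ef i)) = 0"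
    using homogeneous_system_nontrivial[of "{..<M0}" "{..<N0}" "\<lambda>i j. ip (cosn j) (ef i)"] by auto
  define v where "v = (\<lambda>x. \<Sum>j\<in>{..<N0}. a j * cosn j x)"
  have v: "continuous_on {0..pi} v" unfolding v_def by (intro continuous_intros)
  have ipv: "ip v w = (\<Sum>j\<in>{..<N0}. a j * ip (cosn j) w)" if "continuous_on {0..pi} w" for w
    unfolding v_def by (intro ip_sum_left continuous_on_cosn that) auto
  note ro = real_orthogonalD[OF real_orthogonal_cosn]
  have ipe: "ip v (cosn k) = (if k < N0 then a k * of_real (cos_norm k) else 0)" for k
  proof -
    have "ip v (cosn k) = (\<Sum>j\<in>{..<N0}. if j = k then a k * of_real (cos_norm k) else 0)"
      unfolding ipv[OF continuous_on_cosn] by (rule sum.cong) (use ro(3,4) in auto)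
    then show ?thesis by simp
  qed
  have "v x = 0" if x: "x \<in> {0..pi}" for x
  proof (rule perturbed_complete[OF real_orthogonal_ef dense_span_ef v, where K=M0 and \<psi>="\<lambda>n. cosn (N0 + (n - M0))"
        and d="\<lambda>n. KE / real (N0 + (n - M0))" and \<theta>="1/2"])
    show "continuous_on {0..pi} (cosn (N0 + (n - M0)))" for n by (rule continuous_on_cosn)
    show "ip v (cosn (N0 + (n - M0))) = 0" for n using ipe[of "N0 + (n - M0)"] by simp
    show "norm (ef n x - cosn (N0 + (n - M0)) x) \<le> KE / real (N0 + (n - M0))" if "M0 \<le> n" "x \<in> {0..pi}" for n x
      using ef_near_cosn[OF that(2), of "n - M0"] that(1) by simp
    show "1 \<le> wt n" if "M0 \<le> n" for n using wt_shift_ge[of "n - M0"] that by simp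
    show "(\<Sum>n=M0..<K. pi * (KE / real (N0 + (n - M0)))\<^sup>2) \<le> 1/2" for K
    proof -
      have "(\<Sum>n=M0..<K. pi * (KE / real (N0 + (n - M0)))\<^sup>2) = (\<Sum>n=N0..<N0 + (K - M0). pi * (KE / real n)\<^sup>2)"
        by (rule sum.reindex_bij_witness[of _ "\<lambda>n. M0 + (n - N0)" "\<lambda>n. N0 + (n - M0)"]) auto
      then show ?thesis using N0_props(4) by simp
    qed
  qed (use ipv[OF ef_cont] a(2) x continuous_on_cosn in auto)
  then have "ip v (cosn k) = 0" for k
    using ip_cong[of v "\<lambda>x. 0" "cosn k" "cosn k"] by (simp add: ip_def)
  then have "a k = 0" if "k < N0" for k using ipe[of k] that ro(5)[of k] by simp
  then show False using a(1) by auto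
qed

lemma M0_eq_N0: "M0 = N0"
  using M0_le_N0 N0_le_M0 by simp

lemma rho_rr: "n \<ge> N0 \<Longrightarrow> rho lam n = of_real (rr n)"
  using rho_shift[of "n - N0"] by (simp add: M0_eq_N0)

lemma ef_rr: "n \<ge> N0 \<Longrightarrow> x \<in> {0..pi} \<Longrightarrow> ef n x = of_real (cr (rr n) x)"
  using ef_shift[of x "n - N0"] by (simp add: M0_eq_N0)

end

section \<open>Square-summable remainders\<close>

text \<open>Twice the term is at most \<open>(f n)\<^sup>2 + 1 / n\<^sup>2\<close>.\<close>

lemma summable_div_nat:
  fixes f :: "nat \<Rightarrow> real"
  assumes "summable (\<lambda>n. (f n)\<^sup>2)"
  shows "summable (\<lambda>n. \<bar>f n\<bar> / real n)"
proof (rule summable_comparison_test')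
  show "summable (\<lambda>n. (f n)\<^sup>2 + inverse ((real n)\<^sup>2))"
    by (intro summable_add assms inverse_power_summable) auto
  fix n :: nat
  have "0 \<le> (\<bar>f n\<bar> - inverse (real n))\<^sup>2" by simp
  then have "2 * (\<bar>f n\<bar> * inverse (real n)) \<le> (f n)\<^sup>2 + inverse ((real n)\<^sup>2)"
    by (simp add: power2_diff power_inverse)
  moreover have "0 \<le> \<bar>f n\<bar> * inverse (real n)" by simp
  moreover have "norm (\<bar>f n\<bar> / real n) = \<bar>f n\<bar> * inverse (real n)" by (simp add: divide_inverse)
  ultimately show "norm (\<bar>f n\<bar> / real n) \<le> (f n)\<^sup>2 + inverse ((real n)\<^sup>2)" by linarith
qed

context sturm_liouville
begin

abbreviation w0 :: real where "w0 \<equiv> omega q h H"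

lemma qg_add:
  fixes g g' :: "real \<Rightarrow> real"
  assumes "continuous_on {0..pi} g" "continuous_on {0..pi} g'" "x \<in> {0..pi}"
  shows "integral {0..x} (\<lambda>t. q t * (g t + g' t)) = integral {0..x} (\<lambda>t. q t * g t) + integral {0..x} (\<lambda>t. q t * g' t)"
  unfolding distrib_left by (intro Henstock_Kurzweil_Integration.integral_add qg_int assms)

lemma qg_scale: "integral {0..x} (\<lambda>t. q t * (a * g t)) = a * integral {0..x} (\<lambda>t. q t * g t)"
  unfolding mult.left_commute[of _ a] by simp

text \<open>The term \<open>J\<close> above: what the product-to-sum formula leaves of the integral
  of \<open>q t * cos (\<rho> * t) * cos (\<rho> * (pi - t))\<close> besides the part that enters
  \<open>omega\<close>.\<close>

definition Jf :: "real \<Rightarrow> real" where "Jf \<rho> = 1/2 * integral {0..pi} (\<lambda>t. q t * cos (\<rho> * (2 * t - pi)))"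

text \<open>One summand for each error in \<open>kk_bound\<close>: moving \<open>Jf\<close> from
  \<open>rr n\<close> to \<open>n\<close>, the remainder of \<open>dr_asymptotics\<close>, the term
  \<open>\<delta> * sin (\<delta> * pi)\<close>, the linearization of the sine, and the replacement
  of the cosine by 1.\<close>

definition KA :: real where
  "KA = 1/2 * qn * pi * KZ + 2 * (qn * KS + \<bar>H\<bar> * KS) + pi * KZ\<^sup>2 + pi\<^sup>2 * KZ\<^sup>2 / 2 + \<bar>w0\<bar> * pi * KZ"

text \<open>Inserts \<open>cr \<rho> t = cos (\<rho> * t) + sf \<rho> t / \<rho>\<close> into
  \<open>dr_formula\<close>; the non-oscillating half of the product of cosines supplies the
  integral of \<open>q\<close> in \<open>omega\<close>.\<close>

lemma dr_asymptotics:
  assumes \<rho>: "\<rho> > 0"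
  shows "\<bar>dr \<rho> - (- \<rho> * sin (\<rho> * pi) + w0 * cos (\<rho> * pi) + Jf \<rho>)\<bar> \<le> (qn * KS + \<bar>H\<bar> * KS) / \<rho>"
proof -
  have \<rho>0: "\<rho> \<noteq> 0" using \<rho> by simp
  have pi: "pi \<in> {0..pi}" by simp
  have "integral {0..pi} (\<lambda>t. q t * (cr \<rho> t * cos (\<rho> * (pi - t)))) =
      integral {0..pi} (\<lambda>t. q t * ((1/2 * cos (\<rho> * pi) + 1/2 * cos (\<rho> * (2 * t - pi))) + (1/\<rho>) * (sf \<rho> t * cos (\<rho> * (pi - t)))))"
  proof (rule Henstock_Kurzweil_Integration.integral_cong)
    fix t assume t: "t \<in> {0..pi}"
    have "cos (\<rho> * t) * cos (\<rho> * (pi - t)) = 1/2 * cos (\<rho> * pi) + 1/2 * cos (\<rho> * (2 * t - pi))"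
      unfolding cos_times_cos by (simp add: algebra_simps)
    then have "cr \<rho> t * cos (\<rho> * (pi - t)) = (1/2 * cos (\<rho> * pi) + 1/2 * cos (\<rho> * (2 * t - pi))) + (1/\<rho>) * (sf \<rho> t * cos (\<rho> * (pi - t)))"
      unfolding cr_eq[OF \<rho>0 t] by (simp add: distrib_right)
    then show "q t * (cr \<rho> t * cos (\<rho> * (pi - t))) = q t * ((1/2 * cos (\<rho> * pi) + 1/2 * cos (\<rho> * (2 * t - pi))) + (1/\<rho>) * (sf \<rho> t * cos (\<rho> * (pi - t))))"
      by simp
  qed
  also have "\<dots> = (1/2 * cos (\<rho> * pi)) * integral {0..pi} (\<lambda>t. q t * 1) + Jf \<rho> + (1/\<rho>) * integral {0..pi} (\<lambda>t. q t * (sf \<rho> t * cos (\<rho> * (pi - t))))"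
  proof -
    have c1: "continuous_on {0..pi} (\<lambda>t. 1/2 * cos (\<rho> * (2 * t - pi)))" by (intro continuous_intros)
    have c2: "continuous_on {0..pi} (\<lambda>t. (1/\<rho>) * (sf \<rho> t * cos (\<rho> * (pi - t))))" by (intro continuous_intros sf_cont \<rho>0)
    have e: "integral {0..pi} (\<lambda>t. q t * (1/2 * cos (\<rho> * pi))) = (1/2 * cos (\<rho> * pi)) * integral {0..pi} (\<lambda>t. q t * 1)"
      using qg_scale[of pi "1/2 * cos (\<rho> * pi)" "\<lambda>_. 1"] by simp
    show ?thesis
      unfolding qg_add[OF continuous_on_add[OF continuous_on_const c1] c2 pi] qg_add[OF continuous_on_const c1 pi]
      unfolding e Jf_def unfolding qg_scale ..
  qed
  finally have I: "integral {0..pi} (\<lambda>t. q t * (cr \<rho> t * cos (\<rho> * (pi - t)))) =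
    (1/2 * cos (\<rho> * pi)) * integral {0..pi} q + Jf \<rho> + (1/\<rho>) * integral {0..pi} (\<lambda>t. q t * (sf \<rho> t * cos (\<rho> * (pi - t))))"
    by simp
  have Hc: "H * cr \<rho> pi = H * cos (\<rho> * pi) + (1/\<rho>) * (H * sf \<rho> pi)"
    unfolding cr_eq[OF \<rho>0 pi] by (simp add: distrib_left)
  have "dr \<rho> - (- \<rho> * sin (\<rho> * pi) + w0 * cos (\<rho> * pi) + Jf \<rho>) =
      (1/\<rho>) * (integral {0..pi} (\<lambda>t. q t * (sf \<rho> t * cos (\<rho> * (pi - t)))) + H * sf \<rho> pi)"
    using dr_formula[of \<rho>] unfolding I Hc omega_def by (simp add: algebra_simps)
  then have e: "\<bar>dr \<rho> - (- \<rho> * sin (\<rho> * pi) + w0 * cos (\<rho> * pi) + Jf \<rho>)\<bar> =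
      (1/\<rho>) * \<bar>integral {0..pi} (\<lambda>t. q t * (sf \<rho> t * cos (\<rho> * (pi - t)))) + H * sf \<rho> pi\<bar>"
    using \<rho> by (simp add: abs_mult)
  have "\<bar>integral {0..pi} (\<lambda>t. q t * (sf \<rho> t * cos (\<rho> * (pi - t))))\<bar> \<le> qn * KS"
  proof (rule qg_bound[OF _ pi])
    show "continuous_on {0..pi} (\<lambda>t. sf \<rho> t * cos (\<rho> * (pi - t)))" by (intro continuous_intros sf_cont \<rho>0)
    fix t assume t: "t \<in> {0..pi}"
    have "\<bar>sf \<rho> t\<bar> * \<bar>cos (\<rho> * (pi - t))\<bar> \<le> KS * 1" by (intro mult_mono sf_bound t KS_nonneg) auto
    then show "\<bar>sf \<rho> t * cos (\<rho> * (pi - t))\<bar> \<le> KS" by (simp add: abs_mult)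
  qed
  moreover have "\<bar>H * sf \<rho> pi\<bar> \<le> \<bar>H\<bar> * KS" unfolding abs_mult by (intro mult_left_mono sf_bound pi) simp
  ultimately have "\<bar>integral {0..pi} (\<lambda>t. q t * (sf \<rho> t * cos (\<rho> * (pi - t)))) + H * sf \<rho> pi\<bar> \<le> qn * KS + \<bar>H\<bar> * KS"
    by linarith
  then have "(1/\<rho>) * \<bar>integral {0..pi} (\<lambda>t. q t * (sf \<rho> t * cos (\<rho> * (pi - t)))) + H * sf \<rho> pi\<bar> \<le> (1/\<rho>) * (qn * KS + \<bar>H\<bar> * KS)"
    using \<rho> by (intro mult_left_mono) auto
  then show ?thesis unfolding e by simp
qed

lemma Jf_lipschitz: "\<bar>Jf \<rho> - Jf \<sigma>\<bar> \<le> 1/2 * qn * pi * \<bar>\<rho> - \<sigma>\<bar>"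
proof -
  have cc: "continuous_on {0..pi} (\<lambda>t. cos (\<rho> * (2 * t - pi)))" for \<rho> by (intro continuous_intros)
  have "\<bar>integral {0..pi} (\<lambda>t. q t * cos (\<rho> * (2 * t - pi))) - integral {0..pi} (\<lambda>t. q t * cos (\<sigma> * (2 * t - pi)))\<bar> \<le> qn * (pi * \<bar>\<rho> - \<sigma>\<bar>)"
  proof (rule qg_diff_bound[OF cc cc])
    fix t assume t: "t \<in> {0..pi}"
    have "\<bar>cos (\<rho> * (2 * t - pi)) - cos (\<sigma> * (2 * t - pi))\<bar> \<le> \<bar>\<rho> * (2 * t - pi) - \<sigma> * (2 * t - pi)\<bar>"
      by (rule abs_cos_diff_le)
    also have "\<dots> = \<bar>2 * t - pi\<bar> * \<bar>\<rho> - \<sigma>\<bar>" by (simp add: left_diff_distrib[symmetric] abs_mult)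
    also have "\<dots> \<le> pi * \<bar>\<rho> - \<sigma>\<bar>" using t by (intro mult_right_mono) auto
    finally show "\<bar>cos (\<rho> * (2 * t - pi)) - cos (\<sigma> * (2 * t - pi))\<bar> \<le> pi * \<bar>\<rho> - \<sigma>\<bar>" .
  qed simp
  then show ?thesis unfolding Jf_def right_diff_distrib[symmetric] abs_mult by simp
qed

text \<open>At integers \<open>cos (n * (2 * t - pi))\<close> equals \<open>cos (2 * n * t)\<close>
  up to sign, so these are Fourier coefficients of \<open>q\<close>.\<close>

lemma summable_Jf: "summable (\<lambda>n. (Jf (real n))\<^sup>2)"
proof -
  have sq: "(Jf (real n))\<^sup>2 = 1/4 * (integral {0..pi} (\<lambda>x. q x * cos (2 * real n * x)))\<^sup>2" for n
  proof -
    have "cos (real n * (2 * t - pi)) = (- 1) ^ n * cos (2 * real n * t)" for t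
    proof -
      have "cos (real n * (2 * t - pi)) = cos (2 * real n * t - real n * pi)" by (simp add: algebra_simps)
      then show ?thesis by (simp add: cos_diff cos_npi)
    qed
    then have Je: "Jf (real n) = 1/2 * ((- 1) ^ n * integral {0..pi} (\<lambda>x. q x * cos (2 * real n * x)))"
      unfolding Jf_def by (simp add: qg_scale)
    have "((- 1) ^ n)\<^sup>2 = (1::real)"
      by (simp add: power2_eq_square power_mult_distrib[symmetric])
    then show ?thesis unfolding Je power_mult_distrib by (simp add: power_divide)
  qed
  show ?thesis unfolding sq by (intro summable_mult summable_fourier_coeffs(1) q_int q2_int)
qed

text \<open>The remainder \<open>k n\<close> in
  \<open>rho n = n + omega / (pi * n) + k n / n\<close>, for \<open>n \<ge> N0\<close>.\<close>

definition kk :: "nat \<Rightarrow> real" where "kk n = real n * (rr n - real n) - w0 / pi"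

text \<open>The equation \<open>dr (rr n) = 0\<close> reads \<open>rr n * sin (\<delta> * pi) - w0 *
  cos (\<delta> * pi) = Jf (rr n) + E\<close> up to sign. Since \<open>\<delta>\<close> is
  \<open>O(1 / n)\<close>, the left-hand side is \<open>pi * kk n\<close> up to
  \<open>O(1 / n)\<close>. The factor \<open>pi > 1\<close> is dropped at the end.\<close>

lemma kk_bound:
  assumes n: "n \<ge> N0"
  shows "\<bar>kk n\<bar> \<le> \<bar>Jf (real n)\<bar> + KA / real n"
proof -
  define \<delta> where "\<delta> = rr n - real n"
  have n1: "real n \<ge> 1" using N0_props_ge(1)[OF n] by simp
  have d: "\<bar>\<delta>\<bar> \<le> KZ / real n" and r: "rr n > 0" "rr n \<ge> real n / 2" and z: "dr (rr n) = 0"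
    using rr[OF n] by (auto simp: \<delta>_def)
  have \<delta>2: "\<delta>\<^sup>2 \<le> KZ\<^sup>2 / (real n)\<^sup>2"
    using power_mono[OF d, of 2] by (simp add: power_divide)
  define E where "E = dr (rr n) - (- rr n * sin (rr n * pi) + w0 * cos (rr n * pi) + Jf (rr n))"
  have "\<bar>E\<bar> \<le> (qn * KS + \<bar>H\<bar> * KS) / rr n" unfolding E_def by (rule dr_asymptotics[OF r(1)])
  also have "\<dots> \<le> (qn * KS + \<bar>H\<bar> * KS) / (real n / 2)"
    using r n1 qn_nonneg KS_nonneg by (intro divide_left_mono) auto
  finally have E: "\<bar>E\<bar> \<le> 2 * (qn * KS + \<bar>H\<bar> * KS) / real n" by (simp add: mult.commute)
  have J: "\<bar>Jf (rr n) - Jf (real n)\<bar> \<le> 1/2 * qn * pi * KZ / real n"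
  proof -
    have "\<bar>Jf (rr n) - Jf (real n)\<bar> \<le> (1/2 * qn * pi) * \<bar>\<delta>\<bar>" unfolding \<delta>_def by (rule Jf_lipschitz)
    also have "\<dots> \<le> (1/2 * qn * pi) * (KZ / real n)" using d qn_nonneg by (intro mult_left_mono) auto
    finally show ?thesis by simp
  qed
  have "(- 1) ^ n * (rr n * sin (\<delta> * pi) - w0 * cos (\<delta> * pi)) = Jf (rr n) + E"
    using z unfolding E_def sin_shift_npi[of "rr n" n] cos_shift_npi[of "rr n" n] \<delta>_def by (simp add: algebra_simps)
  then have "\<bar>(- 1) ^ n * (rr n * sin (\<delta> * pi) - w0 * cos (\<delta> * pi))\<bar> = \<bar>Jf (rr n) + E\<bar>" by simp
  then have m: "\<bar>rr n * sin (\<delta> * pi) - w0 * cos (\<delta> * pi)\<bar> = \<bar>Jf (rr n) + E\<bar>" by (simp add: abs_mult)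
  have s1: "\<bar>\<delta> * sin (\<delta> * pi)\<bar> \<le> pi * KZ\<^sup>2 / real n"
  proof -
    have "\<bar>\<delta>\<bar> * \<bar>sin (\<delta> * pi)\<bar> \<le> \<bar>\<delta>\<bar> * \<bar>\<delta> * pi\<bar>" by (intro mult_left_mono abs_sin_x_le_abs_x) simp
    also have "\<dots> = pi * \<delta>\<^sup>2" by (simp add: abs_mult power2_eq_square)
    also have "\<dots> \<le> pi * (KZ\<^sup>2 / (real n)\<^sup>2)" using \<delta>2 by (intro mult_left_mono) auto
    also have "\<dots> \<le> pi * (KZ\<^sup>2 / real n)"
      using n1 by (intro mult_left_mono divide_left_mono) (auto simp: power2_eq_square)
    finally show ?thesis by (simp add: abs_mult)
  qed
  have s2: "\<bar>real n * (sin (\<delta> * pi) - \<delta> * pi)\<bar> \<le> pi\<^sup>2 * KZ\<^sup>2 / 2 / real n"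
  proof -
    have "real n * \<bar>sin (\<delta> * pi) - \<delta> * pi\<bar> \<le> real n * ((\<delta> * pi)\<^sup>2 / 2)"
      by (intro mult_left_mono abs_sin_sub_self_le) simp
    also have "\<dots> = (real n * pi\<^sup>2 / 2) * \<delta>\<^sup>2" by (simp add: power_mult_distrib)
    also have "\<dots> \<le> (real n * pi\<^sup>2 / 2) * (KZ\<^sup>2 / (real n)\<^sup>2)" using \<delta>2 by (intro mult_left_mono) auto
    also have "\<dots> = pi\<^sup>2 * KZ\<^sup>2 / 2 / real n" using n1 by (simp add: power2_eq_square)
    finally show ?thesis by (simp add: abs_mult)
  qed
  have s3: "\<bar>w0 * cos (\<delta> * pi) - w0\<bar> \<le> \<bar>w0\<bar> * pi * KZ / real n"
  proof -
    have "\<bar>w0 * cos (\<delta> * pi) - w0\<bar> = \<bar>w0\<bar> * \<bar>cos (\<delta> * pi) - cos 0\<bar>"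
      unfolding abs_mult[symmetric] by (simp only: cos_zero right_diff_distrib mult_1_right)
    also have "\<dots> \<le> \<bar>w0\<bar> * \<bar>\<delta> * pi - 0\<bar>" by (intro mult_left_mono abs_cos_diff_le) simp
    also have "\<dots> = \<bar>w0\<bar> * pi * \<bar>\<delta>\<bar>" by (simp add: abs_mult)
    also have "\<dots> \<le> \<bar>w0\<bar> * pi * (KZ / real n)" using d by (intro mult_left_mono) auto
    finally show ?thesis by simp
  qed
  have "real n * pi * \<delta> - w0 = (rr n * sin (\<delta> * pi) - w0 * cos (\<delta> * pi)) - \<delta> * sin (\<delta> * pi)
      - real n * (sin (\<delta> * pi) - \<delta> * pi) + (w0 * cos (\<delta> * pi) - w0)"
    by (simp add: \<delta>_def algebra_simps)
  then have "\<bar>real n * pi * \<delta> - w0\<bar> \<le> \<bar>Jf (rr n) + E\<bar> + pi * KZ\<^sup>2 / real n + pi\<^sup>2 * KZ\<^sup>2 / 2 / real n + \<bar>w0\<bar> * pi * KZ / real n"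
    using m s1 s2 s3 by linarith
  also have "\<dots> \<le> \<bar>Jf (real n)\<bar> + (1/2 * qn * pi * KZ / real n + 2 * (qn * KS + \<bar>H\<bar> * KS) / real n
      + pi * KZ\<^sup>2 / real n + pi\<^sup>2 * KZ\<^sup>2 / 2 / real n + \<bar>w0\<bar> * pi * KZ / real n)"
    using J E by linarith
  also have "\<dots> = \<bar>Jf (real n)\<bar> + KA / real n"
    unfolding KA_def add_divide_distrib by simp
  finally have fin: "\<bar>real n * pi * \<delta> - w0\<bar> \<le> \<bar>Jf (real n)\<bar> + KA / real n" .
  have "kk n * pi = real n * pi * \<delta> - w0" by (simp add: kk_def \<delta>_def field_simps)
  then have "\<bar>kk n\<bar> * pi = \<bar>real n * pi * \<delta> - w0\<bar>" by (metis abs_mult abs_of_pos pi_gt_zero)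
  moreover have "\<bar>kk n\<bar> * 1 \<le> \<bar>kk n\<bar> * pi" using pi_gt3 by (intro mult_left_mono) auto
  ultimately show ?thesis using fin by linarith
qed

text \<open>Twice the integral over \<open>x\<close> of the integral of
  \<open>q t * sin (\<rho> * t) * cos (\<rho> * t)\<close> over \<open>{0..x}\<close>; the weight
  \<open>pi - t\<close> reflects the exchange of the two integrations. It is the leading deviation
  of the weight numbers from \<open>pi / 2\<close>.\<close>

definition Af :: "real \<Rightarrow> real" where "Af \<rho> = integral {0..pi} (\<lambda>t. q t * ((pi - t) * sin (2 * \<rho> * t)))"

lemma summable_Af: "summable (\<lambda>n. (Af (real n))\<^sup>2)"
proof -
  have "(\<lambda>t. (q t)\<^sup>2) absolutely_integrable_on {0..pi}"
    using q2_int by (intro nonnegative_absolutely_integrable_1) auto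
  then have "(\<lambda>t. (q t)\<^sup>2 * (pi - t)\<^sup>2) absolutely_integrable_on {0..pi}"
    by (rule absolutely_integrable_mult_continuous) (intro continuous_intros)
  then have "(\<lambda>t. (q t * (pi - t))\<^sup>2) integrable_on {0..pi}"
    by (simp add: power_mult_distrib set_lebesgue_integral_eq_integral(1))
  moreover have "(\<lambda>t. q t * (pi - t)) absolutely_integrable_on {0..pi}"
    by (intro qg_abs_int continuous_intros)
  ultimately show ?thesis
    using summable_fourier_coeffs(2)[of "\<lambda>t. q t * (pi - t)"] by (simp add: Af_def mult.assoc)
qed

lemma Af_lipschitz: "\<bar>Af \<rho> - Af \<sigma>\<bar> \<le> 2 * pi\<^sup>2 * qn * \<bar>\<rho> - \<sigma>\<bar>"
proof -
  have cc: "continuous_on {0..pi} (\<lambda>t. (pi - t) * sin (2 * \<rho> * t))" for \<rho> by (intro continuous_intros)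
  have "\<bar>Af \<rho> - Af \<sigma>\<bar> \<le> qn * (pi * (2 * pi * \<bar>\<rho> - \<sigma>\<bar>))"
    unfolding Af_def
  proof (rule qg_diff_bound[OF cc cc])
    fix t assume t: "t \<in> {0..pi}"
    have "\<bar>sin (2 * \<rho> * t) - sin (2 * \<sigma> * t)\<bar> \<le> \<bar>2 * \<rho> * t - 2 * \<sigma> * t\<bar>" by (rule abs_sin_diff_le)
    also have "2 * \<rho> * t - 2 * \<sigma> * t = 2 * t * (\<rho> - \<sigma>)" by (simp add: algebra_simps)
    also have "\<bar>2 * t * (\<rho> - \<sigma>)\<bar> = 2 * t * \<bar>\<rho> - \<sigma>\<bar>" using t by (simp add: abs_mult)
    also have "\<dots> \<le> 2 * pi * \<bar>\<rho> - \<sigma>\<bar>" using t by (intro mult_right_mono) auto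
    finally have "\<bar>pi - t\<bar> * \<bar>sin (2 * \<rho> * t) - sin (2 * \<sigma> * t)\<bar> \<le> pi * (2 * pi * \<bar>\<rho> - \<sigma>\<bar>)"
      using t by (intro mult_mono) auto
    then show "\<bar>(pi - t) * sin (2 * \<rho> * t) - (pi - t) * sin (2 * \<sigma> * t)\<bar> \<le> pi * (2 * pi * \<bar>\<rho> - \<sigma>\<bar>)"
      by (simp add: right_diff_distrib[symmetric] abs_mult)
  qed simp
  then show ?thesis by (simp add: power2_eq_square algebra_simps)
qed

text \<open>For double integrals with \<open>q\<close> inside: an indefinite integral of
  \<open>q * f\<close> against \<open>g'\<close> is traded for a single integral against the
  antiderivative \<open>g\<close>, which is small when \<open>g'\<close> oscillates. The constant
  \<open>a\<close> accommodates the summand \<open>h\<close> of \<open>P\<close>.\<close>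

lemma q_indefinite_by_parts:
  fixes f g g' :: "real \<Rightarrow> real"
  assumes f: "continuous_on {0..pi} f" "\<And>x. x \<in> {0..pi} \<Longrightarrow> \<bar>f x\<bar> \<le> 1"
    and g: "\<And>x. (g has_real_derivative g' x) (at x)" "continuous_on {0..pi} g'"
  shows "((\<lambda>x. q x * (f x * g x) + (a + integral {0..x} (\<lambda>t. q t * f t)) * g' x) has_integral
     ((a + integral {0..pi} (\<lambda>t. q t * f t)) * g pi - a * g 0)) {0..pi}"
proof -
  have "((\<lambda>x. (q x * f x) * g x + (a + integral {0..x} (\<lambda>t. q t * f t)) * g' x) has_integral
     ((a + integral {0..pi} (\<lambda>t. q t * f t)) * g pi - (a + integral {0..0} (\<lambda>t. q t * f t)) * g 0)) {0..pi}"
  proof (rule by_parts_AC)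
    show "(\<lambda>x. q x * f x) absolutely_integrable_on {0..pi}" by (rule qg_abs_int[OF f(1)])
    show "((\<lambda>x. q x * f x) has_integral (a + integral {0..x} (\<lambda>t. q t * f t)) - (a + integral {0..0} (\<lambda>t. q t * f t))) {0..x}" if "x \<in> {0..pi}" for x
      using integrable_integral[OF qg_int[OF f(1) that]] by simp
    show "(g has_vector_derivative g' x) (at x within {0..pi})" for x
      using g(1) has_field_derivative_at_within has_real_derivative_iff_has_vector_derivative by blast
  qed (use g(2) in auto)
  then show ?thesis by (simp add: mult.assoc)
qed

text \<open>\<open>KR / \<rho>\<^sup>2\<close> is the pointwise second-order error of
  \<open>(cr \<rho> x)\<^sup>2\<close>: \<open>2 * qn * KS\<close> comes from the remainder
  \<open>r\<close> of \<open>sf\<close>, and \<open>KS\<^sup>2\<close> from the square of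
  \<open>sf\<close>.\<close>

definition KR :: real where "KR = 2 * qn * KS + KS\<^sup>2"
definition KB :: real where "KB = pi * KZ + 4 * \<bar>h\<bar> + 8 * qn + 2 * pi\<^sup>2 * qn * KZ + 4 * pi * KR"

text \<open>To first order in \<open>1 / \<rho>\<close> the square adds to the squared cosine only
  the cross term with \<open>sf\<close>. Splitting the sine in \<open>sf\<close> turns it into
  multiples of \<open>P x * sin (2 * \<rho> * x)\<close>, \<open>S x * cos (2 * \<rho> * x)\<close>
  and \<open>S x\<close>. The first two oscillate and integrate to \<open>O(1 / \<rho>)\<close>; the
  last survives as \<open>Af \<rho> / 2\<close>.\<close>

lemma sqint_asymptotics:
  assumes \<rho>: "\<rho> > 0"
  shows "\<bar>integral {0..pi} (\<lambda>x. (cr \<rho> x)\<^sup>2) - (pi / 2 + sin (2 * \<rho> * pi) / (4 * \<rho>) - Af \<rho> / (2 * \<rho>))\<bar>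
     \<le> (\<bar>h\<bar> + 2 * qn) / \<rho>\<^sup>2 + pi * KR / \<rho>\<^sup>2"
proof -
  have \<rho>0: "\<rho> \<noteq> 0" using \<rho> by simp
  define P where "P = (\<lambda>x. h + integral {0..x} (\<lambda>t. q t * (cos (\<rho> * t))\<^sup>2))"
  define S where "S = (\<lambda>x. integral {0..x} (\<lambda>t. q t * (sin (\<rho> * t) * cos (\<rho> * t))))"
  define r where "r = (\<lambda>x. integral {0..x} (\<lambda>t. q t * (sf \<rho> t * sin (\<rho> * (x - t)))))"
  have cC: "continuous_on {0..pi} (\<lambda>t. (cos (\<rho> * t))\<^sup>2)" and cS: "continuous_on {0..pi} (\<lambda>t. sin (\<rho> * t) * cos (\<rho> * t))"
    by (intro continuous_intros)+
  have bC: "\<bar>(cos (\<rho> * t))\<^sup>2\<bar> \<le> 1" for t by (simp add: abs_square_le_1)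
  have bS: "\<bar>sin (\<rho> * t) * cos (\<rho> * t)\<bar> \<le> 1" for t
    using mult_mono[OF abs_sin_le_one[of "\<rho> * t"] abs_cos_le_one[of "\<rho> * t"]] by (simp add: abs_mult)
  have sfe: "sf \<rho> x = sin (\<rho> * x) * P x - cos (\<rho> * x) * S x + r x / \<rho>" if x: "x \<in> {0..pi}" for x
  proof -
    have "integral {0..x} (\<lambda>t. q t * (cr \<rho> t * sin (\<rho> * (x - t)))) =
        integral {0..x} (\<lambda>t. q t * ((sin (\<rho> * x) * (cos (\<rho> * t))\<^sup>2 + (- cos (\<rho> * x)) * (sin (\<rho> * t) * cos (\<rho> * t))) + (1/\<rho>) * (sf \<rho> t * sin (\<rho> * (x - t)))))"
    proof (rule Henstock_Kurzweil_Integration.integral_cong)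
      fix t assume t: "t \<in> {0..x}"
      then have t': "t \<in> {0..pi}" using x by auto
      have sd: "sin (\<rho> * (x - t)) = sin (\<rho> * x) * cos (\<rho> * t) - cos (\<rho> * x) * sin (\<rho> * t)"
        by (simp add: right_diff_distrib sin_diff)
      have "cos (\<rho> * t) * sin (\<rho> * (x - t)) = sin (\<rho> * x) * (cos (\<rho> * t))\<^sup>2 + (- cos (\<rho> * x)) * (sin (\<rho> * t) * cos (\<rho> * t))"
        unfolding sd by (simp add: algebra_simps power2_eq_square)
      then have "cr \<rho> t * sin (\<rho> * (x - t)) = (sin (\<rho> * x) * (cos (\<rho> * t))\<^sup>2 + (- cos (\<rho> * x)) * (sin (\<rho> * t) * cos (\<rho> * t))) + (1/\<rho>) * (sf \<rho> t * sin (\<rho> * (x - t)))"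
        unfolding cr_eq[OF \<rho>0 t'] by (simp add: distrib_right)
      then show "q t * (cr \<rho> t * sin (\<rho> * (x - t))) = q t * ((sin (\<rho> * x) * (cos (\<rho> * t))\<^sup>2 + (- cos (\<rho> * x)) * (sin (\<rho> * t) * cos (\<rho> * t))) + (1/\<rho>) * (sf \<rho> t * sin (\<rho> * (x - t))))"
        by simp
    qed
    also have "\<dots> = sin (\<rho> * x) * integral {0..x} (\<lambda>t. q t * (cos (\<rho> * t))\<^sup>2) + (- cos (\<rho> * x)) * S x + (1/\<rho>) * r x"
    proof -
      have c1: "continuous_on {0..pi} (\<lambda>t. sin (\<rho> * x) * (cos (\<rho> * t))\<^sup>2)" by (intro continuous_intros)
      have c2: "continuous_on {0..pi} (\<lambda>t. (- cos (\<rho> * x)) * (sin (\<rho> * t) * cos (\<rho> * t)))" by (intro continuous_intros)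
      have c3: "continuous_on {0..pi} (\<lambda>t. (1/\<rho>) * (sf \<rho> t * sin (\<rho> * (x - t))))" by (intro continuous_intros sf_cont \<rho>0)
      show ?thesis
        unfolding qg_add[OF continuous_on_add[OF c1 c2] c3 x] qg_add[OF c1 c2 x] S_def r_def qg_scale ..
    qed
    finally show ?thesis unfolding sf_def P_def by (simp add: algebra_simps)
  qed
  have rb: "\<bar>r x\<bar> \<le> qn * KS" if x: "x \<in> {0..pi}" for x
    unfolding r_def
  proof (rule qg_bound[OF _ x])
    show "continuous_on {0..pi} (\<lambda>t. sf \<rho> t * sin (\<rho> * (x - t)))" by (intro continuous_intros sf_cont \<rho>0)
    fix t assume t: "t \<in> {0..x}"
    have "\<bar>sf \<rho> t\<bar> * \<bar>sin (\<rho> * (x - t))\<bar> \<le> KS * 1" using t x by (intro mult_mono sf_bound KS_nonneg) auto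
    then show "\<bar>sf \<rho> t * sin (\<rho> * (x - t))\<bar> \<le> KS" by (simp add: abs_mult)
  qed
  define m where "m = (\<lambda>x. (cos (\<rho> * x))\<^sup>2 + (1/\<rho>) * (P x * sin (2 * \<rho> * x) - S x * cos (2 * \<rho> * x) - S x))"
  have pt: "\<bar>(cr \<rho> x)\<^sup>2 - m x\<bar> \<le> KR / \<rho>\<^sup>2" if x: "x \<in> {0..pi}" for x
  proof -
    have "(cr \<rho> x)\<^sup>2 = (cos (\<rho> * x))\<^sup>2 + (1/\<rho>) * (2 * cos (\<rho> * x) * sf \<rho> x) + (sf \<rho> x)\<^sup>2 / \<rho>\<^sup>2"
      unfolding cr_eq[OF \<rho>0 x] by (simp add: power2_sum power_divide algebra_simps)
    also have "2 * cos (\<rho> * x) * sf \<rho> x = (P x * sin (2 * \<rho> * x) - S x * cos (2 * \<rho> * x) - S x) + 2 * cos (\<rho> * x) * r x / \<rho>"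
    proof -
      have s2: "sin (2 * \<rho> * x) = 2 * sin (\<rho> * x) * cos (\<rho> * x)" using sin_double[of "\<rho> * x"] by (simp add: mult.assoc)
      have c2: "cos (2 * \<rho> * x) = 2 * (cos (\<rho> * x))\<^sup>2 - 1" using cos_double_cos[of "\<rho> * x"] by (simp add: mult.assoc)
      show ?thesis unfolding sfe[OF x] s2 c2 by (simp add: algebra_simps power2_eq_square)
    qed
    finally have "(cr \<rho> x)\<^sup>2 - m x = (2 * cos (\<rho> * x) * r x + (sf \<rho> x)\<^sup>2) / \<rho>\<^sup>2"
      using \<rho>0 unfolding m_def by (simp add: field_simps power2_eq_square)
    also have "\<bar>\<dots>\<bar> \<le> KR / \<rho>\<^sup>2"
      unfolding abs_divide KR_def
    proof (rule frac_le)
      have "\<bar>2 * cos (\<rho> * x) * r x\<bar> \<le> 2 * (qn * KS)"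
        using mult_mono[OF abs_cos_le_one[of "\<rho> * x"] rb[OF x]] by (simp add: abs_mult)
      moreover have "(sf \<rho> x)\<^sup>2 \<le> KS\<^sup>2" using power_mono[OF sf_bound[OF x, of \<rho>], of 2] by simp
      moreover have "0 \<le> (sf \<rho> x)\<^sup>2" by simp
      moreover have "2 * (qn * KS) = 2 * qn * KS" by simp
      ultimately show "\<bar>2 * cos (\<rho> * x) * r x + (sf \<rho> x)\<^sup>2\<bar> \<le> 2 * qn * KS + KS\<^sup>2" by linarith
    qed (use \<rho> KS_nonneg qn_nonneg in auto)
    finally show ?thesis .
  qed
  have I1: "((\<lambda>x. (cos (\<rho> * x))\<^sup>2) has_integral (pi / 2 + sin (2 * \<rho> * pi) / (4 * \<rho>))) {0..pi}"
  proof -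
    have "((\<lambda>x. 1/2 + 1/2 * cos (2 * \<rho> * x)) has_integral (1/2 * pi + 1/2 * (sin (2 * \<rho> * pi) / (2 * \<rho>)))) {0..pi}"
      using has_integral_add[OF has_integral_const_real[of "1/2" 0 pi] has_integral_mult_right[OF has_integral_cos_scaled[of "2 * \<rho>" pi], of "1/2"]] \<rho>0
      by (simp add: content_real)
    moreover have "1/2 + 1/2 * cos (2 * \<rho> * x) = (cos (\<rho> * x))\<^sup>2" for x
      using cos_double_cos[of "\<rho> * x"] by (simp add: mult.assoc field_simps)
    ultimately show ?thesis by simp
  qed
  define g2 where "g2 = (\<lambda>x. - cos (2 * \<rho> * x) / (2 * \<rho>))"
  define g3 where "g3 = (\<lambda>x. sin (2 * \<rho> * x) / (2 * \<rho>))"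
  have g2b: "\<bar>g2 x\<bar> \<le> 1 / (2 * \<rho>)" "\<bar>g3 x\<bar> \<le> 1 / (2 * \<rho>)" for x
    using \<rho> by (auto simp: g2_def g3_def abs_divide intro!: divide_right_mono)
  have fb: "\<bar>integral {0..pi} (\<lambda>t. q t * (f t * g t))\<bar> \<le> qn * (1 / (2 * \<rho>))" "\<bar>integral {0..pi} (\<lambda>t. q t * f t)\<bar> \<le> qn * 1"
    if "continuous_on {0..pi} f" "continuous_on {0..pi} g" "\<And>t. \<bar>f t\<bar> \<le> 1" "\<And>t. \<bar>g t\<bar> \<le> 1 / (2 * \<rho>)" for f g :: "real \<Rightarrow> real"
  proof -
    have "\<bar>f t\<bar> * \<bar>g t\<bar> \<le> 1 * (1 / (2 * \<rho>))" for t using that(3,4) by (intro mult_mono) auto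
    then show "\<bar>integral {0..pi} (\<lambda>t. q t * (f t * g t))\<bar> \<le> qn * (1 / (2 * \<rho>))"
      by (intro qg_bound continuous_intros that) (auto simp: abs_mult)
    show "\<bar>integral {0..pi} (\<lambda>t. q t * f t)\<bar> \<le> qn * 1" by (rule qg_bound[OF that(1)]) (use that(3) in auto)
  qed
  have g2c: "continuous_on {0..pi} g2" "continuous_on {0..pi} g3"
    using \<rho>0 unfolding g2_def g3_def by (auto intro!: continuous_intros)
  obtain I2 where I2: "((\<lambda>x. P x * sin (2 * \<rho> * x)) has_integral I2) {0..pi}" "\<bar>I2\<bar> \<le> (\<bar>h\<bar> + qn) / \<rho>"
  proof -
    have "((\<lambda>x. q x * ((cos (\<rho> * x))\<^sup>2 * g2 x) + P x * sin (2 * \<rho> * x)) has_integral P pi * g2 pi - h * g2 0) {0..pi}"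
      unfolding P_def
    proof (rule q_indefinite_by_parts[OF cC bC])
      show "(g2 has_real_derivative sin (2 * \<rho> * x)) (at x)" for x
        unfolding g2_def using \<rho>0 by (auto intro!: derivative_eq_intros)
    qed (intro continuous_intros)
    from has_integral_diff[OF this integrable_integral[OF qg_int[of "\<lambda>x. (cos (\<rho> * x))\<^sup>2 * g2 x" pi]]]
    have "((\<lambda>x. P x * sin (2 * \<rho> * x)) has_integral P pi * g2 pi - h * g2 0 - integral {0..pi} (\<lambda>x. q x * ((cos (\<rho> * x))\<^sup>2 * g2 x))) {0..pi}"
      using continuous_on_mult[OF cC g2c(1)] by simp
    moreover have "\<bar>P pi * g2 pi - h * g2 0 - integral {0..pi} (\<lambda>x. q x * ((cos (\<rho> * x))\<^sup>2 * g2 x))\<bar> \<le> (\<bar>h\<bar> + qn) / \<rho>"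
    proof -
      have "\<bar>P pi\<bar> \<le> \<bar>h\<bar> + qn" unfolding P_def using fb(2)[OF cC g2c(1) bC g2b(1)] by linarith
      then have "\<bar>P pi * g2 pi\<bar> \<le> (\<bar>h\<bar> + qn) * (1 / (2 * \<rho>))" unfolding abs_mult using g2b(1) by (intro mult_mono) auto
      moreover have "\<bar>h * g2 0\<bar> \<le> \<bar>h\<bar> * (1 / (2 * \<rho>))" unfolding abs_mult using g2b(1) by (intro mult_left_mono) auto
      moreover have "(\<bar>h\<bar> + qn) * (1 / (2 * \<rho>)) + \<bar>h\<bar> * (1 / (2 * \<rho>)) + qn * (1 / (2 * \<rho>)) = (\<bar>h\<bar> + qn) / \<rho>"
        using \<rho>0 by (simp add: field_simps)
      ultimately show ?thesis using fb(1)[OF cC g2c(1) bC g2b(1)] by linarith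
    qed
    ultimately show ?thesis by (rule that)
  qed
  obtain I3 where I3: "((\<lambda>x. S x * cos (2 * \<rho> * x)) has_integral I3) {0..pi}" "\<bar>I3\<bar> \<le> qn / \<rho>"
  proof -
    have "((\<lambda>x. q x * ((sin (\<rho> * x) * cos (\<rho> * x)) * g3 x) + (0 + S x) * cos (2 * \<rho> * x)) has_integral (0 + S pi) * g3 pi - 0 * g3 0) {0..pi}"
      unfolding S_def
    proof (rule q_indefinite_by_parts[OF cS bS])
      show "(g3 has_real_derivative cos (2 * \<rho> * x)) (at x)" for x
        unfolding g3_def using \<rho>0 by (auto intro!: derivative_eq_intros)
    qed (intro continuous_intros)
    from has_integral_diff[OF this integrable_integral[OF qg_int[of "\<lambda>x. (sin (\<rho> * x) * cos (\<rho> * x)) * g3 x" pi]]]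
    have "((\<lambda>x. S x * cos (2 * \<rho> * x)) has_integral S pi * g3 pi - integral {0..pi} (\<lambda>x. q x * ((sin (\<rho> * x) * cos (\<rho> * x)) * g3 x))) {0..pi}"
      using continuous_on_mult[OF cS g2c(2)] by simp
    moreover have "\<bar>S pi * g3 pi - integral {0..pi} (\<lambda>x. q x * ((sin (\<rho> * x) * cos (\<rho> * x)) * g3 x))\<bar> \<le> qn / \<rho>"
    proof -
      have "\<bar>S pi\<bar> \<le> qn" unfolding S_def using fb(2)[OF cS g2c(2) bS g2b(2)] by linarith
      then have "\<bar>S pi * g3 pi\<bar> \<le> qn * (1 / (2 * \<rho>))" unfolding abs_mult using g2b(2) qn_nonneg by (intro mult_mono) auto
      moreover have "qn * (1 / (2 * \<rho>)) + qn * (1 / (2 * \<rho>)) = qn / \<rho>"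
        using \<rho>0 by (simp add: field_simps)
      ultimately show ?thesis using fb(1)[OF cS g2c(2) bS g2b(2)] by linarith
    qed
    ultimately show ?thesis by (rule that)
  qed
  have I4: "(S has_integral Af \<rho> / 2) {0..pi}"
  proof -
    \<comment> \<open>As antiderivative of 1, \<open>x - pi\<close> vanishes at \<open>pi\<close>,
      and \<open>S\<close> vanishes at 0, so no boundary term remains.\<close>
    have "((\<lambda>x. q x * ((sin (\<rho> * x) * cos (\<rho> * x)) * (x - pi)) + (0 + S x) * 1) has_integral (0 + S pi) * (pi - pi) - 0 * (0 - pi)) {0..pi}"
      unfolding S_def by (rule q_indefinite_by_parts[OF cS bS]) (auto intro!: derivative_eq_intros)
    from has_integral_diff[OF this integrable_integral[OF qg_int[of "\<lambda>x. (sin (\<rho> * x) * cos (\<rho> * x)) * (x - pi)" pi]]]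
    have "(S has_integral - integral {0..pi} (\<lambda>x. q x * ((sin (\<rho> * x) * cos (\<rho> * x)) * (x - pi)))) {0..pi}"
      using continuous_on_mult[OF cS, of "\<lambda>x. x - pi"] by (simp add: continuous_intros)
    moreover have "- integral {0..pi} (\<lambda>x. q x * ((sin (\<rho> * x) * cos (\<rho> * x)) * (x - pi))) = Af \<rho> / 2"
    proof -
      have "(sin (\<rho> * x) * cos (\<rho> * x)) * (x - pi) = (- 1/2) * ((pi - x) * sin (2 * \<rho> * x))" for x
        using sin_double[of "\<rho> * x"] by (simp add: mult.assoc algebra_simps)
      then show ?thesis unfolding Af_def by (simp only: qg_scale)
    qed
    ultimately show ?thesis by simp
  qed
  have Im: "(m has_integral (pi / 2 + sin (2 * \<rho> * pi) / (4 * \<rho>)) + (1/\<rho>) * (I2 - I3 - Af \<rho> / 2)) {0..pi}"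
    unfolding m_def by (intro has_integral_add has_integral_diff has_integral_mult_right I1 I2(1) I3(1) I4)
  have Ic: "((\<lambda>x. (cr \<rho> x)\<^sup>2) has_integral integral {0..pi} (\<lambda>x. (cr \<rho> x)\<^sup>2)) {0..pi}"
    by (intro integrable_integral integrable_continuous_real continuous_intros cr_cont)
  have "norm (integral {0..pi} (\<lambda>x. (cr \<rho> x)\<^sup>2) - ((pi / 2 + sin (2 * \<rho> * pi) / (4 * \<rho>)) + (1/\<rho>) * (I2 - I3 - Af \<rho> / 2))) \<le> KR / \<rho>\<^sup>2 * measure lborel {0..pi}"
    by (rule has_integral_bound_real[OF _ finite.emptyI has_integral_diff[OF Ic Im]])
       (use pt KS_nonneg qn_nonneg in \<open>auto simp: KR_def\<close>)
  then have 1: "\<bar>integral {0..pi} (\<lambda>x. (cr \<rho> x)\<^sup>2) - ((pi / 2 + sin (2 * \<rho> * pi) / (4 * \<rho>)) + (1/\<rho>) * (I2 - I3 - Af \<rho> / 2))\<bar> \<le> pi * KR / \<rho>\<^sup>2"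
    by (simp add: mult.commute)
  have "\<bar>(1/\<rho>) * (I2 - I3)\<bar> = (1/\<rho>) * \<bar>I2 - I3\<bar>" using \<rho> by (simp add: abs_mult)
  also have "\<dots> \<le> (1/\<rho>) * ((\<bar>h\<bar> + qn) / \<rho> + qn / \<rho>)" using I2(2) I3(2) \<rho> by (intro mult_left_mono) auto
  also have "\<dots> = (\<bar>h\<bar> + 2 * qn) / \<rho>\<^sup>2" using \<rho>0 by (simp add: field_simps power2_eq_square)
  finally have 2: "\<bar>(1/\<rho>) * (I2 - I3)\<bar> \<le> (\<bar>h\<bar> + 2 * qn) / \<rho>\<^sup>2" .
  have 3: "(1/\<rho>) * (I2 - I3 - Af \<rho> / 2) = (1/\<rho>) * (I2 - I3) - Af \<rho> / (2 * \<rho>)"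
    by (simp add: right_diff_distrib)
  show ?thesis using 1 2 unfolding 3 by linarith
qed

text \<open>As \<open>rr n\<close> is within \<open>KZ / n\<close> of an integer,
  \<open>sin (2 * \<rho> * pi)\<close> is itself \<open>O(1 / n)\<close>, and
  \<open>Af \<rho>\<close> may be replaced by the Fourier coefficient \<open>Af n\<close>.\<close>

lemma wt_bound:
  assumes n: "n \<ge> N0"
  shows "\<bar>wt n - pi / 2\<bar> \<le> (\<bar>Af (real n)\<bar> + KB / real n) / real n"
proof -
  define \<rho> where "\<rho> = rr n"
  have n1: "real n \<ge> 1" using N0_props_ge(1)[OF n] by simp
  have d: "\<bar>\<rho> - real n\<bar> \<le> KZ / real n" and r: "\<rho> > 0" "\<rho> \<ge> real n / 2"
    using rr[OF n] by (auto simp: \<rho>_def)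
  have "wt n = integral {0..pi} (\<lambda>x. (cr \<rho> x)\<^sup>2)"
    unfolding wt_sqnorm sqnorm_def
    by (rule Henstock_Kurzweil_Integration.integral_cong) (simp add: ef_rr[OF n] \<rho>_def)
  then have 1: "\<bar>wt n - (pi / 2 + sin (2 * \<rho> * pi) / (4 * \<rho>) - Af \<rho> / (2 * \<rho>))\<bar> \<le> (\<bar>h\<bar> + 2 * qn) / \<rho>\<^sup>2 + pi * KR / \<rho>\<^sup>2"
    using sqint_asymptotics[OF r(1)] by simp
  have inv2: "a / \<rho>\<^sup>2 \<le> 4 * a / (real n)\<^sup>2" if "a \<ge> 0" for a
  proof -
    have "a / \<rho>\<^sup>2 \<le> a / (real n / 2)\<^sup>2" using that r n1 by (intro divide_left_mono power_mono) auto
    then show ?thesis by (simp add: power_divide mult.commute)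
  qed
  have KR0: "KR \<ge> 0" using qn_nonneg KS_nonneg by (simp add: KR_def)
  have 2: "(\<bar>h\<bar> + 2 * qn) / \<rho>\<^sup>2 + pi * KR / \<rho>\<^sup>2 \<le> 4 * (\<bar>h\<bar> + 2 * qn) / (real n)\<^sup>2 + 4 * (pi * KR) / (real n)\<^sup>2"
    using KR0 qn_nonneg by (intro add_mono inv2) auto
  have "\<bar>sin (2 * \<rho> * pi)\<bar> \<le> 2 * pi * (KZ / real n)"
  proof -
    have "sin (2 * \<rho> * pi) = sin (2 * (\<rho> - real n) * pi)"
      using sin_shift_npi[of "2 * \<rho>" "2 * n"] by (simp add: right_diff_distrib)
    then have "\<bar>sin (2 * \<rho> * pi)\<bar> \<le> \<bar>2 * (\<rho> - real n) * pi\<bar>" by (simp only: abs_sin_x_le_abs_x)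
    also have "\<dots> = 2 * pi * \<bar>\<rho> - real n\<bar>" unfolding abs_mult by simp
    also have "\<dots> \<le> 2 * pi * (KZ / real n)" using d by (intro mult_left_mono) auto
    finally show ?thesis .
  qed
  then have "\<bar>sin (2 * \<rho> * pi)\<bar> / (4 * \<rho>) \<le> 2 * pi * (KZ / real n) / (4 * (real n / 2))"
    using r n1 KZ_nonneg by (intro frac_le) auto
  then have 3: "\<bar>sin (2 * \<rho> * pi) / (4 * \<rho>)\<bar> \<le> pi * KZ / (real n)\<^sup>2"
    using r(1) by (simp add: abs_divide power2_eq_square mult.commute mult.left_commute)
  have "\<bar>Af \<rho> - Af (real n)\<bar> \<le> 2 * pi\<^sup>2 * qn * (KZ / real n)"
    using order_trans[OF Af_lipschitz mult_left_mono[OF d, of "2 * pi\<^sup>2 * qn"]] qn_nonneg by simp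
  then have "\<bar>Af \<rho>\<bar> \<le> \<bar>Af (real n)\<bar> + 2 * pi\<^sup>2 * qn * (KZ / real n)" by linarith
  then have "\<bar>Af \<rho>\<bar> / (2 * \<rho>) \<le> (\<bar>Af (real n)\<bar> + 2 * pi\<^sup>2 * qn * (KZ / real n)) / (2 * (real n / 2))"
    using r n1 KZ_nonneg qn_nonneg by (intro frac_le) auto
  then have 4: "\<bar>Af \<rho> / (2 * \<rho>)\<bar> \<le> \<bar>Af (real n)\<bar> / real n + 2 * pi\<^sup>2 * qn * KZ / (real n)\<^sup>2"
    using r(1) by (simp add: abs_divide power2_eq_square add_divide_distrib)
  have "\<bar>wt n - pi / 2\<bar> \<le> \<bar>Af (real n)\<bar> / real n + (pi * KZ / (real n)\<^sup>2 + 2 * pi\<^sup>2 * qn * KZ / (real n)\<^sup>2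
      + 4 * (\<bar>h\<bar> + 2 * qn) / (real n)\<^sup>2 + 4 * (pi * KR) / (real n)\<^sup>2)"
    using 1 2 3 4 by linarith
  also have "\<dots> = (\<bar>Af (real n)\<bar> + KB / real n) / real n"
    unfolding KB_def power2_eq_square add_divide_distrib by (simp add: distrib_left add_divide_distrib)
  finally show ?thesis .
qed

end

section \<open>Convergence of the series\<close>

context sturm_liouville
begin

definition K1 :: real where "K1 = pi\<^sup>2 * KZ\<^sup>2 + 2 * KL * KZ + 2 * KS * KZ"

lemma cos_shift_expansion:
  assumes n: "real n \<ge> 1" and d: "\<bar>\<rho> - real n\<bar> \<le> KZ / real n" and x: "x \<in> {0..pi}"
  shows "\<bar>cos (real n * x) - cos (\<rho> * x) - (\<rho> - real n) * x * sin (real n * x)\<bar> \<le> pi\<^sup>2 * KZ\<^sup>2 / (real n)\<^sup>2"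
proof -
  define y where "y = (\<rho> - real n) * x"
  have "\<rho> * x = real n * x + y" by (simp add: y_def algebra_simps)
  then have "cos (real n * x) - cos (\<rho> * x) - (\<rho> - real n) * x * sin (real n * x)
      = - (cos (real n * x) * (cos y - 1)) + sin (real n * x) * (sin y - y)"
    by (simp add: cos_add y_def[symmetric] algebra_simps)
  also have "\<bar>\<dots>\<bar> \<le> \<bar>cos (real n * x)\<bar> * \<bar>cos y - 1\<bar> + \<bar>sin (real n * x)\<bar> * \<bar>sin y - y\<bar>"
    unfolding abs_mult[symmetric] by linarith
  also have "\<dots> \<le> 1 * (y\<^sup>2 / 2) + 1 * (y\<^sup>2 / 2)"
    by (intro add_mono mult_mono abs_cos_sub_1_le abs_sin_sub_self_le) auto
  also have "\<dots> = y\<^sup>2" by simp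
  also have "y\<^sup>2 \<le> pi\<^sup>2 * KZ\<^sup>2 / (real n)\<^sup>2"
  proof -
    have "\<bar>y\<bar> \<le> (KZ / real n) * pi" unfolding y_def abs_mult using d x by (intro mult_mono) auto
    from power_mono[OF this, of 2] show ?thesis by (simp add: power_mult_distrib power_divide mult.commute)
  qed
  finally show ?thesis .
qed

text \<open>To first order, moving the frequency from \<open>n\<close> to \<open>rr n\<close> acts
  on \<open>cr\<close> as on the pure cosine, because the quotient
  \<open>sf \<rho> x / \<rho>\<close> changes only by \<open>O(1 / n\<^sup>2)\<close>.\<close>

lemma cr_shift_expansion:
  assumes n: "n \<ge> N0" and x: "x \<in> {0..pi}"
  shows "\<bar>cr (real n) x - cr (rr n) x - (rr n - real n) * x * sin (real n * x)\<bar> \<le> K1 / (real n)\<^sup>2"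
proof -
  define \<rho> where "\<rho> = rr n"
  have n1: "real n \<ge> 1" using N0_props_ge(1)[OF n] by simp
  have d: "\<bar>\<rho> - real n\<bar> \<le> KZ / real n" and r: "\<rho> > 0" "\<rho> \<ge> real n / 2"
    using rr[OF n] by (auto simp: \<rho>_def)
  have "sf \<rho> x / \<rho> - sf (real n) x / real n = (sf \<rho> x - sf (real n) x) / \<rho> + sf (real n) x * (real n - \<rho>) / (\<rho> * real n)"
    using r n1 by (simp add: field_simps)
  also have "\<bar>\<dots>\<bar> \<le> \<bar>(sf \<rho> x - sf (real n) x) / \<rho>\<bar> + \<bar>sf (real n) x * (real n - \<rho>) / (\<rho> * real n)\<bar>"
    by (rule abs_triangle_ineq)
  also have "\<dots> \<le> 2 * KL * KZ / (real n)\<^sup>2 + 2 * KS * KZ / (real n)\<^sup>2"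
  proof (rule add_mono)
    have "\<bar>sf \<rho> x - sf (real n) x\<bar> \<le> KL * (KZ / real n)"
      using order_trans[OF sf_lipschitz[OF x] mult_left_mono[OF d KL_nonneg]] .
    then have "\<bar>sf \<rho> x - sf (real n) x\<bar> / \<rho> \<le> KL * (KZ / real n) / (real n / 2)"
      using r n1 KL_nonneg KZ_nonneg by (intro frac_le) auto
    then show "\<bar>(sf \<rho> x - sf (real n) x) / \<rho>\<bar> \<le> 2 * KL * KZ / (real n)\<^sup>2"
      using r(1) by (simp add: abs_divide power2_eq_square mult_ac)
    have "\<bar>sf (real n) x\<bar> * \<bar>real n - \<rho>\<bar> \<le> KS * (KZ / real n)"
      using d by (intro mult_mono sf_bound x KS_nonneg) (auto simp: abs_minus_commute)
    moreover have "\<rho> * real n \<ge> real n / 2 * 1" using r n1 by (intro mult_mono) auto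
    ultimately have "\<bar>sf (real n) x\<bar> * \<bar>real n - \<rho>\<bar> / (\<rho> * real n) \<le> KS * (KZ / real n) / (real n / 2 * 1)"
      using r n1 KS_nonneg KZ_nonneg by (intro frac_le) auto
    then show "\<bar>sf (real n) x * (real n - \<rho>) / (\<rho> * real n)\<bar> \<le> 2 * KS * KZ / (real n)\<^sup>2"
      using r(1) by (simp add: abs_divide abs_mult power2_eq_square mult_ac)
  qed
  finally have 1: "\<bar>sf \<rho> x / \<rho> - sf (real n) x / real n\<bar> \<le> 2 * KL * KZ / (real n)\<^sup>2 + 2 * KS * KZ / (real n)\<^sup>2" .
  have 2: "cr (real n) x = cos (real n * x) + sf (real n) x / real n" "cr \<rho> x = cos (\<rho> * x) + sf \<rho> x / \<rho>"
    using n1 r(1) x by (auto intro: cr_eq)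
  have "K1 / (real n)\<^sup>2 = pi\<^sup>2 * KZ\<^sup>2 / (real n)\<^sup>2 + (2 * KL * KZ / (real n)\<^sup>2 + 2 * KS * KZ / (real n)\<^sup>2)"
    by (simp add: K1_def add_divide_distrib)
  then show ?thesis
    using 1 2 cos_shift_expansion[OF n1 d x] unfolding \<rho>_def[symmetric] by linarith
qed

definition K2 :: real where "K2 = K1 + KE * KZ * pi + KC * (pi\<^sup>2 * KZ\<^sup>2)"

text \<open>The majorant for the M-test. Its parts are the eigenvalue remainder, the weight
  remainder and everything of second order.\<close>

definition bnd :: "nat \<Rightarrow> real" where
  "bnd n = 4 * (\<bar>kk n\<bar> / real n) + KC * \<bar>wt n - pi / 2\<bar> + K2 / (real n)\<^sup>2"

lemma G_term_real:
  assumes n: "n \<ge> N0" and x: "x \<in> {0..pi}"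
  shows "G_term c lam w n x t = of_real (cr (real n) x * cos (real n * t) / (pi / 2)
     - cr (rr n) x * cos (rr n * t) / wt n - corr_term w n x t)"
proof -
  have a: "alpha0 n = of_real (pi / 2)" using N0_props_ge(1)[OF n] by (simp add: alpha0_def)
  have "c (of_nat n) x = of_real (cr (real n) x)" using c_of_real[OF x, of "real n"] by simp
  moreover have "c (rho lam n) x = of_real (cr (rr n) x)" unfolding rho_rr[OF n] by (rule c_of_real[OF x])
  moreover have "cos (rho lam n * of_real t) = of_real (cos (rr n * t))"
    unfolding rho_rr[OF n] by (metis cos_of_real of_real_mult)
  ultimately show ?thesis unfolding G_term_def a alpha_wt cosn_eq by simp
qed

text \<open>To first order the difference of the two products is \<open>\<delta> * B\<close>, and
  \<open>\<delta> = (w0 / pi + kk n) / n\<close>. With the factor \<open>2 / pi\<close>, the part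
  with \<open>w0\<close> is exactly \<open>corr_term\<close>; what is left is
  \<open>kk n / n\<close>, the change of weights \<open>e4\<close> and second-order errors.\<close>

lemma G_term_bound:
  assumes n: "n \<ge> N0" and x: "x \<in> {0..pi}" and t: "t \<in> {0..pi}"
  shows "norm (G_term c lam w0 n x t) \<le> bnd n"
proof -
  define \<rho> where "\<rho> = rr n"
  define \<delta> where "\<delta> = \<rho> - real n"
  have n1: "real n \<ge> 1" and n1': "n \<ge> 1" using N0_props_ge(1)[OF n] by simp_all
  have d: "\<bar>\<delta>\<bar> \<le> KZ / real n" and r: "\<rho> > 0"
    using rr[OF n] by (auto simp: \<rho>_def \<delta>_def)
  define e1 where "e1 = cr (real n) x - cr \<rho> x - \<delta> * x * sin (real n * x)"
  define e2 where "e2 = cos (real n * t) - cos (\<rho> * t) - \<delta> * t * sin (real n * t)"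
  define e3 where "e3 = cr \<rho> x - cos (real n * x)"
  define e4 where "e4 = 2 / pi - 1 / wt n"
  have e1: "\<bar>e1\<bar> \<le> K1 / (real n)\<^sup>2" unfolding e1_def \<delta>_def \<rho>_def by (rule cr_shift_expansion[OF n x])
  have e2: "\<bar>e2\<bar> \<le> pi\<^sup>2 * KZ\<^sup>2 / (real n)\<^sup>2"
    unfolding e2_def \<delta>_def by (rule cos_shift_expansion[OF n1 _ t]) (use d in \<open>simp add: \<delta>_def\<close>)
  have e3: "\<bar>e3\<bar> \<le> KE / real n"
    unfolding e3_def \<rho>_def by (rule cr_near_cos[OF n1' less_imp_le[OF rr(1)[OF n]] rr(3)[OF n] x])
  have wt1: "wt n \<ge> 1" using wt_shift_ge[of "n - N0"] n by (simp add: M0_eq_N0)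
  have e4: "\<bar>e4\<bar> \<le> \<bar>wt n - pi / 2\<bar>"
  proof -
    have e4': "e4 = (wt n - pi / 2) * (2 / (pi * wt n))" using wt1 by (simp add: e4_def field_simps)
    have "\<bar>2 / (pi * wt n)\<bar> \<le> 1"
    proof -
      have "pi * wt n \<ge> pi * 1" using wt1 by (intro mult_left_mono) auto
      then have "pi * wt n \<ge> 2" using pi_gt3 by linarith
      then show ?thesis by (simp add: field_simps)
    qed
    then have "\<bar>wt n - pi / 2\<bar> * \<bar>2 / (pi * wt n)\<bar> \<le> \<bar>wt n - pi / 2\<bar> * 1" by (rule mult_left_mono) simp
    then show ?thesis unfolding e4' abs_mult by simp
  qed
  define B where "B = x * sin (real n * x) * cos (real n * t) + t * sin (real n * t) * cos (real n * x)"
  have B: "\<bar>B\<bar> \<le> 2 * pi"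
  proof -
    have "\<bar>x * sin (real n * x) * cos (real n * t)\<bar> \<le> pi * 1 * 1"
      unfolding abs_mult using x by (intro mult_mono) auto
    moreover have "\<bar>t * sin (real n * t) * cos (real n * x)\<bar> \<le> pi * 1 * 1"
      unfolding abs_mult using t by (intro mult_mono) auto
    ultimately show ?thesis unfolding B_def by linarith
  qed
  have \<delta>: "\<delta> = (w0 / pi + kk n) / real n" using n1 by (simp add: kk_def \<delta>_def \<rho>_def)
  have corr: "corr_term w0 n x t = (2 / pi) * (w0 / pi / real n) * B"
    unfolding corr_term_def B_def power2_eq_square by simp
  define X where "X = (2 / pi) * (kk n / real n) * B + (2 / pi) * (e1 * cos (real n * t) + e3 * \<delta> * t * sin (real n * t) + cr \<rho> x * e2)
     + e4 * (cr \<rho> x * cos (\<rho> * t))"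
  have main: "cr (real n) x * cos (real n * t) / (pi / 2) - cr \<rho> x * cos (\<rho> * t) / wt n - corr_term w0 n x t = X"
  proof -
    have c1: "cr (real n) x = e1 + cr \<rho> x + \<delta> * x * sin (real n * x)" by (simp add: e1_def)
    have c2: "cos (\<rho> * t) = cos (real n * t) - e2 - \<delta> * t * sin (real n * t)" by (simp add: e2_def)
    have "cr (real n) x * cos (real n * t) - cr \<rho> x * cos (\<rho> * t)
       = \<delta> * B + e1 * cos (real n * t) + e3 * \<delta> * t * sin (real n * t) + cr \<rho> x * e2"
      unfolding c1 c2 B_def e3_def by (simp add: algebra_simps)
    then have m0: "cr (real n) x * cos (real n * t) = (\<delta> * B + e1 * cos (real n * t) + e3 * \<delta> * t * sin (real n * t) + cr \<rho> x * e2) + cr \<rho> x * cos (\<rho> * t)"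
      by (simp only: diff_eq_eq)
    have m: "(2 / pi) * (cr (real n) x * cos (real n * t)) = (2 / pi) * (\<delta> * B + e1 * cos (real n * t) + e3 * \<delta> * t * sin (real n * t) + cr \<rho> x * e2)
       + (2 / pi) * (cr \<rho> x * cos (\<rho> * t))"
      unfolding m0 by (rule distrib_left)
    have "cr (real n) x * cos (real n * t) / (pi / 2) - cr \<rho> x * cos (\<rho> * t) / wt n
       = (2 / pi) * (cr (real n) x * cos (real n * t)) - (2 / pi) * (cr \<rho> x * cos (\<rho> * t)) + e4 * (cr \<rho> x * cos (\<rho> * t))"
      by (simp add: e4_def left_diff_distrib)
    also have "\<dots> = (2 / pi) * (\<delta> * B + e1 * cos (real n * t) + e3 * \<delta> * t * sin (real n * t) + cr \<rho> x * e2) + e4 * (cr \<rho> x * cos (\<rho> * t))"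
      unfolding m by simp
    also have "\<delta> * B = (w0 / pi / real n) * B + (kk n / real n) * B"
      unfolding \<delta> by (simp add: add_divide_distrib distrib_right)
    finally show ?thesis unfolding corr X_def by (simp add: distrib_left mult.assoc)
  qed
  have pi2: "\<bar>2 / pi\<bar> \<le> 1" using pi_gt3 by simp
  have "\<bar>(2 / pi) * (kk n / real n) * B\<bar> \<le> (2 / pi) * (\<bar>kk n\<bar> / real n) * (2 * pi)"
    unfolding abs_mult abs_divide using B by (intro mult_mono) auto
  then have x1: "\<bar>(2 / pi) * (kk n / real n) * B\<bar> \<le> 4 * (\<bar>kk n\<bar> / real n)" by simp
  have x2: "\<bar>e1 * cos (real n * t)\<bar> \<le> K1 / (real n)\<^sup>2"
    using mult_mono[OF e1 abs_cos_le_one[of "real n * t"]] e1 by (simp add: abs_mult)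
  have "\<bar>e3 * \<delta> * t * sin (real n * t)\<bar> \<le> KE / real n * (KZ / real n) * pi * 1"
    unfolding abs_mult using e3 d t KE_nonneg KZ_nonneg by (intro mult_mono) auto
  then have x3: "\<bar>e3 * \<delta> * t * sin (real n * t)\<bar> \<le> KE * KZ * pi / (real n)\<^sup>2" by (simp add: power2_eq_square)
  have "\<bar>cr \<rho> x * e2\<bar> \<le> KC * (pi\<^sup>2 * KZ\<^sup>2 / (real n)\<^sup>2)"
    unfolding abs_mult using cr_bound[OF x] e2 KC_pos by (intro mult_mono) auto
  then have x4: "\<bar>cr \<rho> x * e2\<bar> \<le> KC * (pi\<^sup>2 * KZ\<^sup>2) / (real n)\<^sup>2" by simp
  have "\<bar>e4\<bar> * (\<bar>cr \<rho> x\<bar> * \<bar>cos (\<rho> * t)\<bar>) \<le> \<bar>wt n - pi / 2\<bar> * (KC * 1)"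
    using e4 cr_bound[OF x] KC_pos by (intro mult_mono) auto
  then have x5: "\<bar>e4 * (cr \<rho> x * cos (\<rho> * t))\<bar> \<le> KC * \<bar>wt n - pi / 2\<bar>" by (simp add: abs_mult mult.commute)
  define Y where "Y = e1 * cos (real n * t) + e3 * \<delta> * t * sin (real n * t) + cr \<rho> x * e2"
  have "\<bar>Y\<bar> \<le> K1 / (real n)\<^sup>2 + KE * KZ * pi / (real n)\<^sup>2 + KC * (pi\<^sup>2 * KZ\<^sup>2) / (real n)\<^sup>2"
    unfolding Y_def using x2 x3 x4 by linarith
  also have "\<dots> = K2 / (real n)\<^sup>2" by (simp add: K2_def add_divide_distrib)
  finally have Y: "\<bar>Y\<bar> \<le> K2 / (real n)\<^sup>2" .
  have "\<bar>(2 / pi) * Y\<bar> \<le> 1 * \<bar>Y\<bar>" unfolding abs_mult using pi2 by (intro mult_right_mono) auto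
  then have "\<bar>X\<bar> \<le> bnd n"
    unfolding X_def Y_def[symmetric] bnd_def using x1 x5 Y by linarith
  then show ?thesis
    unfolding G_term_real[OF n x] norm_of_real main[unfolded \<rho>_def] by simp
qed

lemma summable_bnd: "summable bnd"
proof -
  have s2: "summable (\<lambda>n. a / (real n)\<^sup>2)" for a :: real
    using summable_mult[OF inverse_power_summable[of 2, where 'a=real], of a] by (simp add: divide_inverse)
  have "summable (\<lambda>n. \<bar>kk n\<bar> / real n)"
  proof (rule summable_comparison_test_ev)
    show "summable (\<lambda>n. \<bar>Jf (real n)\<bar> / real n + KA / (real n)\<^sup>2)"
      by (intro summable_add summable_div_nat summable_Jf s2)
    show "\<forall>\<^sub>F n in sequentially. norm (\<bar>kk n\<bar> / real n) \<le> \<bar>Jf (real n)\<bar> / real n + KA / (real n)\<^sup>2"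
    proof (rule eventually_sequentiallyI[of N0])
      fix n assume "N0 \<le> n"
      then have "\<bar>kk n\<bar> / real n \<le> (\<bar>Jf (real n)\<bar> + KA / real n) / real n"
        by (intro divide_right_mono kk_bound) auto
      then show "norm (\<bar>kk n\<bar> / real n) \<le> \<bar>Jf (real n)\<bar> / real n + KA / (real n)\<^sup>2"
        by (simp add: add_divide_distrib power2_eq_square)
    qed
  qed
  moreover have "summable (\<lambda>n. \<bar>wt n - pi / 2\<bar>)"
  proof (rule summable_comparison_test_ev)
    show "summable (\<lambda>n. \<bar>Af (real n)\<bar> / real n + KB / (real n)\<^sup>2)"
      by (intro summable_add summable_div_nat summable_Af s2)
    show "\<forall>\<^sub>F n in sequentially. norm \<bar>wt n - pi / 2\<bar> \<le> \<bar>Af (real n)\<bar> / real n + KB / (real n)\<^sup>2"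
    proof (rule eventually_sequentiallyI[of N0])
      fix n assume "N0 \<le> n"
      from wt_bound[OF this]
      show "norm \<bar>wt n - pi / 2\<bar> \<le> \<bar>Af (real n)\<bar> / real n + KB / (real n)\<^sup>2"
        by (simp add: add_divide_distrib power2_eq_square)
    qed
  qed
  ultimately show ?thesis
    unfolding bnd_def[abs_def] by (intro summable_add summable_mult s2)
qed

lemma H_term_swap: "H_term c lam w n x t = - G_term c lam w n t x"
  unfolding H_term_def G_term_def corr_term_def by (simp add: algebra_simps)

lemma alpha0_cos_norm: "alpha0 n = of_real (cos_norm n)"
  by (simp add: alpha0_def cos_norm_def)

abbreviation square :: "(real \<times> real) set" where "square \<equiv> {0..pi} \<times> {0..pi}"

lemma G_term_cont: "continuous_on square (\<lambda>(x, t). G_term c lam w n x t)"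
proof -
  have cc: "continuous_on square (\<lambda>z. c \<rho> (fst z))" for \<rho>
    by (rule continuous_on_compose2[OF c_cont]) (auto intro!: continuous_intros)
  show ?thesis
    unfolding G_term_def corr_term_def alpha_wt alpha0_cos_norm divide_inverse case_prod_beta
    by (intro continuous_intros cc)
qed

lemma G_series_uniform:
  "uniform_limit square (\<lambda>N (x, t). \<Sum>n<N. G_term c lam w0 n x t) (\<lambda>(x, t). \<Sum>n. G_term c lam w0 n x t) sequentially"
proof -
  have "uniform_limit square (\<lambda>N z. \<Sum>n<N. G_term c lam w0 n (fst z) (snd z)) (\<lambda>z. \<Sum>n. G_term c lam w0 n (fst z) (snd z)) sequentially"
  proof (rule Weierstrass_m_test_ev[OF _ summable_bnd])
    show "\<forall>\<^sub>F n in sequentially. \<forall>z\<in>square. norm (G_term c lam w0 n (fst z) (snd z)) \<le> bnd n"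
      by (rule eventually_sequentiallyI[of N0]) (auto intro: G_term_bound)
  qed
  then show ?thesis by (simp only: case_prod_unfold)
qed

lemma G_series_summable:
  assumes "x \<in> {0..pi}" "t \<in> {0..pi}"
  shows "summable (\<lambda>n. norm (G_term c lam w0 n x t))"
  by (rule summable_comparison_test_ev[OF _ summable_bnd])
     (rule eventually_sequentiallyI[of N0], use assms G_term_bound in auto)

text \<open>The estimates hold on the whole square, which contains the triangle and its reflection,
  so one majorant serves both series.\<close>

lemma converges_G: "converges_unif_abs_on kernel_dom (G_term c lam w0)"
  and converges_H: "converges_unif_abs_on kernel_dom (H_term c lam w0)"
proof -
  define S where "S = (\<lambda>x t. \<Sum>n. G_term c lam w0 (Suc n) x t)"
  have s1: "summable (\<lambda>n. norm (G_term c lam w0 (Suc n) x t))" if "x \<in> {0..pi}" "t \<in> {0..pi}" for x t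
    using G_series_summable[OF that] by (subst summable_Suc_iff)
  have u1: "uniform_limit square (\<lambda>N (x, t). \<Sum>n=1..N. G_term c lam w0 n x t) (\<lambda>(x, t). S x t) sequentially"
  proof -
    have "uniform_limit square (\<lambda>N z. \<Sum>n<N. G_term c lam w0 (Suc n) (fst z) (snd z)) (\<lambda>z. \<Sum>n. G_term c lam w0 (Suc n) (fst z) (snd z)) sequentially"
    proof (rule Weierstrass_m_test_ev)
      show "summable (\<lambda>n. bnd (Suc n))" using summable_bnd by (subst summable_Suc_iff)
      show "\<forall>\<^sub>F n in sequentially. \<forall>z\<in>square. norm (G_term c lam w0 (Suc n) (fst z) (snd z)) \<le> bnd (Suc n)"
        by (rule eventually_sequentiallyI[of N0]) (auto intro!: G_term_bound)
    qed
    then show ?thesis by (simp only: case_prod_unfold S_def One_nat_def sum.atLeast1_atMost_eq)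
  qed
  have sub: "kernel_dom \<subseteq> square" "prod.swap ` kernel_dom \<subseteq> square" by (auto simp: kernel_dom_def)
  show "converges_unif_abs_on kernel_dom (G_term c lam w0)"
    unfolding converges_unif_abs_on_def
    using s1 uniform_limit_on_subset[OF u1 sub(1)] sub(1) by (auto simp: S_def)
  have "uniform_limit kernel_dom (\<lambda>N z. (case prod.swap z of (x, t) \<Rightarrow> \<Sum>n=1..N. G_term c lam w0 n x t)) (\<lambda>z. case prod.swap z of (x, t) \<Rightarrow> S x t) sequentially"
    using u1 sub(2) unfolding uniform_limit_iff by (fastforce elim!: eventually_mono simp: image_subset_iff)
  then have "uniform_limit kernel_dom (\<lambda>N z. - (case prod.swap z of (x, t) \<Rightarrow> \<Sum>n=1..N. G_term c lam w0 n x t)) (\<lambda>z. - (case prod.swap z of (x, t) \<Rightarrow> S x t)) sequentially"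
    by (rule uniform_limit_uminus)
  then have u2: "uniform_limit kernel_dom (\<lambda>N (x, t). \<Sum>n=1..N. H_term c lam w0 n x t) (\<lambda>(x, t). - S t x) sequentially"
    by (simp add: H_term_swap sum_negf case_prod_unfold)
  have "(\<Sum>n. H_term c lam w0 (Suc n) x t) = - S t x" if "(x, t) \<in> kernel_dom" for x t
    unfolding H_term_swap S_def
    by (rule suminf_minus[OF summable_norm_cancel[OF s1]]) (use that in \<open>auto simp: kernel_dom_def\<close>)
  then have u3: "uniform_limit kernel_dom (\<lambda>N (x, t). \<Sum>n=1..N. H_term c lam w0 n x t) (\<lambda>(x, t). \<Sum>n. H_term c lam w0 (Suc n) x t) sequentially"
    by (intro uniform_limit_cong'[THEN iffD1, OF _ _ u2]) auto
  show "converges_unif_abs_on kernel_dom (H_term c lam w0)"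
    unfolding converges_unif_abs_on_def
    using u3 s1 by (auto simp: H_term_swap kernel_dom_def)
qed

end

section \<open>The cosine coefficients of the correction terms\<close>

text \<open>Fubini's theorem for the integrand extended by 0 to the plane; continuity on the compact
  triangle makes it integrable.\<close>

lemma integral_triangle_swap:
  fixes F :: "real \<Rightarrow> real \<Rightarrow> complex"
  assumes F: "continuous_on kernel_dom (\<lambda>(t, x). F t x)"
  shows "integral {0..pi} (\<lambda>t. integral {0..t} (F t)) = integral {0..pi} (\<lambda>x. integral {x..pi} (\<lambda>t. F t x))"
proof -
  have lint: "(LINT y|lborel. indicator S y *\<^sub>R f y) = integral S f"
    if "compact S" "continuous_on S f" for S and f :: "real \<Rightarrow> complex"
  proof -
    have "set_integrable lborel S f"
      unfolding set_integrable_def by (rule borel_integrable_compact[OF that])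
    from set_borel_integral_eq_integral(2)[OF this] show ?thesis by (simp add: set_lebesgue_integral_def)
  qed
  define g where "g = (\<lambda>t x. indicator kernel_dom (t, x) *\<^sub>R F t x)"
  have "integrable lborel (\<lambda>z. indicator kernel_dom z *\<^sub>R (case z of (t, x) \<Rightarrow> F t x))"
    by (rule borel_integrable_compact[OF compact_kernel_dom F])
  moreover have "(\<lambda>z. indicator kernel_dom z *\<^sub>R (case z of (t, x) \<Rightarrow> F t x)) = case_prod g"
    by (auto simp: g_def fun_eq_iff)
  ultimately have "integrable (lborel \<Otimes>\<^sub>M lborel) (case_prod g)" by (simp add: lborel_prod)
  then have fub: "(LINT x|lborel. (LINT t|lborel. g t x)) = (LINT t|lborel. (LINT x|lborel. g t x))"
    by (rule lborel_pair.Fubini_integral)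
  have rowc: "continuous_on {0..t} (F t)" if "t \<in> {0..pi}" for t
    by (rule continuous_on_kernel_slice[OF F that])
  have colc: "continuous_on {x..pi} (\<lambda>t. F t x)" if "x \<in> {0..pi}" for x
  proof -
    have "continuous_on {x..pi} (\<lambda>t. case (t, x) of (t, x) \<Rightarrow> F t x)"
      by (rule continuous_on_compose2[OF F]) (use that in \<open>auto intro!: continuous_intros simp: kernel_dom_def\<close>)
    then show ?thesis by simp
  qed
  have inner1: "(LINT x|lborel. g t x) = indicator {0..pi} t *\<^sub>R integral {0..t} (F t)" for t
  proof (cases "t \<in> {0..pi}")
    case True
    then have "(\<lambda>x. g t x) = (\<lambda>x. indicator {0..t} x *\<^sub>R F t x)"
      by (auto simp: g_def fun_eq_iff kernel_dom_def indicator_def)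
    then show ?thesis using True lint[OF compact_Icc rowc[OF True]] by simp
  next
    case False
    then have "(\<lambda>x. g t x) = (\<lambda>x. 0)" by (auto simp: g_def fun_eq_iff kernel_dom_def indicator_def)
    then show ?thesis using False by simp
  qed
  have inner2: "(LINT t|lborel. g t x) = indicator {0..pi} x *\<^sub>R integral {x..pi} (\<lambda>t. F t x)" for x
  proof (cases "x \<in> {0..pi}")
    case True
    then have "(\<lambda>t. g t x) = (\<lambda>t. indicator {x..pi} t *\<^sub>R F t x)"
      by (auto simp: g_def fun_eq_iff kernel_dom_def indicator_def)
    then show ?thesis using True lint[OF compact_Icc colc[OF True]] by simp
  next
    case False
    then have "(\<lambda>t. g t x) = (\<lambda>x. 0)" by (auto simp: g_def fun_eq_iff kernel_dom_def indicator_def)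
    then show ?thesis using False by simp
  qed
  have oc1: "continuous_on {0..pi} (\<lambda>t. integral {0..t} (F t))"
    by (rule continuous_on_integral_variable_bounds)
       (use F in \<open>auto elim!: continuous_on_subset simp: kernel_dom_def intro!: continuous_intros\<close>)
  have oc2: "continuous_on {0..pi} (\<lambda>x. integral {x..pi} (\<lambda>t. F t x))"
  proof (rule continuous_on_integral_variable_bounds)
    have "continuous_on {(x, t). x \<in> {0..pi} \<and> x \<le> t \<and> t \<le> pi} (\<lambda>z. case (snd z, fst z) of (t, x) \<Rightarrow> F t x)"
      by (rule continuous_on_compose2[OF F]) (auto intro!: continuous_intros simp: kernel_dom_def)
    then show "continuous_on {(x, t). x \<in> {0..pi} \<and> x \<le> t \<and> t \<le> pi} (\<lambda>(x, t). F t x)"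
      by (simp add: case_prod_unfold)
  qed (auto intro!: continuous_intros)
  show ?thesis
    using fub unfolding inner1 inner2 lint[OF compact_Icc oc1] lint[OF compact_Icc oc2] by simp
qed

definition xsc :: "nat \<Rightarrow> nat \<Rightarrow> real" where
  "xsc n k = integral {0..pi} (\<lambda>x. x * sin (real n * x) * cos (real k * x))"

lemma has_integral_xsc: "((\<lambda>x. x * sin (real n * x) * cos (real k * x)) has_integral xsc n k) {0..pi}"
  unfolding xsc_def by (intro integrable_integral integrable_continuous_real continuous_intros)

text \<open>One integration by parts with \<open>sin (n * x)\<close>; the constant depends on
  \<open>k\<close>, which stays fixed while \<open>n\<close> is summed.\<close>

lemma xsc_bound:
  assumes n: "n > 0"
  shows "\<bar>xsc n k\<bar> \<le> (2 * pi + pi * (real k * pi)) / real n"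
proof -
  have "((\<lambda>t. t * sin (real n * t) * cos (real k * t) - cos (real n * t) / real n * (cos (real k * t) - t * (real k * sin (real k * t))))
     has_integral (- cos (real n * pi) / real n * (pi * cos (real k * pi)) - (- cos (real n * 0) / real n * (0 * cos (real k * 0))))) {0..pi}"
    by (rule fundamental_theorem_of_calculus)
       (use n in \<open>auto intro!: derivative_eq_intros simp: field_simps simp flip: has_real_derivative_iff_has_vector_derivative\<close>)
  from has_integral_diff[OF has_integral_xsc[of n k] this]
  have I: "((\<lambda>t. cos (real n * t) / real n * (cos (real k * t) - t * (real k * sin (real k * t)))) has_integral
      (xsc n k + cos (real n * pi) / real n * (pi * cos (real k * pi)))) {0..pi}" by simp
  have "norm (xsc n k + cos (real n * pi) / real n * (pi * cos (real k * pi))) \<le> (1 / real n * (1 + pi * (real k * 1))) * measure lborel {0..pi}"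
  proof (rule has_integral_bound_real[OF _ finite.emptyI I])
    fix t assume "t \<in> {0..pi} - {}"
    then have t: "t \<in> {0..pi}" by simp
    have "\<bar>t * (real k * sin (real k * t))\<bar> \<le> pi * (real k * 1)"
      unfolding abs_mult using t by (intro mult_mono) auto
    moreover have "\<bar>cos (real k * t)\<bar> \<le> 1" by simp
    ultimately have b: "\<bar>cos (real k * t) - t * (real k * sin (real k * t))\<bar> \<le> 1 + pi * (real k * 1)" by linarith
    show "norm (cos (real n * t) / real n * (cos (real k * t) - t * (real k * sin (real k * t)))) \<le> 1 / real n * (1 + pi * (real k * 1))"
    proof -
      have "\<bar>cos (real n * t) / real n\<bar> \<le> 1 / real n"
        unfolding abs_divide abs_of_nat by (rule divide_right_mono) auto
      then show ?thesis
        unfolding real_norm_def abs_mult using b by (intro mult_mono) auto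
    qed
  qed simp
  then have 1: "\<bar>xsc n k + cos (real n * pi) / real n * (pi * cos (real k * pi))\<bar> \<le> (1 / real n * (1 + pi * (real k * 1))) * pi"
    by simp
  have 2: "\<bar>cos (real n * pi) / real n * (pi * cos (real k * pi))\<bar> \<le> (1 / real n) * (pi * 1)"
    unfolding abs_mult abs_divide using n by (intro mult_mono divide_right_mono) auto
  have "\<bar>xsc n k\<bar> \<le> \<bar>xsc n k + cos (real n * pi) / real n * (pi * cos (real k * pi))\<bar> + \<bar>cos (real n * pi) / real n * (pi * cos (real k * pi))\<bar>"
    using abs_triangle_ineq4[of "xsc n k + cos (real n * pi) / real n * (pi * cos (real k * pi))" "cos (real n * pi) / real n * (pi * cos (real k * pi))"] by simp
  also have "\<dots> \<le> (1 / real n * (1 + pi * (real k * 1))) * pi + (1 / real n) * (pi * 1)"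
    by (rule add_mono[OF 1 2])
  also have "\<dots> = (2 * pi + pi * (real k * pi)) / real n"
    using n by (simp add: field_simps)
  finally show ?thesis .
qed

lemma xsc_0: "k > 0 \<Longrightarrow> xsc k 0 = - pi * (- 1) ^ k / real k"
proof -
  assume k: "k > 0"
  have "((\<lambda>x. x * sin (real k * x) * cos (real 0 * x)) has_integral
      ((- pi * cos (real k * pi) / real k + sin (real k * pi) / (real k)\<^sup>2) - (- 0 * cos (real k * 0) / real k + sin (real k * 0) / (real k)\<^sup>2))) {0..pi}"
    by (rule fundamental_theorem_of_calculus)
       (use k in \<open>auto intro!: derivative_eq_intros simp: field_simps power2_eq_square simp flip: has_real_derivative_iff_has_vector_derivative\<close>)
  from has_integral_unique[OF has_integral_xsc this] show ?thesis by (simp add: cos_npi sin_npi)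
qed

text \<open>Integrates the derivative of \<open>x * sin (j * x) * sin (k * x) / (j * k)\<close>, a
  function that vanishes at both ends.\<close>

lemma xsc_sum:
  assumes "j > 0" "k > 0"
  shows "xsc k j / real k + xsc j k / real j = - (if j = k then pi / 2 else 0) / (real j * real k)"
proof -
  have "((\<lambda>x. x * sin (real k * x) * cos (real j * x) / real k + x * sin (real j * x) * cos (real k * x) / real j
        + sin (real j * x) * sin (real k * x) / (real j * real k))
     has_integral (pi * (sin (real j * pi) * sin (real k * pi)) / (real j * real k) - 0 * (sin (real j * 0) * sin (real k * 0)) / (real j * real k))) {0..pi}"
    by (rule fundamental_theorem_of_calculus)
       (use assms in \<open>auto intro!: derivative_eq_intros simp: field_simps simp flip: has_real_derivative_iff_has_vector_derivative\<close>)
  then have "((\<lambda>x. x * sin (real k * x) * cos (real j * x) / real k + x * sin (real j * x) * cos (real k * x) / real j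
        + sin (real j * x) * sin (real k * x) / (real j * real k)) has_integral 0) {0..pi}"
    by (simp add: sin_npi)
  moreover have "((\<lambda>x. x * sin (real k * x) * cos (real j * x) / real k + x * sin (real j * x) * cos (real k * x) / real j
        + sin (real j * x) * sin (real k * x) / (real j * real k)) has_integral
     (xsc k j / real k + xsc j k / real j + (if j = k \<and> j \<noteq> 0 then pi / 2 else 0) / (real j * real k))) {0..pi}"
    by (intro has_integral_add has_integral_divide has_integral_xsc has_integral_sin_sin)
  ultimately have "0 = xsc k j / real k + xsc j k / real j + (if j = k \<and> j \<noteq> 0 then pi / 2 else 0) / (real j * real k)"
    by (rule has_integral_unique)
  then show ?thesis using assms by auto
qed

lemma has_integral_x2_cos:
  assumes j: "j > 0"
  shows "((\<lambda>x. x\<^sup>2 * cos (real j * x)) has_integral (2 * pi * (- 1) ^ j / (real j)\<^sup>2)) {0..pi}"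
proof -
  have "((\<lambda>x. x\<^sup>2 * cos (real j * x)) has_integral
     ((pi\<^sup>2 * sin (real j * pi) / real j + 2 * pi * cos (real j * pi) / (real j)\<^sup>2 - 2 * sin (real j * pi) / (real j) ^ 3)
     - (0\<^sup>2 * sin (real j * 0) / real j + 2 * 0 * cos (real j * 0) / (real j)\<^sup>2 - 2 * sin (real j * 0) / (real j) ^ 3))) {0..pi}"
    by (rule fundamental_theorem_of_calculus)
       (use j in \<open>auto intro!: derivative_eq_intros simp: field_simps power2_eq_square power3_eq_cube simp flip: has_real_derivative_iff_has_vector_derivative\<close>)
  then show ?thesis by (simp add: cos_npi sin_npi)
qed

text \<open>The sum of the correction terms without the factor \<open>w / pi\<^sup>2\<close>, valid
  away from the corner \<open>(pi, pi)\<close>. It comes from the sawtooth series of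
  \<open>sin (n * y) / n\<close> at \<open>y = x + t\<close> and \<open>y = x - t\<close>; the
  second one produces the maximum.\<close>

definition corr_sum :: "real \<Rightarrow> real \<Rightarrow> real" where
  "corr_sum x t = pi * max x t - x\<^sup>2 - t\<^sup>2"

text \<open>The \<open>k\<close>-th cosine integral of \<open>corr_sum x\<close>, see
  \<open>has_integral_corr_sum_cos\<close>.\<close>

definition corr_coef :: "nat \<Rightarrow> real \<Rightarrow> real" where
  "corr_coef k x = (if k = 0 then pi ^ 3 / 6 - pi * x\<^sup>2 / 2 else - pi * ((- 1) ^ k + cos (real k * x)) / (real k)\<^sup>2)"

lemma has_integral_corr_sum_cos:
  assumes x: "x \<in> {0..pi}"
  shows "((\<lambda>t. corr_sum x t * cos (real k * t)) has_integral corr_coef k x) {0..pi}"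
proof (cases "k = 0")
  case True
  have 1: "((\<lambda>t. corr_sum x t) has_integral ((pi * x * x - x\<^sup>2 * x - x ^ 3 / 3) - (pi * x * 0 - x\<^sup>2 * 0 - 0 ^ 3 / 3))) {0..x}"
  proof (rule has_integral_eq[rotated])
    show "((\<lambda>t. pi * x - x\<^sup>2 - t\<^sup>2) has_integral ((pi * x * x - x\<^sup>2 * x - x ^ 3 / 3) - (pi * x * 0 - x\<^sup>2 * 0 - 0 ^ 3 / 3))) {0..x}"
      by (rule fundamental_theorem_of_calculus)
         (use x in \<open>auto intro!: derivative_eq_intros simp: power2_eq_square simp flip: has_real_derivative_iff_has_vector_derivative\<close>)
  qed (auto simp: corr_sum_def)
  have 2: "((\<lambda>t. corr_sum x t) has_integral ((pi * (pi\<^sup>2 / 2) - x\<^sup>2 * pi - pi ^ 3 / 3) - (pi * (x\<^sup>2 / 2) - x\<^sup>2 * x - x ^ 3 / 3))) {x..pi}"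
  proof (rule has_integral_eq[rotated])
    show "((\<lambda>t. pi * t - x\<^sup>2 - t\<^sup>2) has_integral ((pi * (pi\<^sup>2 / 2) - x\<^sup>2 * pi - pi ^ 3 / 3) - (pi * (x\<^sup>2 / 2) - x\<^sup>2 * x - x ^ 3 / 3))) {x..pi}"
      by (rule fundamental_theorem_of_calculus)
         (use x in \<open>auto intro!: derivative_eq_intros simp: power2_eq_square simp flip: has_real_derivative_iff_has_vector_derivative\<close>)
  qed (auto simp: corr_sum_def)
  have "((\<lambda>t. corr_sum x t) has_integral (((pi * x * x - x\<^sup>2 * x - x ^ 3 / 3) - (pi * x * 0 - x\<^sup>2 * 0 - 0 ^ 3 / 3))
     + ((pi * (pi\<^sup>2 / 2) - x\<^sup>2 * pi - pi ^ 3 / 3) - (pi * (x\<^sup>2 / 2) - x\<^sup>2 * x - x ^ 3 / 3)))) {0..pi}"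
    by (rule has_integral_combine[OF _ _ 1 2]) (use x in auto)
  moreover have "((pi * x * x - x\<^sup>2 * x - x ^ 3 / 3) - (pi * x * 0 - x\<^sup>2 * 0 - 0 ^ 3 / 3))
     + ((pi * (pi\<^sup>2 / 2) - x\<^sup>2 * pi - pi ^ 3 / 3) - (pi * (x\<^sup>2 / 2) - x\<^sup>2 * x - x ^ 3 / 3)) = corr_coef k x"
    using True by (simp add: corr_coef_def field_simps power2_eq_square power3_eq_cube)
  ultimately show ?thesis using True by simp
next
  case False
  define K where "K = real k"
  have K: "K \<noteq> 0" "K > 0" using False by (auto simp: K_def)
  have ck: "cos (K * pi) = (- 1) ^ k" "sin (K * pi) = 0" by (auto simp: K_def cos_npi sin_npi)
  define P where "P = (\<lambda>t. t * sin (K * t) / K + cos (K * t) / K\<^sup>2)"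
  have P: "((\<lambda>t. t * cos (K * t)) has_integral (P b - P a)) {a..b}" if "a \<le> b" for a b
    unfolding P_def
    by (rule fundamental_theorem_of_calculus[OF that])
       (use K in \<open>auto intro!: derivative_eq_intros simp: field_simps power2_eq_square simp flip: has_real_derivative_iff_has_vector_derivative\<close>)
  have C: "((\<lambda>t. cos (K * t)) has_integral sin (K * b) / K) {0..b}" if "0 \<le> b" for b
    by (rule has_integral_cos_scaled[OF K(1) that])
  have 1: "((\<lambda>t. max x t * cos (K * t)) has_integral (x * (sin (K * x) / K))) {0..x}"
    by (rule has_integral_eq[OF _ has_integral_mult_right[OF C]]) (use x in auto)
  have 2: "((\<lambda>t. max x t * cos (K * t)) has_integral (P pi - P x)) {x..pi}"
    by (rule has_integral_eq[OF _ P]) (use x in auto)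
  have m: "((\<lambda>t. max x t * cos (K * t)) has_integral (x * (sin (K * x) / K) + (P pi - P x))) {0..pi}"
    by (rule has_integral_combine[OF _ _ 1 2]) (use x in auto)
  have x2: "((\<lambda>t. t\<^sup>2 * cos (K * t)) has_integral (2 * pi * (- 1) ^ k / K\<^sup>2)) {0..pi}"
    unfolding K_def using has_integral_x2_cos[of k] False by simp
  have "((\<lambda>t. pi * (max x t * cos (K * t)) - x\<^sup>2 * cos (K * t) - t\<^sup>2 * cos (K * t)) has_integral
     (pi * (x * (sin (K * x) / K) + (P pi - P x)) - x\<^sup>2 * (sin (K * pi) / K) - 2 * pi * (- 1) ^ k / K\<^sup>2)) {0..pi}"
    by (intro has_integral_diff has_integral_mult_right m x2 C) simp
  moreover have "pi * (x * (sin (K * x) / K) + (P pi - P x)) - x\<^sup>2 * (sin (K * pi) / K) - 2 * pi * (- 1) ^ k / K\<^sup>2 = corr_coef k x"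
    using False K unfolding P_def corr_coef_def ck K_def[symmetric] by (simp add: field_simps)
  moreover have "pi * (max x t * cos (K * t)) - x\<^sup>2 * cos (K * t) - t\<^sup>2 * cos (K * t) = corr_sum x t * cos (real k * t)" for t
    by (simp add: corr_sum_def K_def algebra_simps)
  ultimately show ?thesis by simp
qed

text \<open>Because division by \<open>real 0\<close> gives 0, one formula covers
  \<open>j = 0\<close> and \<open>k = 0\<close> too; otherwise it is \<open>xsc_sum\<close>. The
  right-hand side has the shape that termwise integration gives in
  \<open>corr_int_sums_uniform\<close>.\<close>

lemma has_integral_corr_coef_cos:
  "((\<lambda>x. corr_coef k x * cos (real j * x)) has_integral (pi * (xsc k j / real k + xsc j k / real j))) {0..pi}"
proof (cases "k = 0")
  case True
  show ?thesis
  proof (cases "j = 0")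
    case j: True
    have "((\<lambda>x. pi ^ 3 / 6 - pi * x\<^sup>2 / 2) has_integral ((pi ^ 3 / 6 * pi - pi * pi ^ 3 / 6) - (pi ^ 3 / 6 * 0 - pi * 0 ^ 3 / 6))) {0..pi}"
      by (rule fundamental_theorem_of_calculus)
         (auto intro!: derivative_eq_intros simp: power2_eq_square simp flip: has_real_derivative_iff_has_vector_derivative)
    then show ?thesis using True j by (simp add: corr_coef_def power3_eq_cube)
  next
    case j: False
    have "((\<lambda>x. pi ^ 3 / 6 * cos (real j * x) - pi / 2 * (x\<^sup>2 * cos (real j * x))) has_integral
       (pi ^ 3 / 6 * 0 - pi / 2 * (2 * pi * (- 1) ^ j / (real j)\<^sup>2))) {0..pi}"
      using has_integral_cos_nat[of j] j
      by (intro has_integral_diff has_integral_mult_right has_integral_x2_cos) auto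
    moreover have "pi ^ 3 / 6 * cos (real j * x) - pi / 2 * (x\<^sup>2 * cos (real j * x)) = corr_coef k x * cos (real j * x)" for x
      using True by (simp add: corr_coef_def algebra_simps)
    moreover have "pi ^ 3 / 6 * 0 - pi / 2 * (2 * pi * (- 1) ^ j / (real j)\<^sup>2) = pi * (xsc k j / real k + xsc j k / real j)"
      using True j by (simp add: xsc_0 power2_eq_square)
    ultimately show ?thesis by simp
  qed
next
  case k: False
  have "((\<lambda>x. - pi * (- 1) ^ k / (real k)\<^sup>2 * cos (real j * x) + - pi / (real k)\<^sup>2 * (cos (real k * x) * cos (real j * x))) has_integral
      (- pi * (- 1) ^ k / (real k)\<^sup>2 * (if j = 0 then pi else 0) + - pi / (real k)\<^sup>2 * (if k = j then if k = 0 then pi else pi / 2 else 0))) {0..pi}"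
    by (intro has_integral_add has_integral_mult_right has_integral_cos_nat has_integral_cos_cos)
  moreover have "- pi * (- 1) ^ k / (real k)\<^sup>2 * cos (real j * x) + - pi / (real k)\<^sup>2 * (cos (real k * x) * cos (real j * x)) = corr_coef k x * cos (real j * x)" for x
    using k by (simp add: corr_coef_def field_simps)
  moreover have "- pi * (- 1) ^ k / (real k)\<^sup>2 * (if j = 0 then pi else 0) + - pi / (real k)\<^sup>2 * (if k = j then if k = 0 then pi else pi / 2 else 0)
     = pi * (xsc k j / real k + xsc j k / real j)"
  proof (cases "j = 0")
    case True then show ?thesis using k by (simp add: xsc_0 power2_eq_square)
  next
    case False then show ?thesis using k xsc_sum[of j k] by (simp add: power2_eq_square)
  qed
  ultimately show ?thesis by simp
qed

text \<open>As \<open>ip\<close> carries no conjugation, \<open>v\<close> is paired with its own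
  conjugate, a uniform limit of cosine sums.\<close>

lemma cos_complete:
  assumes v: "continuous_on {0..pi} v" and o: "\<And>k. ip v (cosn k) = 0" and x: "x \<in> {0..pi}"
  shows "v x = 0"
proof -
  have "ip v (\<lambda>x. cnj (v x)) = 0"
    by (rule dense_span_complete[OF dense_span_cosn continuous_on_cosn absolutely_integrable_continuous_real[OF v] o])
       (intro continuous_intros v)
  then have "integral {0..pi} (\<lambda>x. complex_of_real ((norm (v x))\<^sup>2)) = 0"
    unfolding ip_def complex_norm_square .
  moreover have "((\<lambda>x. complex_of_real ((norm (v x))\<^sup>2)) has_integral of_real (sqnorm v)) {0..pi}"
    unfolding sqnorm_def by (intro has_integral_of_real integrable_integral integrable_continuous_real continuous_intros v)
  ultimately have "complex_of_real (sqnorm v) = 0" by (simp add: integral_unique)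
  then have "sqnorm v = 0" by simp
  then show ?thesis using sqnorm_eq_0_imp[OF v _ x] by simp
qed

text \<open>The \<open>k\<close>-th cosine integral in \<open>t\<close> of
  \<open>corr_term w n x\<close>; for \<open>n > k\<close> only the part with \<open>xsc n k\<close>
  remains.\<close>

definition corr_int :: "real \<Rightarrow> nat \<Rightarrow> nat \<Rightarrow> real \<Rightarrow> real" where
  "corr_int w k n x = 2 * w / (pi\<^sup>2 * real n) * (x * sin (real n * x) * (if n = k then cos_norm k else 0) + cos (real n * x) * xsc n k)"

lemma has_integral_corr_term_cos:
  "((\<lambda>t. corr_term w n x t * cos (real k * t)) has_integral corr_int w k n x) {0..pi}"
proof -
  have cc: "((\<lambda>x. cos (real n * x) * cos (real k * x)) has_integral (if n = k then cos_norm k else 0)) {0..pi}"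
    using has_integral_cos_cos[of n k] by (auto simp: cos_norm_def)
  have "((\<lambda>t. 2 * w / (pi\<^sup>2 * real n) * ((x * sin (real n * x)) * (cos (real n * t) * cos (real k * t)) + cos (real n * x) * (t * sin (real n * t) * cos (real k * t))))
     has_integral corr_int w k n x) {0..pi}"
    unfolding corr_int_def by (intro has_integral_mult_right has_integral_add cc has_integral_xsc)
  moreover have "2 * w / (pi\<^sup>2 * real n) * ((x * sin (real n * x)) * (cos (real n * t) * cos (real k * t)) + cos (real n * x) * (t * sin (real n * t) * cos (real k * t)))
     = corr_term w n x t * cos (real k * t)" for t
    by (simp add: corr_term_def algebra_simps)
  ultimately show ?thesis by simp
qed

lemma has_integral_corr_int_cos:
  "((\<lambda>x. corr_int w k n x * cos (real j * x)) has_integral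
     (2 * w / (pi\<^sup>2 * real n) * (xsc n j * (if n = k then cos_norm k else 0) + (if n = j then cos_norm j else 0) * xsc n k))) {0..pi}"
proof -
  have cc: "((\<lambda>x. cos (real n * x) * cos (real j * x)) has_integral (if n = j then cos_norm j else 0)) {0..pi}"
    using has_integral_cos_cos[of n j] by (auto simp: cos_norm_def)
  have "((\<lambda>x. 2 * w / (pi\<^sup>2 * real n) * ((x * sin (real n * x) * cos (real j * x)) * (if n = k then cos_norm k else 0) + (cos (real n * x) * cos (real j * x)) * xsc n k))
     has_integral (2 * w / (pi\<^sup>2 * real n) * (xsc n j * (if n = k then cos_norm k else 0) + (if n = j then cos_norm j else 0) * xsc n k))) {0..pi}"
    by (intro has_integral_mult_right has_integral_mult_left has_integral_add cc has_integral_xsc)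
  moreover have "2 * w / (pi\<^sup>2 * real n) * ((x * sin (real n * x) * cos (real j * x)) * (if n = k then cos_norm k else 0) + (cos (real n * x) * cos (real j * x)) * xsc n k)
     = corr_int w k n x * cos (real j * x)" for x
    by (simp add: corr_int_def algebra_simps)
  ultimately show ?thesis by simp
qed

lemma corr_int_cont: "continuous_on S (corr_int w k n)"
  unfolding corr_int_def[abs_def] by (intro continuous_intros)

lemma corr_coef_cont: "continuous_on S (corr_coef k)"
proof (cases "k = 0")
  case True
  then have "corr_coef k = (\<lambda>x. pi ^ 3 / 6 - pi * x\<^sup>2 / 2)" by (simp add: corr_coef_def fun_eq_iff)
  then show ?thesis by (auto intro!: continuous_intros)
next
  case False
  then have "corr_coef k = (\<lambda>x. - pi * ((- 1) ^ k + cos (real k * x)) / (real k)\<^sup>2)" by (simp add: corr_coef_def fun_eq_iff)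
  then show ?thesis using False by (auto intro!: continuous_intros)
qed

lemma ip_of_real_cosn:
  assumes "((\<lambda>x. f x * cos (real j * x)) has_integral I) {0..pi}"
  shows "ip (\<lambda>x. of_real (f x)) (cosn j) = of_real I"
  unfolding ip_def cosn_eq of_real_mult[symmetric] by (rule integral_unique[OF has_integral_of_real[OF assms]])

text \<open>After integration in \<open>t\<close> the terms are \<open>O(1 / n\<^sup>2)\<close> for
  fixed \<open>k\<close>, so the sum converges uniformly in \<open>x\<close>. Its limit is
  identified through its own cosine coefficients, to which only \<open>n = j\<close> and
  \<open>n = k\<close> contribute.\<close>

lemma corr_int_sums_uniform:
  "uniform_limit {0..pi} (\<lambda>N x. \<Sum>n<N. complex_of_real (corr_int w k n x)) (\<lambda>x. of_real (w / pi\<^sup>2 * corr_coef k x)) sequentially"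
proof -
  define C where "C = 2 * pi + pi * (real k * pi)"
  have C0: "C \<ge> 0" by (simp add: C_def)
  define S where "S = (\<lambda>x. \<Sum>n. complex_of_real (corr_int w k n x))"
  have U: "uniform_limit {0..pi} (\<lambda>N x. \<Sum>n<N. complex_of_real (corr_int w k n x)) S sequentially"
    unfolding S_def
  proof (rule Weierstrass_m_test_ev)
    show "summable (\<lambda>n. 2 * \<bar>w\<bar> * C * inverse ((real n)\<^sup>2))"
      by (intro summable_mult inverse_power_summable) simp
    show "\<forall>\<^sub>F n in sequentially. \<forall>x\<in>{0..pi}. norm (complex_of_real (corr_int w k n x)) \<le> 2 * \<bar>w\<bar> * C * inverse ((real n)\<^sup>2)"
    proof (rule eventually_sequentiallyI[of "Suc k"], intro ballI)
      fix n x assume n: "Suc k \<le> n"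
      have n1: "real n \<ge> 1" using n by simp
      have "corr_int w k n x = 2 * w / (pi\<^sup>2 * real n) * (cos (real n * x) * xsc n k)"
        using n by (simp add: corr_int_def)
      also have "\<bar>\<dots>\<bar> \<le> 2 * \<bar>w\<bar> / real n * (1 * (C / real n))"
      proof -
        have "pi * pi \<ge> 1 * 1" using pi_gt3 by (intro mult_mono) auto
        then have "1 * real n \<le> pi\<^sup>2 * real n" by (intro mult_right_mono) (auto simp: power2_eq_square)
        then have "\<bar>2 * w / (pi\<^sup>2 * real n)\<bar> \<le> 2 * \<bar>w\<bar> / real n"
          using n1 by (simp add: abs_mult abs_divide) (intro divide_left_mono, auto)
        moreover have "\<bar>xsc n k\<bar> \<le> C / real n" unfolding C_def using n by (intro xsc_bound) simp
        ultimately show ?thesis unfolding abs_mult[of "2 * w / (pi\<^sup>2 * real n)"] abs_mult[of "cos (real n * x)"]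
          using C0 by (intro mult_mono) auto
      qed
      finally show "norm (complex_of_real (corr_int w k n x)) \<le> 2 * \<bar>w\<bar> * C * inverse ((real n)\<^sup>2)"
        by (simp add: power2_eq_square divide_inverse mult_ac)
    qed
  qed
  have pc: "continuous_on {0..pi} (\<lambda>x. \<Sum>n<N. complex_of_real (corr_int w k n x))" for N
    by (intro continuous_intros corr_int_cont)
  have Sc: "continuous_on {0..pi} S"
    by (rule uniform_limit_theorem[OF always_eventually U]) (use pc in auto)
  have Rc: "continuous_on {0..pi} (\<lambda>x. complex_of_real (w / pi\<^sup>2 * corr_coef k x))"
    by (intro continuous_intros corr_coef_cont)
  have ipS: "ip S (cosn j) = of_real (w / pi * (xsc k j / real k + xsc j k / real j))" for j
  proof -
    define T where "T = (\<lambda>n. 2 * w / (pi\<^sup>2 * real n) * (xsc n j * (if n = k then cos_norm k else 0) + (if n = j then cos_norm j else 0) * xsc n k))"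
    have lim: "(\<lambda>N. ip (\<lambda>x. \<Sum>n<N. complex_of_real (corr_int w k n x)) (cosn j)) \<longlonglongrightarrow> ip S (cosn j)"
      by (rule ip_uniform_limit[OF U pc continuous_on_cosn]) simp
    have ev: "\<forall>\<^sub>F N in sequentially. ip (\<lambda>x. \<Sum>n<N. complex_of_real (corr_int w k n x)) (cosn j) = of_real (w / pi * (xsc k j / real k + xsc j k / real j))"
    proof (rule eventually_sequentiallyI[of "Suc (max j k)"])
      fix N assume "Suc (max j k) \<le> N"
      then have N: "j < N" "k < N" by auto
      have "ip (\<lambda>x. \<Sum>n<N. complex_of_real (corr_int w k n x)) (cosn j) = (\<Sum>n<N. ip (\<lambda>x. complex_of_real (corr_int w k n x)) (cosn j))"
        using ip_sum_left[of "{..<N}" "\<lambda>n x. complex_of_real (corr_int w k n x)" "cosn j" "\<lambda>_. 1"]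
        by (simp add: continuous_intros corr_int_cont)
      also have "\<dots> = of_real (\<Sum>n<N. T n)"
        by (simp add: ip_of_real_cosn[OF has_integral_corr_int_cos] T_def)
      also have "(\<Sum>n<N. T n) = (\<Sum>n<N. (if n = k then 2 * w / (pi\<^sup>2 * real k) * (xsc k j * cos_norm k) else 0) + (if n = j then 2 * w / (pi\<^sup>2 * real j) * (cos_norm j * xsc j k) else 0))"
        by (rule sum.cong) (auto simp: T_def distrib_left)
      also have "\<dots> = 2 * w / (pi\<^sup>2 * real k) * (xsc k j * cos_norm k) + 2 * w / (pi\<^sup>2 * real j) * (cos_norm j * xsc j k)"
        using N by (simp add: sum.distrib)
      also have "\<dots> = w / pi * (xsc k j / real k + xsc j k / real j)"
        by (auto simp: cos_norm_def power2_eq_square field_simps)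
      finally show "ip (\<lambda>x. \<Sum>n<N. complex_of_real (corr_int w k n x)) (cosn j) = of_real (w / pi * (xsc k j / real k + xsc j k / real j))" .
    qed
    show ?thesis by (rule LIMSEQ_unique[OF lim tendsto_eventually[OF ev]])
  qed
  have ipR: "ip (\<lambda>x. of_real (w / pi\<^sup>2 * corr_coef k x)) (cosn j) = of_real (w / pi * (xsc k j / real k + xsc j k / real j))" for j
  proof (rule ip_of_real_cosn)
    have "((\<lambda>x. w / pi\<^sup>2 * (corr_coef k x * cos (real j * x))) has_integral (w / pi\<^sup>2 * (pi * (xsc k j / real k + xsc j k / real j)))) {0..pi}"
      by (intro has_integral_mult_right has_integral_corr_coef_cos)
    then show "((\<lambda>x. w / pi\<^sup>2 * corr_coef k x * cos (real j * x)) has_integral (w / pi * (xsc k j / real k + xsc j k / real j))) {0..pi}"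
      by (simp add: mult.assoc power2_eq_square)
  qed
  have SR: "S x = of_real (w / pi\<^sup>2 * corr_coef k x)" if "x \<in> {0..pi}" for x
  proof -
    have "S x - of_real (w / pi\<^sup>2 * corr_coef k x) = 0"
      by (rule cos_complete[where v="\<lambda>x. S x - of_real (w / pi\<^sup>2 * corr_coef k x)", OF _ _ that])
         (simp_all only: ip_diff_left[OF Sc Rc continuous_on_cosn] ipS ipR continuous_on_diff[OF Sc Rc] diff_self)
    then show ?thesis by simp
  qed
  show ?thesis
    by (rule uniform_limit_cong'[THEN iffD1, OF _ _ U]) (simp_all only: SR)
qed

section \<open>The representations of the kernels\<close>

context sturm_liouville
begin

text \<open>
  The series starts at \<open>n = 0\<close>: \<open>corr_term w 0\<close> is \<open>0\<close> because of the division by \<open>real 0\<close>,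
  so \<open>G_term c lam w 0\<close> is exactly the pair of terms standing outside the series in the theorem.
\<close>
definition Phi :: "real \<Rightarrow> real \<Rightarrow> complex" where
  "Phi x t = (\<Sum>n. G_term c lam w0 n x t) + of_real (w0 / pi\<^sup>2 * corr_sum x t)"

definition Gt :: "real \<Rightarrow> real \<Rightarrow> complex" where
  "Gt x t = (if t \<le> x then G x t else - Hker t x)"

lemma corr_sum_cont: "continuous_on S (\<lambda>(x, t). corr_sum x t)"
  unfolding corr_sum_def case_prod_unfold by (intro continuous_intros)

lemma Phi_cont: "continuous_on square (\<lambda>(x, t). Phi x t)"
proof -
  have "continuous_on square (\<lambda>(x, t). \<Sum>n<N. G_term c lam w0 n x t)" for N
    using G_term_cont unfolding case_prod_unfold by (intro continuous_on_sum)
  then have "continuous_on square (\<lambda>(x, t). \<Sum>n. G_term c lam w0 n x t)"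
    by (intro uniform_limit_theorem[OF always_eventually G_series_uniform]) auto
  then have "continuous_on square (\<lambda>z. (case z of (x, t) \<Rightarrow> \<Sum>n. G_term c lam w0 n x t) + complex_of_real (w0 / pi\<^sup>2 * (case z of (x, t) \<Rightarrow> corr_sum x t)))"
    by (intro continuous_intros corr_sum_cont)
  then show ?thesis by (simp add: Phi_def case_prod_unfold)
qed

lemma Phi_slice_cont:
  assumes "x \<in> {0..pi}"
  shows "continuous_on {0..pi} (Phi x)"
proof -
  have "continuous_on {0..pi} (\<lambda>t. case (x, t) of (x, t) \<Rightarrow> Phi x t)"
    by (rule continuous_on_compose2[OF Phi_cont]) (use assms in \<open>auto intro!: continuous_intros\<close>)
  then show ?thesis by simp
qed

lemma Hker_column_cont:
  assumes "x \<in> {0..pi}"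
  shows "continuous_on {x..pi} (\<lambda>t. Hker t x)"
proof -
  have "continuous_on {x..pi} (\<lambda>t. case (t, x) of (t, x) \<Rightarrow> Hker t x)"
    by (rule continuous_on_compose2[OF Hker_cont]) (use assms in \<open>auto intro!: continuous_intros simp: kernel_dom_def\<close>)
  then show ?thesis by simp
qed

definition cosr :: "nat \<Rightarrow> real \<Rightarrow> complex" where "cosr n t = cos (rho lam n * of_real t)"

lemma cosr_cont: "continuous_on S (cosr n)"
  unfolding cosr_def[abs_def] by (intro continuous_intros)

text \<open>The eigenfunction is \<open>T\<close> applied to \<open>cosr n\<close>, and the inverse
  operator undoes this.\<close>

lemma Hker_ef: "x \<in> {0..pi} \<Longrightarrow> ef n x + integral {0..x} (\<lambda>s. Hker x s * ef n s) = cosr n x"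
proof -
  assume x: "x \<in> {0..pi}"
  have a: "volterra_op Hker (volterra_op G (cosr n)) x = cosr n x" by (rule Hker_G[OF cosr_cont x])
  have b: "volterra_op Hker (volterra_op G (cosr n)) x = volterra_op Hker (ef n) x"
  proof -
    have e: "volterra_op G (cosr n) s = ef n s" if "s \<in> {0..pi}" for s
      using c_volterra[OF that, of "rho lam n"] by (simp add: ef_def cosr_def[abs_def])
    have "integral {0..x} (\<lambda>s. Hker x s * volterra_op G (cosr n) s) = integral {0..x} (\<lambda>s. Hker x s * ef n s)"
      by (rule Henstock_Kurzweil_Integration.integral_cong) (use x e in auto)
    then show ?thesis using e[OF x] by (simp add: volterra_op_def[of Hker])
  qed
  show ?thesis using trans[OF b[symmetric] a] by (simp add: volterra_op_def)
qed

definition Hcol :: "nat \<Rightarrow> real \<Rightarrow> complex" where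
  "Hcol k x = integral {x..pi} (\<lambda>t. Hker t x * cosn k t)"

lemma Hcol_cont: "continuous_on {0..pi} (Hcol k)"
  unfolding Hcol_def
proof (rule continuous_on_integral_variable_bounds)
  have "continuous_on {(x, t). x \<in> {0..pi} \<and> x \<le> t \<and> t \<le> pi} (\<lambda>z. case (snd z, fst z) of (t, x) \<Rightarrow> Hker t x)"
    by (rule continuous_on_compose2[OF Hker_cont]) (auto intro!: continuous_intros simp: kernel_dom_def)
  then have "continuous_on {(x, t). x \<in> {0..pi} \<and> x \<le> t \<and> t \<le> pi} (\<lambda>z. (case (snd z, fst z) of (t, x) \<Rightarrow> Hker t x) * cosn k (snd z))"
    by (intro continuous_intros)
  then show "continuous_on {(x, t). x \<in> {0..pi} \<and> x \<le> t \<and> t \<le> pi} (\<lambda>(x, t). Hker t x * cosn k t)"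
    by (simp add: case_prod_unfold)
qed (auto intro!: continuous_intros)

text \<open>Exchanging the integrations turns the columns of \<open>Hker\<close> into rows, to which
  \<open>Hker_ef\<close> applies. This is what makes \<open>- Hker t x\<close> the right
  continuation of \<open>G\<close> across the diagonal.\<close>

lemma ip_Hcol: "ip (Hcol k) (ef m) = ip (cosr m) (cosn k) - ip (ef m) (cosn k)"
proof -
  have F: "continuous_on kernel_dom (\<lambda>(t, x). Hker t x * cosn k t * ef m x)"
  proof -
    have "continuous_on kernel_dom (\<lambda>z. (case z of (t, x) \<Rightarrow> Hker t x) * cosn k (fst z) * ef m (snd z))"
      by (intro continuous_on_mult Hker_cont continuous_on_compose2[OF ef_cont] continuous_on_compose2[OF continuous_on_cosn[of UNIV]])
        (auto intro!: continuous_intros simp: kernel_dom_def)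
    then show ?thesis by (simp add: case_prod_unfold)
  qed
  have "ip (Hcol k) (ef m) = integral {0..pi} (\<lambda>x. integral {x..pi} (\<lambda>t. Hker t x * cosn k t * ef m x))"
    unfolding ip_def Hcol_def by simp
  also have "\<dots> = integral {0..pi} (\<lambda>t. integral {0..t} (\<lambda>x. Hker t x * cosn k t * ef m x))"
    by (rule integral_triangle_swap[OF F, symmetric])
  also have "\<dots> = ip (\<lambda>t. cosr m t - ef m t) (cosn k)"
    unfolding ip_def
  proof (rule Henstock_Kurzweil_Integration.integral_cong)
    fix t assume t: "t \<in> {0..pi}"
    have "integral {0..t} (\<lambda>x. Hker t x * cosn k t * ef m x) = integral {0..t} (\<lambda>x. cosn k t * (Hker t x * ef m x))"
      by (simp add: mult_ac)
    also have "\<dots> = cosn k t * integral {0..t} (\<lambda>x. Hker t x * ef m x)" by simp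
    also have "integral {0..t} (\<lambda>x. Hker t x * ef m x) = cosr m t - ef m t"
      using Hker_ef[OF t, of m] by (simp add: algebra_simps)
    finally show "integral {0..t} (\<lambda>x. Hker t x * cosn k t * ef m x) = (cosr m t - ef m t) * cosn k t" by (simp add: mult.commute)
  qed
  also have "\<dots> = ip (cosr m) (cosn k) - ip (ef m) (cosn k)"
    by (rule ip_diff_left[OF cosr_cont ef_cont continuous_on_cosn])
  finally show ?thesis .
qed

lemma Gt_cosn_integral:
  assumes x: "x \<in> {0..pi}"
  shows "(Gt x) absolutely_integrable_on {0..pi}"
    and "((\<lambda>t. Gt x t * cosn k t) has_integral (c (of_nat k) x - cosn k x - Hcol k x)) {0..pi}"
proof -
  have xs: "0 \<le> x" "x \<le> pi" using x by auto
  have Gs: "continuous_on {0..x} (G x)" by (rule continuous_on_kernel_slice[OF G_cont x])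
  have Hs: "continuous_on {x..pi} (\<lambda>t. Hker t x)" by (rule Hker_column_cont[OF x])
  have "Gt x absolutely_integrable_on {0..x}"
    by (rule absolutely_integrable_spike[OF absolutely_integrable_continuous_real[OF Gs] negligible_empty]) (auto simp: Gt_def)
  moreover have "Gt x absolutely_integrable_on {x..pi}"
    by (rule absolutely_integrable_spike[OF absolutely_integrable_continuous_real[OF continuous_on_minus[OF Hs]] negligible_sing[of x]])
       (auto simp: Gt_def)
  ultimately show "(Gt x) absolutely_integrable_on {0..pi}"
    by (rule absolutely_integrable_on_combine[OF _ _ xs])
  have "((\<lambda>t. G x t * cosn k t) has_integral (c (of_nat k) x - cosn k x)) {0..x}"
  proof -
    have "integral {0..x} (\<lambda>t. G x t * cosn k t) = c (of_nat k) x - cosn k x"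
      using c_volterra[OF x, of "of_nat k"] by (simp add: volterra_op_def)
    moreover have "(\<lambda>t. G x t * cosn k t) integrable_on {0..x}"
      by (intro integrable_continuous_real continuous_on_mult Gs continuous_on_cosn)
    ultimately show ?thesis by (metis integrable_integral)
  qed
  then have 1: "((\<lambda>t. Gt x t * cosn k t) has_integral (c (of_nat k) x - cosn k x)) {0..x}"
    by (rule has_integral_eq[rotated]) (auto simp: Gt_def)
  have "((\<lambda>t. Hker t x * cosn k t) has_integral Hcol k x) {x..pi}"
    unfolding Hcol_def by (intro integrable_integral integrable_continuous_real continuous_on_mult Hs continuous_on_cosn)
  then have "((\<lambda>t. - (Hker t x * cosn k t)) has_integral - Hcol k x) {x..pi}" by (rule has_integral_neg)
  then have 2: "((\<lambda>t. Gt x t * cosn k t) has_integral - Hcol k x) {x..pi}"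
    by (rule has_integral_spike[OF negligible_sing[of x], rotated]) (auto simp: Gt_def)
  show "((\<lambda>t. Gt x t * cosn k t) has_integral (c (of_nat k) x - cosn k x - Hcol k x)) {0..pi}"
    using has_integral_combine[OF xs 1 2] by simp
qed

definition Psi :: "nat \<Rightarrow> real \<Rightarrow> complex" where
  "Psi k x = integral {0..pi} (\<lambda>t. Phi x t * cosn k t)"

lemma Psi_cont: "continuous_on {0..pi} (Psi k)"
proof -
  have "continuous_on square (\<lambda>z. (case z of (x, t) \<Rightarrow> Phi x t) * cosn k (snd z))"
    by (intro continuous_intros Phi_cont)
  then have "continuous_on ({0..pi} \<times> cbox 0 pi) (\<lambda>(x, t). Phi x t * cosn k t)"
    by (simp add: case_prod_unfold)
  from integral_continuous_on_param[OF this] show ?thesis unfolding Psi_def by simp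
qed

text \<open>The \<open>k\<close>-th cosine integral of the \<open>N\<close>-th partial sum of
  \<open>Phi x\<close>, with the three series kept apart so that \<open>ip_Psi\<close> can treat
  each by its own argument.\<close>

definition psum :: "nat \<Rightarrow> nat \<Rightarrow> real \<Rightarrow> complex" where
  "psum k N x = (\<Sum>n<N. if n = k then c (of_nat k) x else 0)
     - (\<Sum>n<N. ip (cosr n) (cosn k) / of_real (wt n) * ef n x)
     - (\<Sum>n<N. complex_of_real (corr_int w0 k n x)) + of_real (w0 / pi\<^sup>2 * corr_coef k x)"

lemma has_integral_G_term_cos:
  "((\<lambda>t. G_term c lam w0 n x t * cosn k t) has_integral
     ((if n = k then c (of_nat k) x else 0) - ip (cosr n) (cosn k) / of_real (wt n) * ef n x - of_real (corr_int w0 k n x))) {0..pi}"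
proof -
  note ro = real_orthogonalD[OF real_orthogonal_cosn]
  have 1: "((\<lambda>t. cosn n t * cosn k t) has_integral (if n = k then of_real (cos_norm k) else 0)) {0..pi}"
    using integrable_integral[OF ip_integrable[OF continuous_on_cosn continuous_on_cosn, of n k]] ro(3)[of n k] ro(4)[of k]
    by (auto simp: ip_def split: if_splits)
  have 2: "((\<lambda>t. cosr n t * cosn k t) has_integral ip (cosr n) (cosn k)) {0..pi}"
    unfolding ip_def by (intro integrable_integral ip_integrable cosr_cont continuous_on_cosn)
  have 3: "((\<lambda>t. complex_of_real (corr_term w0 n x t * cos (real k * t))) has_integral of_real (corr_int w0 k n x)) {0..pi}"
    by (intro has_integral_of_real has_integral_corr_term_cos)
  have "((\<lambda>t. c (of_nat n) x / alpha0 n * (cosn n t * cosn k t) - ef n x / of_real (wt n) * (cosr n t * cosn k t) - complex_of_real (corr_term w0 n x t * cos (real k * t)))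
     has_integral (c (of_nat n) x / alpha0 n * (if n = k then of_real (cos_norm k) else 0) - ef n x / of_real (wt n) * ip (cosr n) (cosn k) - of_real (corr_int w0 k n x))) {0..pi}"
    by (intro has_integral_diff has_integral_mult_right 1 2 3)
  moreover have "c (of_nat n) x / alpha0 n * (cosn n t * cosn k t) - ef n x / of_real (wt n) * (cosr n t * cosn k t) - complex_of_real (corr_term w0 n x t * cos (real k * t))
     = G_term c lam w0 n x t * cosn k t" for t
    unfolding G_term_def alpha_wt of_real_mult cosn_eq[of k, symmetric] ef_def cosr_def by (simp add: algebra_simps)
  moreover have "c (of_nat n) x / alpha0 n * (if n = k then of_real (cos_norm k) else 0) = (if n = k then c (of_nat k) x else 0)"
    using ro(5)[of k] by (simp add: alpha0_cos_norm)
  ultimately show ?thesis by (simp add: mult.commute)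
qed

lemma psum_integral:
  assumes x: "x \<in> {0..pi}"
  shows "((\<lambda>t. ((\<Sum>n<N. G_term c lam w0 n x t) + of_real (w0 / pi\<^sup>2 * corr_sum x t)) * cosn k t) has_integral psum k N x) {0..pi}"
proof -
  have 1: "((\<lambda>t. \<Sum>n<N. G_term c lam w0 n x t * cosn k t) has_integral
     (\<Sum>n<N. (if n = k then c (of_nat k) x else 0) - ip (cosr n) (cosn k) / of_real (wt n) * ef n x - of_real (corr_int w0 k n x))) {0..pi}"
    by (intro has_integral_sum has_integral_G_term_cos finite_lessThan)
  have 2: "((\<lambda>t. complex_of_real (w0 / pi\<^sup>2 * (corr_sum x t * cos (real k * t)))) has_integral of_real (w0 / pi\<^sup>2 * corr_coef k x)) {0..pi}"
    by (intro has_integral_of_real has_integral_mult_right has_integral_corr_sum_cos x)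
  have "((\<lambda>t. (\<Sum>n<N. G_term c lam w0 n x t * cosn k t) + complex_of_real (w0 / pi\<^sup>2 * (corr_sum x t * cos (real k * t)))) has_integral psum k N x) {0..pi}"
    using has_integral_add[OF 1 2] by (simp add: psum_def sum_subtractf)
  moreover have "(\<Sum>n<N. G_term c lam w0 n x t * cosn k t) + complex_of_real (w0 / pi\<^sup>2 * (corr_sum x t * cos (real k * t)))
     = ((\<Sum>n<N. G_term c lam w0 n x t) + of_real (w0 / pi\<^sup>2 * corr_sum x t)) * cosn k t" for t
    unfolding cosn_eq by (simp add: sum_distrib_right distrib_right)
  ultimately show ?thesis by simp
qed

lemma psum_uniform: "uniform_limit {0..pi} (psum k) (Psi k) sequentially"
proof (rule uniform_limitI)
  fix e :: real assume e: "e > 0"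
  then have "e / 4 > 0" by simp
  from uniform_limitD[OF G_series_uniform this]
  have "\<forall>\<^sub>F N in sequentially. \<forall>z\<in>square. dist (\<Sum>n<N. G_term c lam w0 n (fst z) (snd z)) (\<Sum>n. G_term c lam w0 n (fst z) (snd z)) < e / 4"
    by (simp add: case_prod_unfold)
  then show "\<forall>\<^sub>F N in sequentially. \<forall>x\<in>{0..pi}. dist (psum k N x) (Psi k x) < e"
  proof (rule eventually_mono, intro ballI)
    fix N x assume N: "\<forall>z\<in>square. dist (\<Sum>n<N. G_term c lam w0 n (fst z) (snd z)) (\<Sum>n. G_term c lam w0 n (fst z) (snd z)) < e / 4"
      and x: "x \<in> {0..pi}"
    have I: "((\<lambda>t. Phi x t * cosn k t) has_integral Psi k x) {0..pi}"
      unfolding Psi_def by (intro integrable_integral ip_integrable Phi_slice_cont x continuous_on_cosn)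
    have "norm (psum k N x - Psi k x) \<le> e / 4 * measure lborel {0..pi}"
    proof (rule has_integral_bound_real[OF _ finite.emptyI has_integral_diff[OF psum_integral[OF x] I]])
      fix t assume "t \<in> {0..pi} - {}"
      then have t: "(x, t) \<in> square" using x by simp
      have "norm (((\<Sum>n<N. G_term c lam w0 n x t) + of_real (w0 / pi\<^sup>2 * corr_sum x t)) * cosn k t - Phi x t * cosn k t)
          = norm ((\<Sum>n<N. G_term c lam w0 n x t) - (\<Sum>n. G_term c lam w0 n x t)) * norm (cosn k t)"
        unfolding left_diff_distrib[symmetric] norm_mult Phi_def by simp
      also have "\<dots> \<le> e / 4 * 1"
      proof (rule mult_mono)
        show "norm ((\<Sum>n<N. G_term c lam w0 n x t) - (\<Sum>n. G_term c lam w0 n x t)) \<le> e / 4"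
          using bspec[OF N t] by (simp add: dist_norm)
        show "norm (cosn k t) \<le> 1" unfolding cosn_eq norm_of_real by simp
      qed (use e in auto)
      finally show "norm (((\<Sum>n<N. G_term c lam w0 n x t) + of_real (w0 / pi\<^sup>2 * corr_sum x t)) * cosn k t - Phi x t * cosn k t) \<le> e / 4" by simp
    qed (use e in simp)
    also have "\<dots> = e / 4 * pi" by simp
    also have "\<dots> < e / 4 * 4" using e pi_less_4 by (intro mult_strict_left_mono) auto
    finally show "dist (psum k N x) (Psi k x) < e" by (simp add: dist_norm)
  qed
qed

text \<open>For large \<open>N\<close> the first sum is \<open>c (of_nat k)\<close>, and
  orthogonality reduces the second to \<open>n = m\<close>. The correction sums and
  \<open>corr_coef\<close> cancel in the limit by \<open>corr_int_sums_uniform\<close>.\<close>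

lemma ip_Psi: "ip (Psi k) (ef m) = ip (c (of_nat k)) (ef m) - ip (cosr m) (cosn k)"
proof -
  note ro = real_orthogonalD[OF real_orthogonal_ef]
  define R where "R = (\<lambda>x. complex_of_real (w0 / pi\<^sup>2 * corr_coef k x))"
  define S where "S = (\<lambda>N x. \<Sum>n<N. complex_of_real (corr_int w0 k n x))"
  define E where "E = (\<lambda>N x. \<Sum>n<N. ip (cosr n) (cosn k) / of_real (wt n) * ef n x)"
  define A where "A = (\<lambda>N x. \<Sum>n<N. if n = k then c (of_nat k) x else 0)"
  have Rc: "continuous_on {0..pi} R" unfolding R_def by (intro continuous_intros corr_coef_cont)
  have Sc: "continuous_on {0..pi} (S N)" for N unfolding S_def by (intro continuous_intros corr_int_cont)
  have Ec: "continuous_on {0..pi} (E N)" for N unfolding E_def by (intro continuous_intros ef_cont)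
  have Ac: "continuous_on {0..pi} (A N)" for N unfolding A_def
  proof (rule continuous_on_sum)
    show "continuous_on {0..pi} (\<lambda>x. if n = k then c (of_nat k) x else 0)" for n
      by (cases "n = k") (simp_all add: c_cont)
  qed
  have p: "psum k N = (\<lambda>x. A N x - E N x - S N x + R x)" for N
    by (simp add: psum_def A_def E_def S_def R_def fun_eq_iff)
  have pc: "continuous_on {0..pi} (psum k N)" for N
    unfolding p by (intro continuous_intros Ac Ec Sc Rc)
  have lim: "(\<lambda>N. ip (psum k N) (ef m)) \<longlonglongrightarrow> ip (Psi k) (ef m)"
    by (rule ip_uniform_limit[OF psum_uniform pc ef_cont]) simp
  have limS: "(\<lambda>N. ip (S N) (ef m)) \<longlonglongrightarrow> ip R (ef m)"
  proof (rule ip_uniform_limit[OF _ Sc ef_cont])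
    show "uniform_limit {0..pi} S R sequentially" unfolding S_def R_def by (rule corr_int_sums_uniform)
  qed simp
  have ev: "\<forall>\<^sub>F N in sequentially. ip (psum k N) (ef m) = ip (c (of_nat k)) (ef m) - ip (cosr m) (cosn k) - ip (S N) (ef m) + ip R (ef m)"
  proof (rule eventually_sequentiallyI[of "Suc (max k m)"])
    fix N assume "Suc (max k m) \<le> N"
    then have N: "k < N" "m < N" by auto
    have "ip (psum k N) (ef m) = ip (A N) (ef m) - ip (E N) (ef m) - ip (S N) (ef m) + ip R (ef m)"
      unfolding p
      by (subst ip_add_left, intro continuous_intros Ac Ec Sc, rule Rc, rule ef_cont,
          subst ip_diff_left, intro continuous_intros Ac Ec, rule Sc, rule ef_cont,
          subst ip_diff_left, rule Ac, rule Ec, rule ef_cont, rule refl)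
    moreover have "A N = c (of_nat k)" using N by (simp add: A_def fun_eq_iff)
    moreover have "ip (E N) (ef m) = ip (cosr m) (cosn k)"
    proof -
      have "ip (E N) (ef m) = (\<Sum>n<N. ip (cosr n) (cosn k) / of_real (wt n) * ip (ef n) (ef m))"
        unfolding E_def by (rule ip_sum_left) (auto intro: ef_cont)
      also have "\<dots> = (\<Sum>n<N. if n = m then ip (cosr m) (cosn k) else 0)"
        using ro(5) by (intro sum.cong) (auto simp: ro(3,4) less_imp_neq[symmetric])
      finally show ?thesis using N by simp
    qed
    ultimately show "ip (psum k N) (ef m) = ip (c (of_nat k)) (ef m) - ip (cosr m) (cosn k) - ip (S N) (ef m) + ip R (ef m)" by simp
  qed
  have "(\<lambda>N. ip (c (of_nat k)) (ef m) - ip (cosr m) (cosn k) - ip (S N) (ef m) + ip R (ef m)) \<longlonglongrightarrow>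
      ip (c (of_nat k)) (ef m) - ip (cosr m) (cosn k) - ip R (ef m) + ip R (ef m)"
    by (intro tendsto_intros limS)
  then have "(\<lambda>N. ip (psum k N) (ef m)) \<longlonglongrightarrow> ip (c (of_nat k)) (ef m) - ip (cosr m) (cosn k) - ip R (ef m) + ip R (ef m)"
    by (rule Lim_transform_eventually) (use ev in \<open>auto elim: eventually_mono\<close>)
  from LIMSEQ_unique[OF lim this] show ?thesis by simp
qed

text \<open>Both sides have the same inner product with every \<open>ef m\<close>, since the
  contributions \<open>ip (ef m) (cosn k)\<close> of \<open>cosn k\<close> and \<open>Hcol k\<close>
  cancel. Completeness of the eigenfunctions settles the variable \<open>x\<close>; that of the
  cosines settles \<open>t\<close> in \<open>Gt_orthogonal\<close>.\<close>

lemma Gt_cosn_coefficients: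
  assumes x: "x \<in> {0..pi}"
  shows "c (of_nat k) x - cosn k x - Hcol k x = Psi k x"
proof -
  define D where "D = (\<lambda>x. (c (of_nat k) x - cosn k x - Hcol k x) - Psi k x)"
  have Dc: "continuous_on {0..pi} D"
    unfolding D_def by (intro continuous_intros c_cont Hcol_cont Psi_cont)
  have "ip D (ef m) = 0" for m
  proof -
    have "ip D (ef m) = ip (c (of_nat k)) (ef m) - ip (cosn k) (ef m) - ip (Hcol k) (ef m) - ip (Psi k) (ef m)"
      unfolding D_def
      by (subst ip_diff_left, intro continuous_intros c_cont Hcol_cont, rule Psi_cont, rule ef_cont,
          subst ip_diff_left, intro continuous_intros c_cont, rule Hcol_cont, rule ef_cont,
          subst ip_diff_left, rule c_cont, rule continuous_on_cosn, rule ef_cont, rule refl)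
    then show ?thesis unfolding ip_Psi ip_Hcol ip_commute[of "cosn k" "ef m"] by simp
  qed
  then have "D x = 0" using ef_complete[OF Dc _ x] by blast
  then show ?thesis by (simp add: D_def)
qed

lemma Gt_orthogonal:
  assumes x: "x \<in> {0..pi}" and u: "continuous_on {0..pi} u"
  shows "((\<lambda>t. (Gt x t - Phi x t) * u t) has_integral 0) {0..pi}"
proof -
  have ai: "(\<lambda>t. Gt x t - Phi x t) absolutely_integrable_on {0..pi}"
    by (intro set_integral_diff(1) Gt_cosn_integral(1) absolutely_integrable_continuous_real Phi_slice_cont x)
  have "ip (\<lambda>t. Gt x t - Phi x t) (cosn k) = 0" for k
  proof -
    have I: "((\<lambda>t. Phi x t * cosn k t) has_integral Psi k x) {0..pi}"
      unfolding Psi_def by (intro integrable_integral ip_integrable Phi_slice_cont x continuous_on_cosn)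
    have "((\<lambda>t. (Gt x t - Phi x t) * cosn k t) has_integral (c (of_nat k) x - cosn k x - Hcol k x - Psi k x)) {0..pi}"
      using has_integral_diff[OF Gt_cosn_integral(2)[OF x] I] by (simp add: left_diff_distrib)
    then show ?thesis unfolding ip_def using Gt_cosn_coefficients[OF x, of k] by (simp add: integral_unique)
  qed
  then have "ip (\<lambda>t. Gt x t - Phi x t) u = 0"
    by (intro dense_span_complete[OF dense_span_cosn continuous_on_cosn ai _ u])
  moreover have "(\<lambda>t. (Gt x t - Phi x t) * u t) integrable_on {0..pi}"
    by (rule set_lebesgue_integral_eq_integral(1)[OF absolutely_integrable_mult_continuous[OF ai u]])
  ultimately show ?thesis unfolding ip_def by (metis integrable_integral)
qed

text \<open>The integrand is \<open>(norm (g t))\<^sup>2 * r t\<close>, continuous and nonnegative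
  with integral 0.\<close>

lemma weighted_zero:
  fixes g :: "real \<Rightarrow> complex" and r :: "real \<Rightarrow> real"
  assumes g: "continuous_on {0..pi} g" and r: "continuous_on {0..pi} r" "\<And>t. t \<in> {0..pi} \<Longrightarrow> 0 \<le> r t"
    and I: "((\<lambda>t. g t * (cnj (g t) * of_real (r t))) has_integral 0) {0..pi}"
    and t: "t \<in> {0..pi}" "r t > 0"
  shows "g t = 0"
proof -
  have "((\<lambda>t. Re (g t * (cnj (g t) * of_real (r t)))) has_integral Re 0) {0..pi}" by (rule has_integral_Re[OF I])
  moreover have "Re (g t * (cnj (g t) * of_real (r t))) = (norm (g t))\<^sup>2 * r t" for t
    unfolding mult.assoc[symmetric] complex_norm_square[symmetric] of_real_mult[symmetric] Re_complex_of_real ..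
  ultimately have "((\<lambda>t. (norm (g t))\<^sup>2 * r t) has_integral 0) (cbox 0 pi)" by simp
  moreover have "pi / 2 \<in> box 0 pi" by simp
  then have "box 0 pi \<noteq> {}" by blast
  ultimately have "(norm (g t))\<^sup>2 * r t = 0"
    by (rule has_integral_0_cbox_imp_0[rotated 2]) (use g r t in \<open>auto intro!: continuous_intros\<close>)
  then show ?thesis using t by simp
qed

text \<open>
  \<open>Gt x\<close> may jump at \<open>x\<close>, so the difference is tested against its own conjugate, cut off at \<open>x\<close>.
\<close>
lemma G_eq_Phi_strict:
  assumes "0 \<le> t" "t < x" "x \<le> pi"
  shows "G x t = Phi x t"
proof -
  have x: "x \<in> {0..pi}" using assms by auto
  have mt: "continuous_on {0..pi} (\<lambda>t. f (min t x))" if "continuous_on {0..x} f" for f :: "real \<Rightarrow> complex"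
    by (rule continuous_on_compose2[OF that]) (use x in \<open>auto intro!: continuous_intros\<close>)
  \<comment> \<open>Constant continuation beyond \<open>x\<close> keeps the test function
    continuous, and the weight \<open>r\<close> removes the part where \<open>g\<close> is no longer
    the difference in question.\<close>
  define g where "g = (\<lambda>t. G x (min t x) - Phi x (min t x))"
  have g: "continuous_on {0..pi} g"
    unfolding g_def
    by (intro continuous_on_diff mt continuous_on_kernel_slice[OF G_cont x] continuous_on_subset[OF Phi_slice_cont[OF x]])
       (use x in auto)
  define r where "r = (\<lambda>t. max 0 (x - t))"
  have r: "continuous_on {0..pi} r" unfolding r_def by (intro continuous_intros)
  have "((\<lambda>t. (Gt x t - Phi x t) * (cnj (g t) * of_real (r t))) has_integral 0) {0..pi}"
    by (rule Gt_orthogonal[OF x]) (intro continuous_intros g r)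
  then have I: "((\<lambda>t. g t * (cnj (g t) * of_real (r t))) has_integral 0) {0..pi}"
    by (rule has_integral_eq[rotated]) (auto simp: g_def r_def Gt_def max_def)
  have "g t = 0"
    by (rule weighted_zero[OF g r _ I]) (use assms in \<open>auto simp: r_def\<close>)
  then show ?thesis using assms by (simp add: g_def)
qed

lemma Hker_eq_Phi_strict:
  assumes "0 \<le> x" "x < t" "t \<le> pi"
  shows "Hker t x = - Phi x t"
proof -
  have x: "x \<in> {0..pi}" using assms by auto
  have mt: "continuous_on {0..pi} (\<lambda>t. f (max t x))" if "continuous_on {x..pi} f" for f :: "real \<Rightarrow> complex"
    by (rule continuous_on_compose2[OF that]) (use x in \<open>auto intro!: continuous_intros\<close>)
  define g where "g = (\<lambda>t. - Hker (max t x) x - Phi x (max t x))"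
  have g: "continuous_on {0..pi} g"
    unfolding g_def
    by (intro continuous_on_diff continuous_on_minus mt[of "\<lambda>t. Hker t x"] mt[of "Phi x"] Hker_column_cont[OF x] continuous_on_subset[OF Phi_slice_cont[OF x]])
       (use x in auto)
  define r where "r = (\<lambda>t. max 0 (t - x))"
  have r: "continuous_on {0..pi} r" unfolding r_def by (intro continuous_intros)
  have "((\<lambda>t. (Gt x t - Phi x t) * (cnj (g t) * of_real (r t))) has_integral 0) {0..pi}"
    by (rule Gt_orthogonal[OF x]) (intro continuous_intros g r)
  then have I: "((\<lambda>t. g t * (cnj (g t) * of_real (r t))) has_integral 0) {0..pi}"
    by (rule has_integral_eq[rotated]) (auto simp: g_def r_def Gt_def max_def)
  have "g t = 0"
    by (rule weighted_zero[OF g r _ I]) (use assms in \<open>auto simp: r_def\<close>)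
  then have "- Hker t x - Phi x t = 0" using assms by (simp add: g_def)
  then show ?thesis by (simp add: eq_neg_iff_add_eq_0 neg_eq_iff_add_eq_0 add.commute)
qed

text \<open>For \<open>x > 0\<close> the diagonal point is a limit along its row. At the vertex
  \<open>(0, 0)\<close> the row is a single point, so the limit is taken along the edge
  \<open>t = 0\<close>.\<close>

lemma kernel_extend_to_diagonal:
  fixes K :: "real \<Rightarrow> real \<Rightarrow> complex"
  assumes K: "continuous_on kernel_dom (\<lambda>(x, t). K x t)"
    and z: "\<And>x t. 0 \<le> t \<Longrightarrow> t < x \<Longrightarrow> x \<le> pi \<Longrightarrow> K x t = 0"
    and xt: "0 \<le> t" "t \<le> x" "x \<le> pi"
  shows "K x t = 0"
proof (cases "t < x")
  case True then show ?thesis using z xt by auto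
next
  case False
  then have t: "t = x" using xt by simp
  show ?thesis
  proof (cases "x = 0")
    case True
    have c: "continuous_on (closure {0<..pi}) (\<lambda>y. K y 0)"
    proof -
      have "continuous_on {0..pi} (\<lambda>y. case (y, 0) of (x, t) \<Rightarrow> K x t)"
        by (rule continuous_on_compose2[OF K]) (auto intro!: continuous_intros simp: kernel_dom_def)
      then show ?thesis by simp
    qed
    have "K 0 0 = 0" by (rule continuous_constant_on_closure[OF c]) (auto intro: z)
    then show ?thesis using t True by simp
  next
    case False
    then have x: "x \<in> {0..pi}" "0 < x" using xt t by auto
    have c: "continuous_on (closure {0..<x}) (K x)"
      using continuous_on_kernel_slice[OF K x(1)] x by simp
    have "K x x = 0" by (rule continuous_constant_on_closure[OF c]) (use x z in auto)
    then show ?thesis using t by simp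
  qed
qed

lemma G_eq_Phi:
  assumes "0 \<le> t" "t \<le> x" "x \<le> pi"
  shows "G x t = Phi x t"
proof -
  have "G x t - Phi x t = 0"
  proof (rule kernel_extend_to_diagonal[OF _ _ assms])
    have "continuous_on kernel_dom (\<lambda>(x, t). Phi x t)"
      by (rule continuous_on_subset[OF Phi_cont]) (auto simp: kernel_dom_def)
    then show "continuous_on kernel_dom (\<lambda>(x, t). G x t - Phi x t)"
      using continuous_on_diff[OF G_cont] by (simp add: case_prod_unfold)
  qed (simp add: G_eq_Phi_strict)
  then show ?thesis by simp
qed

lemma Hker_eq_Phi:
  assumes "0 \<le> t" "t \<le> x" "x \<le> pi"
  shows "Hker x t = - Phi t x"
proof -
  have "Hker x t + Phi t x = 0"
  proof (rule kernel_extend_to_diagonal[OF _ _ assms])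
    have "continuous_on kernel_dom (\<lambda>z. case (snd z, fst z) of (x, t) \<Rightarrow> Phi x t)"
      by (rule continuous_on_compose2[OF Phi_cont]) (auto simp: kernel_dom_def intro!: continuous_intros)
    then show "continuous_on kernel_dom (\<lambda>(x, t). Hker x t + Phi t x)"
      using continuous_on_add[OF Hker_cont] by (simp add: case_prod_unfold)
  qed (simp add: Hker_eq_Phi_strict)
  then show ?thesis by (simp add: eq_neg_iff_add_eq_0)
qed

lemma G_series_split:
  assumes "x \<in> {0..pi}" "t \<in> {0..pi}"
  shows "(\<Sum>n. G_term c lam w0 n x t) = (\<Sum>n. G_term c lam w0 (Suc n) x t) + (c 0 x / of_real pi - c (rho lam 0) x * cos (rho lam 0 * of_real t) / alpha c lam 0)"
proof -
  have "summable (\<lambda>n. G_term c lam w0 n x t)" by (rule summable_norm_cancel[OF G_series_summable[OF assms]])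
  from suminf_split_head[OF this] show ?thesis by (simp add: G_term_def[of _ _ _ 0] alpha0_def corr_term_def)
qed

theorem kernel_representations:
  "converges_unif_abs_on kernel_dom (G_term c lam (omega q h H)) \<and>
     (\<forall>x t. 0 \<le> t \<and> t \<le> x \<and> x \<le> pi \<longrightarrow>
        G x t = (\<Sum>n. G_term c lam (omega q h H) (Suc n) x t)
          + c 0 x / of_real pi
          - c (rho lam 0) x * cos (rho lam 0 * of_real t) / alpha c lam 0
          + of_real (omega q h H / pi\<^sup>2 * (pi * x - x\<^sup>2 - t\<^sup>2))) \<and>
     converges_unif_abs_on kernel_dom (H_term c lam (omega q h H)) \<and>
     (\<forall>x t. 0 \<le> t \<and> t \<le> x \<and> x \<le> pi \<longrightarrow>
        Hker x t = (\<Sum>n. H_term c lam (omega q h H) (Suc n) x t)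
          + cos (rho lam 0 * of_real x) * c (rho lam 0) t / alpha c lam 0
          - c 0 t / of_real pi
          - of_real (omega q h H / pi\<^sup>2 * (pi * x - x\<^sup>2 - t\<^sup>2)))"
proof (intro conjI allI impI converges_G converges_H)
  fix x t :: real assume a: "0 \<le> t \<and> t \<le> x \<and> x \<le> pi"
  then have xt: "x \<in> {0..pi}" "t \<in> {0..pi}" by auto
  \<comment> \<open>As \<open>t \<le> x\<close>, both orders of the arguments give the maximum
    \<open>x\<close>.\<close>
  have R: "corr_sum x t = pi * x - x\<^sup>2 - t\<^sup>2" "corr_sum t x = pi * x - x\<^sup>2 - t\<^sup>2" using a by (auto simp: corr_sum_def)
  show "G x t = (\<Sum>n. G_term c lam w0 (Suc n) x t)
          + c 0 x / of_real pi
          - c (rho lam 0) x * cos (rho lam 0 * of_real t) / alpha c lam 0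
          + of_real (w0 / pi\<^sup>2 * (pi * x - x\<^sup>2 - t\<^sup>2))"
    using G_eq_Phi[of t x] a unfolding Phi_def R G_series_split[OF xt] by simp
  have s: "summable (\<lambda>n. G_term c lam w0 (Suc n) t x)"
    using summable_norm_cancel[OF G_series_summable[OF xt(2,1)]] by (subst summable_Suc_iff)
  have "(\<Sum>n. H_term c lam w0 (Suc n) x t) = - (\<Sum>n. G_term c lam w0 (Suc n) t x)"
    unfolding H_term_swap by (rule suminf_minus[OF s])
  then show "Hker x t = (\<Sum>n. H_term c lam w0 (Suc n) x t)
          + cos (rho lam 0 * of_real x) * c (rho lam 0) t / alpha c lam 0
          - c 0 t / of_real pi
          - of_real (w0 / pi\<^sup>2 * (pi * x - x\<^sup>2 - t\<^sup>2))"
    using Hker_eq_Phi[of t x] a unfolding Phi_def R G_series_split[OF xt(2,1)] by (simp add: mult.commute)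
qed

end

theorem theorem6:
  fixes q :: "real \<Rightarrow> real" and h H :: real
    and c :: "complex \<Rightarrow> real \<Rightarrow> complex"
    and lam :: "nat \<Rightarrow> real"
    and G Hker :: "real \<Rightarrow> real \<Rightarrow> complex"
  assumes q: "L2_0pi q"
    and c: "\<And>\<rho>. cauchy_solution q h \<rho> (c \<rho>)"
    and lam: "eigenvalue_enumeration q h H lam"
    and G: "transmutation_kernel q c G"
    and Hker: "inverse_kernel G Hker"
  shows
    "converges_unif_abs_on kernel_dom (G_term c lam (omega q h H)) \<and>
     (\<forall>x t. 0 \<le> t \<and> t \<le> x \<and> x \<le> pi \<longrightarrow>
        G x t = (\<Sum>n. G_term c lam (omega q h H) (Suc n) x t)
          + c 0 x / of_real pi
          - c (rho lam 0) x * cos (rho lam 0 * of_real t) / alpha c lam 0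
          + of_real (omega q h H / pi\<^sup>2 * (pi * x - x\<^sup>2 - t\<^sup>2))) \<and>
     converges_unif_abs_on kernel_dom (H_term c lam (omega q h H)) \<and>
     (\<forall>x t. 0 \<le> t \<and> t \<le> x \<and> x \<le> pi \<longrightarrow>
        Hker x t = (\<Sum>n. H_term c lam (omega q h H) (Suc n) x t)
          + cos (rho lam 0 * of_real x) * c (rho lam 0) t / alpha c lam 0
          - c 0 t / of_real pi
          - of_real (omega q h H / pi\<^sup>2 * (pi * x - x\<^sup>2 - t\<^sup>2)))"
proof -
  interpret sturm_liouville q h H c lam G Hker
    by unfold_locales (fact q c lam G Hker)+
  show ?thesis by (rule kernel_representations)
qed

end
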